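(* Let $A\in\mathbb{Z}^{n\times d}$ with $n\ge d$ have full column rank, and let $b\in\mathbb{Z}^d$, $c\in\mathbb{Z}^n$, all with entries in $[-U,U]$; let $0<\varepsilon<1$. Suppose $A$ has $\mathrm{nnz}$ nonzero entries, $A^\top A$ has condition number at most $\kappa$, and the linear program $\min_{A^\top x=b,\,x\ge 0} c^\top x$ has inner radius $r$ and outer radius $R$. Then there is an algorithm that finds $\hat x\in\mathbb{R}^n$ with $$c^\top\hat x\le \min_{A^\top x=b,\,x\ge0}c^\top x+\varepsilon\quad\text{and}\quad \|A^\top\hat x-b\|_2\le\varepsilon,$$ using $O\!\left(d^3\,\mathrm{nnz}\cdot n^{0.5}\cdot\log^{O(1)}\!\left(\frac{n\kappa UR}{\varepsilon r}\right)\right)$ bit operations and $O\!\left(n\log\!\left(\frac{n\kappa UR}{\varepsilon r}\right)\right)$ bits of working space.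
   Context: For a linear program $\min_{A^\top x=b,\,x\ge0}c^\top x$ with $A\in\mathbb{R}^{n\times d}$: the inner radius $r\ge0$ is such that there exists $x$ with $A^\top x=b$ and $x_i\ge r$ for all $i\in[n]$; the outer radius $R$ is such that every $x\ge0$ with $A^\top x=b$ satisfies $\|x\|_2\le R$. Computational model: RAM with read-only input; time in bit operations, space in bits of working space excluding the input. *)

theory Defs
  imports
    "HOL-Library.Log_Nat"
    "Jordan_Normal_Form.Char_Poly"
    "Jordan_Normal_Form.DL_Rank"
begin

section \<open>A random access machine with read-only input\<close>

text \<open>
  The working memory consists of cells of arbitrary integers, addressed by natural numbers
  and initially zero; there are no further registers.  The input is an array of integers that
  instructions can read, at an address held in a working cell, but not write.
\<close>

datatype operand =
    Imm int   \<comment> \<open>constant\<close>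
  | Dir nat   \<comment> \<open>working cell \<open>a\<close>\<close>
  | Ind nat   \<comment> \<open>working cell whose address is stored in working cell \<open>a\<close>\<close>
  | Inp nat   \<comment> \<open>input cell whose address is stored in working cell \<open>a\<close>\<close>

datatype target = ToDir nat | ToInd nat

datatype arith = Add | Sub | Mul | Div

datatype instr =
    Move target operand
  | Arith arith target operand operand
  | JumpPos operand nat

type_synonym program = "instr list"

type_synonym config = "nat \<times> (nat \<Rightarrow> int)"  \<comment> \<open>program counter, working memory\<close>

definition read_input :: "int list \<Rightarrow> nat \<Rightarrow> int" where
  "read_input inp a = (if a < length inp then inp ! a else 0)"

fun operand_val :: "int list \<Rightarrow> (nat \<Rightarrow> int) \<Rightarrow> operand \<Rightarrow> int" where
  "operand_val inp m (Imm k) = k"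
| "operand_val inp m (Dir a) = m a"
| "operand_val inp m (Ind a) = m (nat (m a))"
| "operand_val inp m (Inp a) = read_input inp (nat (m a))"

fun target_addr :: "(nat \<Rightarrow> int) \<Rightarrow> target \<Rightarrow> nat" where
  "target_addr m (ToDir a) = a"
| "target_addr m (ToInd a) = nat (m a)"

fun arith_val :: "arith \<Rightarrow> int \<Rightarrow> int \<Rightarrow> int" where
  "arith_val Add x y = x + y"
| "arith_val Sub x y = x - y"
| "arith_val Mul x y = x * y"
| "arith_val Div x y = x div y"

fun exec_instr :: "int list \<Rightarrow> instr \<Rightarrow> config \<Rightarrow> config" where
  "exec_instr inp (Move t s) (pc, m) =
     (Suc pc, m(target_addr m t := operand_val inp m s))"
| "exec_instr inp (Arith f t s1 s2) (pc, m) =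
     (Suc pc, m(target_addr m t := arith_val f (operand_val inp m s1) (operand_val inp m s2)))"
| "exec_instr inp (JumpPos s l) (pc, m) =
     (if operand_val inp m s > 0 then l else Suc pc, m)"

definition halted :: "program \<Rightarrow> config \<Rightarrow> bool" where
  "halted P cf \<longleftrightarrow> length P \<le> fst cf"

definition step :: "program \<Rightarrow> int list \<Rightarrow> config \<Rightarrow> config" where
  "step P inp cf = (if halted P cf then cf else exec_instr inp (P ! fst cf) cf)"

definition config_at :: "program \<Rightarrow> int list \<Rightarrow> nat \<Rightarrow> config" where
  "config_at P inp t = (step P inp ^^ t) (0, \<lambda>_. 0)"

definition halts :: "program \<Rightarrow> int list \<Rightarrow> bool" where
  "halts P inp \<longleftrightarrow> (\<exists>t. halted P (config_at P inp t))"

definition num_steps :: "program \<Rightarrow> int list \<Rightarrow> nat" where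
  "num_steps P inp = (LEAST t. halted P (config_at P inp t))"

definition final_memory :: "program \<Rightarrow> int list \<Rightarrow> nat \<Rightarrow> int" where
  "final_memory P inp = snd (config_at P inp (num_steps P inp))"

subsection \<open>Time in bit operations\<close>

text \<open>Binary digits of the absolute value, and one bit for the sign.\<close>

definition bit_size :: "int \<Rightarrow> nat" where
  "bit_size x = 1 + floorlog 2 (nat \<bar>x\<bar>)"

text \<open>
  Logarithmic cost: an instruction pays for all bits of the addresses and values it handles.
  Multiplication and division are charged the schoolbook number of bit operations.
\<close>

fun operand_cost :: "int list \<Rightarrow> (nat \<Rightarrow> int) \<Rightarrow> operand \<Rightarrow> nat" where
  "operand_cost inp m (Imm k) = bit_size k"
| "operand_cost inp m (Dir a) = bit_size (int a) + bit_size (m a)"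
| "operand_cost inp m (Ind a) = bit_size (int a) + bit_size (m a) + bit_size (m (nat (m a)))"
| "operand_cost inp m (Inp a) =
     bit_size (int a) + bit_size (m a) + bit_size (read_input inp (nat (m a)))"

fun target_cost :: "(nat \<Rightarrow> int) \<Rightarrow> target \<Rightarrow> nat" where
  "target_cost m (ToDir a) = bit_size (int a)"
| "target_cost m (ToInd a) = bit_size (int a) + bit_size (m a)"

fun arith_cost :: "arith \<Rightarrow> int \<Rightarrow> int \<Rightarrow> nat" where
  "arith_cost Add x y = bit_size x + bit_size y"
| "arith_cost Sub x y = bit_size x + bit_size y"
| "arith_cost Mul x y = bit_size x * bit_size y"
| "arith_cost Div x y = bit_size x * bit_size y"

fun instr_cost :: "int list \<Rightarrow> (nat \<Rightarrow> int) \<Rightarrow> instr \<Rightarrow> nat" where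
  "instr_cost inp m (Move t s) = operand_cost inp m s + target_cost m t"
| "instr_cost inp m (Arith f t s1 s2) =
     operand_cost inp m s1 + operand_cost inp m s2 + target_cost m t
     + arith_cost f (operand_val inp m s1) (operand_val inp m s2)"
| "instr_cost inp m (JumpPos s l) = operand_cost inp m s"

definition bit_time :: "program \<Rightarrow> int list \<Rightarrow> nat" where
  "bit_time P inp =
     (\<Sum>t < num_steps P inp.
        instr_cost inp (snd (config_at P inp t)) (P ! fst (config_at P inp t)))"

subsection \<open>Working space in bits\<close>

text \<open>
  All cells below the highest one ever used are charged, each with the size of its largest
  content during the computation and hence with at least one bit.  Charging unused cells in
  between prevents a program from storing information for free in the choice of sparse addresses.
\<close>

definition cells_used :: "program \<Rightarrow> int list \<Rightarrow> nat" where
  "cells_used P inp =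
     (LEAST k. \<forall>t \<le> num_steps P inp. \<forall>a \<ge> k. snd (config_at P inp t) a = 0)"

definition bit_space :: "program \<Rightarrow> int list \<Rightarrow> nat" where
  "bit_space P inp =
     (\<Sum>a < cells_used P inp.
        Max ((\<lambda>t. bit_size (snd (config_at P inp t) a)) ` {..num_steps P inp}))"

section \<open>Linear programs\<close>

definition l2_norm :: "real vec \<Rightarrow> real" where
  "l2_norm v = sqrt (v \<bullet> v)"

definition real_mat :: "int mat \<Rightarrow> real mat" where
  "real_mat A = map_mat real_of_int A"

definition real_vec :: "int vec \<Rightarrow> real vec" where
  "real_vec v = map_vec real_of_int v"

definition nnz :: "'a::zero mat \<Rightarrow> nat" where
  "nnz A = card {(i, j). i < dim_row A \<and> j < dim_col A \<and> A $$ (i, j) \<noteq> 0}"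

definition full_column_rank :: "real mat \<Rightarrow> bool" where
  "full_column_rank A \<longleftrightarrow> vec_space.rank (dim_row A) A = dim_col A"

definition singular_values :: "real mat \<Rightarrow> real set" where
  "singular_values M = {s. 0 \<le> s \<and> eigenvalue (M\<^sup>T * M) (s\<^sup>2)}"

text \<open>For square invertible \<open>M\<close> only: otherwise the smallest singular value may be zero.\<close>

definition condition_number :: "real mat \<Rightarrow> real" where
  "condition_number M = Max (singular_values M) / Min (singular_values M)"

definition lp_feasible :: "real mat \<Rightarrow> real vec \<Rightarrow> real vec set" where
  "lp_feasible A b =
     {x \<in> carrier_vec (dim_row A). A\<^sup>T *\<^sub>v x = b \<and> (\<forall>i < dim_row A. 0 \<le> x $ i)}"

definition lp_min :: "real mat \<Rightarrow> real vec \<Rightarrow> real vec \<Rightarrow> real" where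
  "lp_min A b c = (LEAST v. v \<in> (\<lambda>x. c \<bullet> x) ` lp_feasible A b)"

definition has_inner_radius :: "real mat \<Rightarrow> real vec \<Rightarrow> real \<Rightarrow> bool" where
  "has_inner_radius A b r \<longleftrightarrow> 0 \<le> r \<and>
     (\<exists>x \<in> carrier_vec (dim_row A). A\<^sup>T *\<^sub>v x = b \<and> (\<forall>i < dim_row A. r \<le> x $ i))"

definition has_outer_radius :: "real mat \<Rightarrow> real vec \<Rightarrow> real \<Rightarrow> bool" where
  "has_outer_radius A b R \<longleftrightarrow> (\<forall>x \<in> lp_feasible A b. l2_norm x \<le> R)"

subsection \<open>Machine representation of input and output\<close>

text \<open>
  The matrix is given by its nonzero entries, as triples (row, column, value) in row-major
  order.  The real parameters are given by the exponent of a power of two next to them, rounded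
  in the direction that preserves their meaning: \<open>\<epsilon>\<close> and \<open>r\<close> downwards, \<open>\<kappa>\<close> and \<open>R\<close> upwards.
  This loses at most a factor of two in each, and it makes sense for arbitrary real parameters.
\<close>

definition sparse_entries :: "int mat \<Rightarrow> int list" where
  "sparse_entries A =
     concat (map (\<lambda>(i, j). [int i, int j, A $$ (i, j)])
       (filter (\<lambda>(i, j). A $$ (i, j) \<noteq> 0) (List.product [0..<dim_row A] [0..<dim_col A])))"

definition lp_input ::
  "int mat \<Rightarrow> int vec \<Rightarrow> int vec \<Rightarrow> real \<Rightarrow> real \<Rightarrow> real \<Rightarrow> real \<Rightarrow> int list" where
  "lp_input A b c \<epsilon> \<kappa> r R =
     [int (dim_row A), int (dim_col A), int (nnz A),
      \<lfloor>log 2 \<epsilon>\<rfloor>, \<lceil>log 2 \<kappa>\<rceil>, \<lfloor>log 2 r\<rfloor>, \<lceil>log 2 R\<rceil>]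
     @ sparse_entries A @ list_of_vec b @ list_of_vec c"

text \<open>
  The output is left in the working memory, so that it counts towards the space:
  coordinate \<open>i\<close> is the quotient of the cells \<open>2 * i\<close> and \<open>2 * i + 1\<close>.
\<close>

definition outputs_vec :: "program \<Rightarrow> int list \<Rightarrow> real vec \<Rightarrow> bool" where
  "outputs_vec P inp x \<longleftrightarrow>
     (\<forall>i < dim_vec x. final_memory P inp (2 * i + 1) > 0 \<and>
        x $ i = real_of_int (final_memory P inp (2 * i))
                / real_of_int (final_memory P inp (2 * i + 1)))"

text \<open>
  The maximum with 1 serves only to avoid a vanishing logarithm inside O-bounds for \<open>n = 1\<close>:
  for \<open>n \<ge> 2\<close>, the inequalities \<open>U \<ge> 1\<close>, \<open>\<kappa> \<ge> 1\<close>, \<open>\<epsilon> < 1\<close> and \<open>R \<ge> sqrt n * r\<close>, valid for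
  every linear program with the stated parameters, make the logarithm larger than 1.
\<close>

definition log_factor :: "nat \<Rightarrow> real \<Rightarrow> real \<Rightarrow> real \<Rightarrow> real \<Rightarrow> real \<Rightarrow> real" where
  "log_factor n \<kappa> U R \<epsilon> r = max 1 (log 2 (real n * \<kappa> * U * R / (\<epsilon> * r)))"

end

theory Submission
  imports Defs "HOL-Computational_Algebra.Polynomial" "HOL-Number_Theory.Cong"
begin

text \<open>
  Since the output need not be nonnegative, one linear system suffices. Let \<open>T\<close> be a power of two
  with \<open>T \<ge> R\<^sup>2 / \<epsilon>\<close>, let \<open>y\<close> solve \<open>A\<^sup>T A y = b + T A\<^sup>T c\<close> and put \<open>x = A y - T c\<close>. Then
  \<open>A\<^sup>T x = b\<close>, and \<open>T c \<bullet> (x - x') = - x \<bullet> (x - x') \<le> \<parallel>x'\<parallel>\<^sup>2 / 4 \<le> R\<^sup>2 / 4\<close> for every feasible \<open>x'\<close>.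

  To obtain \<open>y\<close> in \<open>n\<close> words of working space, the numerators and the denominator of Cramer's rule
  are computed modulo about \<open>d\<close> prime powers of word size: the traces of the powers of \<open>- A\<^sup>T A\<close> need
  only sparse matrix-vector products, Newton's identities (scaled by factorials, hence free of
  divisions) turn them into the characteristic polynomial, and Horner's scheme applies the resulting
  adjugate to the right-hand side. The exact values have about \<open>d\<close> words each and are never written
  down: Chinese remaindering recovers the fractions \<open>value / modulus\<close> to a fixed number of words, and
  the quotient of two such fractions approximates a coordinate of \<open>y\<close>.
\<close>

section \<open>A while language on the machine\<close>

text \<open>The point \<open>A y - T c\<close> minimizes
  \<open>c \<bullet> x + |x|^2 / (2 T)\<close> over the affine space \<open>A^T x = b\<close>: this
  is the linear program with a quadratic regularization in place of the sign constraints. Its gap is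
  at most \<open>R^2 / (4 T)\<close>, a quarter of \<open>\<epsilon>\<close>; the rest of
  \<open>\<epsilon>\<close> pays for rounding \<open>y\<close> to multiples of \<open>1 / W\<close>.

  The time is a product of four counts: about \<open>d\<close> moduli, \<open>d\<close> unit vectors
  for the traces, \<open>d\<close> products for each of them, and \<open>nnz\<close> entries for
  each product.

  One obstacle is the word length. \<open>T\<close> depends on \<open>R\<close>, whereas the
  permitted logarithm contains \<open>R\<close> only as \<open>R / r\<close>. So \<open>r\<close>
  itself needs an upper bound in terms of \<open>n\<close>, \<open>\<kappa>\<close> and
  \<open>U\<close>, and it has one because the feasible set is bounded.

  The other obstacle is the space. There is room for a fixed number of vectors, but neither for a
  \<open>d\<close> by \<open>d\<close> matrix nor for the residues of \<open>d\<close> numerators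
  modulo \<open>d\<close> numbers. Hence matrix powers are applied to one unit vector at a time, and
  the residues of the numerators are recomputed instead of stored.\<close>

datatype hop = HAdd | HSub | HMul | HDiv | HMod

datatype exp = Cst int | Reg nat | Arr nat exp | In exp | Bin hop exp exp

datatype com =
    Skip
  | SetR nat exp
  | SetA nat exp exp
  | SetO exp exp
  | Seq com com (infixr \<open>;;\<close> 60)
  | Cond exp com com
  | While exp com

type_synonym st = "(nat \<Rightarrow> int) \<times> (nat \<Rightarrow> nat \<Rightarrow> int)"

fun hval :: "hop \<Rightarrow> int \<Rightarrow> int \<Rightarrow> int" where
  "hval HAdd x y = x + y"
| "hval HSub x y = x - y"
| "hval HMul x y = x * y"
| "hval HDiv x y = x div y"
| "hval HMod x y = x mod y"

fun eval :: "int list \<Rightarrow> st \<Rightarrow> exp \<Rightarrow> int" where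
  "eval inp \<sigma> (Cst k) = k"
| "eval inp \<sigma> (Reg r) = fst \<sigma> r"
| "eval inp \<sigma> (Arr q e) = snd \<sigma> q (nat (eval inp \<sigma> e))"
| "eval inp \<sigma> (In e) = read_input inp (nat (eval inp \<sigma> e))"
| "eval inp \<sigma> (Bin h e1 e2) = hval h (eval inp \<sigma> e1) (eval inp \<sigma> e2)"

text \<open>
  Cells 0 to 48 are the registers, cell 49 holds the base address of the arrays, cells 50 to 63
  are temporaries. Entry \<open>k\<close> of array \<open>q\<close> (\<open>1 \<le> q < 16\<close>) is the cell \<open>base + 16 * k + q\<close>;
  array 0 is write-only and consists of the cells below the base address themselves.
\<close>

abbreviation (input) tmp :: "nat \<Rightarrow> nat" where "tmp k \<equiv> 50 + k"

definition addr_code :: "nat \<Rightarrow> nat \<Rightarrow> instr list" where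
  "addr_code q k =
    [Arith Mul (ToDir (tmp k)) (Dir (tmp k)) (Imm 16),
     Arith Add (ToDir (tmp k)) (Dir (tmp k)) (Dir 49),
     Arith Add (ToDir (tmp k)) (Dir (tmp k)) (Imm (int q))]"

text \<open>The machine has no remainder operation. It is computed as
  \<open>x - (x div y) * y\<close> with a third temporary, which is why an operator at level
  \<open>k\<close> may touch level \<open>k + 2\<close>.\<close>

fun hop_code :: "hop \<Rightarrow> nat \<Rightarrow> instr list" where
  "hop_code HAdd k = [Arith Add (ToDir (tmp k)) (Dir (tmp k)) (Dir (tmp (k+1)))]"
| "hop_code HSub k = [Arith Sub (ToDir (tmp k)) (Dir (tmp k)) (Dir (tmp (k+1)))]"
| "hop_code HMul k = [Arith Mul (ToDir (tmp k)) (Dir (tmp k)) (Dir (tmp (k+1)))]"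
| "hop_code HDiv k = [Arith Div (ToDir (tmp k)) (Dir (tmp k)) (Dir (tmp (k+1)))]"
| "hop_code HMod k =
    [Arith Div (ToDir (tmp (k+2))) (Dir (tmp k)) (Dir (tmp (k+1))),
     Arith Mul (ToDir (tmp (k+2))) (Dir (tmp (k+2))) (Dir (tmp (k+1))),
     Arith Sub (ToDir (tmp k)) (Dir (tmp k)) (Dir (tmp (k+2)))]"

fun exp_code :: "exp \<Rightarrow> nat \<Rightarrow> instr list" where
  "exp_code (Cst c) k = [Move (ToDir (tmp k)) (Imm c)]"
| "exp_code (Reg r) k = [Move (ToDir (tmp k)) (Dir r)]"
| "exp_code (Arr q e) k =
    exp_code e k @ addr_code q k @ [Move (ToDir (tmp k)) (Ind (tmp k))]"
| "exp_code (In e) k = exp_code e k @ [Move (ToDir (tmp k)) (Inp (tmp k))]"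
| "exp_code (Bin h e1 e2) k = exp_code e1 k @ exp_code e2 (Suc k) @ hop_code h k"

text \<open>Jump targets are absolute, so code is generated for a given start address.
  \<open>JumpPos\<close> jumps on positive values: the else branch therefore comes first, and
  \<open>JumpPos (Imm 1)\<close> serves as goto.\<close>

fun com_code :: "com \<Rightarrow> nat \<Rightarrow> instr list" where
  "com_code Skip pc = []"
| "com_code (SetR r e) pc = exp_code e 0 @ [Move (ToDir r) (Dir (tmp 0))]"
| "com_code (SetA q e1 e2) pc =
    exp_code e1 0 @ addr_code q 0 @ exp_code e2 1 @ [Move (ToInd (tmp 0)) (Dir (tmp 1))]"
| "com_code (SetO e1 e2) pc =
    exp_code e1 0 @ exp_code e2 1 @ [Move (ToInd (tmp 0)) (Dir (tmp 1))]"
| "com_code (c1 ;; c2) pc =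
    (let k1 = com_code c1 pc in k1 @ com_code c2 (pc + length k1))"
| "com_code (Cond e c1 c2) pc =
    (let p = pc + length (exp_code e 0) + 1;
         k2 = com_code c2 p;
         p' = p + length k2 + 1;
         k1 = com_code c1 p'
     in exp_code e 0 @ [JumpPos (Dir (tmp 0)) p'] @ k2 @
        [JumpPos (Imm 1) (p' + length k1)] @ k1)"
| "com_code (While e c) pc =
    (let p = pc + length (exp_code e 0) + 2;
         k = com_code c p
     in exp_code e 0 @ [JumpPos (Dir (tmp 0)) p, JumpPos (Imm 1) (p + length k + 1)] @ k @
        [JumpPos (Imm 1) pc])"

text \<open>The bound on \<open>k\<close> keeps the scratch cell of \<open>HMod\<close> among the
  temporaries; the bound on constants keeps immediate operands within the limit of
  \<open>opnd_ok\<close>.\<close>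

fun wf_exp :: "nat \<Rightarrow> exp \<Rightarrow> bool" where
  "wf_exp k (Cst c) \<longleftrightarrow> k \<le> 11 \<and> \<bar>c\<bar> \<le> 64"
| "wf_exp k (Reg r) \<longleftrightarrow> k \<le> 11 \<and> r < 49"
| "wf_exp k (Arr q e) \<longleftrightarrow> 1 \<le> q \<and> q < 16 \<and> wf_exp k e"
| "wf_exp k (In e) \<longleftrightarrow> wf_exp k e"
| "wf_exp k (Bin h e1 e2) \<longleftrightarrow> wf_exp k e1 \<and> wf_exp (Suc k) e2"

fun wf_com :: "com \<Rightarrow> bool" where
  "wf_com Skip \<longleftrightarrow> True"
| "wf_com (SetR r e) \<longleftrightarrow> r < 49 \<and> wf_exp 0 e"
| "wf_com (SetA q e1 e2) \<longleftrightarrow> 1 \<le> q \<and> q < 16 \<and> wf_exp 0 e1 \<and> wf_exp 1 e2"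
| "wf_com (SetO e1 e2) \<longleftrightarrow> wf_exp 0 e1 \<and> wf_exp 1 e2"
| "wf_com (c1 ;; c2) \<longleftrightarrow> wf_com c1 \<and> wf_com c2"
| "wf_com (Cond e c1 c2) \<longleftrightarrow> wf_exp 0 e \<and> wf_com c1 \<and> wf_com c2"
| "wf_com (While e c) \<longleftrightarrow> wf_exp 0 e \<and> wf_com c"

fun regs_written :: "com \<Rightarrow> nat set" where
  "regs_written (SetR r e) = {r}"
| "regs_written (c1 ;; c2) = regs_written c1 \<union> regs_written c2"
| "regs_written (Cond e c1 c2) = regs_written c1 \<union> regs_written c2"
| "regs_written (While e c) = regs_written c"
| "regs_written _ = {}"

fun arrs_written :: "com \<Rightarrow> nat set" where
  "arrs_written (SetA q e1 e2) = {q}"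
| "arrs_written (SetO e1 e2) = {0}"
| "arrs_written (c1 ;; c2) = arrs_written c1 \<union> arrs_written c2"
| "arrs_written (Cond e c1 c2) = arrs_written c1 \<union> arrs_written c2"
| "arrs_written (While e c) = arrs_written c"
| "arrs_written _ = {}"

definition code_at :: "program \<Rightarrow> nat \<Rightarrow> instr list \<Rightarrow> bool" where
  "code_at P pc cs \<longleftrightarrow> (\<forall>i<length cs. pc + i < length P \<and> P ! (pc + i) = cs ! i)"

lemma code_at_Nil [simp]: "code_at P pc []"
  by (simp add: code_at_def)

lemma code_at_Cons [simp]:
  "code_at P pc (c # cs) \<longleftrightarrow> pc < length P \<and> P ! pc = c \<and> code_at P (Suc pc) cs"
  unfolding code_at_def by (auto simp: less_Suc_eq_0_disj)

lemma code_at_append [simp]: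
  "code_at P pc (c1 @ c2) \<longleftrightarrow> code_at P pc c1 \<and> code_at P (pc + length c1) c2"
  by (induction c1 arbitrary: pc) auto

text \<open>Straight-line code contained in the program executes at most \<open>length P\<close>
  instructions, a constant once the program is fixed.\<close>

lemma code_at_length: "code_at P pc cs \<Longrightarrow> length cs \<le> length P"
proof (cases cs rule: rev_cases)
  case (snoc ys y)
  assume "code_at P pc cs"
  then have "pc + length ys < length P" using snoc by simp
  then show ?thesis using snoc by simp
qed simp

lemma code_at_self: "code_at (a @ b @ c) (length a) b"
  unfolding code_at_def by (auto simp: nth_append)

lemma abs_div_le: "\<bar>x div y\<bar> \<le> \<bar>x\<bar>" for x y :: int
proof -
  have p: "\<bar>x div y\<bar> \<le> \<bar>x\<bar>" if y: "y > 0" for x y :: int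
  proof (cases "x \<ge> 0")
    case True
    then have "0 \<le> x div y" "x div y \<le> x"
      using y zdiv_mono2[of x 1 y] by (auto simp: pos_imp_zdiv_nonneg_iff)
    then show ?thesis using True by simp
  next
    case False
    then have "x div y \<le> 0" "x \<le> x div y"
      using y zdiv_mono2_neg[of x 1 y] zdiv_mono1[of x 0 y] by auto
    then show ?thesis using False by simp
  qed
  show ?thesis
  proof (cases "y > 0")
    case False
    then show ?thesis using p[of "- y" "- x"] by (cases "y = 0") auto
  qed (rule p)
qed

text \<open>The intermediate product in the code for \<open>HMod\<close> differs from
  \<open>x\<close> by the remainder only.\<close>

lemma abs_div_mult_le: "\<bar>x div y * y\<bar> \<le> \<bar>x\<bar> + \<bar>y\<bar>" for x y :: int
proof (cases "y = 0")
  case False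
  then have "\<bar>x mod y\<bar> < \<bar>y\<bar>" by (simp add: abs_mod_less)
  moreover have "x div y * y = x - x mod y" by (simp add: minus_mod_eq_div_mult)
  ultimately show ?thesis by linarith
qed simp

lemma bit_size_mono: "\<bar>x\<bar> \<le> y \<Longrightarrow> bit_size x \<le> bit_size y"
  unfolding bit_size_def by (auto intro!: floorlog_mono)

section \<open>Cost of single instructions and of machine runs\<close>

locale machine =
  fixes inp :: "int list" and V :: int and S :: nat and n :: nat
  assumes S64: "64 \<le> S" and SV: "int S + int n + 100 \<le> V"
    and inp0: "read_input inp 0 = int n"
begin

definition "base = 64 + 2 * n"
definition "mtop = base + 16 * S"
text \<open>\<open>V\<close> bounds the values of the while language. \<open>V'\<close> leaves room
  for what only the compiled code sees: addresses up to \<open>base + 16 * S\<close> and the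
  products inside \<open>HMod\<close>.\<close>

definition "V' = 18 * V"
definition "\<beta> = bit_size V'"
text \<open>At most two operands at \<open>3 * \<beta>\<close> each, a target at
  \<open>2 * \<beta>\<close>, and the operation at \<open>2 * \<beta>\<close> for a sum or
  \<open>\<beta> * \<beta>\<close> for a schoolbook product.\<close>

definition "cmax = 10 * \<beta> + \<beta> * \<beta>"

lemma VV': "V \<le> V'" "1000 \<le> V'" "2 * V \<le> V'" "int mtop \<le> V'" "100 \<le> V"
  using S64 SV unfolding V'_def mtop_def base_def by auto

text \<open>The first condition bounds the cost of instructions and the size of cells, the second
  the number of cells used.\<close>

definition "good (m :: nat \<Rightarrow> int) \<longleftrightarrow> (\<forall>a. \<bar>m a\<bar> \<le> V') \<and> (\<forall>a\<ge>mtop. m a = 0)"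

fun opnd_ok :: "(nat \<Rightarrow> int) \<Rightarrow> operand \<Rightarrow> bool" where
  "opnd_ok m (Imm k) \<longleftrightarrow> \<bar>k\<bar> \<le> 1000"
| "opnd_ok m (Dir a) \<longleftrightarrow> a \<le> 1000"
| "opnd_ok m (Ind a) \<longleftrightarrow> a \<le> 1000"
| "opnd_ok m (Inp a) \<longleftrightarrow> a \<le> 1000 \<and> \<bar>read_input inp (nat (m a))\<bar> \<le> V'"

fun targ_ok :: "target \<Rightarrow> bool" where
  "targ_ok (ToDir a) \<longleftrightarrow> a \<le> 1000"
| "targ_ok (ToInd a) \<longleftrightarrow> a \<le> 1000"

fun instr_ok :: "(nat \<Rightarrow> int) \<Rightarrow> instr \<Rightarrow> bool" where
  "instr_ok m (Move t s) \<longleftrightarrow> targ_ok t \<and> opnd_ok m s"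
| "instr_ok m (Arith f t s1 s2) \<longleftrightarrow> targ_ok t \<and> opnd_ok m s1 \<and> opnd_ok m s2"
| "instr_ok m (JumpPos s l) \<longleftrightarrow> opnd_ok m s"

lemma bs: "\<bar>x\<bar> \<le> V' \<Longrightarrow> bit_size x \<le> \<beta>"
  unfolding \<beta>_def by (rule bit_size_mono)

lemma bs_nat: "a \<le> 1000 \<Longrightarrow> bit_size (int a) \<le> \<beta>"
  using VV' by (intro bs) auto

lemma opnd_cost: "good m \<Longrightarrow> opnd_ok m s \<Longrightarrow>
    operand_cost inp m s \<le> 3 * \<beta> \<and> \<bar>operand_val inp m s\<bar> \<le> V'"
  using VV' by (cases s) (auto simp: good_def intro!: add_mono bs bs_nat
    order_trans[OF add_mono[OF add_mono], OF bs_nat bs bs] order_trans[OF add_mono, OF bs_nat bs]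
    order_trans[OF bs])

lemma targ_cost: "good m \<Longrightarrow> targ_ok t \<Longrightarrow> target_cost m t \<le> 2 * \<beta>"
  by (cases t) (auto simp: good_def intro!: order_trans[OF add_mono, OF bs_nat bs]
    order_trans[OF bs_nat])

lemma instr_cost_le: assumes "good m" "instr_ok m i" shows "instr_cost inp m i \<le> cmax"
proof (cases i)
  case (Move t s)
  then show ?thesis using opnd_cost[of m s] targ_cost[of m t] assms by (simp add: cmax_def)
next
  case (Arith f t s1 s2)
  let ?x = "operand_val inp m s1" and ?y = "operand_val inp m s2"
  have o: "operand_cost inp m s1 \<le> 3 * \<beta>" "\<bar>?x\<bar> \<le> V'"
     "operand_cost inp m s2 \<le> 3 * \<beta>" "\<bar>?y\<bar> \<le> V'" "target_cost m t \<le> 2 * \<beta>"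
    using opnd_cost[of m s1] opnd_cost[of m s2] targ_cost[of m t] assms Arith by auto
  have "arith_cost f ?x ?y \<le> 2 * \<beta> + \<beta> * \<beta>"
    using bs[OF o(2)] bs[OF o(4)] by (cases f) (auto intro: trans_le_add2 mult_le_mono)
  then show ?thesis using o Arith by (simp add: cmax_def)
next
  case (JumpPos s l)
  then show ?thesis using opnd_cost[of m s] assms by (simp add: cmax_def)
qed

text \<open>A run that certifies, at every configuration it leaves, what the cost bound needs;
  \<open>reach_steps\<close> extracts the final configuration and the cost of each step.\<close>

inductive reach :: "program \<Rightarrow> nat \<Rightarrow> config \<Rightarrow> config \<Rightarrow> bool" for P where
  refl: "reach P 0 cf cf"
| step: "reach P t cf (pc, m) \<Longrightarrow> pc < length P \<Longrightarrow> good m \<Longrightarrow> instr_ok m (P ! pc) \<Longrightarrow>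
    exec_instr inp (P ! pc) (pc, m) = cf' \<Longrightarrow> reach P (Suc t) cf cf'"

lemma reach_trans: "reach P t' cf' cf'' \<Longrightarrow> reach P t cf cf' \<Longrightarrow> reach P (t + t') cf cf''"
  by (induction rule: reach.induct) (auto intro: reach.step)

lemma reach_1: "pc < length P \<Longrightarrow> good m \<Longrightarrow> instr_ok m (P ! pc) \<Longrightarrow>
    exec_instr inp (P ! pc) (pc, m) = cf' \<Longrightarrow> reach P 1 (pc, m) cf'"
  using reach.step[OF reach.refl] by simp

lemma reach_Cons: "reach P t cf' cf'' \<Longrightarrow> pc < length P \<Longrightarrow> good m \<Longrightarrow> instr_ok m (P ! pc) \<Longrightarrow>
    exec_instr inp (P ! pc) (pc, m) = cf' \<Longrightarrow> reach P (Suc t) (pc, m) cf''"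
  using reach_trans[OF _ reach_1] by fastforce

lemma reach_steps: "reach P t cf cf' \<Longrightarrow> (step P inp ^^ t) cf = cf' \<and>
   (\<forall>i<t. let cfi = (step P inp ^^ i) cf in \<not> halted P cfi \<and> good (snd cfi) \<and>
      instr_cost inp (snd cfi) (P ! fst cfi) \<le> cmax)"
proof (induction rule: reach.induct)
  case (step t cf pc m cf')
  have "(Defs.step P inp ^^ Suc t) cf = cf'"
    using step by (simp add: Defs.step_def[of P inp "(pc, m)"] halted_def)
  moreover have "\<not> halted P (pc, m)" using step by (simp add: halted_def)
  ultimately show ?case using step instr_cost_le[of m "P ! pc"]
    by (auto simp: Let_def less_Suc_eq)
qed simp

section \<open>Memory contents that represent program states\<close>

definition rel :: "(nat \<Rightarrow> int) \<Rightarrow> st \<Rightarrow> bool" where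
  "rel m \<sigma> \<longleftrightarrow> good m \<and> m 49 = int base \<and> (\<forall>r<49. m r = fst \<sigma> r \<and> \<bar>m r\<bar> \<le> V) \<and>
     (\<forall>k. 64 \<le> k \<longrightarrow> k < base \<longrightarrow> m k = snd \<sigma> 0 k) \<and>
     (\<forall>q k. 1 \<le> q \<longrightarrow> q < 16 \<longrightarrow> k < S \<longrightarrow> m (base + 16 * k + q) = snd \<sigma> q k \<and> \<bar>snd \<sigma> q k\<bar> \<le> V)"

lemma rel_tmp: "rel m \<sigma> \<Longrightarrow> 50 \<le> a \<Longrightarrow> a < 64 \<Longrightarrow> \<bar>v\<bar> \<le> V' \<Longrightarrow> rel (m(a := v)) \<sigma>"
  unfolding rel_def good_def base_def mtop_def by auto

text \<open>Only input reads and results of operations are checked for size: constants are bounded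
  by \<open>wf_exp\<close>, registers and array entries by \<open>rel\<close>.\<close>

fun safe :: "st \<Rightarrow> exp \<Rightarrow> bool" where
  "safe \<sigma> (Cst c) \<longleftrightarrow> True"
| "safe \<sigma> (Reg r) \<longleftrightarrow> True"
| "safe \<sigma> (Arr q e) \<longleftrightarrow> safe \<sigma> e \<and> 0 \<le> eval inp \<sigma> e \<and> eval inp \<sigma> e < int S"
| "safe \<sigma> (In e) \<longleftrightarrow> safe \<sigma> e \<and> \<bar>eval inp \<sigma> (In e)\<bar> \<le> V"
| "safe \<sigma> (Bin h e1 e2) \<longleftrightarrow> safe \<sigma> e1 \<and> safe \<sigma> e2 \<and> \<bar>eval inp \<sigma> (Bin h e1 e2)\<bar> \<le> V"

lemma eval_le: "rel m \<sigma> \<Longrightarrow> wf_exp k e \<Longrightarrow> safe \<sigma> e \<Longrightarrow> \<bar>eval inp \<sigma> e\<bar> \<le> V"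
proof (cases e)
  case (Arr q e')
  assume "rel m \<sigma>" "wf_exp k e" "safe \<sigma> e"
  then show ?thesis using Arr by (auto simp: rel_def)
qed (use VV' in \<open>auto simp: rel_def\<close>)

lemma wf_exp_le: "wf_exp k e \<Longrightarrow> k \<le> 11"
  by (induction e arbitrary: k) auto

lemma addr_code_reach:
  assumes m: "rel m \<sigma>" and k: "k \<le> 11" and q: "1 \<le> q" "q < 16"
    and v: "0 \<le> m (tmp k)" "m (tmp k) < int S" and P: "code_at P pc (addr_code q k)"
  shows "\<exists>m'. reach P 3 (pc, m) (pc + 3, m') \<and>
     m' (tmp k) = int (base + 16 * nat (m (tmp k)) + q) \<and> rel m' \<sigma> \<and> (\<forall>j<k. m' (tmp j) = m (tmp j))"
proof -
  let ?m1 = "m(tmp k := m (tmp k) * 16)"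
  let ?m2 = "?m1(tmp k := m (tmp k) * 16 + int base)"
  let ?m3 = "?m2(tmp k := m (tmp k) * 16 + int base + int q)"
  have b: "16 * m (tmp k) + int base + int q \<le> int mtop" using v q by (simp add: mtop_def)
  have r1: "rel ?m1 \<sigma>" using b v VV' by (intro rel_tmp m) (use k in auto)
  have r2: "rel ?m2 \<sigma>" using b v VV' by (intro rel_tmp r1) (use k in auto)
  have r3: "rel ?m3 \<sigma>" using b v VV' by (intro rel_tmp r2) (use k in auto)
  have g: "good m" "good ?m1" "good ?m2" "m 49 = int base" using m r1 r2 by (auto simp: rel_def)
  have "reach P (Suc (Suc 1)) (pc, m) (Suc (Suc (Suc pc)), ?m3)"
    apply (rule reach_Cons[where m=m])
        apply (rule reach_Cons[where m="?m1"])
            apply (rule reach_1[where m="?m2"])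
    using P g k q by (auto simp: addr_code_def)
  then have "reach P 3 (pc, m) (pc + 3, ?m3)" by (simp only: numeral_3_eq_3 One_nat_def add_Suc_right add_0_right)
  moreover have "?m3 (tmp k) = int (base + 16 * nat (m (tmp k)) + q)" "\<forall>j<k. ?m3 (tmp j) = m (tmp j)"
    using v by auto
  ultimately show ?thesis using r3 by blast
qed

lemma hop_code_reach:
  assumes m: "rel m \<sigma>" and k: "k \<le> 10"
    and v: "m (tmp k) = x" "m (tmp (Suc k)) = y" "\<bar>x\<bar> \<le> V" "\<bar>y\<bar> \<le> V" "\<bar>hval h x y\<bar> \<le> V"
    and P: "code_at P pc (hop_code h k)"
  shows "\<exists>m'. reach P (length (hop_code h k)) (pc, m) (pc + length (hop_code h k), m') \<and>
     m' (tmp k) = hval h x y \<and> rel m' \<sigma> \<and> (\<forall>j<k. m' (tmp j) = m (tmp j))"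
proof (cases "h = HMod")
  case False
  let ?m = "m(tmp k := hval h x y)"
  have r: "rel ?m \<sigma>" using v VV' k by (intro rel_tmp m) auto
  have g: "good m" using m by (simp add: rel_def)
  have "reach P 1 (pc, m) (Suc pc, ?m)"
    apply (rule reach_1)
    using P g k v False by (cases h; auto)+
  then have "reach P (length (hop_code h k)) (pc, m) (pc + length (hop_code h k), ?m)"
    using False by (cases h) simp_all
  moreover have "?m (tmp k) = hval h x y" "\<forall>j<k. ?m (tmp j) = m (tmp j)" by auto
  ultimately show ?thesis using r by blast
next
  case h: True
  let ?m1 = "m(tmp (k+2) := x div y)"
  let ?m2 = "?m1(tmp (k+2) := x div y * y)"
  let ?m3 = "?m2(tmp k := x - x div y * y)"
  have b: "\<bar>x div y\<bar> \<le> V'" "\<bar>x div y * y\<bar> \<le> V'" "\<bar>x - x div y * y\<bar> \<le> V'"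
    using abs_div_le[of x y] abs_div_mult_le[of x y] v VV' h by (auto simp: minus_div_mult_eq_mod)
  have r1: "rel ?m1 \<sigma>" using b by (intro rel_tmp m) (use k in auto)
  have r2: "rel ?m2 \<sigma>" using b by (intro rel_tmp r1) (use k in auto)
  have r3: "rel ?m3 \<sigma>" using b by (intro rel_tmp r2) (use k in auto)
  have g: "good m" "good ?m1" "good ?m2" using m r1 r2 by (auto simp: rel_def)
  have "reach P (Suc (Suc 1)) (pc, m) (Suc (Suc (Suc pc)), ?m3)"
    apply (rule reach_Cons[where m=m])
        apply (rule reach_Cons[where m="?m1"])
            apply (rule reach_1[where m="?m2"])
    using P g k v h by auto
  then have "reach P (length (hop_code h k)) (pc, m) (pc + length (hop_code h k), ?m3)"
    using h by simp
  moreover have "?m3 (tmp k) = hval h x y" "\<forall>j<k. ?m3 (tmp j) = m (tmp j)"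
    using h by (auto simp: minus_div_mult_eq_mod)
  ultimately show ?thesis using r3 by blast
qed

text \<open>The temporaries form a stack: evaluation at level \<open>k\<close> preserves all lower
  levels, so the left operand survives the evaluation of the right one.\<close>

lemma exp_code_reach:
  "rel m \<sigma> \<Longrightarrow> wf_exp k e \<Longrightarrow> safe \<sigma> e \<Longrightarrow> code_at P pc (exp_code e k) \<Longrightarrow>
   \<exists>m'. reach P (length (exp_code e k)) (pc, m) (pc + length (exp_code e k), m') \<and>
     m' (tmp k) = eval inp \<sigma> e \<and> rel m' \<sigma> \<and> (\<forall>j<k. m' (tmp j) = m (tmp j))"
proof (induction e arbitrary: m k pc)
  case (Cst c)
  let ?m = "m(tmp k := c)"
  have r: "rel ?m \<sigma>" using Cst VV' by (intro rel_tmp) auto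
  have g: "good m" using Cst by (simp add: rel_def)
  have "reach P 1 (pc, m) (Suc pc, ?m)" by (rule reach_1) (use Cst g in auto)
  then have "reach P (length (exp_code (Cst c) k)) (pc, m) (pc + length (exp_code (Cst c) k), ?m)" by simp
  moreover have "?m (tmp k) = eval inp \<sigma> (Cst c)" "\<forall>j<k. ?m (tmp j) = m (tmp j)" by auto
  ultimately show ?case using r by blast
next
  case (Reg x)
  let ?m = "m(tmp k := m x)"
  have g: "good m" "m x = fst \<sigma> x" using Reg by (auto simp: rel_def)
  have "\<bar>m x\<bar> \<le> V'" using g(1) unfolding good_def by blast
  then have r: "rel ?m \<sigma>" using Reg by (intro rel_tmp) auto
  have "reach P 1 (pc, m) (Suc pc, ?m)" by (rule reach_1) (use Reg g in auto)
  then have "reach P (length (exp_code (Reg x) k)) (pc, m) (pc + length (exp_code (Reg x) k), ?m)" by simp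
  moreover have "?m (tmp k) = eval inp \<sigma> (Reg x)" "\<forall>j<k. ?m (tmp j) = m (tmp j)" using g by auto
  ultimately show ?case using r by blast
next
  case (Arr q e)
  let ?l = "length (exp_code e k)"
  obtain m1 where 1: "reach P ?l (pc, m) (pc + ?l, m1)" "m1 (tmp k) = eval inp \<sigma> e"
    "rel m1 \<sigma>" "\<forall>j<k. m1 (tmp j) = m (tmp j)"
    using Arr.IH[of m k pc] Arr.prems by auto
  have k: "k \<le> 11" using Arr.prems wf_exp_le by auto
  obtain m2 where 2: "reach P 3 (pc + ?l, m1) (pc + ?l + 3, m2)" "rel m2 \<sigma>"
     "m2 (tmp k) = int (base + 16 * nat (m1 (tmp k)) + q)" "\<forall>j<k. m2 (tmp j) = m1 (tmp j)"
    using addr_code_reach[OF 1(3) k, of q P "pc + ?l"] Arr.prems 1 by auto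
  let ?v = "snd \<sigma> q (nat (eval inp \<sigma> e))"
  let ?m = "m2(tmp k := ?v)"
  have v: "m2 (base + 16 * nat (eval inp \<sigma> e) + q) = ?v" "\<bar>?v\<bar> \<le> V"
    using 2(2) Arr.prems unfolding rel_def by auto
  have g: "good m2" using 2 by (auto simp: rel_def)
  have a: "m2 (nat (m2 (tmp k))) = ?v" unfolding 2(3) 1(2) nat_int by (rule v)
  have r: "rel ?m \<sigma>" using 2 v VV' k by (intro rel_tmp) auto
  have "reach P 1 (pc + ?l + 3, m2) (Suc (pc + ?l + 3), ?m)"
    by (rule reach_1) (use Arr.prems g a k in \<open>auto simp: addr_code_def numeral_3_eq_3\<close>)
  from reach_trans[OF this reach_trans[OF 2(1) 1(1)]] have "reach P (length (exp_code (Arr q e) k)) (pc, m) (pc + length (exp_code (Arr q e) k), ?m)"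
    by (simp add: addr_code_def numeral_3_eq_3 del: fun_upd_apply)
  moreover have "?m (tmp k) = eval inp \<sigma> (Arr q e)" "\<forall>j<k. ?m (tmp j) = m (tmp j)" using 1 2 by auto
  ultimately show ?case using r by blast
next
  case (In e)
  let ?l = "length (exp_code e k)"
  obtain m1 where 1: "reach P ?l (pc, m) (pc + ?l, m1)" "m1 (tmp k) = eval inp \<sigma> e"
    "rel m1 \<sigma>" "\<forall>j<k. m1 (tmp j) = m (tmp j)"
    using In.IH[of m k pc] In.prems by auto
  have k: "k \<le> 11" using In.prems wf_exp_le by auto
  let ?m = "m1(tmp k := read_input inp (nat (eval inp \<sigma> e)))"
  have g: "good m1" using 1 by (auto simp: rel_def)
  have r: "rel ?m \<sigma>" using 1 In.prems VV' k by (intro rel_tmp) auto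
  have "reach P 1 (pc + ?l, m1) (Suc (pc + ?l), ?m)"
    by (rule reach_1) (use In.prems g 1 k VV' in auto)
  from reach_trans[OF this 1(1)] have "reach P (length (exp_code (In e) k)) (pc, m) (pc + length (exp_code (In e) k), ?m)"
    by simp
  moreover have "?m (tmp k) = eval inp \<sigma> (In e)" "\<forall>j<k. ?m (tmp j) = m (tmp j)" using 1 by auto
  ultimately show ?case using r by blast
next
  case (Bin h e1 e2)
  let ?l1 = "length (exp_code e1 k)" and ?l2 = "length (exp_code e2 (Suc k))"
  let ?l3 = "length (hop_code h k)"
  obtain m1 where 1: "reach P ?l1 (pc, m) (pc + ?l1, m1)" "m1 (tmp k) = eval inp \<sigma> e1"
    "rel m1 \<sigma>" "\<forall>j<k. m1 (tmp j) = m (tmp j)"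
    using Bin.IH(1)[of m k pc] Bin.prems by auto
  obtain m2 where 2: "reach P ?l2 (pc + ?l1, m1) (pc + ?l1 + ?l2, m2)"
    "m2 (tmp (Suc k)) = eval inp \<sigma> e2"
    "rel m2 \<sigma>" "\<forall>j<Suc k. m2 (tmp j) = m1 (tmp j)"
    using Bin.IH(2)[of m1 "Suc k" "pc + ?l1"] Bin.prems 1 by auto
  have k: "k \<le> 10" using Bin.prems wf_exp_le[of "Suc k" e2] by auto
  have le: "\<bar>eval inp \<sigma> e1\<bar> \<le> V" "\<bar>eval inp \<sigma> e2\<bar> \<le> V"
    using eval_le[OF Bin.prems(1)] Bin.prems(2,3) by auto
  have 22: "m2 (tmp k) = eval inp \<sigma> e1" using 1 2 by auto
  obtain m3 where 3: "reach P ?l3 (pc + ?l1 + ?l2, m2) (pc + ?l1 + ?l2 + ?l3, m3)"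
     "m3 (tmp k) = hval h (eval inp \<sigma> e1) (eval inp \<sigma> e2)" "rel m3 \<sigma>" "\<forall>j<k. m3 (tmp j) = m2 (tmp j)"
    using hop_code_reach[OF 2(3) k 22 2(2) le, of h P "pc + ?l1 + ?l2"] Bin.prems
    by (auto simp: add.assoc)
  from reach_trans[OF 3(1) reach_trans[OF 2(1) 1(1)]] show ?case
    using 1 2 3 by (intro exI[of _ m3]) (auto simp: add.assoc)
qed

section \<open>Timed semantics and correctness of the compiler\<close>

inductive exec :: "com \<Rightarrow> st \<Rightarrow> nat \<Rightarrow> st \<Rightarrow> bool" where
  Skip: "exec Skip \<sigma> 0 \<sigma>"
| SetR: "safe \<sigma> e \<Longrightarrow> exec (SetR r e) \<sigma> 1 ((fst \<sigma>)(r := eval inp \<sigma> e), snd \<sigma>)"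
| SetA: "safe \<sigma> e1 \<Longrightarrow> safe \<sigma> e2 \<Longrightarrow> 0 \<le> eval inp \<sigma> e1 \<Longrightarrow> eval inp \<sigma> e1 < int S \<Longrightarrow>
    exec (SetA q e1 e2) \<sigma> 1
      (fst \<sigma>, (snd \<sigma>)(q := (snd \<sigma> q)(nat (eval inp \<sigma> e1) := eval inp \<sigma> e2)))"
| SetO: "safe \<sigma> e1 \<Longrightarrow> safe \<sigma> e2 \<Longrightarrow> 64 \<le> eval inp \<sigma> e1 \<Longrightarrow> eval inp \<sigma> e1 < int base \<Longrightarrow>
    exec (SetO e1 e2) \<sigma> 1
      (fst \<sigma>, (snd \<sigma>)(0 := (snd \<sigma> 0)(nat (eval inp \<sigma> e1) := eval inp \<sigma> e2)))"
| Seq: "exec c1 \<sigma> t1 \<sigma>' \<Longrightarrow> exec c2 \<sigma>' t2 \<sigma>'' \<Longrightarrow> exec (c1 ;; c2) \<sigma> (t1 + t2) \<sigma>''"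
| CondT: "safe \<sigma> e \<Longrightarrow> eval inp \<sigma> e > 0 \<Longrightarrow> exec c1 \<sigma> t \<sigma>' \<Longrightarrow> exec (Cond e c1 c2) \<sigma> (Suc t) \<sigma>'"
| CondF: "safe \<sigma> e \<Longrightarrow> \<not> eval inp \<sigma> e > 0 \<Longrightarrow> exec c2 \<sigma> t \<sigma>' \<Longrightarrow> exec (Cond e c1 c2) \<sigma> (Suc t) \<sigma>'"
| WhileF: "safe \<sigma> e \<Longrightarrow> \<not> eval inp \<sigma> e > 0 \<Longrightarrow> exec (While e c) \<sigma> 1 \<sigma>"
| WhileT: "safe \<sigma> e \<Longrightarrow> eval inp \<sigma> e > 0 \<Longrightarrow> exec c \<sigma> t \<sigma>' \<Longrightarrow> exec (While e c) \<sigma>' t' \<sigma>'' \<Longrightarrow>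
    exec (While e c) \<sigma> (Suc (t + t')) \<sigma>''"

lemma exec_frame:
  "exec c \<sigma> t \<sigma>' \<Longrightarrow> (\<forall>r. r \<notin> regs_written c \<longrightarrow> fst \<sigma>' r = fst \<sigma> r) \<and>
     (\<forall>q. q \<notin> arrs_written c \<longrightarrow> snd \<sigma>' q = snd \<sigma> q)"
  by (induction rule: exec.induct) auto

lemma rel_setR: "rel m \<sigma> \<Longrightarrow> r < 49 \<Longrightarrow> \<bar>v\<bar> \<le> V \<Longrightarrow> rel (m(r := v)) ((fst \<sigma>)(r := v), snd \<sigma>)"
  using VV' unfolding rel_def good_def base_def mtop_def by auto

text \<open>By Euclidean division by 16, distinct pairs of an index and an array number below 16
  have distinct addresses, so the write changes one entry only.\<close>

lemma rel_setA:
  assumes "rel m \<sigma>" "1 \<le> q" "q < 16" "k < S" "\<bar>v\<bar> \<le> V"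
  shows "rel (m(base + 16 * k + q := v)) (fst \<sigma>, (snd \<sigma>)(q := (snd \<sigma> q)(k := v)))"
proof -
  have "q' = q \<and> k' = k" if "base + 16 * k' + q' = base + 16 * k + q" "q' < 16" for q' k'
  proof -
    have "16 * k' + q' = 16 * k + q" using that(1) by simp
    moreover have "(16 * k' + q') mod 16 = q'" "(16 * k' + q') div 16 = k'"
      "(16 * k + q) mod 16 = q" "(16 * k + q) div 16 = k" using that(2) assms(3) by auto
    ultimately show ?thesis by metis
  qed
  then show ?thesis
    using assms VV' unfolding rel_def good_def by (auto simp: base_def mtop_def)
qed

lemma rel_setO:
  assumes "rel m \<sigma>" "64 \<le> k" "k < base" "\<bar>v\<bar> \<le> V"
  shows "rel (m(k := v)) (fst \<sigma>, (snd \<sigma>)(0 := (snd \<sigma> 0)(k := v)))"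
  using assms VV' unfolding rel_def good_def by (auto simp: base_def mtop_def)

text \<open>\<open>exec\<close> charges one unit per assignment and per evaluated test. The
  instructions that belong to one unit, including the jumps after it, occur at different places of
  the program, so a unit costs at most \<open>length P\<close> steps.\<close>

lemma com_code_reach:
  "exec c \<sigma> t \<sigma>' \<Longrightarrow> wf_com c \<Longrightarrow> code_at P pc (com_code c pc) \<Longrightarrow> rel m \<sigma> \<Longrightarrow>
   \<exists>m' t'. t' \<le> t * length P \<and> reach P t' (pc, m) (pc + length (com_code c pc), m') \<and> rel m' \<sigma>'"
proof (induction arbitrary: pc m rule: exec.induct)
  case (Skip \<sigma>)
  then show ?case by (intro exI[of _ m] exI[of _ 0]) (auto intro: reach.refl)
next
  case (SetR \<sigma> e r)
  let ?l = "length (exp_code e 0)"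
  obtain m1 where 1: "reach P ?l (pc, m) (pc + ?l, m1)" "m1 (tmp 0) = eval inp \<sigma> e" "rel m1 \<sigma>"
    using exp_code_reach[of m \<sigma> 0 e P pc] SetR by auto
  let ?m = "m1(r := eval inp \<sigma> e)"
  have "\<bar>eval inp \<sigma> e\<bar> \<le> V" using SetR eval_le by fastforce
  then have r: "rel ?m ((fst \<sigma>)(r := eval inp \<sigma> e), snd \<sigma>)"
    using SetR 1 by (intro rel_setR) auto
  have g: "good m1" using 1 by (auto simp: rel_def)
  have "reach P 1 (pc + ?l, m1) (Suc (pc + ?l), ?m)"
    by (rule reach_1) (use SetR g 1 in auto)
  from reach_trans[OF this 1(1)]
  have "reach P (?l + 1) (pc, m) (pc + length (com_code (SetR r e) pc), ?m)" by simp
  moreover have "?l + 1 \<le> 1 * length P" using code_at_length[OF SetR.prems(2)] by simp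
  ultimately show ?case using r by blast
next
  case (SetA \<sigma> e1 e2 q)
  let ?l1 = "length (exp_code e1 0)" and ?l2 = "length (exp_code e2 1)"
  let ?k = "nat (eval inp \<sigma> e1)"
  obtain m1 where 1: "reach P ?l1 (pc, m) (pc + ?l1, m1)" "m1 (tmp 0) = eval inp \<sigma> e1" "rel m1 \<sigma>"
    using exp_code_reach[of m \<sigma> 0 e1 P pc] SetA by auto
  have "code_at P (pc + ?l1) (addr_code q 0)" using SetA by auto
  then obtain m2 where 2: "reach P 3 (pc + ?l1, m1) (pc + ?l1 + 3, m2)" "rel m2 \<sigma>"
     "m2 (tmp 0) = int (base + 16 * nat (m1 (tmp 0)) + q)"
    using addr_code_reach[OF 1(3), of 0 q P "pc + ?l1"] SetA 1 by auto
  have "code_at P (pc + ?l1 + 3) (exp_code e2 1)" using SetA.prems(2) by (simp add: addr_code_def numeral_3_eq_3)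
  then obtain m3 where 3: "reach P ?l2 (pc + ?l1 + 3, m2) (pc + ?l1 + 3 + ?l2, m3)"
     "m3 (tmp 1) = eval inp \<sigma> e2" "rel m3 \<sigma>" "m3 (tmp 0) = int (base + 16 * ?k + q)"
    using exp_code_reach[of m2 \<sigma> 1 e2 P "pc + ?l1 + 3"] SetA 2 1(2) by auto
  let ?m = "m3(base + 16 * ?k + q := eval inp \<sigma> e2)"
  have "\<bar>eval inp \<sigma> e2\<bar> \<le> V" using SetA eval_le by fastforce
  then have r: "rel ?m (fst \<sigma>, (snd \<sigma>)(q := (snd \<sigma> q)(?k := eval inp \<sigma> e2)))"
    using SetA 3 by (intro rel_setA) auto
  have g: "good m3" using 3 by (auto simp: rel_def)
  have a: "nat (m3 (tmp 0)) = base + 16 * ?k + q" unfolding 3(4) nat_int ..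
  have "P ! (pc + ?l1 + 3 + ?l2) = Move (ToInd (tmp 0)) (Dir (tmp 1))" "pc + ?l1 + 3 + ?l2 < length P"
    using SetA.prems(2) by (auto simp: addr_code_def numeral_3_eq_3 add.assoc)
  then have "reach P 1 (pc + ?l1 + 3 + ?l2, m3) (Suc (pc + ?l1 + 3 + ?l2), ?m)"
    by (intro reach_1) (use g 3(2) a in auto)
  from reach_trans[OF this reach_trans[OF 3(1) reach_trans[OF 2(1) 1(1)]]]
  have "reach P (?l1 + 3 + ?l2 + 1) (pc, m) (pc + length (com_code (SetA q e1 e2) pc), ?m)"
    by (simp add: addr_code_def numeral_3_eq_3 add.assoc[of pc] del: fun_upd_apply)
  moreover have "?l1 + 3 + ?l2 + 1 \<le> 1 * length P"
    using code_at_length[OF SetA.prems(2)] by (simp add: addr_code_def)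
  ultimately show ?case using r by blast
next
  case (SetO \<sigma> e1 e2)
  let ?l1 = "length (exp_code e1 0)" and ?l2 = "length (exp_code e2 1)"
  let ?k = "nat (eval inp \<sigma> e1)"
  obtain m1 where 1: "reach P ?l1 (pc, m) (pc + ?l1, m1)" "m1 (tmp 0) = eval inp \<sigma> e1" "rel m1 \<sigma>"
    using exp_code_reach[of m \<sigma> 0 e1 P pc] SetO by auto
  have "code_at P (pc + ?l1) (exp_code e2 1)" using SetO by auto
  then obtain m3 where 3: "reach P ?l2 (pc + ?l1, m1) (pc + ?l1 + ?l2, m3)"
     "m3 (tmp 1) = eval inp \<sigma> e2" "rel m3 \<sigma>" "m3 (tmp 0) = eval inp \<sigma> e1"
    using exp_code_reach[of m1 \<sigma> 1 e2 P "pc + ?l1"] SetO 1 by auto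
  let ?m = "m3(?k := eval inp \<sigma> e2)"
  have "\<bar>eval inp \<sigma> e2\<bar> \<le> V" using SetO eval_le by fastforce
  then have r: "rel ?m (fst \<sigma>, (snd \<sigma>)(0 := (snd \<sigma> 0)(?k := eval inp \<sigma> e2)))"
    using SetO 3 by (intro rel_setO) auto
  have g: "good m3" using 3 by (auto simp: rel_def)
  have "P ! (pc + ?l1 + ?l2) = Move (ToInd (tmp 0)) (Dir (tmp 1))" "pc + ?l1 + ?l2 < length P"
    using SetO.prems(2) by (auto simp: add.assoc)
  then have "reach P 1 (pc + ?l1 + ?l2, m3) (Suc (pc + ?l1 + ?l2), ?m)"
    by (intro reach_1) (use g 3 in auto)
  from reach_trans[OF this reach_trans[OF 3(1) 1(1)]]
  have "reach P (?l1 + ?l2 + 1) (pc, m) (pc + length (com_code (SetO e1 e2) pc), ?m)"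
    by (simp add: add.assoc del: fun_upd_apply)
  moreover have "?l1 + ?l2 + 1 \<le> 1 * length P" using code_at_length[OF SetO.prems(2)] by simp
  ultimately show ?case using r by blast
next
  case (Seq c1 \<sigma> t1 \<sigma>' c2 t2 \<sigma>'')
  let ?l1 = "length (com_code c1 pc)"
  obtain m1 u1 where 1: "u1 \<le> t1 * length P" "reach P u1 (pc, m) (pc + ?l1, m1)" "rel m1 \<sigma>'"
    using Seq.IH(1)[of pc m] Seq.prems by (auto simp: Let_def)
  let ?l2 = "length (com_code c2 (pc + ?l1))"
  obtain m2 u2 where 2: "u2 \<le> t2 * length P" "reach P u2 (pc + ?l1, m1) (pc + ?l1 + ?l2, m2)" "rel m2 \<sigma>''"
    using Seq.IH(2)[of "pc + ?l1" m1] Seq.prems 1 by (auto simp: Let_def)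
  from reach_trans[OF 2(2) 1(2)] show ?case using 1 2
    by (intro exI[of _ m2] exI[of _ "u1 + u2"]) (auto simp: Let_def add.assoc algebra_simps)
next
  case (CondT \<sigma> e c1 t \<sigma>' c2)
  let ?l = "length (exp_code e 0)"
  let ?p = "pc + ?l + 1"
  let ?k2 = "com_code c2 ?p"
  let ?p' = "?p + length ?k2 + 1"
  let ?k1 = "com_code c1 ?p'"
  obtain m1 where 1: "reach P ?l (pc, m) (pc + ?l, m1)" "m1 (tmp 0) = eval inp \<sigma> e" "rel m1 \<sigma>"
    using exp_code_reach[of m \<sigma> 0 e P pc] CondT by (auto simp: Let_def)
  have g: "good m1" using 1 by (auto simp: rel_def)
  have 2: "reach P 1 (pc + ?l, m1) (?p', m1)"
    by (rule reach_1) (use CondT g 1 in \<open>auto simp: Let_def\<close>)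
  have "code_at P ?p' ?k1" using CondT.prems(2) by (simp add: Let_def)
  then obtain m2 u where 3: "u \<le> t * length P" "reach P u (?p', m1) (?p' + length ?k1, m2)" "rel m2 \<sigma>'"
    using CondT.IH[of ?p' m1] CondT.prems 1 by auto
  from reach_trans[OF 3(2) reach_trans[OF 2 1(1)]] show ?case
    using 3 code_at_length[OF CondT.prems(2)]
    by (intro exI[of _ m2] exI[of _ "?l + 1 + u"]) (auto simp: Let_def add.assoc)
next
  case (CondF \<sigma> e c2 t \<sigma>' c1)
  let ?l = "length (exp_code e 0)"
  let ?p = "pc + ?l + 1"
  let ?k2 = "com_code c2 ?p"
  let ?p' = "?p + length ?k2 + 1"
  let ?k1 = "com_code c1 ?p'"
  obtain m1 where 1: "reach P ?l (pc, m) (pc + ?l, m1)" "m1 (tmp 0) = eval inp \<sigma> e" "rel m1 \<sigma>"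
    using exp_code_reach[of m \<sigma> 0 e P pc] CondF by (auto simp: Let_def)
  have g: "good m1" using 1 by (auto simp: rel_def)
  have 2: "reach P 1 (pc + ?l, m1) (?p, m1)"
    by (rule reach_1) (use CondF g 1 in \<open>auto simp: Let_def\<close>)
  have "code_at P ?p ?k2" using CondF.prems(2) by (simp add: Let_def)
  then obtain m2 u where 3: "u \<le> t * length P" "reach P u (?p, m1) (?p + length ?k2, m2)" "rel m2 \<sigma>'"
    using CondF.IH[of ?p m1] CondF.prems 1 by auto
  have g2: "good m2" using 3 by (auto simp: rel_def)
  have 4: "reach P 1 (?p + length ?k2, m2) (?p' + length ?k1, m2)"
    by (rule reach_1) (use CondF.prems g2 in \<open>auto simp: Let_def\<close>)
  from reach_trans[OF 4 reach_trans[OF 3(2) reach_trans[OF 2 1(1)]]] show ?case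
    using 3 code_at_length[OF CondF.prems(2)]
    by (intro exI[of _ m2] exI[of _ "?l + 1 + u + 1"]) (auto simp: Let_def add.assoc)
next
  case (WhileF \<sigma> e c)
  let ?l = "length (exp_code e 0)"
  let ?p = "pc + ?l + 2"
  let ?k = "com_code c ?p"
  obtain m1 where 1: "reach P ?l (pc, m) (pc + ?l, m1)" "m1 (tmp 0) = eval inp \<sigma> e" "rel m1 \<sigma>"
    using exp_code_reach[of m \<sigma> 0 e P pc] WhileF by (auto simp: Let_def)
  have g: "good m1" using 1 by (auto simp: rel_def)
  have 2: "reach P 1 (pc + ?l, m1) (Suc (pc + ?l), m1)"
    by (rule reach_1) (use WhileF g 1 in \<open>auto simp: Let_def\<close>)
  have 3: "reach P 1 (Suc (pc + ?l), m1) (?p + length ?k + 1, m1)"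
    by (rule reach_1) (use WhileF g 1 in \<open>auto simp: Let_def\<close>)
  from reach_trans[OF 3 reach_trans[OF 2 1(1)]] show ?case
    using 1 code_at_length[OF WhileF.prems(2)]
    by (intro exI[of _ m1] exI[of _ "?l + 1 + 1"]) (auto simp: Let_def add.assoc)
next
  case (WhileT \<sigma> e c t \<sigma>' t' \<sigma>'')
  let ?l = "length (exp_code e 0)"
  let ?p = "pc + ?l + 2"
  let ?k = "com_code c ?p"
  obtain m1 where 1: "reach P ?l (pc, m) (pc + ?l, m1)" "m1 (tmp 0) = eval inp \<sigma> e" "rel m1 \<sigma>"
    using exp_code_reach[of m \<sigma> 0 e P pc] WhileT by (auto simp: Let_def)
  have g: "good m1" using 1 by (auto simp: rel_def)
  have 2: "reach P 1 (pc + ?l, m1) (?p, m1)"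
    by (rule reach_1) (use WhileT g 1 in \<open>auto simp: Let_def\<close>)
  have ck: "code_at P ?p ?k" using WhileT.prems(2) by (simp add: Let_def)
  then obtain m2 u where 3: "u \<le> t * length P" "reach P u (?p, m1) (?p + length ?k, m2)" "rel m2 \<sigma>'"
    using WhileT.IH(1)[of ?p m1] WhileT.prems 1 by auto
  have g2: "good m2" using 3 by (auto simp: rel_def)
  have 4: "reach P 1 (?p + length ?k, m2) (pc, m2)"
    by (rule reach_1) (use WhileT.prems g2 in \<open>auto simp: Let_def\<close>)
  obtain m3 u' where 5: "u' \<le> t' * length P"
    "reach P u' (pc, m2) (pc + length (com_code (While e c) pc), m3)" "rel m3 \<sigma>''"
    using WhileT.IH(2)[of pc m2] WhileT.prems 3 by auto
  have "?l + 1 + u + 1 + u' \<le> Suc (t + t') * length P"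
    using 3(1) 5(1) code_at_length[OF WhileT.prems(2)] by (auto simp: Let_def algebra_simps)
  with reach_trans[OF 5(2) reach_trans[OF 4 reach_trans[OF 3(2) reach_trans[OF 2 1(1)]]]] show ?case
    using 5(3) by (intro exI[of _ m3] exI[of _ "?l + 1 + u + 1 + u'"]) blast
qed

end

section \<open>Prologue, epilogue and cost of complete programs\<close>

definition prologue :: "instr list" where
  "prologue = [Move (ToDir 49) (Inp 49), Arith Mul (ToDir 49) (Dir 49) (Imm 2),
     Arith Add (ToDir 49) (Dir 49) (Imm 64)]"

text \<open>
  Overwrites all of the cells 0 to 63 with the first entries of array 15; the pointer that walks
  through the array lives in the cell that is overwritten last.
\<close>

definition copy_code :: "nat \<Rightarrow> instr list" where
  "copy_code j = concat (map (\<lambda>k. [Move (ToDir k) (Ind 63),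
     Arith Add (ToDir 63) (Dir 63) (Imm 16)]) [0..<j])"

definition epilogue :: "instr list" where
  "epilogue = [Move (ToDir 63) (Dir 49), Arith Add (ToDir 63) (Dir 63) (Imm 15)] @
     copy_code 63 @ [Move (ToDir 63) (Ind 63)]"

definition compile :: "com \<Rightarrow> program" where
  "compile c = prologue @ com_code c 3 @ epilogue"

lemma copy_code_Suc: "copy_code (Suc j) = copy_code j @
    [Move (ToDir j) (Ind 63), Arith Add (ToDir 63) (Dir 63) (Imm 16)]"
  by (simp add: copy_code_def)

lemma length_copy_code [simp]: "length (copy_code j) = 2 * j"
  by (induction j) (auto simp: copy_code_Suc, simp add: copy_code_def)

context machine
begin

text \<open>The copies overwrite only cells below 63, while the source starts above
  \<open>base \<ge> 64\<close> and the pointer is cell 63; nothing still to be read is lost.\<close>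

lemma copy_code_reach:
  assumes m: "good m" and p: "m 63 = int (base + 15)"
    and a: "\<And>k. k < S \<Longrightarrow> m (base + 16 * k + 15) = f k"
  shows "j \<le> 63 \<Longrightarrow> code_at P pc (copy_code j) \<Longrightarrow>
    \<exists>m'. reach P (2 * j) (pc, m) (pc + 2 * j, m') \<and> good m' \<and> m' 63 = int (base + 16 * j + 15) \<and>
      (\<forall>k<j. m' k = f k) \<and> (\<forall>a\<ge>64. m' a = m a)"
proof (induction j)
  case 0
  then show ?case using m p by (intro exI[of _ m]) (auto intro: reach.refl)
next
  case (Suc j)
  then obtain m1 where 1: "reach P (2 * j) (pc, m) (pc + 2 * j, m1)" "good m1"
     "m1 63 = int (base + 16 * j + 15)" "\<forall>k<j. m1 k = f k" "\<forall>a\<ge>64. m1 a = m a"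
    by (auto simp: copy_code_Suc)
  have b: "64 \<le> base" by (simp add: base_def)
  have jS: "j < S" using Suc.prems S64 by simp
  have f: "m1 (base + 16 * j + 15) = f j" using 1(5) a[OF jS] b by simp
  have fV: "\<bar>f j\<bar> \<le> V'" using 1(2) f unfolding good_def by metis
  let ?m2 = "m1(j := f j)"
  let ?m3 = "?m2(63 := int (base + 16 * Suc j + 15))"
  have le: "int (base + 16 * Suc j + 15) \<le> V'"
    using Suc.prems S64 SV by (simp add: V'_def base_def)
  have g2: "good ?m2" using 1(2) fV Suc.prems b by (auto simp: good_def mtop_def)
  have g3: "good ?m3" using g2 le b by (auto simp: good_def mtop_def)
  have c: "code_at P (pc + 2 * j) [Move (ToDir j) (Ind 63), Arith Add (ToDir 63) (Dir 63) (Imm 16)]"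
    using Suc.prems by (simp add: copy_code_Suc)
  have n63: "nat (m1 63) = base + 16 * j + 15" unfolding 1(3) nat_int ..
  have "reach P (Suc 1) (pc + 2 * j, m1) (Suc (Suc (pc + 2 * j)), ?m3)"
    apply (rule reach_Cons[where m=m1])
        apply (rule reach_1[where m="?m2"])
    using c g2 1(2,3) n63 f Suc.prems by auto
  from reach_trans[OF this 1(1)] have "reach P (2 * Suc j) (pc, m) (pc + 2 * Suc j, ?m3)" by simp
  moreover have "\<forall>k<Suc j. ?m3 k = f k" "\<forall>a\<ge>64. ?m3 a = m a" "?m3 63 = int (base + 16 * Suc j + 15)"
    using 1 Suc.prems by (auto simp: less_Suc_eq)
  ultimately show ?case using g3 by blast
qed

lemma compile_correct:
  assumes ex: "exec c (\<lambda>_. 0, \<lambda>_ _. 0) t \<sigma>'" and wf: "wf_com c"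
  defines "P \<equiv> compile c"
  shows "halts P inp"
    and "k < 64 \<Longrightarrow> final_memory P inp k = snd \<sigma>' 15 k"
    and "64 \<le> k \<Longrightarrow> k < 64 + 2 * n \<Longrightarrow> final_memory P inp k = snd \<sigma>' 0 k"
    and "bit_time P inp \<le> (t * length P + 140) * cmax"
    and "bit_space P inp \<le> mtop * \<beta>"
proof -
  let ?l = "length (com_code c 3)"
  have len: "length P = 3 + ?l + length epilogue" by (simp add: P_def compile_def prologue_def)
  have c0: "code_at P 0 prologue" and c1: "code_at P 3 (com_code c 3)"
    and c2: "code_at P (3 + ?l) epilogue"
    using code_at_self[of "[]" prologue "com_code c 3 @ epilogue"]
      code_at_self[of prologue "com_code c 3" epilogue]
      code_at_self[of "prologue @ com_code c 3" epilogue "[]"]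
    by (simp_all add: P_def compile_def) (simp_all add: prologue_def numeral_3_eq_3)
  let ?m0 = "\<lambda>_::nat. 0::int"
  let ?m1 = "?m0(49 := int n)"
  let ?m2 = "?m1(49 := int n * 2)"
  let ?m3 = "?m2(49 := int n * 2 + 64)"
  have V0: "0 \<le> V'" "0 \<le> V" "int n \<le> V'" "int n * 2 + 64 \<le> V'"
    using VV' SV by (auto simp: base_def V'_def)
  have g: "good ?m0" "good ?m1" "good ?m2" "good ?m3"
    using V0 by (auto simp: good_def mtop_def base_def)
  \<comment> \<open>Cell 49 is still zero, so \<open>Inp 49\<close> reads input entry 0, which is
    \<open>n\<close> by \<open>inp0\<close>.\<close>
  have r0: "reach P (Suc (Suc 1)) (0, ?m0) (Suc (Suc (Suc 0)), ?m3)"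
    apply (rule reach_Cons[where m="?m0"])
        apply (rule reach_Cons[where m="?m1"])
            apply (rule reach_1[where m="?m2"])
    using c0 g inp0 V0 by (simp_all add: prologue_def)
  have rel0: "rel ?m3 (\<lambda>_. 0, \<lambda>_ _. 0)"
    using g(4) V0 by (auto simp: rel_def base_def)
  obtain m4 u where 4: "u \<le> t * length P" "reach P u (3, ?m3) (3 + ?l, m4)" "rel m4 \<sigma>'"
    using com_code_reach[OF ex wf c1 rel0] by auto
  have b: "64 \<le> base" by (simp add: base_def)
  have m4: "good m4" "m4 49 = int base" "\<And>k. k < S \<Longrightarrow> m4 (base + 16 * k + 15) = snd \<sigma>' 15 k"
     "\<And>k. 64 \<le> k \<Longrightarrow> k < base \<Longrightarrow> m4 k = snd \<sigma>' 0 k"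
    using 4(3) unfolding rel_def by auto
  let ?m5 = "m4(63 := int base)"
  let ?m6 = "?m5(63 := int (base + 15))"
  have le: "int (base + 15) \<le> V'" using S64 SV by (simp add: V'_def base_def)
  have g5: "good ?m5" "good ?m6" using m4(1) le b by (auto simp: good_def mtop_def)
  have r5: "reach P (Suc 1) (3 + ?l, m4) (Suc (Suc (3 + ?l)), ?m6)"
    apply (rule reach_Cons[where m=m4])
        apply (rule reach_1[where m="?m5"])
    using c2 g5 m4(1,2) by (auto simp: epilogue_def)
  have c6: "code_at P (Suc (Suc (3 + ?l))) (copy_code 63)"
    using c2 by (auto simp: epilogue_def)
  obtain m7 where 7: "reach P 126 (Suc (Suc (3 + ?l)), ?m6) (Suc (Suc (3 + ?l)) + 126, m7)" "good m7"
     "m7 63 = int (base + 16 * 63 + 15)" "\<forall>k<63. m7 k = snd \<sigma>' 15 k" "\<forall>a\<ge>64. m7 a = m4 a"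
    using copy_code_reach[of ?m6 "snd \<sigma>' 15" 63, OF g5(2) _ _ _ c6] m4(3) b by auto
  let ?m8 = "m7(63 := snd \<sigma>' 15 63)"
  have f63: "m7 (nat (m7 63)) = snd \<sigma>' 15 63"
    unfolding 7(3) nat_int using 7(5) m4(3)[of 63] S64 b by simp
  have "\<bar>snd \<sigma>' 15 63\<bar> \<le> V'" using 7(2) f63 unfolding good_def by metis
  then have g8: "good ?m8" using 7(2) b by (auto simp: good_def mtop_def)
  have r8: "reach P 1 (Suc (Suc (3 + ?l)) + 126, m7) (Suc (Suc (Suc (3 + ?l)) + 126), ?m8)"
    apply (rule reach_1) using c2 7(2) f63 by (auto simp: epilogue_def)
  \<comment> \<open>Three instructions of the prologue, \<open>u\<close> of the command,
    \<open>2 + 2 * 63 + 1\<close> of the epilogue; the constant 140 in the time bound covers all but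
    \<open>u\<close>.\<close>
  define T where "T = 3 + u + 2 + 126 + 1"
  have "reach P T (0, ?m0) (length P, ?m8)"
    using reach_trans[OF r8 reach_trans[OF 7(1) reach_trans[OF r5 reach_trans[OF 4(2) r0[folded numeral_3_eq_3]]]]]
    by (simp add: T_def len epilogue_def numeral_3_eq_3 add.commute add.left_commute)
  from reach_steps[OF this] have fin: "config_at P inp T = (length P, ?m8)"
    and run: "\<And>i. i < T \<Longrightarrow> \<not> halted P (config_at P inp i) \<and> good (snd (config_at P inp i)) \<and>
      instr_cost inp (snd (config_at P inp i)) (P ! fst (config_at P inp i)) \<le> cmax"
    unfolding config_at_def Let_def by auto
  have h: "halted P (config_at P inp T)" unfolding fin halted_def by simp
  then show "halts P inp" unfolding halts_def by blast
  have ns: "num_steps P inp = T"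
    unfolding num_steps_def
  proof (rule Least_equality, rule h)
    fix y assume "halted P (config_at P inp y)"
    then show "T \<le> y" using run[of y] by (meson not_less)
  qed
  have fm: "final_memory P inp = ?m8" by (simp add: final_memory_def ns fin)
  show "k < 64 \<Longrightarrow> final_memory P inp k = snd \<sigma>' 15 k"
    using 7(4) unfolding fm by (cases "k = 63") auto
  show "64 \<le> k \<Longrightarrow> k < 64 + 2 * n \<Longrightarrow> final_memory P inp k = snd \<sigma>' 0 k"
    using 7(5) m4(4)[of k] unfolding fm by (auto simp: base_def)
  have "bit_time P inp \<le> (\<Sum>i<T. cmax)"
    unfolding bit_time_def ns by (rule sum_mono) (use run in auto)
  also have "\<dots> \<le> (t * length P + 140) * cmax"
    using 4(1) by (simp add: T_def)
  finally show "bit_time P inp \<le> (t * length P + 140) * cmax" .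
  have gd: "good (snd (config_at P inp i))" if "i \<le> T" for i
    using run[of i] fin g8 that by (cases "i = T") auto
  have "cells_used P inp \<le> mtop"
    unfolding cells_used_def by (rule Least_le) (use gd in \<open>auto simp: ns good_def\<close>)
  have "bit_space P inp \<le> (\<Sum>a<cells_used P inp. \<beta>)"
    unfolding bit_space_def
  proof (rule sum_mono)
    fix a
    show "Max ((\<lambda>t. bit_size (snd (config_at P inp t) a)) ` {..num_steps P inp}) \<le> \<beta>"
      by (subst Max_le_iff) (use gd in \<open>auto simp: ns good_def intro!: bs\<close>)
  qed
  also have "\<dots> \<le> mtop * \<beta>" using \<open>cells_used P inp \<le> mtop\<close> by simp
  finally show "bit_space P inp \<le> mtop * \<beta>" .
qed

end

section \<open>Compactness and the spectral theorem in coordinates\<close>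

text \<open>Bolzano-Weierstrass one coordinate at a time: a subsequence that converges in the
  earlier coordinates has a further one that is monotone and bounded in the next.\<close>

lemma coord_convergent_subseq:
  fixes X :: "nat \<Rightarrow> nat \<Rightarrow> real"
  assumes "\<And>k i. i < d \<Longrightarrow> \<bar>X k i\<bar> \<le> B"
  shows "\<exists>\<phi> l. strict_mono \<phi> \<and> (\<forall>i<d. (\<lambda>k. X (\<phi> k) i) \<longlonglongrightarrow> l i)"
  using assms
proof (induction d)
  case 0
  show ?case by (intro exI[of _ id]) (auto simp: strict_mono_def)
next
  case (Suc d)
  from Suc.IH[OF Suc.prems] obtain \<phi> l where
    1: "strict_mono \<phi>" "\<forall>i<d. (\<lambda>k. X (\<phi> k) i) \<longlonglongrightarrow> l i" by auto
  obtain \<psi> where 2: "strict_mono \<psi>" "monoseq (\<lambda>k. X (\<phi> (\<psi> k)) d)"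
    using seq_monosub[of "\<lambda>k. X (\<phi> k) d"] by auto
  have "Bseq (\<lambda>k. X (\<phi> (\<psi> k)) d)"
    by (rule BseqI'[of _ B]) (use Suc.prems[of d] in auto)
  then obtain c where c: "(\<lambda>k. X (\<phi> (\<psi> k)) d) \<longlonglongrightarrow> c"
    using Bseq_monoseq_convergent[OF _ 2(2)] unfolding convergent_def by auto
  have "(\<lambda>k. X ((\<phi> \<circ> \<psi>) k) i) \<longlonglongrightarrow> (l(d := c)) i" if "i < Suc d" for i
  proof (cases "i = d")
    case False
    then have "(\<lambda>k. X (\<phi> k) i) \<longlonglongrightarrow> l i" using 1 that by auto
    from LIMSEQ_subseq_LIMSEQ[OF this 2(1)] show ?thesis using False by (simp add: o_def)
  qed (use c in simp)
  then show ?case using strict_mono_o[OF 1(1) 2(1)] by blast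
qed

text \<open>Vectors are functions of which only the coordinates below \<open>d\<close> count;
  compactness is expressed by bounds on these and closure under coordinatewise limits.\<close>

lemma coord_attains_min:
  fixes f :: "(nat \<Rightarrow> real) \<Rightarrow> real"
  assumes ne: "K \<noteq> {}" and bd: "\<And>x i. x \<in> K \<Longrightarrow> i < d \<Longrightarrow> \<bar>x i\<bar> \<le> B"
    and cl: "\<And>X l. (\<And>k. X k \<in> K) \<Longrightarrow> (\<And>i. i < d \<Longrightarrow> (\<lambda>k. X k i) \<longlonglongrightarrow> l i) \<Longrightarrow> l \<in> K"
    and co: "\<And>X l. (\<And>i. i < d \<Longrightarrow> (\<lambda>k. X k i) \<longlonglongrightarrow> l i) \<Longrightarrow> (\<lambda>k. f (X k)) \<longlonglongrightarrow> f l"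
  shows "\<exists>x\<in>K. \<forall>y\<in>K. f x \<le> f y"
proof -
  \<comment> \<open>\<open>arctan\<close> preserves the order and provides an infimum before
    \<open>f\<close> is known to be bounded below.\<close>
  let ?g = "\<lambda>x. arctan (f x)"
  define v where "v = Inf (?g ` K)"
  have bdd: "bdd_below (?g ` K)"
    by (rule bdd_belowI2[of _ "- (pi / 2)"]) (use arctan_lbound in \<open>auto intro: less_imp_le\<close>)
  have "\<exists>x\<in>K. ?g x < v + 1 / real (Suc k)" for k
  proof -
    have "v < v + 1 / real (Suc k)" by simp
    then have "\<exists>y\<in>?g ` K. y < v + 1 / real (Suc k)"
      using cInf_less_iff[of "?g ` K" "v + 1 / real (Suc k)"] ne bdd unfolding v_def by blast
    then show ?thesis by blast
  qed
  then obtain X where X: "\<And>k. X k \<in> K" "\<And>k. ?g (X k) < v + 1 / real (Suc k)" by metis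
  have "\<exists>\<phi> l. strict_mono \<phi> \<and> (\<forall>i<d. (\<lambda>k. X (\<phi> k) i) \<longlonglongrightarrow> l i)"
    by (rule coord_convergent_subseq) (use bd X(1) in auto)
  then obtain \<phi> l where l: "strict_mono (\<phi> :: nat \<Rightarrow> nat)" "\<forall>i<d. (\<lambda>k. X (\<phi> k) i) \<longlonglongrightarrow> l i"
    by blast
  have lK: "l \<in> K" by (rule cl[of "\<lambda>k. X (\<phi> k)"]) (use X l in auto)
  have "(\<lambda>k. ?g (X (\<phi> k))) \<longlonglongrightarrow> ?g l"
    by (intro tendsto_arctan co) (use l in auto)
  moreover have "(\<lambda>k. v + 1 / real (Suc (\<phi> k))) \<longlonglongrightarrow> v"
    using LIMSEQ_subseq_LIMSEQ[OF LIMSEQ_inverse_real_of_nat_add[of v] l(1)]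
    by (simp add: o_def inverse_eq_divide)
  ultimately have "?g l \<le> v"
    by (rule LIMSEQ_le) (use X(2) in \<open>auto intro: less_imp_le\<close>)
  moreover have "v \<le> ?g y" if "y \<in> K" for y
    unfolding v_def using bdd that by (auto intro: cInf_lower)
  ultimately have "\<forall>y\<in>K. ?g l \<le> ?g y" by force
  then show ?thesis using lK by (auto simp: arctan_le_iff)
qed

section \<open>Inner products and orthonormal systems\<close>

definition ip :: "nat \<Rightarrow> (nat \<Rightarrow> real) \<Rightarrow> (nat \<Rightarrow> real) \<Rightarrow> real" where
  "ip d x y = (\<Sum>i<d. x i * y i)"

definition mvr :: "nat \<Rightarrow> (nat \<Rightarrow> nat \<Rightarrow> real) \<Rightarrow> (nat \<Rightarrow> real) \<Rightarrow> nat \<Rightarrow> real" where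
  "mvr d S x i = (\<Sum>j<d. S i j * x j)"

lemma ip_sym: "ip d x y = ip d y x" by (simp add: ip_def mult.commute)
lemma ip_add: "ip d (\<lambda>i. x i + y i) z = ip d x z + ip d y z"
  by (simp add: ip_def distrib_right sum.distrib)
lemma ip_scale: "ip d (\<lambda>i. a * x i) z = a * ip d x z"
  by (simp add: ip_def sum_distrib_left mult.assoc)
lemma ip_add2: "ip d z (\<lambda>i. x i + y i) = ip d z x + ip d z y"
  by (simp add: ip_def distrib_left sum.distrib)
lemma ip_scale2: "ip d z (\<lambda>i. a * x i) = a * ip d z x"
  by (simp add: ip_def sum_distrib_left mult_ac)
lemma ip_diff: "ip d (\<lambda>i. x i - y i) z = ip d x z - ip d y z"
  by (simp add: ip_def left_diff_distrib sum_subtractf)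
lemma ip_sum: "ip d (\<lambda>i. \<Sum>a\<in>A. f a i) z = (\<Sum>a\<in>A. ip d (f a) z)"
  by (simp add: ip_def sum_distrib_right) (rule sum.swap)
lemma ip_nonneg: "0 \<le> ip d x x" by (auto simp: ip_def intro: sum_nonneg)
lemma ip_cong: "(\<And>i. i < d \<Longrightarrow> x i = x' i) \<Longrightarrow> (\<And>i. i < d \<Longrightarrow> y i = y' i) \<Longrightarrow> ip d x y = ip d x' y'"
  by (simp add: ip_def)

lemma ip_zero: "ip d x x = 0 \<Longrightarrow> i < d \<Longrightarrow> x i = 0"
  unfolding ip_def by (subst (asm) sum_nonneg_eq_0_iff) auto

lemma ip_unit: "i < d \<Longrightarrow> ip d (\<lambda>j. if j = i then 1 else 0) x = x i"
proof -
  assume i: "i < d"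
  have "ip d (\<lambda>j. if j = i then 1 else 0) x = (\<Sum>j<d. if j = i then x j else 0)"
    unfolding ip_def by (rule sum.cong) auto
  then show ?thesis using i by simp
qed

lemma mvr_sym:
  assumes "\<And>i j. i < d \<Longrightarrow> j < d \<Longrightarrow> S i j = S j i"
  shows "ip d x (mvr d S y) = ip d (mvr d S x) y"
proof -
  have "ip d x (mvr d S y) = (\<Sum>i<d. \<Sum>j<d. x i * (S i j * y j))"
    by (simp add: ip_def mvr_def sum_distrib_left)
  also have "\<dots> = (\<Sum>j<d. \<Sum>i<d. x i * (S i j * y j))" by (rule sum.swap)
  also have "\<dots> = (\<Sum>j<d. \<Sum>i<d. S j i * x i * y j)"
    by (intro sum.cong refl) (use assms in auto)
  finally show ?thesis by (simp add: ip_def mvr_def sum_distrib_right)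
qed

lemma mvr_add: "mvr d S (\<lambda>i. x i + a * y i) = (\<lambda>i. mvr d S x i + a * mvr d S y i)"
  by (rule ext) (simp add: mvr_def distrib_left sum.distrib sum_distrib_left mult_ac)

lemma mvr_scale: "mvr d S (\<lambda>i. a * y i) = (\<lambda>i. a * mvr d S y i)"
  by (rule ext) (simp add: mvr_def sum_distrib_left mult_ac)

lemma mvr_sum: "mvr d S (\<lambda>i. \<Sum>a\<in>A. f a i) = (\<lambda>i. \<Sum>a\<in>A. mvr d S (f a) i)"
  unfolding mvr_def sum_distrib_left by (rule ext, rule sum.swap)

lemma mvr_cong: "(\<And>i. i < d \<Longrightarrow> x i = x' i) \<Longrightarrow> mvr d S x = mvr d S x'"
  by (rule ext) (simp add: mvr_def)

definition orthonormal :: "nat \<Rightarrow> nat \<Rightarrow> (nat \<Rightarrow> nat \<Rightarrow> real) \<Rightarrow> bool" where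
  "orthonormal d k u \<longleftrightarrow> (\<forall>a<k. \<forall>b<k. ip d (u a) (u b) = (if a = b then 1 else 0))"

context
  fixes d k :: nat and u :: "nat \<Rightarrow> nat \<Rightarrow> real"
  assumes on: "orthonormal d k u"
begin

text \<open>The projection of a unit vector onto the orthogonal complement of the system.\<close>

definition "resid i0 = (\<lambda>i. (if i = i0 then 1 else 0) - (\<Sum>a<k. u a i0 * u a i))"

lemma resid_orth: "i0 < d \<Longrightarrow> b < k \<Longrightarrow> ip d (resid i0) (u b) = 0"
proof -
  assume i0: "i0 < d" and b: "b < k"
  have "ip d (\<lambda>i. \<Sum>a<k. u a i0 * u a i) (u b) = (\<Sum>a<k. u a i0 * ip d (u a) (u b))"
    by (simp add: ip_sum ip_scale)
  also have "\<dots> = (\<Sum>a<k. if a = b then u a i0 else 0)"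
    by (rule sum.cong) (use on b in \<open>auto simp: orthonormal_def\<close>)
  finally show ?thesis using i0 b by (simp add: resid_def ip_diff ip_unit)
qed

lemma resid_norm: "i0 < d \<Longrightarrow> ip d (resid i0) (resid i0) = 1 - (\<Sum>a<k. (u a i0)\<^sup>2)"
proof -
  assume i0: "i0 < d"
  have "ip d (resid i0) (resid i0) =
     ip d (\<lambda>j. if j = i0 then 1 else 0) (resid i0) - ip d (\<lambda>i. \<Sum>a<k. u a i0 * u a i) (resid i0)"
    unfolding ip_diff[symmetric] by (rule ip_cong) (auto simp: resid_def)
  also have "ip d (\<lambda>i. \<Sum>a<k. u a i0 * u a i) (resid i0) = 0"
    using resid_orth[OF i0] by (simp add: ip_sum ip_scale ip_sym[of d "u _"])
  finally show ?thesis using i0 by (simp add: ip_unit resid_def power2_eq_square)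
qed

text \<open>This is the trace of the orthogonal projector, hence its rank. It yields a direction
  outside the system if \<open>k < d\<close> and completeness if \<open>k = d\<close>.\<close>

lemma sum_resid_norm: "(\<Sum>i<d. ip d (resid i) (resid i)) = real d - real k"
proof -
  have "(\<Sum>i<d. ip d (resid i) (resid i)) = (\<Sum>i<d. 1 - (\<Sum>a<k. (u a i)\<^sup>2))"
    by (rule sum.cong) (auto simp: resid_norm)
  also have "\<dots> = real d - (\<Sum>a<k. ip d (u a) (u a))"
    by (simp add: sum_subtractf ip_def power2_eq_square) (rule sum.swap)
  also have "(\<Sum>a<k. ip d (u a) (u a)) = (\<Sum>a<k. 1)"
    by (rule sum.cong) (use on in \<open>auto simp: orthonormal_def\<close>)
  finally show ?thesis by simp
qed

lemma orthonormal_complete: "k = d \<Longrightarrow> i < d \<Longrightarrow> j < d \<Longrightarrow> (\<Sum>a<d. u a i * u a j) = (if i = j then 1 else 0)"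
proof -
  assume k: "k = d" and i: "i < d" and j: "j < d"
  have "ip d (resid i) (resid i) = 0"
    using sum_resid_norm k i by (simp add: sum_nonneg_eq_0_iff ip_nonneg)
  from ip_zero[OF this j] have "(if j = i then 1 else 0) - (\<Sum>a<k. u a i * u a j) = 0"
    by (simp add: resid_def)
  then show ?thesis using k by (auto split: if_splits)
qed

text \<open>A minimizer \<open>x\<close> of the Rayleigh quotient on the complement is an
  eigenvector. Its residual \<open>h = S x - \<mu> x\<close> stays in the complement because
  \<open>S\<close> is symmetric, and moving from \<open>x\<close> along \<open>- h\<close> would
  lower the quotient at first order unless \<open>h\<close> vanished.\<close>

lemma next_eigenvector:
  assumes sym: "\<And>i j. i < d \<Longrightarrow> j < d \<Longrightarrow> S i j = S j i"
    and ev: "\<And>a i. a < k \<Longrightarrow> i < d \<Longrightarrow> mvr d S (u a) i = lam a * u a i" and kd: "k < d"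
  shows "\<exists>x \<mu>. ip d x x = 1 \<and> (\<forall>a<k. ip d x (u a) = 0) \<and> (\<forall>i<d. mvr d S x i = \<mu> * x i)"
proof -
  define K where "K = {x. ip d x x = 1 \<and> (\<forall>a<k. ip d x (u a) = 0)}"
  define q where "q x = ip d x (mvr d S x)" for x
  have tip: "(\<lambda>k. ip d (X k) (Y k)) \<longlonglongrightarrow> ip d l m"
    if "\<And>i. i < d \<Longrightarrow> (\<lambda>k. X k i) \<longlonglongrightarrow> l i" "\<And>i. i < d \<Longrightarrow> (\<lambda>k. Y k i) \<longlonglongrightarrow> m i" for X Y l m
    unfolding ip_def using that by (auto intro!: tendsto_sum tendsto_mult)
  obtain i0 where i0: "i0 < d" "ip d (resid i0) (resid i0) > 0"
  proof -
    have "\<exists>i<d. ip d (resid i) (resid i) > 0"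
    proof (rule ccontr)
      assume "\<not> ?thesis"
      then have "(\<Sum>i<d. ip d (resid i) (resid i)) \<le> 0" by (auto intro!: sum_nonpos)
      then show False using sum_resid_norm kd by simp
    qed
    then show ?thesis using that by blast
  qed
  have norm: "(\<lambda>i. inverse (sqrt (ip d h h)) * h i) \<in> K"
    if "ip d h h > 0" "\<forall>a<k. ip d h (u a) = 0" for h
  proof -
    have "sqrt (ip d h h) * sqrt (ip d h h) = ip d h h" using that(1) by simp
    then have "inverse (sqrt (ip d h h)) * (inverse (sqrt (ip d h h)) * ip d h h) = 1"
      using that(1) by (simp add: field_simps del: real_sqrt_mult_self)
    then show ?thesis using that(2) by (simp add: K_def ip_scale ip_scale2)
  qed
  have ne: "K \<noteq> {}" using norm[OF i0(2)] resid_orth[OF i0(1)] by auto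
  have "\<exists>x\<in>K. \<forall>y\<in>K. q x \<le> q y"
  proof (rule coord_attains_min[where B = 1 and d = d])
    fix x i assume "x \<in> K" "i < d"
    then have "(x i)\<^sup>2 \<le> ip d x x"
      unfolding ip_def power2_eq_square by (intro member_le_sum) auto
    then show "\<bar>x i\<bar> \<le> 1" using \<open>x \<in> K\<close> by (simp add: K_def abs_square_le_1)
  next
    fix X :: "nat \<Rightarrow> nat \<Rightarrow> real" and l assume X: "\<And>k. X k \<in> K" "\<And>i. i < d \<Longrightarrow> (\<lambda>k. X k i) \<longlonglongrightarrow> l i"
    have "(\<lambda>k. ip d (X k) (X k)) \<longlonglongrightarrow> ip d l l" by (rule tip) (use X in auto)
    then have "ip d l l = 1" using X by (simp add: K_def LIMSEQ_const_iff)
    moreover have "ip d l (u a) = 0" if "a < k" for a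
    proof -
      have "(\<lambda>k. ip d (X k) (u a)) \<longlonglongrightarrow> ip d l (u a)" by (rule tip) (use X in auto)
      then show ?thesis using X that by (simp add: K_def LIMSEQ_const_iff)
    qed
    ultimately show "l \<in> K" by (simp add: K_def)
  next
    fix X :: "nat \<Rightarrow> nat \<Rightarrow> real" and l assume X: "\<And>i. i < d \<Longrightarrow> (\<lambda>k. X k i) \<longlonglongrightarrow> l i"
    then show "(\<lambda>k. q (X k)) \<longlonglongrightarrow> q l"
      unfolding q_def mvr_def by (intro tip tendsto_sum tendsto_mult tendsto_const) auto
  qed (use ne in auto)
  then obtain x where x: "x \<in> K" "\<And>y. y \<in> K \<Longrightarrow> q x \<le> q y" by blast
  define \<mu> where "\<mu> = q x"
  have qs: "q (\<lambda>i. c * h i) = c\<^sup>2 * q h" for c h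
    by (simp add: q_def mvr_scale ip_scale ip_scale2 power2_eq_square)
  have ray: "\<mu> * ip d h h \<le> q h" if "\<forall>a<k. ip d h (u a) = 0" for h
  proof (cases "ip d h h = 0")
    case True
    then have "q h = 0" using ip_zero[OF True] by (simp add: q_def ip_def)
    then show ?thesis using True by simp
  next
    case False
    then have p: "ip d h h > 0" using ip_nonneg[of d h] by linarith
    from x(2)[OF norm[OF p that]] have "\<mu> \<le> inverse (ip d h h) * q h"
      using p by (simp add: qs \<mu>_def power2_eq_square flip: inverse_mult_distrib)
    then show ?thesis using p by (simp add: field_simps)
  qed
  define h where "h = (\<lambda>i. mvr d S x i - \<mu> * x i)"
  have xu: "\<forall>a<k. ip d x (u a) = 0" "ip d x x = 1" using x by (auto simp: K_def)
  have hu: "\<forall>a<k. ip d h (u a) = 0"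
  proof (intro allI impI)
    fix a assume a: "a < k"
    have "ip d (mvr d S x) (u a) = ip d x (mvr d S (u a))" using mvr_sym[OF sym] by simp
    also have "\<dots> = ip d x (\<lambda>i. lam a * u a i)" by (rule ip_cong) (use ev a in auto)
    finally show "ip d h (u a) = 0" using xu a by (simp add: h_def ip_diff ip_scale ip_scale2)
  qed
  have mh: "ip d x (mvr d S h) = ip d (mvr d S x) h" by (rule mvr_sym[OF sym])
  have hh: "ip d h h = ip d (mvr d S x) h - \<mu> * ip d x h"
    by (subst (1) h_def) (simp add: ip_diff ip_scale)
  \<comment> \<open>Minimality at \<open>x + s * h\<close>, expanded in \<open>s\<close>; by
    \<open>hh\<close> the linear coefficient is twice the squared norm of \<open>h\<close>.\<close>
  have key: "0 \<le> 2 * s * ip d h h + s\<^sup>2 * (q h - \<mu> * ip d h h)" for s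
  proof -
    have "\<forall>a<k. ip d (\<lambda>i. x i + s * h i) (u a) = 0" using xu hu by (simp add: ip_add ip_scale)
    from ray[OF this] have
      "\<mu> * (1 + 2 * s * ip d x h + s\<^sup>2 * ip d h h) \<le> q x + 2 * s * ip d (mvr d S x) h + s\<^sup>2 * q h"
      using mh ip_sym[of d h x] ip_sym[of d h "mvr d S x"] unfolding q_def mvr_add
      by (simp add: ip_add ip_add2 ip_scale ip_scale2 xu power2_eq_square algebra_simps)
    then show ?thesis unfolding hh \<mu>_def[symmetric] by (simp add: algebra_simps)
  qed
  have "ip d h h = 0"
  proof (rule ccontr)
    assume "ip d h h \<noteq> 0"
    then have p: "ip d h h > 0" using ip_nonneg[of d h] by linarith
    define B where "B = \<bar>q h - \<mu> * ip d h h\<bar> + ip d h h"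
    have B: "B > 0" "q h - \<mu> * ip d h h \<le> B" using p by (auto simp: B_def)
    \<comment> \<open>The minimizer of \<open>2 * w * ip d h h + w\<^sup>2 * B\<close>, where
      \<open>B\<close> is a positive upper bound of the quadratic coefficient.\<close>
    define w where "w = - (ip d h h / B)"
    have "w\<^sup>2 * (q h - \<mu> * ip d h h) \<le> w\<^sup>2 * B" by (rule mult_left_mono[OF B(2)]) simp
    with key[of w] have "0 \<le> 2 * w * ip d h h + w\<^sup>2 * B" by linarith
    also have "\<dots> = - ((ip d h h)\<^sup>2 / B)" using B by (simp add: w_def power2_eq_square field_simps)
    also have "\<dots> < 0" using p B by simp
    finally show False by simp
  qed
  then have "\<forall>i<d. mvr d S x i = \<mu> * x i" using ip_zero[of d h] by (simp add: h_def)
  then show ?thesis using xu by blast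
qed

end

theorem spectral:
  assumes sym: "\<And>i j. i < d \<Longrightarrow> j < d \<Longrightarrow> S i j = S j i"
  obtains u lam where "orthonormal d d u"
    "\<And>a i. a < d \<Longrightarrow> i < d \<Longrightarrow> mvr d S (u a) i = lam a * u a i"
proof -
  have "k \<le> d \<Longrightarrow> \<exists>u lam. orthonormal d k u \<and> (\<forall>a<k. \<forall>i<d. mvr d S (u a) i = lam a * u a i)" for k
  proof (induction k)
    case (Suc k)
    then obtain u lam where 1: "orthonormal d k u" "\<forall>a<k. \<forall>i<d. mvr d S (u a) i = lam a * u a i"
      by auto
    have "\<exists>x \<mu>. ip d x x = 1 \<and> (\<forall>a<k. ip d x (u a) = 0) \<and> (\<forall>i<d. mvr d S x i = \<mu> * x i)"
    proof (rule next_eigenvector[OF 1(1) _ _ Suc_le_lessD[OF Suc.prems], where lam = lam])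
      show "S i j = S j i" if "i < d" "j < d" for i j using that by (rule sym)
    qed (use 1(2) in auto)
    then obtain x \<mu> where 2: "ip d x x = 1" "\<forall>a<k. ip d x (u a) = 0" "\<forall>i<d. mvr d S x i = \<mu> * x i"
      by blast
    have "\<forall>a<k. ip d (u a) x = 0" using 2(2) ip_sym[of d x] by metis
    then have "orthonormal d (Suc k) (u(k := x))"
      using 1(1) 2 by (auto simp: orthonormal_def less_Suc_eq)
    moreover have "\<forall>a<Suc k. \<forall>i<d. mvr d S ((u(k := x)) a) i = (lam(k := \<mu>)) a * (u(k := x)) a i"
      using 1(2) 2 by (auto simp: less_Suc_eq)
    ultimately show ?case by blast
  qed (auto simp: orthonormal_def)
  from this[of d] show ?thesis using that by auto
qed

section \<open>Solving a linear system through the characteristic polynomial\<close>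

text \<open>Multiplication by \<open>- M\<close>. With the sign in the operator the relevant
  polynomial is \<open>det (x + M)\<close>, whose coefficients are the elementary symmetric
  functions of the eigenvalues of \<open>M\<close> without alternating signs.\<close>

definition negop :: "nat \<Rightarrow> (nat \<Rightarrow> nat \<Rightarrow> int) \<Rightarrow> (nat \<Rightarrow> int) \<Rightarrow> nat \<Rightarrow> int" where
  "negop d M x j = - (\<Sum>j'<d. M j j' * x j')"

definition unit :: "nat \<Rightarrow> nat \<Rightarrow> int" where "unit i = (\<lambda>j. if j = i then 1 else 0)"

definition trp :: "nat \<Rightarrow> (nat \<Rightarrow> nat \<Rightarrow> int) \<Rightarrow> nat \<Rightarrow> int" where
  "trp d M k = (\<Sum>i<d. (negop d M ^^ k) (unit i) i)"

text \<open>Newton's identity \<open>k * e k = - (\<Sum>j<k. e j * p (k - j))\<close>, with the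
  power sums \<open>p\<close> of the eigenvalues of \<open>- M\<close>, multiplied by
  \<open>fact (k - 1)\<close> and written for \<open>fact k * e k\<close>. The product of indices is
  \<open>fact (k - 1) / fact j\<close>; as no division is left, the recursion makes sense modulo any
  number.\<close>

function Cf :: "nat \<Rightarrow> (nat \<Rightarrow> nat \<Rightarrow> int) \<Rightarrow> nat \<Rightarrow> int" where
  "Cf d M k = (if k = 0 then 1 else
     - (\<Sum>j<k. Cf d M j * (\<Prod>i=Suc j..<k. int i) * trp d M (k - j)))"
  by auto
termination by (relation "measure (\<lambda>(d, M, k). k)") auto

declare Cf.simps [simp del]

text \<open>Horner's scheme for the vector
  \<open>fact (k - 1) * (\<Sum>j<k. e j * (- M) ^ (k - 1 - j)) g\<close>. At \<open>k = d\<close>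
  the matrix polynomial is the adjugate of \<open>M\<close>, by Cayley-Hamilton.\<close>

fun Zf :: "nat \<Rightarrow> (nat \<Rightarrow> nat \<Rightarrow> int) \<Rightarrow> (nat \<Rightarrow> int) \<Rightarrow> nat \<Rightarrow> nat \<Rightarrow> int" where
  "Zf d M g 0 = (\<lambda>j. 0)"
| "Zf d M g (Suc k) = (\<lambda>j. int k * negop d M (Zf d M g k) j + Cf d M k * g j)"

text \<open>In an eigenbasis, identities between polynomials in \<open>M\<close> become identities
  between the real numbers \<open>lam a\<close>. This replaces determinants, adjugates and the
  Cayley-Hamilton theorem.\<close>

locale eigenbasis =
  fixes d :: nat and M :: "nat \<Rightarrow> nat \<Rightarrow> int" and u :: "nat \<Rightarrow> nat \<Rightarrow> real" and lam :: "nat \<Rightarrow> real"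
  assumes on: "orthonormal d d u"
    and ev: "\<And>a i. a < d \<Longrightarrow> i < d \<Longrightarrow> mvr d (\<lambda>i j. real_of_int (M i j)) (u a) i = lam a * u a i"
    and pos: "\<And>a. a < d \<Longrightarrow> lam a > 0"
begin

abbreviation "Mr \<equiv> \<lambda>i j. real_of_int (M i j)"

lemma expand: "i < d \<Longrightarrow> x i = (\<Sum>a<d. ip d x (u a) * u a i)"
proof -
  assume i: "i < d"
  have "(\<Sum>a<d. ip d x (u a) * u a i) = (\<Sum>a<d. \<Sum>j<d. x j * (u a j * u a i))"
    by (simp add: ip_def sum_distrib_right mult.assoc)
  also have "\<dots> = (\<Sum>j<d. x j * (\<Sum>a<d. u a j * u a i))"
    by (subst sum.swap) (simp add: sum_distrib_left)
  also have "\<dots> = (\<Sum>j<d. if j = i then x j else 0)"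
    by (rule sum.cong) (auto simp: orthonormal_complete[OF on refl] i)
  finally show ?thesis using i by simp
qed

lemma parseval: "ip d x x = (\<Sum>a<d. (ip d x (u a))\<^sup>2)"
proof -
  have "ip d x x = ip d (\<lambda>i. \<Sum>a<d. ip d x (u a) * u a i) x"
    by (rule ip_cong) (auto simp: expand[symmetric])
  also have "\<dots> = (\<Sum>a<d. ip d x (u a) * ip d (u a) x)" by (simp add: ip_sum ip_scale)
  finally show ?thesis by (simp add: power2_eq_square ip_sym[of d "u _"])
qed

lemma mvr_expand:
  assumes "\<And>i. i < d \<Longrightarrow> x i = (\<Sum>a<d. c a * u a i)" "i < d"
  shows "mvr d Mr x i = (\<Sum>a<d. lam a * c a * u a i)"
proof -
  have "mvr d Mr x i = mvr d Mr (\<lambda>i. \<Sum>a<d. c a * u a i) i"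
    by (rule fun_cong[OF mvr_cong]) (use assms(1) in auto)
  also have "\<dots> = (\<Sum>a<d. c a * mvr d Mr (u a) i)" by (simp add: mvr_sum mvr_scale)
  finally show ?thesis using ev assms(2) by (simp add: mult_ac)
qed

lemma negop_expand:
  assumes "\<And>i. i < d \<Longrightarrow> real_of_int (x i) = (\<Sum>a<d. c a * u a i)" "i < d"
  shows "real_of_int (negop d M x i) = (\<Sum>a<d. (- lam a * c a) * u a i)"
proof -
  have "real_of_int (negop d M x i) = - mvr d Mr (\<lambda>i. real_of_int (x i)) i"
    by (simp add: negop_def mvr_def)
  also have "\<dots> = - (\<Sum>a<d. lam a * c a * u a i)" using mvr_expand[OF assms] by simp
  finally show ?thesis by (simp add: sum_negf)
qed

lemma trp_eq: "real_of_int (trp d M k) = (\<Sum>a<d. (- lam a) ^ k)"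
proof -
  have pw: "i < d \<Longrightarrow> real_of_int ((negop d M ^^ k) x i) =
      (\<Sum>a<d. ((- lam a) ^ k * ip d (\<lambda>j. real_of_int (x j)) (u a)) * u a i)" for x i
  proof (induction k arbitrary: i)
    case 0
    then show ?case using expand[of i "\<lambda>j. real_of_int (x j)"] by simp
  next
    case (Suc k)
    show ?case using negop_expand[OF Suc.IH] Suc.prems by (simp add: mult.assoc)
  qed
  have "real_of_int (trp d M k) = (\<Sum>i<d. \<Sum>a<d. (- lam a) ^ k * (u a i * u a i))"
    unfolding trp_def of_int_sum
  proof (rule sum.cong[OF refl])
    fix i assume "i \<in> {..<d}"
    then have i: "i < d" by simp
    have "ip d (\<lambda>j. real_of_int (unit i j)) (u a) = u a i" for a
      using ip_unit[OF i, of "u a"] by (simp add: unit_def if_distrib cong: if_cong)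
    then show "real_of_int ((negop d M ^^ k) (unit i) i) = (\<Sum>a<d. (- lam a) ^ k * (u a i * u a i))"
      unfolding pw[OF i] by (simp add: mult.assoc)
  qed
  also have "\<dots> = (\<Sum>a<d. (- lam a) ^ k * ip d (u a) (u a))"
    by (subst sum.swap) (simp add: ip_def sum_distrib_left)
  also have "\<dots> = (\<Sum>a<d. (- lam a) ^ k)"
    by (rule sum.cong) (use on in \<open>auto simp: orthonormal_def\<close>)
  finally show ?thesis .
qed

section \<open>Newton's identities for the eigenvalues\<close>

definition "chi = (\<Prod>a<d. [:lam a, 1:])"
definition "E k = coeff chi (d - k)"
definition "Q a = (\<Prod>b\<in>{..<d}-{a}. [:lam b, 1:])"
text \<open>The coefficients that synthetic division of \<open>chi\<close> by
  \<open>x + lam a\<close> produces; \<open>qq_Q\<close> identifies them with those of the quotient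
  \<open>Q a\<close>.\<close>

definition "qq a k = (\<Sum>j\<le>k. E j * (- lam a) ^ (k - j))"

lemma deg_chi: "degree chi = d" "lead_coeff chi = 1"
proof -
  have "degree (\<Prod>a\<in>A. [:lam a, 1:]) = card A" if "finite A" for A
    using that by (subst degree_prod_eq_sum_degree) auto
  then show "degree chi = d" by (simp add: chi_def)
  show "lead_coeff chi = 1" unfolding chi_def by (simp add: lead_coeff_prod)
qed

lemma deg_Q: "a < d \<Longrightarrow> degree (Q a) < d"
  unfolding Q_def by (subst degree_prod_eq_sum_degree) auto

lemma chi_Q: "a < d \<Longrightarrow> chi = [:lam a, 1:] * Q a"
  unfolding chi_def Q_def by (subst prod.remove[of _ a]) auto

lemma E_0: "E 0 = 1" using deg_chi by (simp add: E_def)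

lemma E_d: "E d = (\<Prod>a<d. lam a)"
  by (simp add: E_def chi_def poly_0_coeff_0[symmetric] poly_prod)

lemma qq_Suc: "qq a (Suc k) = E (Suc k) - lam a * qq a k"
proof -
  have "(\<Sum>j\<le>k. E j * (- lam a) ^ (Suc k - j)) = - lam a * qq a k"
    unfolding qq_def sum_distrib_left by (rule sum.cong) (auto simp: Suc_diff_le)
  then show ?thesis by (simp add: qq_def)
qed

lemma qq_Q: "a < d \<Longrightarrow> k < d \<Longrightarrow> coeff (Q a) (d - 1 - k) = qq a k"
proof (induction k)
  case 0
  have "coeff chi d = coeff (Q a) (d - 1) + lam a * coeff (Q a) d"
    using 0 by (subst chi_Q[of a]) (auto simp: coeff_pCons split: nat.split)
  moreover have "coeff (Q a) d = 0" using deg_Q[of a] 0 by (simp add: coeff_eq_0)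
  ultimately show ?case using E_0 by (simp add: qq_def E_def)
next
  case (Suc k)
  have e: "d - Suc k = Suc (d - 1 - Suc k)" "d - 1 - k = d - Suc k" using Suc.prems by auto
  have "coeff chi (d - Suc k) = coeff (Q a) (d - 1 - Suc k) + lam a * coeff (Q a) (d - 1 - k)"
    unfolding e(2) using Suc.prems by (subst chi_Q[of a]) (auto simp: e(1) coeff_pCons)
  then show ?case using Suc qq_Suc[of a k] by (simp add: E_def)
qed

text \<open>The division leaves no remainder: this is the Cayley-Hamilton identity in the direction
  of \<open>u a\<close>.\<close>

lemma qq_last: "a < d \<Longrightarrow> lam a * qq a (d - 1) = E d"
proof -
  assume a: "a < d"
  have "coeff chi 0 = lam a * coeff (Q a) 0" by (subst chi_Q[OF a]) simp
  then show ?thesis using qq_Q[OF a, of "d - 1"] a by (simp add: E_def)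
qed

text \<open>Two readings of \<open>\<Sum>a<d. qq a k\<close>: expanded by definition it gives the
  power sums, and as a coefficient it belongs to the derivative of \<open>chi\<close>, which is the
  sum of all \<open>Q a\<close>.\<close>

lemma newton: "0 < k \<Longrightarrow> k \<le> d \<Longrightarrow> (\<Sum>j<k. E j * real_of_int (trp d M (k - j))) = - real k * E k"
proof -
  assume k: "0 < k" "k \<le> d"
  have "(\<Sum>a<d. qq a k) = (\<Sum>j\<le>k. E j * (\<Sum>a<d. (- lam a) ^ (k - j)))"
    unfolding qq_def by (subst sum.swap) (simp add: sum_distrib_left)
  also have "\<dots> = (\<Sum>j\<le>k. E j * real_of_int (trp d M (k - j)))" by (simp add: trp_eq)
  also have "\<dots> = (\<Sum>j<k. E j * real_of_int (trp d M (k - j))) + E k * real d"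
    by (simp add: lessThan_Suc_atMost[symmetric] trp_eq)
  finally have 1: "(\<Sum>a<d. qq a k) = (\<Sum>j<k. E j * real_of_int (trp d M (k - j))) + E k * real d" .
  have "(\<Sum>a<d. qq a k) = real (d - k) * E k"
  \<comment> \<open>\<open>Q a\<close> has degree below \<open>d\<close>, so for
    \<open>k = d\<close> there is no coefficient to compare; the vanishing remainder takes its
    place.\<close>
  proof (cases "k = d")
    case True
    have "qq a d = 0" if "a < d" for a
      using qq_Suc[of a "d - 1"] qq_last[OF that] that k by (cases d) auto
    then show ?thesis using True by simp
  next
    case False
    then have kd: "k < d" using k by simp
    have "coeff (pderiv chi) (d - 1 - k) = real (d - k) * E k"
      using kd by (simp add: coeff_pderiv E_def Suc_diff_Suc)
    moreover have "pderiv chi = (\<Sum>a<d. Q a)"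
      unfolding chi_def Q_def pderiv_prod by (simp add: pderiv_pCons)
    ultimately show ?thesis using qq_Q[OF _ kd] by (simp add: coeff_sum)
  qed
  with 1 show ?thesis using k by (simp add: of_nat_diff algebra_simps)
qed

lemma Cf_eq: "k \<le> d \<Longrightarrow> real_of_int (Cf d M k) = fact k * E k"
proof (induction k rule: less_induct)
  case (less k)
  show ?case
  proof (cases "k = 0")
    case True
    then show ?thesis using E_0 by (simp add: Cf.simps)
  next
    case False
    have f: "fact j * (\<Prod>i=Suc j..<k. real i) = fact (k - 1)" if "j < k" for j
      using that
    proof (induction k)
      case (Suc k)
      show ?case
      proof (cases "j = k")
        case False
        then have "j < k" using Suc.prems by simp
        from Suc.IH[OF this] have "fact j * (\<Prod>i=Suc j..<Suc k. real i) = fact (k - 1) * real k"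
          using \<open>j < k\<close> by (simp add: mult.assoc[symmetric])
        then show ?thesis using \<open>j < k\<close> by (cases k) (simp_all add: mult.commute)
      qed simp
    qed simp
    have "real_of_int (Cf d M k) =
       - (\<Sum>j<k. real_of_int (Cf d M j) * (\<Prod>i=Suc j..<k. real i) * real_of_int (trp d M (k - j)))"
      using False by (subst Cf.simps) simp
    also have "\<dots> = - (\<Sum>j<k. fact (k - 1) * (E j * real_of_int (trp d M (k - j))))"
      using less f by (auto intro!: sum.cong simp: mult_ac)
    also have "\<dots> = fact (k - 1) * real k * E k"
      using newton[of k] False less.prems by (simp add: sum_distrib_left[symmetric])
    finally show ?thesis using False by (cases k) (auto simp: mult_ac)
  qed
qed

lemma Zf_eq: "k < d \<Longrightarrow> j < d \<Longrightarrow> real_of_int (Zf d M g (Suc k) j) =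
   (\<Sum>a<d. (fact k * qq a k * ip d (\<lambda>j. real_of_int (g j)) (u a)) * u a j)"
proof (induction k arbitrary: j)
  case 0
  have "real_of_int (g j) = (\<Sum>a<d. ip d (\<lambda>j. real_of_int (g j)) (u a) * u a j)"
    by (rule expand) (use 0 in auto)
  then show ?case using E_0 by (simp add: Cf.simps qq_def)
next
  case (Suc k)
  let ?g = "\<lambda>a. ip d (\<lambda>j. real_of_int (g j)) (u a)"
  have gj: "real_of_int (g j) = (\<Sum>a<d. ?g a * u a j)"
    by (rule expand) (use Suc.prems in auto)
  have "real_of_int (Zf d M g (Suc (Suc k)) j) =
     real (Suc k) * (\<Sum>a<d. (- lam a * (fact k * qq a k * ?g a)) * u a j) + fact (Suc k) * E (Suc k) * real_of_int (g j)"
    using negop_expand[of "Zf d M g (Suc k)", OF Suc.IH] Suc.prems Cf_eq[of "Suc k"]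
    by (simp del: fact_Suc)
  also have "\<dots> = (\<Sum>a<d. (fact (Suc k) * qq a (Suc k) * ?g a) * u a j)"
    unfolding gj qq_Suc sum_distrib_left sum.distrib[symmetric]
    by (rule sum.cong) (auto simp: algebra_simps)
  finally show ?case .
qed

section \<open>The solution, its norm, and the size of the denominator\<close>

definition "sol g j = (\<Sum>a<d. (ip d (\<lambda>j. real_of_int (g j)) (u a) / lam a) * u a j)"

lemma sol_correct: "i < d \<Longrightarrow> mvr d Mr (sol g) i = real_of_int (g i)"
proof -
  assume i: "i < d"
  have "mvr d Mr (sol g) i = (\<Sum>a<d. lam a * (ip d (\<lambda>j. real_of_int (g j)) (u a) / lam a) * u a i)"
    by (rule mvr_expand) (use i in \<open>auto simp: sol_def\<close>)
  also have "\<dots> = (\<Sum>a<d. ip d (\<lambda>j. real_of_int (g j)) (u a) * u a i)"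
    using pos by (intro sum.cong) (auto simp: less_imp_neq[symmetric] field_simps)
  finally show ?thesis using expand[OF i, of "\<lambda>j. real_of_int (g j)"] by simp
qed

lemma ip_sol: "a < d \<Longrightarrow> ip d (sol g) (u a) = ip d (\<lambda>j. real_of_int (g j)) (u a) / lam a"
proof -
  assume a: "a < d"
  have "ip d (sol g) (u a) = (\<Sum>b<d. (ip d (\<lambda>j. real_of_int (g j)) (u b) / lam b) * ip d (u b) (u a))"
    unfolding sol_def by (subst ip_sum) (simp add: ip_scale[symmetric])
  also have "\<dots> = (\<Sum>b<d. if b = a then ip d (\<lambda>j. real_of_int (g j)) (u b) / lam b else 0)"
    by (rule sum.cong) (use on a in \<open>auto simp: orthonormal_def\<close>)
  finally show ?thesis using a by simp
qed

lemma sol_norm: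
  assumes "\<And>a. a < d \<Longrightarrow> lam a \<ge> 1 / \<kappa>" "0 < \<kappa>"
  shows "ip d (sol g) (sol g) \<le> \<kappa>\<^sup>2 * ip d (\<lambda>j. real_of_int (g j)) (\<lambda>j. real_of_int (g j))"
  unfolding parseval sum_distrib_left
proof (rule sum_mono)
  fix a assume "a \<in> {..<d}"
  then have a: "a < d" by simp
  have "1 / lam a \<le> \<kappa>" using assms(1)[OF a] assms(2) pos[OF a] by (simp add: field_simps)
  then have "(1 / lam a)\<^sup>2 \<le> \<kappa>\<^sup>2" using pos[OF a] by (intro power_mono) auto
  then have "(1 / lam a)\<^sup>2 * (ip d (\<lambda>j. real_of_int (g j)) (u a))\<^sup>2 \<le>
      \<kappa>\<^sup>2 * (ip d (\<lambda>j. real_of_int (g j)) (u a))\<^sup>2" by (rule mult_right_mono) auto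
  then show "(ip d (sol g) (u a))\<^sup>2 \<le> \<kappa>\<^sup>2 * (ip d (\<lambda>j. real_of_int (g j)) (u a))\<^sup>2"
    unfolding ip_sol[OF a] by (simp add: power_divide)
qed

text \<open>Cramer's rule scaled by \<open>fact d\<close>: the left side is \<open>fact d\<close>
  times the adjugate applied to \<open>g\<close>, and \<open>Cf d M d\<close> is
  \<open>fact d\<close> times the determinant.\<close>

lemma Zf_sol: "0 < d \<Longrightarrow> j < d \<Longrightarrow> real_of_int (int d * Zf d M g d j) = real_of_int (Cf d M d) * sol g j"
proof -
  assume d: "0 < d" and j: "j < d"
  have f: "real d * fact (d - 1) = fact d" using d by (cases d) auto
  have "real_of_int (int d * Zf d M g d j) =
     (\<Sum>a<d. real d * (fact (d - 1) * qq a (d - 1) * ip d (\<lambda>j. real_of_int (g j)) (u a)) * u a j)"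
    using Zf_eq[of "d - 1" j g] d j by (simp add: sum_distrib_left mult.assoc)
  also have "\<dots> = (\<Sum>a<d. fact d * E d * ((ip d (\<lambda>j. real_of_int (g j)) (u a) / lam a) * u a j))"
  proof (rule sum.cong[OF refl])
    fix a assume "a \<in> {..<d}"
    then have a: "a < d" by simp
    have "qq a (d - 1) = E d / lam a" using qq_last[OF a] pos[OF a] by (simp add: field_simps)
    then show "real d * (fact (d - 1) * qq a (d - 1) * ip d (\<lambda>j. real_of_int (g j)) (u a)) * u a j =
      fact d * E d * ((ip d (\<lambda>j. real_of_int (g j)) (u a) / lam a) * u a j)"
      unfolding f[symmetric] by simp
  qed
  also have "\<dots> = fact d * E d * sol g j" unfolding sol_def by (rule sum_distrib_left[symmetric])
  finally show ?thesis by (simp add: Cf_eq)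
qed

lemma Cf_pos: "0 < Cf d M d"
proof -
  have "0 < real_of_int (Cf d M d)" unfolding Cf_eq[OF order_refl] E_d
    using pos by (intro mult_pos_pos prod_pos) auto
  then show ?thesis by simp
qed

lemma sum_lam: "(\<Sum>a<d. lam a) = (\<Sum>i<d. real_of_int (M i i))"
proof -
  have "real_of_int (trp d M 1) = - (\<Sum>i<d. real_of_int (M i i))"
    by (simp add: trp_def negop_def unit_def if_distrib sum_negf cong: if_cong)
  then show ?thesis using trp_eq[of 1] by (simp add: sum_negf)
qed

text \<open>Each eigenvalue is at most the trace, and \<open>fact d \<le> d ^ d\<close>.\<close>

lemma Cf_le:
  assumes "(\<Sum>i<d. real_of_int (M i i)) \<le> s"
  shows "real_of_int (Cf d M d) \<le> (real d * s) ^ d"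
proof -
  have "lam a \<le> s" if "a < d" for a
  proof -
    have "lam a \<le> (\<Sum>a<d. lam a)" using pos that by (intro member_le_sum) (auto intro: less_imp_le)
    then show ?thesis using assms sum_lam by simp
  qed
  then have "(\<Prod>a<d. lam a) \<le> (\<Prod>a<d. s)" using pos by (intro prod_mono) (auto intro: less_imp_le)
  moreover have "fact d \<le> real d ^ d" using fact_le_power[of d] by simp
  moreover have "0 \<le> (\<Prod>a<d. lam a)" using pos by (intro prod_nonneg) (auto intro: less_imp_le)
  ultimately show ?thesis unfolding Cf_eq[OF order_refl] E_d power_mult_distrib
    by (intro mult_mono) auto
qed

end

section \<open>Counting primes\<close>

text \<open>
  The integral of \<open>x ^ i * (1 - x) ^ j\<close> over the unit interval, \<open>i! * j! / (i + j + 1)!\<close>, is a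
  rational number whose denominator divides every common multiple of \<open>1, \<dots>, i + j + 1\<close>.
\<close>

lemma beta_mult_Ints:
  assumes x: "\<And>i. 1 \<le> i \<Longrightarrow> i \<le> N \<Longrightarrow> i dvd x" and "i + j < N"
  shows "real x * (fact i * fact j / fact (Suc (i + j))) \<in> \<int>"
  using assms(2)
proof (induction j arbitrary: i)
  case 0
  then have "Suc i dvd x" using x[of "Suc i"] by simp
  then obtain k where "x = k * Suc i" by (metis dvdE mult.commute)
  moreover have "fact i / fact (Suc i) = (1 / real (Suc i) :: real)" by simp
  ultimately have "real x * (fact i * fact 0 / fact (Suc (i + 0))) = real k"
    by (simp del: fact_Suc of_nat_Suc mult_Suc_right)
  then show ?case by simp
next
  case (Suc j)
  \<comment> \<open>The integral of \<open>x ^ i * (1 - x) ^ j * (1 - x)\<close>, taken termwise in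
    the last factor.\<close>
  have e: "fact i * fact (Suc j) / fact (Suc (i + Suc j)) =
      (fact i * fact j / fact (Suc (i + j)) - fact (Suc i) * fact j / fact (Suc (Suc i + j)) :: real)"
  proof -
    have "fact i * fact j / fact (Suc (i + j)) =
       (fact i * fact j * real (Suc (Suc (i + j))) / fact (Suc (Suc (i + j))) :: real)"
      by (subst fact_Suc[of "Suc (i + j)"]) (simp del: fact_Suc)
    moreover define F :: real where "F = fact (Suc (Suc (i + j)))"
    moreover have "fact (Suc j) = real (Suc j) * (fact j :: real)" "fact (Suc i) = real (Suc i) * (fact i :: real)"
      by (simp_all only: fact_Suc)
    ultimately show ?thesis
      by (simp del: fact_Suc add: diff_divide_distrib[symmetric]) (simp add: algebra_simps)
  qed
  have "real x * (fact i * fact j / fact (Suc (i + j))) \<in> \<int>"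
       "real x * (fact (Suc i) * fact j / fact (Suc (Suc i + j))) \<in> \<int>"
    using Suc.IH[of i] Suc.IH[of "Suc i"] Suc.prems by auto
  from Ints_diff[OF this] show ?case unfolding e right_diff_distrib .
qed

text \<open>For \<open>i = j = m\<close> the multiple of the integral is a positive integer, hence
  at least 1. So \<open>x\<close> is at least \<open>2 * m + 1\<close> times the central binomial
  coefficient.\<close>

lemma common_multiple_ge:
  assumes x: "\<And>i. 1 \<le> i \<Longrightarrow> i \<le> 2 * m + 1 \<Longrightarrow> i dvd x" and "0 < x" "0 < m"
  shows "4 ^ m \<le> x"
proof -
  have "real x * (fact m * fact m / fact (Suc (m + m))) \<in> \<int>"
    by (rule beta_mult_Ints[of "2 * m + 1"]) (use x in auto)
  moreover have "real x * (fact m * fact m / fact (Suc (m + m))) > 0" using assms by simp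
  ultimately have ge: "1 \<le> real x * (fact m * fact m / fact (Suc (m + m)))"
    by (elim Ints_cases) (simp del: fact_Suc)
  have b: "real ((2 * m) choose m) = fact (2 * m) / (fact m * fact m)"
    by (subst binomial_fact) (auto simp: mult_2)
  have "fact (Suc (m + m)) \<le> real x * (fact m * fact m)" using ge by (simp add: field_simps del: fact_Suc)
  moreover have "fact (Suc (m + m)) = real (2 * m + 1) * fact (2 * m)"
    unfolding fact_Suc mult_2 by simp
  ultimately have "real (2 * m + 1) * fact (2 * m) \<le> real x * (fact m * fact m)" by simp
  then have "real (2 * m + 1) * real ((2 * m) choose m) \<le> real x"
    unfolding b times_divide_eq_right by (subst pos_divide_le_eq) auto
  moreover have "4 ^ m \<le> 2 * real m * real ((2 * m) choose m)"
    using central_binomial_lower_bound[of m] assms by (simp add: field_simps)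
  moreover have "2 * real m * real ((2 * m) choose m) \<le> real (2 * m + 1) * real ((2 * m) choose m)"
    by (rule mult_right_mono) auto
  ultimately have "4 ^ m \<le> real x" by linarith
  then show ?thesis using of_nat_le_iff[of "4 ^ m" x, where ?'a = real] by simp
qed

text \<open>With fewer than \<open>K\<close> primes up to \<open>N\<close>, the product of their
  largest powers up to \<open>N\<close> would be a common multiple of \<open>1, ..., N\<close> of
  size at most \<open>N ^ K\<close>, against the lower bound \<open>4 ^ (8 * K\<^sup>2)\<close>. A
  quadratic bound is affordable: trial division of all candidates takes about \<open>K ^ 3\<close>
  operations.\<close>

lemma many_primes: "K \<le> card {p. prime p \<and> p \<le> 16 * K\<^sup>2 + (1::nat)}"
proof (rule ccontr)
  define N where "N = 16 * K\<^sup>2 + 1"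
  define A where "A = {p::nat. prime p \<and> p \<le> N}"
  assume "\<not> ?thesis"
  then have cA: "card A < K" by (simp add: A_def N_def)
  then have K: "0 < K" by simp
  have fin: "finite A" by (rule finite_subset[of _ "{..N}"]) (auto simp: A_def)
  define e where "e p = Max {k. p ^ k \<le> N}" for p :: nat
  have ex: "p ^ k \<le> N \<Longrightarrow> k \<le> e p" "p ^ e p \<le> N" if "p \<in> A" for p k
  proof -
    have p: "2 \<le> p" using that by (auto simp: A_def prime_ge_2_nat)
    have "{k. p ^ k \<le> N} \<subseteq> {..N}"
    proof (clarsimp)
      fix k assume "p ^ k \<le> N"
      moreover have "k < p ^ k" using p by (simp add: less_exp power_gt_expt)
      ultimately show "k \<le> N" by simp
    qed
    then have f: "finite {k. p ^ k \<le> N}" by (rule finite_subset) simp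
    show "p ^ k \<le> N \<Longrightarrow> k \<le> e p" unfolding e_def using f by (intro Max_ge) auto
    have "{k. p ^ k \<le> N} \<noteq> {}" by (auto simp: N_def intro: exI[of _ 0])
    from Max_in[OF f this] show "p ^ e p \<le> N" by (simp add: e_def)
  qed
  define x where "x = (\<Prod>p\<in>A. p ^ e p)"
  have "4 ^ (8 * K\<^sup>2) \<le> x"
  proof (rule common_multiple_ge)
    show "0 < x" unfolding x_def by (intro prod_pos) (auto simp: A_def prime_gt_0_nat)
    show "0 < 8 * K\<^sup>2" using K by simp
    fix i :: nat assume i: "1 \<le> i" "i \<le> 2 * (8 * K\<^sup>2) + 1"
    have sub: "prime_factors i \<subseteq> A"
    proof
      fix p assume "p \<in> prime_factors i"
      then have "prime p" "p dvd i" by auto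
      then have "p \<le> i" using i by (auto dest: dvd_imp_le)
      then show "p \<in> A" using \<open>prime p\<close> i by (auto simp: A_def N_def)
    qed
    have "i = (\<Prod>p \<in> prime_factors i. p ^ multiplicity p i)"
      using i by (intro prime_factorization_nat) auto
    also have "\<dots> dvd (\<Prod>p \<in> prime_factors i. p ^ e p)"
    proof (rule prod_dvd_prod)
      fix p assume "p \<in> prime_factors i"
      then have pA: "p \<in> A" using sub by auto
      have "p ^ multiplicity p i \<le> i" using i by (intro dvd_imp_le multiplicity_dvd) auto
      then have "multiplicity p i \<le> e p" using i by (intro ex(1)[OF pA]) (auto simp: N_def)
      then show "p ^ multiplicity p i dvd p ^ e p" by (rule le_imp_power_dvd)
    qed
    also have "\<dots> dvd x" unfolding x_def by (rule prod_dvd_prod_subset[OF fin sub])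
    finally show "i dvd x" .
  qed
  also have "x \<le> (\<Prod>p\<in>A. N)" unfolding x_def by (rule prod_mono) (use ex(2) in auto)
  also have "\<dots> = N ^ card A" by simp
  also have "\<dots> \<le> N ^ K" using cA by (intro power_increasing) (auto simp: N_def)
  also have "\<dots> \<le> (2 ^ (5 + 2 * K)) ^ K"
  proof (rule power_mono)
    have "K\<^sup>2 \<le> (2 ^ K)\<^sup>2" by (rule power_mono) (simp_all add: less_imp_le)
    then have "K\<^sup>2 \<le> 2 ^ (2 * K)" by (simp add: power_mult power2_eq_square flip: power_add mult_2)
    moreover have "(1::nat) \<le> 2 ^ (2 * K)" by simp
    ultimately have "N \<le> 17 * 2 ^ (2 * K)" unfolding N_def by linarith
    also have "\<dots> \<le> 2 ^ 5 * 2 ^ (2 * K)" by simp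
    finally show "N \<le> 2 ^ (5 + 2 * K)" by (simp add: power_add)
  qed simp
  also have "\<dots> = 2 ^ (5 * K + 2 * K\<^sup>2)" by (simp add: power2_eq_square algebra_simps flip: power_mult)
  also have "\<dots> < 2 ^ (16 * K\<^sup>2)"
  proof (rule power_strict_increasing)
    have "K \<le> K\<^sup>2" by (simp add: power2_eq_square)
    moreover have "0 < K\<^sup>2" using K by simp
    ultimately
    show "5 * K + 2 * K\<^sup>2 < 16 * K\<^sup>2" by linarith
  qed simp
  also have "\<dots> = 4 ^ (8 * K\<^sup>2)" by (simp add: power_mult)
  finally show False by simp
qed

definition plist :: "nat \<Rightarrow> nat list" where "plist p = filter prime [0..<p]"

lemma plist_Suc: "plist (Suc p) = plist p @ (if prime p then [p] else [])"
  by (simp add: plist_def)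

lemma plist_2: "plist 2 = []"
  by (auto simp: plist_def filter_empty_conv dest: prime_ge_2_nat)

lemma plist_many: "K \<le> length (plist (16 * K\<^sup>2 + 2))"
proof -
  have "length (plist (16 * K\<^sup>2 + 2)) = card {p. prime p \<and> p \<le> 16 * K\<^sup>2 + (1::nat)}"
    unfolding plist_def
  proof (subst distinct_card[symmetric])
    have "set (filter prime [0..<16 * K\<^sup>2 + 2]) = {p. prime p \<and> p \<le> 16 * K\<^sup>2 + 1}"
      by (auto simp del: upt_Suc simp: less_Suc_eq_le)
    then show "card (set (filter prime [0..<16 * K\<^sup>2 + 2])) = card {p. prime p \<and> p \<le> 16 * K\<^sup>2 + 1}"
      by (rule arg_cong)
  qed simp
  then show ?thesis using many_primes[of K] by simp
qed

lemma plist_nth: "l < length (plist p) \<Longrightarrow> prime (plist p ! l) \<and> plist p ! l < p"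
  using nth_mem[of l "plist p"] by (auto simp: plist_def)

lemma plist_distinct: "distinct (plist p)" by (simp add: plist_def)

lemma prime_iff_plist:
  assumes "2 \<le> p"
  shows "prime p \<longleftrightarrow> (\<forall>l<length (plist p). \<not> plist p ! l dvd p)"
proof
  assume "prime p"
  then show "\<forall>l<length (plist p). \<not> plist p ! l dvd p"
    by (metis less_irrefl not_prime_1 plist_nth prime_nat_iff)
next
  assume r: "\<forall>l<length (plist p). \<not> plist p ! l dvd p"
  show "prime p"
  proof (rule ccontr)
    assume np: "\<not> prime p"
    obtain q where q: "prime q" "q dvd p" using prime_factor_nat[of p] assms by auto
    then have "q < p" using np assms by (metis dvd_imp_le le_neq_implies_less less_le_trans zero_less_numeral)
    then have "q \<in> set (plist p)" using q by (auto simp: plist_def)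
    then show False using r q by (metis in_set_conv_nth)
  qed
qed

section \<open>Fractional Chinese remaindering\<close>

text \<open>
  Summing the rounded-down fractions \<open>(X w\<^sub>l mod m\<^sub>l) / m\<^sub>l\<close> in units of \<open>1 / S\<close> and modulo 1 yields
  \<open>X / N\<close> up to \<open>J\<close> units, without ever forming \<open>X\<close> or \<open>N\<close>.
\<close>

lemma crt_fraction:
  fixes m w :: "nat \<Rightarrow> int"
  assumes pos: "\<And>l. l < J \<Longrightarrow> 0 < m l"
    and cop: "\<And>l j. l < J \<Longrightarrow> j < J \<Longrightarrow> l \<noteq> j \<Longrightarrow> coprime (m l) (m j)"
    and inv: "\<And>l. l < J \<Longrightarrow> [w l * (\<Prod>j\<in>{..<J}-{l}. m j) = 1] (mod m l)"
    and S: "0 < S"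
  defines "N \<equiv> \<Prod>l<J. m l"
  obtains a where "[(\<Sum>l<J. ((X * w l) mod m l * S) div m l) = a] (mod S)"
    "real_of_int S * real_of_int X / real_of_int N - real J \<le> real_of_int a"
    "real_of_int a \<le> real_of_int S * real_of_int X / real_of_int N"
proof -
  define r where "r l = (X * w l) mod m l" for l
  define Nl where "Nl l = (\<Prod>j\<in>{..<J}-{l}. m j)" for l
  have N: "l < J \<Longrightarrow> N = m l * Nl l" for l unfolding N_def Nl_def by (subst prod.remove[of _ l]) auto
  have Npos: "0 < N" unfolding N_def by (rule prod_pos) (use pos in auto)
  have "[(\<Sum>l<J. r l * Nl l) = X] (mod (\<Prod>l<J. m l))"
  proof (rule cong_cong_prod_coprime)
    show "\<forall>l\<in>{..<J}. [(\<Sum>l<J. r l * Nl l) = X] (mod m l)"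
    proof
      fix l assume "l \<in> {..<J}"
      then have l: "l < J" by simp
      have "(\<Sum>j<J. r j * Nl j) = r l * Nl l + (\<Sum>j\<in>{..<J}-{l}. r j * Nl j)"
        by (subst sum.remove[of _ l]) (use l in auto)
      moreover have "m l dvd (\<Sum>j\<in>{..<J}-{l}. r j * Nl j)"
      proof (rule dvd_sum)
        fix j assume "j \<in> {..<J} - {l}"
        then have "m l dvd Nl j" unfolding Nl_def using l by (intro dvd_prodI) auto
        then show "m l dvd r j * Nl j" by simp
      qed
      ultimately have 1: "[(\<Sum>j<J. r j * Nl j) = r l * Nl l] (mod m l)"
        by (simp add: cong_iff_dvd_diff)
      have "[r l * Nl l = (X * w l) * Nl l] (mod m l)"
        unfolding r_def by (intro cong_mult) auto
      also have "(X * w l) * Nl l = X * (w l * Nl l)" by simp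
      also have "[X * (w l * Nl l) = X * 1] (mod m l)"
        using inv[OF l] unfolding Nl_def by (intro cong_mult cong_refl)
      finally show "[(\<Sum>l<J. r l * Nl l) = X] (mod m l)" using 1 cong_trans by fastforce
    qed
    show "\<forall>i\<in>{..<J}. \<forall>j\<in>{..<J}. i \<noteq> j \<longrightarrow> coprime (m i) (m j)" using cop by auto
  qed
  \<comment> \<open>The unknown integer \<open>q\<close> contributes a multiple of \<open>S\<close>
    to the sum of fractions and disappears modulo \<open>S\<close>.\<close>
  then obtain q where q: "(\<Sum>l<J. r l * Nl l) = X + q * N"
    unfolding N_def[symmetric] by (metis cong_iff_lin cong_sym mult.commute)
  define a where "a = (\<Sum>l<J. (r l * S) div m l) - q * S"
  have real: "(\<Sum>l<J. real_of_int (r l) * real_of_int S / real_of_int (m l)) =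
     real_of_int S * real_of_int X / real_of_int N + real_of_int (q * S)"
  proof -
    have "(\<Sum>l<J. real_of_int (r l) * real_of_int S / real_of_int (m l)) =
       (\<Sum>l<J. real_of_int S / real_of_int N * real_of_int (r l * Nl l))"
    proof (rule sum.cong[OF refl])
      fix l assume "l \<in> {..<J}"
      then have l: "l < J" by simp
      have "Nl l \<noteq> 0" "m l \<noteq> 0" using N[OF l] Npos by auto
      then show "real_of_int (r l) * real_of_int S / real_of_int (m l) =
        real_of_int S / real_of_int N * real_of_int (r l * Nl l)"
        unfolding N[OF l] by (simp add: field_simps)
    qed
    also have "\<dots> = real_of_int S / real_of_int N * real_of_int (X + q * N)"
      by (simp only: sum_distrib_left[symmetric] of_int_sum[symmetric] q)
    finally show ?thesis using Npos by (simp add: field_simps)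
  qed
  have fl: "real_of_int (r l) * real_of_int S / real_of_int (m l) - 1 \<le> real_of_int ((r l * S) div m l)"
    "real_of_int ((r l * S) div m l) \<le> real_of_int (r l) * real_of_int S / real_of_int (m l)" if "l < J" for l
    using floor_divide_of_int_eq[of "r l * S" "m l", where ?'a = real]
      of_int_floor_le[of "real_of_int (r l * S) / real_of_int (m l)"]
      real_of_int_floor_gt_diff_one[of "real_of_int (r l * S) / real_of_int (m l)"] by auto
  have "(\<Sum>l<J. real_of_int (r l) * real_of_int S / real_of_int (m l) - 1) \<le> (\<Sum>l<J. real_of_int ((r l * S) div m l))"
    "(\<Sum>l<J. real_of_int ((r l * S) div m l)) \<le> (\<Sum>l<J. real_of_int (r l) * real_of_int S / real_of_int (m l))"
    using fl by (auto intro!: sum_mono)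
  then have "real_of_int S * real_of_int X / real_of_int N - real J \<le> real_of_int a"
    "real_of_int a \<le> real_of_int S * real_of_int X / real_of_int N"
    unfolding sum_subtractf real a_def by auto
  moreover have "[(\<Sum>l<J. (r l * S) div m l) = a] (mod S)"
    by (simp add: a_def cong_iff_dvd_diff)
  ultimately show ?thesis using that unfolding r_def by blast
qed

text \<open>Numerators may be negative, so residues are read in the symmetric range.\<close>

lemma centered_mod:
  fixes a S x :: int
  assumes "[x = a] (mod S)" "2 * \<bar>a\<bar> < S"
  shows "(if 2 * (x mod S) - S > 0 then x mod S - S else x mod S) = a"
proof -
  have e: "x mod S = a mod S" using assms(1) by (simp add: cong_def)
  show ?thesis
  proof (cases "a \<ge> 0")
    case True
    then have "a mod S = a" using assms(2) by simp
    then show ?thesis unfolding e using assms(2) True by simp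
  next
    case False
    then have "(a + S) mod S = a + S" using assms(2) by (intro mod_pos_pos_trivial) auto
    then have "a mod S = a + S" by simp
    then show ?thesis unfolding e using assms(2) False by simp
  qed
qed

text \<open>Numerator and denominator are known up to the common factor \<open>s\<close>, each too
  small by at most \<open>J\<close>. So \<open>aX - y * aD\<close> is at most
  \<open>J * (1 + \<bar>y\<bar>) \<le> W\<^sup>2\<close> in absolute value, and division by
  \<open>aD \<ge> W ^ 4\<close> leaves at most \<open>1 / W\<^sup>2\<close>.\<close>

lemma fraction_quotient:
  fixes aX aD J y W s :: real
  assumes "s * (D * y) - J \<le> aX" "aX \<le> s * (D * y)" "s * D - J \<le> aD" "aD \<le> s * D"
    and "W ^ 4 \<le> aD" "0 \<le> J" "J \<le> W" "1 + \<bar>y\<bar> \<le> W"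
  shows "\<bar>aX / aD - y\<bar> \<le> 1 / W"
proof -
  have W: "1 \<le> W" using assms(8) by simp
  have W4: "1 \<le> W ^ 4" using W by (rule one_le_power)
  then have aD: "0 < aD" using assms(5) by simp
  have "\<bar>aX - y * aD\<bar> \<le> J + \<bar>y\<bar> * J"
  proof -
    have "\<bar>aX - s * (D * y)\<bar> \<le> J" "\<bar>s * D - aD\<bar> \<le> J" using assms by auto
    then have "\<bar>y * (s * D - aD)\<bar> \<le> \<bar>y\<bar> * J" unfolding abs_mult by (intro mult_left_mono) auto
    moreover have "aX - y * aD = (aX - s * (D * y)) + y * (s * D - aD)" by (simp add: algebra_simps)
    ultimately show ?thesis using \<open>\<bar>aX - s * (D * y)\<bar> \<le> J\<close> by linarith
  qed
  also have "\<dots> = J * (1 + \<bar>y\<bar>)" by (simp add: algebra_simps)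
  also have "\<dots> \<le> W * W" using assms by (intro mult_mono) auto
  finally have "\<bar>aX - y * aD\<bar> \<le> W * W" .
  then have "\<bar>(aX - y * aD) / aD\<bar> \<le> W * W / W ^ 4"
    unfolding abs_divide using aD W4 assms(5) by (intro frac_le) auto
  also have "W * W / W ^ 4 = 1 / W\<^sup>2" using W by (simp add: power2_eq_square power4_eq_xxxx)
  also have "\<dots> \<le> 1 / W" using W by (simp add: power2_eq_square field_simps)
  finally show ?thesis using aD by (simp add: diff_divide_distrib)
qed

text \<open>One Euclidean step more than halves the product of the two remainders; this product is
  the potential behind the logarithmic running time.\<close>

lemma euclid_halves:
  fixes a b :: int
  assumes "0 < b" "b \<le> a"
  shows "2 * (b * (a mod b)) < a * b"
proof -
  have "1 \<le> a div b" using assms by (simp add: int_one_le_iff_zero_less pos_imp_zdiv_pos_iff)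
  then have "b * 1 \<le> b * (a div b)" using assms by (intro mult_left_mono) auto
  moreover have "a = b * (a div b) + a mod b" by simp
  moreover have "a mod b < b" using assms by simp
  ultimately have "2 * (a mod b) < a" by linarith
  then show ?thesis using assms by (simp add: mult.commute[of a b])
qed

section \<open>Reasoning about while programs\<close>

abbreviation (input) eadd (infixl \<open>.+\<close> 65) where "eadd \<equiv> Bin HAdd"
abbreviation (input) esub (infixl \<open>.-\<close> 65) where "esub \<equiv> Bin HSub"
abbreviation (input) emul (infixl \<open>.*\<close> 70) where "emul \<equiv> Bin HMul"
abbreviation (input) ediv (infixl \<open>.div\<close> 70) where "ediv \<equiv> Bin HDiv"
abbreviation (input) emod (infixl \<open>.mod\<close> 70) where "emod \<equiv> Bin HMod"

text \<open>The limit is evaluated anew before every round; \<open>ok_For\<close> therefore asks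
  that its value survive whatever the loop writes.\<close>

definition For :: "nat \<Rightarrow> exp \<Rightarrow> com \<Rightarrow> com" where
  "For r lm c = (SetR r (Cst 0) ;; While (lm .- Reg r) (c ;; SetR r (Reg r .+ Cst 1)))"

lemma regs_written_For [simp]: "regs_written (For r lm c) = insert r (regs_written c)"
  by (auto simp: For_def)

lemma arrs_written_For [simp]: "arrs_written (For r lm c) = arrs_written c"
  by (auto simp: For_def)

lemma wf_For [simp]: "wf_com (For r lm c) \<longleftrightarrow> r < 49 \<and> wf_exp 0 lm \<and> wf_com c"
  by (auto simp: For_def)

definition same :: "nat set \<Rightarrow> nat set \<Rightarrow> st \<Rightarrow> st \<Rightarrow> bool" where
  "same X Y \<sigma> \<sigma>' \<longleftrightarrow> (\<forall>r. r \<notin> X \<longrightarrow> fst \<sigma>' r = fst \<sigma> r) \<and> (\<forall>q. q \<notin> Y \<longrightarrow> snd \<sigma>' q = snd \<sigma> q)"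

context machine
begin

text \<open>Total correctness within a time budget, stated for a concrete initial state. For
  straight-line code this makes the rules equivalences, and simplification executes the program
  symbolically.\<close>

definition ok :: "com \<Rightarrow> st \<Rightarrow> nat \<Rightarrow> (st \<Rightarrow> bool) \<Rightarrow> bool" where
  "ok c \<sigma> t Q \<longleftrightarrow> (\<exists>\<sigma>' t'. exec c \<sigma> t' \<sigma>' \<and> t' \<le> t \<and> Q \<sigma>')"

inductive_cases exec_SeqE: "exec (c1 ;; c2) \<sigma> t \<sigma>'"

inductive_simps exec_Skip: "exec Skip \<sigma> t \<sigma>'"
inductive_simps exec_SetR: "exec (SetR r e) \<sigma> t \<sigma>'"
inductive_simps exec_SetA: "exec (SetA q e1 e2) \<sigma> t \<sigma>'"
inductive_simps exec_SetO: "exec (SetO e1 e2) \<sigma> t \<sigma>'"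
inductive_simps exec_Cond: "exec (Cond e c1 c2) \<sigma> t \<sigma>'"
inductive_simps exec_Seq: "exec (c1 ;; c2) \<sigma> t \<sigma>'"

lemma ok_mono: "ok c \<sigma> t Q \<Longrightarrow> t \<le> t' \<Longrightarrow> (\<And>\<sigma>'. Q \<sigma>' \<Longrightarrow> Q' \<sigma>') \<Longrightarrow> ok c \<sigma> t' Q'"
  unfolding ok_def by (meson order_trans)

lemma ok_frame: "ok c \<sigma> t Q \<Longrightarrow>
    ok c \<sigma> t (\<lambda>\<sigma>'. Q \<sigma>' \<and> same (regs_written c) (arrs_written c) \<sigma> \<sigma>')"
  unfolding ok_def same_def using exec_frame by blast

lemma ok_Skip [simp]: "ok Skip \<sigma> t Q \<longleftrightarrow> Q \<sigma>"
  by (auto simp: ok_def exec_Skip)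

lemma ok_SetR [simp]: "ok (SetR r e) \<sigma> t Q \<longleftrightarrow>
    0 < t \<and> safe \<sigma> e \<and> Q ((fst \<sigma>)(r := eval inp \<sigma> e), snd \<sigma>)"
  by (auto simp: ok_def exec_SetR)

lemma ok_SetA [simp]: "ok (SetA q e1 e2) \<sigma> t Q \<longleftrightarrow>
    0 < t \<and> safe \<sigma> e1 \<and> safe \<sigma> e2 \<and> 0 \<le> eval inp \<sigma> e1 \<and> eval inp \<sigma> e1 < int S \<and>
    Q (fst \<sigma>, (snd \<sigma>)(q := (snd \<sigma> q)(nat (eval inp \<sigma> e1) := eval inp \<sigma> e2)))"
  by (auto simp: ok_def exec_SetA)

lemma ok_SetO [simp]: "ok (SetO e1 e2) \<sigma> t Q \<longleftrightarrow>
    0 < t \<and> safe \<sigma> e1 \<and> safe \<sigma> e2 \<and> 64 \<le> eval inp \<sigma> e1 \<and> eval inp \<sigma> e1 < int base \<and>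
    Q (fst \<sigma>, (snd \<sigma>)(0 := (snd \<sigma> 0)(nat (eval inp \<sigma> e1) := eval inp \<sigma> e2)))"
  by (auto simp: ok_def exec_SetO)

lemma ok_Cond [simp]: "ok (Cond e c1 c2) \<sigma> t Q \<longleftrightarrow>
    0 < t \<and> safe \<sigma> e \<and> (if eval inp \<sigma> e > 0 then ok c1 \<sigma> (t - 1) Q else ok c2 \<sigma> (t - 1) Q)"
  unfolding ok_def exec_Cond
  apply (cases "eval inp \<sigma> e > 0"; simp; intro iffI conjI; clarsimp)
       apply (metis Suc_pred Suc_le_mono less_Suc_eq_0_disj less_le_trans not_less_eq_eq le_numeral_extra(3) zero_less_Suc)
  by (metis Suc_le_mono Suc_pred less_le_trans zero_less_Suc)+

lemma ok_seqI: "ok c1 \<sigma> t1 R \<Longrightarrow> (\<And>\<sigma>'. R \<sigma>' \<Longrightarrow> ok c2 \<sigma>' t2 Q) \<Longrightarrow> t1 + t2 \<le> t \<Longrightarrow> ok (c1 ;; c2) \<sigma> t Q"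
  unfolding ok_def by (meson add_mono exec.Seq order_trans)

lemma ok_Seq_SetR [simp]: "ok (SetR r e ;; c) \<sigma> t Q \<longleftrightarrow>
    0 < t \<and> safe \<sigma> e \<and> ok c ((fst \<sigma>)(r := eval inp \<sigma> e), snd \<sigma>) (t - 1) Q"
  unfolding ok_def exec_Seq exec_SetR by force

lemma ok_Seq_SetA [simp]: "ok (SetA q e1 e2 ;; c) \<sigma> t Q \<longleftrightarrow>
    0 < t \<and> safe \<sigma> e1 \<and> safe \<sigma> e2 \<and> 0 \<le> eval inp \<sigma> e1 \<and> eval inp \<sigma> e1 < int S \<and>
    ok c (fst \<sigma>, (snd \<sigma>)(q := (snd \<sigma> q)(nat (eval inp \<sigma> e1) := eval inp \<sigma> e2))) (t - 1) Q"
  unfolding ok_def exec_Seq exec_SetA by force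

lemma ok_Seq_Skip [simp]: "ok (Skip ;; c) \<sigma> t Q \<longleftrightarrow> ok c \<sigma> t Q"
  unfolding ok_def exec_Seq exec_Skip by (cases \<sigma>) auto

lemma ok_Seq_assoc [simp]: "ok ((c1 ;; c2) ;; c3) \<sigma> t Q \<longleftrightarrow> ok (c1 ;; c2 ;; c3) \<sigma> t Q"
proof -
  have "exec ((c1 ;; c2) ;; c3) \<sigma> u \<sigma>' \<longleftrightarrow> exec (c1 ;; c2 ;; c3) \<sigma> u \<sigma>'" for u \<sigma>'
  proof
    assume "exec ((c1 ;; c2) ;; c3) \<sigma> u \<sigma>'"
    then obtain t1 t2 t3 a b where "exec c1 \<sigma> t1 a" "exec c2 a t2 b" "exec c3 b t3 \<sigma>'" "u = t1 + t2 + t3"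
      by (elim exec_SeqE) blast
    then show "exec (c1 ;; c2 ;; c3) \<sigma> u \<sigma>'"
      unfolding add.assoc by (metis exec.Seq)
  next
    assume "exec (c1 ;; c2 ;; c3) \<sigma> u \<sigma>'"
    then obtain t1 t2 t3 a b where "exec c1 \<sigma> t1 a" "exec c2 a t2 b" "exec c3 b t3 \<sigma>'" "u = t1 + (t2 + t3)"
      by (elim exec_SeqE) blast
    then show "exec ((c1 ;; c2) ;; c3) \<sigma> u \<sigma>'"
      unfolding add.assoc[symmetric] by (metis exec.Seq)
  qed
  then show ?thesis unfolding ok_def by simp
qed

text \<open>Moving the continuation into both branches lets symbolic execution proceed past a
  conditional.\<close>

lemma ok_Seq_Cond [simp]: "ok (Cond e c1 c2 ;; c) \<sigma> t Q \<longleftrightarrow>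
    0 < t \<and> safe \<sigma> e \<and> (if eval inp \<sigma> e > 0 then ok (c1 ;; c) \<sigma> (t - 1) Q else ok (c2 ;; c) \<sigma> (t - 1) Q)"
proof -
  have 1: "exec (Cond e c1 c2 ;; c) \<sigma> u \<sigma>' \<longleftrightarrow> safe \<sigma> e \<and>
     (\<exists>v. u = Suc v \<and> exec ((if eval inp \<sigma> e > 0 then c1 else c2) ;; c) \<sigma> v \<sigma>')" for u \<sigma>'
    unfolding exec_Seq exec_Cond by (cases "eval inp \<sigma> e > 0") (simp, metis add_Suc)+
  show ?thesis unfolding ok_def 1
    by (cases "eval inp \<sigma> e > 0"; cases t; simp) (metis Suc_le_mono)+
qed

lemma ok_While_measure:
  assumes "I \<sigma>" and safe: "\<And>\<sigma>'. I \<sigma>' \<Longrightarrow> safe \<sigma>' e"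
    and body: "\<And>\<sigma>'. I \<sigma>' \<Longrightarrow> eval inp \<sigma>' e > 0 \<Longrightarrow> ok c \<sigma>' t (\<lambda>\<sigma>''. I \<sigma>'' \<and> f \<sigma>'' < f \<sigma>')"
  shows "ok (While e c) \<sigma> (f \<sigma> * (t + 1) + 1) (\<lambda>\<sigma>'. I \<sigma>' \<and> \<not> eval inp \<sigma>' e > 0)"
  using assms(1)
proof (induction "f \<sigma>" arbitrary: \<sigma> rule: less_induct)
  case less
  show ?case
  proof (cases "eval inp \<sigma> e > 0")
    case False
    have "exec (While e c) \<sigma> 1 \<sigma>" by (rule exec.WhileF[OF safe[OF less.prems] False])
    moreover have "1 \<le> f \<sigma> * (t + 1) + 1" by simp
    ultimately show ?thesis unfolding ok_def using less.prems False by blast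
  next
    case True
    from body[OF less.prems True] obtain \<sigma>' u where
      1: "exec c \<sigma> u \<sigma>'" "u \<le> t" "I \<sigma>'" "f \<sigma>' < f \<sigma>" unfolding ok_def by blast
    from less.hyps[OF 1(4,3)] obtain \<sigma>'' v where
      2: "exec (While e c) \<sigma>' v \<sigma>''" "v \<le> f \<sigma>' * (t + 1) + 1" "I \<sigma>''" "\<not> eval inp \<sigma>'' e > 0"
      unfolding ok_def by blast
    have "Suc (u + v) \<le> Suc (f \<sigma>') * (t + 1) + 1" using 1(2) 2(2) by simp
    also have "\<dots> \<le> f \<sigma> * (t + 1) + 1" using 1(4) by (intro add_mono mult_right_mono) auto
    finally show ?thesis unfolding ok_def
      using exec.WhileT[OF safe[OF less.prems] True 1(1) 2(1)] 2(3,4) by blast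
  qed
qed

text \<open>\<open>I k\<close> describes the state after \<open>k\<close> rounds. By
  \<open>Ir\<close> it ignores the counter register, which changes outside the body; that nothing
  else changes follows from the registers and arrays that occur in the body. A round adds a test and
  an increment to the time of the body, the loop one assignment and a last test.\<close>

lemma ok_For:
  assumes r: "r \<notin> regs_written c"
    and L: "\<And>\<sigma>'. same (insert r (regs_written c)) (arrs_written c) \<sigma> \<sigma>' \<Longrightarrow> safe \<sigma>' lm \<and> eval inp \<sigma>' lm = L"
    and LV: "\<bar>L\<bar> < V"
    and I0: "I 0 \<sigma>"
    and Ir: "\<And>k s a v. I k (s(r := v), a) = I k (s, a)"
    and body: "\<And>k \<sigma>'. k < nat L \<Longrightarrow> fst \<sigma>' r = int k \<Longrightarrow>
       same (insert r (regs_written c)) (arrs_written c) \<sigma> \<sigma>' \<Longrightarrow> I k \<sigma>' \<Longrightarrow> ok c \<sigma>' t (I (Suc k))"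
    and T: "nat L * (t + 2) + 2 \<le> t'"
  shows "ok (For r lm c) \<sigma> t' (\<lambda>\<sigma>'. I (nat L) \<sigma>' \<and>
     same (insert r (regs_written c)) (arrs_written c) \<sigma> \<sigma>')"
proof -
  let ?sm = "same (insert r (regs_written c)) (arrs_written c) \<sigma>"
  define J where "J \<sigma>' \<longleftrightarrow> (\<exists>k \<le> nat L. fst \<sigma>' r = int k \<and> I k \<sigma>' \<and> ?sm \<sigma>')" for \<sigma>'
  define f where "f \<sigma>' = nat (L - fst \<sigma>' r)" for \<sigma>' :: st
  have V0: "0 < V" using LV by linarith
  have J: "ok (While (lm .- Reg r) (c ;; SetR r (Reg r .+ Cst 1))) ((fst \<sigma>)(r := 0), snd \<sigma>)
     (f ((fst \<sigma>)(r := 0), snd \<sigma>) * ((t + 1) + 1) + 1)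
     (\<lambda>\<sigma>'. J \<sigma>' \<and> \<not> eval inp \<sigma>' (lm .- Reg r) > 0)"
  proof (rule ok_While_measure)
    show "J ((fst \<sigma>)(r := 0), snd \<sigma>)"
      unfolding J_def using I0 Ir[of 0 "fst \<sigma>" 0 "snd \<sigma>"] by (intro exI[of _ 0]) (auto simp: same_def)
    fix \<sigma>' assume "J \<sigma>'"
    then obtain k where k: "k \<le> nat L" "fst \<sigma>' r = int k" "I k \<sigma>'" "?sm \<sigma>'" by (auto simp: J_def)
    show "safe \<sigma>' (lm .- Reg r)" using L[OF k(4)] k LV V0 by auto
    assume g: "eval inp \<sigma>' (lm .- Reg r) > 0"
    then have kL: "k < nat L" using L[OF k(4)] k by auto
    have "ok c \<sigma>' t (\<lambda>\<sigma>''. I (Suc k) \<sigma>'' \<and> same (regs_written c) (arrs_written c) \<sigma>' \<sigma>'')"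
      by (rule ok_frame[OF body[OF kL k(2,4,3)]])
    then show "ok (c ;; SetR r (Reg r .+ Cst 1)) \<sigma>' (t + 1) (\<lambda>\<sigma>''. J \<sigma>'' \<and> f \<sigma>'' < f \<sigma>')"
    proof (rule ok_seqI[where ?t2.0 = 1])
      fix \<sigma>'' assume s: "I (Suc k) \<sigma>'' \<and> same (regs_written c) (arrs_written c) \<sigma>' \<sigma>''"
      then have rk: "fst \<sigma>'' r = int k" using r k by (simp add: same_def)
      have I': "I (Suc k) ((fst \<sigma>'')(r := v), snd \<sigma>'')" for v using s Ir[of "Suc k" "fst \<sigma>''"] by simp
      have sm: "?sm ((fst \<sigma>'')(r := v), snd \<sigma>'')" for v using s k(4) by (auto simp: same_def)
      show "ok (SetR r (Reg r .+ Cst 1)) \<sigma>'' 1 (\<lambda>\<sigma>''. J \<sigma>'' \<and> f \<sigma>'' < f \<sigma>')"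
        using rk kL LV k(2) I' sm unfolding J_def f_def
        by (auto intro!: exI[of _ "Suc k"])
    qed simp
  qed
  have "ok (For r lm c) \<sigma> t' (\<lambda>\<sigma>'. J \<sigma>' \<and> \<not> eval inp \<sigma>' (lm .- Reg r) > 0)"
    unfolding For_def using T by (auto intro!: ok_mono[OF J] simp: f_def)
  then show ?thesis
  proof (rule ok_mono)
    fix \<sigma>' assume a: "J \<sigma>' \<and> \<not> eval inp \<sigma>' (lm .- Reg r) > 0"
    then obtain k where k: "k \<le> nat L" "fst \<sigma>' r = int k" "I k \<sigma>'" "?sm \<sigma>'" by (auto simp: J_def)
    then have "k = nat L" using a L[OF k(4)] by auto
    then show "I (nat L) \<sigma>' \<and> ?sm \<sigma>'" using k by simp
  qed simp
qed

end

section \<open>The program\<close>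

abbreviation (input) "row_e \<equiv> In (Cst 7 .+ Cst 3 .* Reg 7)"
abbreviation (input) "col_e \<equiv> In (Cst 8 .+ Cst 3 .* Reg 7)"
abbreviation (input) "val_e \<equiv> In (Cst 9 .+ Cst 3 .* Reg 7)"

text \<open>
  Registers: 0 is \<open>n\<close>, 32 is \<open>d\<close>, 2 is \<open>nnz\<close>, 3 the number \<open>d + 8\<close> of moduli, 8 the current modulus,
  13 is \<open>T\<close>, 14 the word bound \<open>W\<close>, 16 is \<open>X \<ge> \<kappa> / \<epsilon>\<close>, 21 is \<open>W ^ 4\<close>, 20 is \<open>W ^ 8\<close>; 30 and 31 are the
  positions of \<open>b\<close> and \<open>c\<close> in the input. Arrays: 2 the current vector, 3 the traces, 4 the
  coefficients \<open>k! e\<^sub>k\<close>, 5 the right-hand side, 6 the primes, 7 the moduli, 8 the residues of the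
  denominator, 9 the inverse cofactors, 10 the numerators, 11 the rounded solution, 12 a vector of
  length \<open>n\<close>, 15 the output.
\<close>

definition zero_prog :: "nat \<Rightarrow> exp \<Rightarrow> com" where
  "zero_prog q lm = For 29 lm (SetA q (Reg 29) (Cst 0))"

definition mv_prog :: com where
  "mv_prog =
    zero_prog 12 (Reg 0) ;;
    For 7 (Reg 2) (SetA 12 row_e ((Arr 12 row_e .+ val_e .* Arr 2 col_e) .mod Reg 8)) ;;
    zero_prog 2 (Reg 32) ;;
    For 7 (Reg 2) (SetA 2 col_e ((Arr 2 col_e .- val_e .* Arr 12 row_e) .mod Reg 8))"

text \<open>The trace is collected from one unit vector at a time: this takes \<open>d * d\<close>
  products but keeps a single vector instead of a matrix power.\<close>

definition trace_prog :: com where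
  "trace_prog =
    zero_prog 3 (Reg 32 .+ Cst 1) ;;
    For 4 (Reg 32)
     (zero_prog 2 (Reg 32) ;; SetA 2 (Reg 4) (Cst 1) ;;
      For 6 (Reg 32)
       (mv_prog ;;
        SetA 3 (Reg 6 .+ Cst 1) ((Arr 3 (Reg 6 .+ Cst 1) .+ Arr 2 (Reg 4)) .mod Reg 8)))"

definition newton_prog :: com where
  "newton_prog =
    SetA 4 (Cst 0) (Cst 1) ;;
    For 6 (Reg 32)
     (SetR 17 (Cst 0) ;;
      For 5 (Reg 6 .+ Cst 1)
       (SetR 17 ((Reg 17 .* Reg 5 .+ Arr 4 (Reg 5) .* Arr 3 (Reg 6 .+ Cst 1 .- Reg 5)) .mod Reg 8)) ;;
      SetA 4 (Reg 6 .+ Cst 1) ((Cst 0 .- Reg 17) .mod Reg 8))"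

text \<open>The addend \<open>Cst 0\<close> gives the last loop the shape of a Horner update, so
  that \<open>horner_inner\<close> covers both loops. The denominator is placed behind the
  \<open>d\<close> numerators.\<close>

definition horner_prog :: com where
  "horner_prog =
    zero_prog 2 (Reg 32) ;;
    For 6 (Reg 32)
     (mv_prog ;;
      For 4 (Reg 32)
       (SetA 2 (Reg 4) ((Reg 6 .* Arr 2 (Reg 4) .+ Arr 4 (Reg 6) .* Arr 5 (Reg 4)) .mod Reg 8))) ;;
    For 4 (Reg 32) (SetA 2 (Reg 4) ((Reg 32 .* Arr 2 (Reg 4) .+ Cst 0) .mod Reg 8)) ;;
    SetA 2 (Reg 32) (Arr 4 (Reg 32))"

definition solve_prog :: com where
  "solve_prog = trace_prog ;; newton_prog ;; horner_prog"

text \<open>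
  The matrix \<open>A\<^sup>T A\<close> in terms of the entry list, so that one product with it costs two sweeps.
\<close>

definition sparse_gram :: "nat \<Rightarrow> (nat \<Rightarrow> nat) \<Rightarrow> (nat \<Rightarrow> nat) \<Rightarrow> (nat \<Rightarrow> int) \<Rightarrow> nat \<Rightarrow> nat \<Rightarrow> int" where
  "sparse_gram nz ro co va j j' = (\<Sum>e<nz. if co e = j then
     va e * (\<Sum>e'<nz. if ro e' = ro e \<and> co e' = j' then va e' else 0) else 0)"

section \<open>The input as seen by the program, and sizes as powers of the word bound\<close>

locale lp = machine inp V S n for inp V S n +
  fixes d nz :: nat and ro co :: "nat \<Rightarrow> nat" and va bv cv :: "nat \<Rightarrow> int"
    and eE eK eR sg T X W :: int
  assumes dims: "1 \<le> d" "d \<le> n" "n \<le> nz"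
    and inp_params: "read_input inp 1 = int d" "read_input inp 2 = int nz"
      "read_input inp 3 = eE" "read_input inp 4 = eK" "read_input inp 6 = eR"
    and inp_row: "\<And>e. e < nz \<Longrightarrow> read_input inp (7 + 3 * e) = int (ro e)"
    and inp_col: "\<And>e. e < nz \<Longrightarrow> read_input inp (8 + 3 * e) = int (co e)"
    and inp_val: "\<And>e. e < nz \<Longrightarrow> read_input inp (9 + 3 * e) = va e"
    and inp_b: "\<And>j. j < d \<Longrightarrow> read_input inp (7 + 3 * nz + j) = bv j"
    and inp_c: "\<And>i. i < n \<Longrightarrow> read_input inp (7 + 3 * nz + d + i) = cv i"
    and ro: "\<And>e. e < nz \<Longrightarrow> ro e < n" and co: "\<And>e. e < nz \<Longrightarrow> co e < d"
    and sg_def: "sg = 1 + (\<Sum>i<3 * nz + d + n. (read_input inp (7 + i))\<^sup>2)"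
    and nz_sg: "int nz \<le> sg"
    and T_def: "T = 2 ^ nat (2 * eR - eE)" and X_def: "X = 2 ^ nat (eK - eE)"
    and W_def: "W = 2 ^ 20 * sg ^ 4 * T * X"
    and exps: "\<bar>eE\<bar> \<le> W" "\<bar>eK\<bar> \<le> W" "\<bar>eR\<bar> \<le> W"
    and V_def: "V = W ^ 16" and S_def: "S = 2 * n + 80"
begin

abbreviation "M \<equiv> sparse_gram nz ro co va"

lemma sg_ge: "1 \<le> sg" unfolding sg_def by (simp add: sum_nonneg)
lemma T_ge: "1 \<le> T" and X_ge: "1 \<le> X" by (simp_all add: T_def X_def)

lemma W_ge: "2 ^ 20 * sg ^ 4 \<le> W" "2 ^ 20 * sg \<le> W" "2 ^ 20 * (sg\<^sup>2 * T) \<le> W" "2 ^ 20 \<le> W"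
proof -
  have TX: "1 \<le> T * X" using mult_mono[OF T_ge X_ge] T_ge by simp
  have s4: "1 \<le> sg ^ 4" "sg \<le> sg ^ 4" "sg\<^sup>2 \<le> sg ^ 4"
    using sg_ge power_increasing[of 1 4 sg] power_increasing[of 2 4 sg] by auto
  have "sg ^ 4 * 1 \<le> sg ^ 4 * (T * X)" using s4 TX by (intro mult_left_mono) auto
  then show 1: "2 ^ 20 * sg ^ 4 \<le> W" unfolding W_def by (simp add: mult.assoc)
  then show "2 ^ 20 * sg \<le> W" "2 ^ 20 \<le> W" using s4 by simp_all
  have "sg\<^sup>2 * T * 1 \<le> sg ^ 4 * T * X" using s4 T_ge X_ge by (intro mult_mono) auto
  then show "2 ^ 20 * (sg\<^sup>2 * T) \<le> W" unfolding W_def by (simp add: mult.assoc)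
qed

lemma W1: "1 \<le> W" "2 \<le> W" "0 < W" using W_ge(4) by auto

lemma Wpow_mono: "i \<le> j \<Longrightarrow> W ^ i \<le> W ^ j" using W1 by (intro power_increasing) auto

text \<open>Sizes are tracked by exponents of \<open>W\<close>: products add exponents, sums and
  differences raise the exponent by one, and everything up to \<open>W ^ 16\<close> is
  admissible.\<close>

lemma bV: "\<bar>x\<bar> \<le> W ^ k \<Longrightarrow> k \<le> 16 \<Longrightarrow> \<bar>x\<bar> \<le> V"
  unfolding V_def using Wpow_mono[of k 16] by simp

lemma bmult: "\<bar>x\<bar> \<le> W ^ i \<Longrightarrow> \<bar>y\<bar> \<le> W ^ j \<Longrightarrow> i + j = k \<Longrightarrow> \<bar>x * y\<bar> \<le> W ^ k"
proof -
  assume "\<bar>x\<bar> \<le> W ^ i" "\<bar>y\<bar> \<le> W ^ j" "i + j = k"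
  then have "\<bar>x * y\<bar> \<le> W ^ i * W ^ j" unfolding abs_mult by (intro mult_mono) auto
  then show ?thesis using \<open>i + j = k\<close> by (simp add: power_add[symmetric])
qed

lemma badd: "\<bar>x\<bar> \<le> W ^ i \<Longrightarrow> \<bar>y\<bar> \<le> W ^ i \<Longrightarrow> \<bar>x + y\<bar> \<le> W ^ Suc i"
  "\<bar>x\<bar> \<le> W ^ i \<Longrightarrow> \<bar>y\<bar> \<le> W ^ i \<Longrightarrow> \<bar>x - y\<bar> \<le> W ^ Suc i"
proof -
  have "2 * W ^ i \<le> W ^ Suc i" using mult_right_mono[OF W1(2), of "W ^ i"] W1 by simp
  then show "\<bar>x\<bar> \<le> W ^ i \<Longrightarrow> \<bar>y\<bar> \<le> W ^ i \<Longrightarrow> \<bar>x + y\<bar> \<le> W ^ Suc i"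
    "\<bar>x\<bar> \<le> W ^ i \<Longrightarrow> \<bar>y\<bar> \<le> W ^ i \<Longrightarrow> \<bar>x - y\<bar> \<le> W ^ Suc i" by linarith+
qed

lemma bup: "\<bar>x\<bar> \<le> W ^ i \<Longrightarrow> i \<le> j \<Longrightarrow> \<bar>x\<bar> \<le> W ^ j"
  using Wpow_mono[of i j] by simp

lemma bmod: "0 < m \<Longrightarrow> m \<le> W ^ k \<Longrightarrow> \<bar>x mod m\<bar> \<le> W ^ k"
  using pos_mod_sign[of m x] pos_mod_bound[of m x] by linarith

lemma bmod_ex: "\<exists>y. x = y mod m \<Longrightarrow> 0 < m \<Longrightarrow> m \<le> W ^ i \<Longrightarrow> i \<le> k \<Longrightarrow> \<bar>x\<bar> \<le> W ^ k"
  using bup[OF bmod] by blast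

lemma nat_bounds: "int nz \<le> W" "int n \<le> W" "int d \<le> W" "2 ^ 20 * int nz \<le> W" "10 * int nz + 1000 \<le> W"
  "10 * int nz + 1000 < V"
proof -
  show a: "2 ^ 20 * int nz \<le> W" using nz_sg W_ge(2) by simp
  then show "int nz \<le> W" "int n \<le> W" "int d \<le> W" "10 * int nz + 1000 \<le> W" using dims by auto
  then have "10 * int nz + 1000 \<le> W ^ 1" by simp
  moreover have "W ^ 1 < V" unfolding V_def using W1 by (intro power_strict_increasing) auto
  ultimately show "10 * int nz + 1000 < V" by linarith
qed

text \<open>An integer is bounded by its square, hence every entry by the sum of squares in
  \<open>sg\<close>.\<close>

lemma input_le: "i < 3 * nz + d + n \<Longrightarrow> \<bar>read_input inp (7 + i)\<bar> \<le> sg - 1"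
proof -
  assume i: "i < 3 * nz + d + n"
  let ?x = "read_input inp (7 + i)"
  have "\<bar>?x\<bar> \<le> ?x\<^sup>2"
    using mult_left_mono[of 1 "\<bar>?x\<bar>" "\<bar>?x\<bar>"] by (cases "?x = 0") (auto simp: power2_eq_square)
  also have "\<dots> \<le> (\<Sum>i<3 * nz + d + n. (read_input inp (7 + i))\<^sup>2)"
    using i by (intro member_le_sum) auto
  finally show ?thesis by (simp add: sg_def)
qed

lemma va_le: "e < nz \<Longrightarrow> \<bar>va e\<bar> \<le> sg" and bv_le: "j < d \<Longrightarrow> \<bar>bv j\<bar> \<le> sg" and cv_le: "i < n \<Longrightarrow> \<bar>cv i\<bar> \<le> sg"
proof -
  show "e < nz \<Longrightarrow> \<bar>va e\<bar> \<le> sg" using input_le[of "2 + 3 * e"] inp_val[of e] by simp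
  show "j < d \<Longrightarrow> \<bar>bv j\<bar> \<le> sg" using input_le[of "3 * nz + j"] inp_b[of j] by (simp add: add.assoc)
  show "i < n \<Longrightarrow> \<bar>cv i\<bar> \<le> sg" using input_le[of "3 * nz + d + i"] inp_c[of i] by (simp add: add.assoc)
qed

lemma sgW: "sg \<le> W" using W_ge(2) sg_ge by simp

lemma S_ge: "2 * n + 80 \<le> S" "int S \<le> 2 * int n + 80" by (simp_all add: S_def)

lemma va_W: "e < nz \<Longrightarrow> \<bar>va e\<bar> \<le> W ^ 1" using va_le[of e] sgW by simp

lemma nat_index: "nat (7 + 3 * int k) = 7 + 3 * k" "nat (8 + 3 * int k) = 8 + 3 * k" "nat (9 + 3 * int k) = 9 + 3 * k"
  by (simp_all add: nat_eq_iff)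

lemma entry: assumes "k < nz"
  shows "read_input inp (nat (7 + 3 * int k)) = int (ro k)" "read_input inp (nat (8 + 3 * int k)) = int (co k)"
    "read_input inp (nat (9 + 3 * int k)) = va k" "\<bar>va k\<bar> \<le> V" "ro k < n" "co k < d"
    "int (ro k) \<le> V" "int (co k) \<le> V" "int (ro k) < int S" "int (co k) < int S" "ro k < S" "co k < S"
    "\<bar>3 * int k\<bar> \<le> V" "\<bar>7 + 3 * int k\<bar> \<le> V" "\<bar>8 + 3 * int k\<bar> \<le> V" "\<bar>9 + 3 * int k\<bar> \<le> V"
    "3 * int k \<le> V" "7 + 3 * int k \<le> V" "8 + 3 * int k \<le> V" "9 + 3 * int k \<le> V"
  unfolding nat_index using inp_row inp_col inp_val assms ro[OF assms] co[OF assms] bV[OF va_W[OF assms]] nat_bounds dims S_ge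
  by auto

definition regs0 :: "st \<Rightarrow> bool" where
  "regs0 \<sigma> \<longleftrightarrow> fst \<sigma> 0 = int n \<and> fst \<sigma> 32 = int d \<and> fst \<sigma> 2 = int nz"

lemma zero_ok:
  assumes L: "\<And>\<sigma>'. same {29} {q} \<sigma> \<sigma>' \<Longrightarrow> safe \<sigma>' lm \<and> eval inp \<sigma>' lm = int N" and N: "N \<le> S"
    and t: "3 * N + 2 \<le> t"
  shows "ok (zero_prog q lm) \<sigma> t (\<lambda>\<sigma>'. (\<forall>i<N. snd \<sigma>' q i = 0) \<and> same {29} {q} \<sigma> \<sigma>')"
proof -
  have NV: "\<bar>int N\<bar> < V" using N S_ge nat_bounds dims by simp
  show ?thesis unfolding zero_prog_def
    by (rule ok_mono[OF ok_For[where I = "\<lambda>k \<sigma>'. \<forall>i<k. snd \<sigma>' q i = 0" and L = "int N" and t = 1]])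
      (use L NV N t in \<open>auto simp: less_Suc_eq\<close>)
qed

text \<open>The inner sum is coordinate \<open>ro e\<close> of \<open>A v\<close>. Exchanging the
  summations shows that computing this vector once, for all columns, yields the product with the
  Gram matrix.\<close>

lemma negop_sparse: "negop d M v j = - (\<Sum>e<nz. if co e = j then
     va e * (\<Sum>e'<nz. if ro e' = ro e then va e' * v (co e') else 0) else 0)"
proof -
  have "(\<Sum>j'<d. M j j' * v j') = (\<Sum>j'<d. \<Sum>e<nz. if co e = j then
     va e * (\<Sum>e'<nz. if ro e' = ro e \<and> co e' = j' then va e' * v j' else 0) else 0)"
    unfolding sparse_gram_def sum_distrib_right
    by (intro sum.cong HOL.refl) (auto simp: sum_distrib_right mult.assoc if_distrib[of "\<lambda>x. x * _"] cong: if_cong intro!: sum.cong)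
  also have "\<dots> = (\<Sum>e<nz. \<Sum>j'<d. if co e = j then
     va e * (\<Sum>e'<nz. if ro e' = ro e \<and> co e' = j' then va e' * v j' else 0) else 0)"
    by (rule sum.swap)
  also have "\<dots> = (\<Sum>e<nz. if co e = j then
     va e * (\<Sum>e'<nz. if ro e' = ro e then va e' * v (co e') else 0) else 0)"
  proof (rule sum.cong[OF HOL.refl])
    fix e assume "e \<in> {..<nz}"
    have "(\<Sum>j'<d. \<Sum>e'<nz. if ro e' = ro e \<and> co e' = j' then va e' * v j' else 0) =
      (\<Sum>e'<nz. \<Sum>j'<d. if ro e' = ro e \<and> co e' = j' then va e' * v j' else 0)" by (rule sum.swap)
    also have "\<dots> = (\<Sum>e'<nz. if ro e' = ro e then va e' * v (co e') else 0)"
    proof (rule sum.cong[OF HOL.refl])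
      fix e' assume "e' \<in> {..<nz}"
      then have c: "co e' < d" using co by simp
      have "(\<Sum>j'<d. if ro e' = ro e \<and> co e' = j' then va e' * v j' else 0) =
        (\<Sum>j'<d. if j' = co e' then (if ro e' = ro e then va e' * v (co e') else 0) else 0)"
        by (rule sum.cong) auto
      also have "\<dots> = (if ro e' = ro e then va e' * v (co e') else 0)" using c by simp
      finally show "(\<Sum>j'<d. if ro e' = ro e \<and> co e' = j' then va e' * v j' else 0) =
        (if ro e' = ro e then va e' * v (co e') else 0)" .
    qed
    finally show "(\<Sum>j'<d. if co e = j then va e * (\<Sum>e'<nz. if ro e' = ro e \<and> co e' = j' then va e' * v j' else 0) else 0) =
      (if co e = j then va e * (\<Sum>e'<nz. if ro e' = ro e then va e' * v (co e') else 0) else 0)"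
      by (simp add: sum_distrib_left[symmetric])
  qed
  finally show ?thesis unfolding negop_def by simp
qed

lemma negop_cong: "(\<And>j. j < d \<Longrightarrow> [x j = y j] (mod m)) \<Longrightarrow> [negop d A x j = negop d A y j] (mod m)"
  unfolding negop_def by (intro cong_minus_minus_iff[THEN iffD2] cong_sum cong_mult cong_refl) auto

text \<open>Reduction after every single entry keeps the words within \<open>W ^ 2\<close>;
  congruences connect the result with the exact product.\<close>

lemma mv_ok:
  assumes r: "regs0 \<sigma>" and m: "fst \<sigma> 8 = m" "0 < m" "m \<le> W ^ 2"
    and v: "\<And>j. j < d \<Longrightarrow> \<bar>snd \<sigma> 2 j\<bar> \<le> W ^ 2"
  shows "ok mv_prog \<sigma> (20 * nz) (\<lambda>\<sigma>'. (\<forall>j<d. snd \<sigma>' 2 j = negop d M (snd \<sigma> 2) j mod m) \<and>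
     same {7, 29} {2, 12} \<sigma> \<sigma>')"
proof -
  define v0 where "v0 = snd \<sigma> 2"
  define u0 where "u0 i = (\<Sum>e<nz. if ro e = i then va e * v0 (co e) else 0) mod m" for i
  have u0b: "\<bar>u0 i\<bar> \<le> W ^ 2" for i unfolding u0_def using m by (intro bmod) auto
  have 1: "ok (zero_prog 12 (Reg 0)) \<sigma> (3 * n + 2) (\<lambda>\<sigma>'. (\<forall>i<n. snd \<sigma>' 12 i = 0) \<and> same {29} {12} \<sigma> \<sigma>')"
    by (rule zero_ok) (use r S_ge in \<open>auto simp: regs0_def same_def\<close>)
  have 2: "ok (For 7 (Reg 2) (SetA 12 row_e ((Arr 12 row_e .+ val_e .* Arr 2 col_e) .mod Reg 8))) \<sigma>1 (3 * nz + 2)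
      (\<lambda>\<sigma>'. (\<forall>i<n. snd \<sigma>' 12 i = u0 i) \<and> same {7} {12} \<sigma>1 \<sigma>')"
    if s: "\<forall>i<n. snd \<sigma>1 12 i = 0" "same {29} {12} \<sigma> \<sigma>1" for \<sigma>1
  proof -
    let ?I = "\<lambda>k \<sigma>'. \<forall>i<n. snd \<sigma>' 12 i = (\<Sum>e<k. if ro e = i then va e * v0 (co e) else 0) mod m"
    have reg: "fst \<sigma>1 2 = int nz" "fst \<sigma>1 8 = m" "snd \<sigma>1 2 = v0"
      using s r m by (auto simp: same_def regs0_def v0_def)
    show ?thesis
    proof (rule ok_mono[OF ok_For[where I = ?I and L = "int nz" and t = 1]])
      fix k \<sigma>' assume k: "k < nat (int nz)" "fst \<sigma>' 7 = int k" and I: "?I k \<sigma>'"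
        and sm: "same (insert 7 (regs_written (SetA 12 row_e ((Arr 12 row_e .+ val_e .* Arr 2 col_e) .mod Reg 8))))
          (arrs_written (SetA 12 row_e ((Arr 12 row_e .+ val_e .* Arr 2 col_e) .mod Reg 8))) \<sigma>1 \<sigma>'"
      have k': "k < nz" using k by simp
      note en = entry[OF k']
      have st: "snd \<sigma>' 2 = v0" "fst \<sigma>' 8 = m" using sm reg by (auto simp: same_def)
      have b1: "\<bar>v0 (co k)\<bar> \<le> W ^ 2" using v en v0_def by auto
      have b2: "\<bar>va k * v0 (co k)\<bar> \<le> W ^ 3" using va_W[OF k'] b1 by (rule bmult) simp
      have "\<exists>y. snd \<sigma>' 12 (ro k) = y mod m" using I en(5) by blast
      then have b3: "\<bar>snd \<sigma>' 12 (ro k)\<bar> \<le> W ^ 3" by (rule bmod_ex[OF _ m(2,3)]) simp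
      have new: "(snd \<sigma>' 12 (ro k) + va k * v0 (co k)) mod m =
          (\<Sum>e<Suc k. if ro e = ro k then va e * v0 (co e) else 0) mod m"
        using I en(5) by (simp add: mod_add_left_eq)
      have bb: "\<bar>va k * v0 (co k)\<bar> \<le> V" "\<bar>snd \<sigma>' 12 (ro k) + va k * v0 (co k)\<bar> \<le> V"
        "\<bar>(snd \<sigma>' 12 (ro k) + va k * v0 (co k)) mod m\<bar> \<le> V"
        using bV[OF b2] bV[OF badd(1)[OF b3 b2]] bV[OF bmod[OF m(2,3)]] by simp_all
      show "ok (SetA 12 row_e ((Arr 12 row_e .+ val_e .* Arr 2 col_e) .mod Reg 8)) \<sigma>' 1 (?I (Suc k))"
        by (simp add: en bb k(2) st del: sum.lessThan_Suc) (use I new in \<open>auto\<close>)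
    qed (use s reg nat_bounds in \<open>auto simp: same_def u0_def\<close>)
  qed
  have 3: "ok (zero_prog 2 (Reg 32)) \<sigma>2 (3 * d + 2) (\<lambda>\<sigma>'. (\<forall>i<d. snd \<sigma>' 2 i = 0) \<and> same {29} {2} \<sigma>2 \<sigma>')"
    if "same {7,29} {12} \<sigma> \<sigma>2" for \<sigma>2
    by (rule zero_ok) (use r S_ge dims that in \<open>auto simp: regs0_def same_def\<close>)
  have 4: "ok (For 7 (Reg 2) (SetA 2 col_e ((Arr 2 col_e .- val_e .* Arr 12 row_e) .mod Reg 8))) \<sigma>3 (3 * nz + 2)
      (\<lambda>\<sigma>'. (\<forall>j<d. snd \<sigma>' 2 j = (- (\<Sum>e<nz. if co e = j then va e * u0 (ro e) else 0)) mod m) \<and> same {7} {2} \<sigma>3 \<sigma>')"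
    if s: "\<forall>i<d. snd \<sigma>3 2 i = 0" "same {7,29} {2,12} \<sigma> \<sigma>3" "\<forall>i<n. snd \<sigma>3 12 i = u0 i" for \<sigma>3
  proof -
    let ?I = "\<lambda>k \<sigma>'. \<forall>j<d. snd \<sigma>' 2 j = (- (\<Sum>e<k. if co e = j then va e * u0 (ro e) else 0)) mod m"
    let ?c = "SetA 2 col_e ((Arr 2 col_e .- val_e .* Arr 12 row_e) .mod Reg 8)"
    have reg: "fst \<sigma>3 2 = int nz" "fst \<sigma>3 8 = m"
      using s r m by (auto simp: same_def regs0_def)
    show ?thesis
    proof (rule ok_mono[OF ok_For[where I = ?I and L = "int nz" and t = 1]])
      fix k \<sigma>' assume k: "k < nat (int nz)" "fst \<sigma>' 7 = int k" and I: "?I k \<sigma>'"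
        and sm: "same (insert 7 (regs_written ?c)) (arrs_written ?c) \<sigma>3 \<sigma>'"
      have k': "k < nz" using k by simp
      note en = entry[OF k']
      have st: "snd \<sigma>' 12 (ro k) = u0 (ro k)" "fst \<sigma>' 8 = m" using sm reg s en by (auto simp: same_def)
      have b2: "\<bar>va k * u0 (ro k)\<bar> \<le> W ^ 3" using va_W[OF k'] u0b by (rule bmult) simp
      have "\<exists>y. snd \<sigma>' 2 (co k) = y mod m" using I en(6) by blast
      then have b3: "\<bar>snd \<sigma>' 2 (co k)\<bar> \<le> W ^ 3" by (rule bmod_ex[OF _ m(2,3)]) simp
      have new: "(snd \<sigma>' 2 (co k) - va k * u0 (ro k)) mod m =
          (- (\<Sum>e<Suc k. if co e = co k then va e * u0 (ro e) else 0)) mod m"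
        using I en(6) by (simp add: mod_diff_left_eq)
      have bb: "\<bar>va k * u0 (ro k)\<bar> \<le> V" "\<bar>snd \<sigma>' 2 (co k) - va k * u0 (ro k)\<bar> \<le> V"
        "\<bar>(snd \<sigma>' 2 (co k) - va k * u0 (ro k)) mod m\<bar> \<le> V"
        using bV[OF b2] bV[OF badd(2)[OF b3 b2]] bV[OF bmod[OF m(2,3)]] by simp_all
      show "ok ?c \<sigma>' 1 (?I (Suc k))"
        by (simp add: en bb k(2) st del: sum.lessThan_Suc) (use I new in \<open>auto\<close>)
    qed (use s reg nat_bounds in \<open>auto simp: same_def\<close>)
  qed
  have fin: "(- (\<Sum>e<nz. if co e = j then va e * u0 (ro e) else 0)) mod m = negop d M v0 j mod m" for j
    unfolding negop_sparse cong_def[symmetric] u0_def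
    by (intro cong_minus_minus_iff[THEN iffD2] cong_sum) (auto simp: cong_def mod_mult_right_eq)
  show ?thesis unfolding mv_prog_def
    apply (rule ok_seqI[OF 1])
     apply (rule ok_seqI[OF 2], simp, simp)
      apply (rule ok_seqI[OF 3])
        apply (force simp: same_def)
       apply (rule ok_mono[OF 4])
           apply simp
          apply (force simp: same_def)
         apply (force simp: same_def)
        apply (rule order_refl)
       apply (force simp: fin v0_def same_def)
      apply (rule order_refl)
     apply (rule order_refl)
    using dims by simp
qed

end

text \<open>The frames of the subprograms as rewrite rules, so that later proofs need not unfold the
  programs.\<close>

lemma written_progs [simp]:
  "regs_written (zero_prog q lm) = {29}" "arrs_written (zero_prog q lm) = {q}"
  "regs_written mv_prog = {7, 29}" "arrs_written mv_prog = {2, 12}"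
  "regs_written trace_prog = {4, 6, 7, 29}" "arrs_written trace_prog = {2, 3, 12}"
  "regs_written newton_prog = {5, 6, 17}" "arrs_written newton_prog = {4}"
  "regs_written horner_prog = {4, 6, 7, 29}" "arrs_written horner_prog = {2, 12}"
  "regs_written solve_prog = {4, 5, 6, 7, 17, 29}" "arrs_written solve_prog = {2, 3, 4, 12}"
  by (auto simp: zero_prog_def mv_prog_def trace_prog_def newton_prog_def horner_prog_def solve_prog_def)

section \<open>Traces, Newton's identities and Horner's scheme modulo one number\<close>

context lp
begin

lemma dnz: "1 \<le> nz" "d \<le> nz" "1 \<le> d * nz" "d \<le> d * nz" "nz \<le> d * nz" "d * nz \<le> d * d * nz" "d * d \<le> d * d * nz"
  using dims by (auto simp: mult.assoc)

lemma bint: "k \<le> nz \<Longrightarrow> \<bar>int k\<bar> \<le> W ^ 1" using nat_bounds by simp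

definition modulus :: "st \<Rightarrow> int \<Rightarrow> bool" where
  "modulus \<sigma> m \<longleftrightarrow> regs0 \<sigma> \<and> fst \<sigma> 8 = m \<and> 0 < m \<and> m \<le> W ^ 2"

lemma modulus_same: "modulus \<sigma> m \<Longrightarrow> same R A \<sigma> \<sigma>' \<Longrightarrow> {0, 2, 8, 32} \<inter> R = {} \<Longrightarrow> modulus \<sigma>' m"
  by (auto simp: modulus_def regs0_def same_def)

lemma modulus_upd [simp]: "r \<notin> {0, 2, 8, 32} \<Longrightarrow> modulus (s(r := v), a) m = modulus (s, b) m"
  by (auto simp: modulus_def regs0_def)

text \<open>The start vector is not reduced modulo \<open>m\<close>, so the invariant speaks of
  congruence and size. \<open>B\<close> is the contribution of the unit vectors treated
  before.\<close>

lemma trace_inner: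
  assumes m: "modulus \<sigma> m" and i: "fst \<sigma> 4 = int i" "i < d"
    and V: "\<And>j. j < d \<Longrightarrow> snd \<sigma> 2 j = unit i j"
    and Tr: "\<And>k. 1 \<le> k \<Longrightarrow> k \<le> d \<Longrightarrow> snd \<sigma> 3 k = B k mod m"
  shows "ok (For 6 (Reg 32) (mv_prog ;;
        SetA 3 (Reg 6 .+ Cst 1) ((Arr 3 (Reg 6 .+ Cst 1) .+ Arr 2 (Reg 4)) .mod Reg 8))) \<sigma> (25 * (d * nz))
     (\<lambda>\<sigma>'. (\<forall>k. 1 \<le> k \<longrightarrow> k \<le> d \<longrightarrow> snd \<sigma>' 3 k = (B k + (negop d M ^^ k) (unit i) i) mod m) \<and>
        same {6, 7, 29} {2, 3, 12} \<sigma> \<sigma>')"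
proof -
  let ?N = "negop d M"
  let ?c = "mv_prog ;; SetA 3 (Reg 6 .+ Cst 1) ((Arr 3 (Reg 6 .+ Cst 1) .+ Arr 2 (Reg 4)) .mod Reg 8)"
  define I where "I k \<sigma>' \<longleftrightarrow> (\<forall>j<d. [snd \<sigma>' 2 j = (?N ^^ k) (unit i) j] (mod m) \<and> \<bar>snd \<sigma>' 2 j\<bar> \<le> W ^ 2) \<and>
     (\<forall>k'. 1 \<le> k' \<longrightarrow> k' \<le> d \<longrightarrow> snd \<sigma>' 3 k' = (B k' + (if k' \<le> k then (?N ^^ k') (unit i) i else 0)) mod m)"
    for k and \<sigma>' :: st
  have mm: "0 < m" "m \<le> W ^ 2" using m by (auto simp: modulus_def)
  show ?thesis
  proof (rule ok_mono[OF ok_For[where I = I and L = "int d" and t = "20 * nz + 1"]])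
    show "I 0 \<sigma>"
      using V Tr W1 by (auto simp: I_def unit_def)
    show "I k (s(6 := v), a) = I k (s, a)" for k s a v by (simp add: I_def)
    show "nat (int d) * (20 * nz + 1 + 2) + 2 \<le> 25 * (d * nz)"
    proof -
      have "nat (int d) * (20 * nz + 1 + 2) + 2 = 20 * (d * nz) + 3 * d + 2" by (simp add: algebra_simps)
      then show ?thesis using dnz by linarith
    qed
  next
    fix k \<sigma>' assume k: "k < nat (int d)" "fst \<sigma>' 6 = int k" and I: "I k \<sigma>'"
      and sm: "same (insert 6 (regs_written ?c)) (arrs_written ?c) \<sigma> \<sigma>'"
    have kd: "k < d" using k by simp
    have m': "modulus \<sigma>' m" using modulus_same[OF m sm] by simp
    have i': "fst \<sigma>' 4 = int i" using sm i by (simp add: same_def)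
    have 1: "ok mv_prog \<sigma>' (20 * nz) (\<lambda>\<sigma>''. (\<forall>j<d. snd \<sigma>'' 2 j = ?N (snd \<sigma>' 2) j mod m) \<and>
       same {7, 29} {2, 12} \<sigma>' \<sigma>'')"
      by (rule mv_ok) (use m' I in \<open>auto simp: modulus_def I_def\<close>)
    show "ok ?c \<sigma>' (20 * nz + 1) (I (Suc k))"
    proof (rule ok_seqI[OF 1])
      fix \<sigma>2 assume a: "(\<forall>j<d. snd \<sigma>2 2 j = ?N (snd \<sigma>' 2) j mod m) \<and> same {7, 29} {2, 12} \<sigma>' \<sigma>2"
      have r2: "fst \<sigma>2 6 = int k" "fst \<sigma>2 4 = int i" "fst \<sigma>2 8 = m" "snd \<sigma>2 3 = snd \<sigma>' 3"
        using a k i' m' by (auto simp: same_def modulus_def)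
      have v: "[snd \<sigma>2 2 j = (?N ^^ Suc k) (unit i) j] (mod m)" "\<bar>snd \<sigma>2 2 j\<bar> \<le> W ^ 2" if "j < d" for j
      proof -
        have e: "snd \<sigma>2 2 j = ?N (snd \<sigma>' 2) j mod m" using a that by blast
        have "[?N (snd \<sigma>' 2) j = ?N ((?N ^^ k) (unit i)) j] (mod m)"
          by (rule negop_cong) (use I in \<open>auto simp: I_def\<close>)
        then show "[snd \<sigma>2 2 j = (?N ^^ Suc k) (unit i) j] (mod m)" by (simp add: e cong_def)
        show "\<bar>snd \<sigma>2 2 j\<bar> \<le> W ^ 2" unfolding e using mm by (intro bmod)
      qed
      define x where "x = snd \<sigma>2 3 (Suc k)"
      define y where "y = snd \<sigma>2 2 i"
      have xe: "x = B (Suc k) mod m" using I kd r2 by (auto simp: x_def I_def)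
      have xb: "\<bar>x\<bar> \<le> W ^ 2" unfolding xe using mm by (intro bmod)
      have yb: "\<bar>y\<bar> \<le> W ^ 2" using v(2)[OF i(2)] by (simp add: y_def)
      have bb: "\<bar>x + y\<bar> \<le> V" "\<bar>(x + y) mod m\<bar> \<le> V"
        using bV[OF badd(1)[OF xb yb]] bV[OF bmod[OF mm]] by simp_all
      have new: "(x + y) mod m = (B (Suc k) + (?N ^^ Suc k) (unit i) i) mod m"
        using v(1)[OF i(2)] unfolding xe y_def by (simp add: cong_def mod_add_left_eq) (metis mod_add_right_eq)
      have ix: "nat (int k + 1) = Suc k" "\<bar>int k + 1\<bar> \<le> V" "int k + 1 < int S" "int i < int S" "i < S"
        using kd i(2) S_ge nat_bounds dims by auto
      have Q: "I (Suc k) (fst \<sigma>2, (snd \<sigma>2)(3 := (snd \<sigma>2 3)(Suc k := (x + y) mod m)))"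
        using v I r2 unfolding I_def by (auto simp: new le_Suc_eq)
      show "ok (SetA 3 (Reg 6 .+ Cst 1) ((Arr 3 (Reg 6 .+ Cst 1) .+ Arr 2 (Reg 4)) .mod Reg 8)) \<sigma>2 1 (I (Suc k))"
        using ix(2) Q by (simp add: r2(1-3) ix bb x_def[symmetric] y_def[symmetric])
    qed simp
  qed (use m i nat_bounds dims in \<open>auto simp: I_def same_def modulus_def regs0_def insert_commute\<close>)
qed

lemma trace_ok:
  assumes m: "modulus \<sigma> m"
  shows "ok trace_prog \<sigma> (50 * (d * d * nz)) (\<lambda>\<sigma>'. (\<forall>k. 1 \<le> k \<longrightarrow> k \<le> d \<longrightarrow> snd \<sigma>' 3 k = trp d M k mod m) \<and>
     same {4, 6, 7, 29} {2, 3, 12} \<sigma> \<sigma>')"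
proof -
  let ?N = "negop d M"
  let ?i = "For 6 (Reg 32) (mv_prog ;;
        SetA 3 (Reg 6 .+ Cst 1) ((Arr 3 (Reg 6 .+ Cst 1) .+ Arr 2 (Reg 4)) .mod Reg 8))"
  let ?c = "zero_prog 2 (Reg 32) ;; SetA 2 (Reg 4) (Cst 1) ;; ?i"
  let ?B = "\<lambda>i k. \<Sum>i'<i. (?N ^^ k) (unit i') i'"
  define I where "I i \<sigma>' \<longleftrightarrow> (\<forall>k. 1 \<le> k \<longrightarrow> k \<le> d \<longrightarrow> snd \<sigma>' 3 k = ?B i k mod m)" for i and \<sigma>' :: st
  have mr: "fst \<sigma> 32 = int d" using m by (auto simp: modulus_def regs0_def)
  have 1: "ok (zero_prog 3 (Reg 32 .+ Cst 1)) \<sigma> (3 * (d + 1) + 2)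
     (\<lambda>\<sigma>'. (\<forall>i<d + 1. snd \<sigma>' 3 i = 0) \<and> same {29} {3} \<sigma> \<sigma>')"
    by (rule zero_ok) (use mr nat_bounds S_ge dims in \<open>auto simp: same_def\<close>)
  have 2: "ok (For 4 (Reg 32) ?c) \<sigma>1 (d * (32 * (d * nz) + 2) + 2)
      (\<lambda>\<sigma>'. I (nat (int d)) \<sigma>' \<and> same (insert 4 (regs_written ?c)) (arrs_written ?c) \<sigma>1 \<sigma>')"
    if s: "\<forall>i<d + 1. snd \<sigma>1 3 i = 0" "same {29} {3} \<sigma> \<sigma>1" for \<sigma>1
  proof (rule ok_For[where I = I and L = "int d" and t = "32 * (d * nz)"])
    have m1: "modulus \<sigma>1 m" using modulus_same[OF m s(2)] by simp
    show "I 0 \<sigma>1" using s by (auto simp: I_def)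
    show "I k (s(4 := v), a) = I k (s, a)" for k s a v by (simp add: I_def)
    show "\<bar>int d\<bar> < V" using nat_bounds dims by simp
    show "safe \<sigma>' (Reg 32) \<and> eval inp \<sigma>' (Reg 32) = int d"
      if "same (insert 4 (regs_written ?c)) (arrs_written ?c) \<sigma>1 \<sigma>'" for \<sigma>'
      using that m1 by (auto simp: same_def modulus_def regs0_def)
    fix i \<sigma>' assume i: "i < nat (int d)" "fst \<sigma>' 4 = int i" and I: "I i \<sigma>'"
      and sm: "same (insert 4 (regs_written ?c)) (arrs_written ?c) \<sigma>1 \<sigma>'"
    have id: "i < d" using i by simp
    have m': "modulus \<sigma>' m" using modulus_same[OF m1 sm] by simp
    have z: "ok (zero_prog 2 (Reg 32)) \<sigma>' (3 * d + 2) (\<lambda>\<sigma>''. (\<forall>j<d. snd \<sigma>'' 2 j = 0) \<and> same {29} {2} \<sigma>' \<sigma>'')"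
      by (rule zero_ok) (use m' S_ge dims in \<open>auto simp: same_def modulus_def regs0_def\<close>)
    show "ok ?c \<sigma>' (32 * (d * nz)) (I (Suc i))"
    proof (rule ok_seqI[OF z])
      fix \<sigma>2 assume a: "(\<forall>j<d. snd \<sigma>2 2 j = 0) \<and> same {29} {2} \<sigma>' \<sigma>2"
      let ?s3 = "(fst \<sigma>2, (snd \<sigma>2)(2 := (snd \<sigma>2 2)(i := 1)))"
      have i2: "fst \<sigma>2 4 = int i" using a i by (simp add: same_def)
      have m2: "modulus \<sigma>2 m" using m' a by (auto intro: modulus_same)
      have "ok ?i ?s3 (25 * (d * nz)) (\<lambda>\<sigma>'. (\<forall>k. 1 \<le> k \<longrightarrow> k \<le> d \<longrightarrow> snd \<sigma>' 3 k = (?B i k + (?N ^^ k) (unit i) i) mod m) \<and>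
        same {6, 7, 29} {2, 3, 12} ?s3 \<sigma>')"
      proof (rule trace_inner[OF _ _ id])
        show "modulus ?s3 m" using m2 by (simp add: modulus_def regs0_def)
        show "snd ?s3 2 j = unit i j" if "j < d" for j using a that by (auto simp: unit_def)
        show "snd ?s3 3 k = ?B i k mod m" if "1 \<le> k" "k \<le> d" for k
          using I a that by (auto simp: I_def same_def)
      qed (use i2 in simp)
      then have "ok ?i ?s3 (25 * (d * nz)) (I (Suc i))"
        by (rule ok_mono) (auto simp: I_def)
      then show "ok (SetA 2 (Reg 4) (Cst 1) ;; ?i) \<sigma>2 (25 * (d * nz) + 1) (I (Suc i))"
        using id S_ge dims by (simp add: i2)
    qed (use dnz in linarith)
  qed simp_all
  show ?thesis unfolding trace_prog_def
  proof (rule ok_seqI[OF 1])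
    fix \<sigma>1 assume a: "(\<forall>i<d + 1. snd \<sigma>1 3 i = 0) \<and> same {29} {3} \<sigma> \<sigma>1"
    show "ok (For 4 (Reg 32) ?c) \<sigma>1 (d * (32 * (d * nz) + 2) + 2)
      (\<lambda>\<sigma>'. (\<forall>k. 1 \<le> k \<longrightarrow> k \<le> d \<longrightarrow> snd \<sigma>' 3 k = trp d M k mod m) \<and> same {4, 6, 7, 29} {2, 3, 12} \<sigma> \<sigma>')"
      by (rule ok_mono[OF 2]) (use a in \<open>auto simp: I_def trp_def same_def\<close>)
  next
    have "3 * (d + 1) + 2 + (d * (32 * (d * nz) + 2) + 2) = 32 * (d * d * nz) + 5 * d + 7" by (simp add: algebra_simps)
    then show "3 * (d + 1) + 2 + (d * (32 * (d * nz) + 2) + 2) \<le> 50 * (d * d * nz)" using dnz by linarith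
  qed
qed

text \<open>The sum in the recursion of \<open>Cf\<close> is itself evaluated by a Horner scheme:
  multiplying the accumulator by the loop index extends every product of indices by one factor, so
  no quotient of factorials is computed separately.\<close>

lemma newton_inner:
  assumes m: "modulus \<sigma> m" and k: "fst \<sigma> 6 = int k" "k < d" and a0: "fst \<sigma> 17 = 0"
    and C: "\<And>k'. k' \<le> k \<Longrightarrow> [snd \<sigma> 4 k' = Cf d M k'] (mod m) \<and> \<bar>snd \<sigma> 4 k'\<bar> \<le> W ^ 2"
    and Tr: "\<And>k. 1 \<le> k \<Longrightarrow> k \<le> d \<Longrightarrow> snd \<sigma> 3 k = trp d M k mod m"
  shows "ok (For 5 (Reg 6 .+ Cst 1)
       (SetR 17 ((Reg 17 .* Reg 5 .+ Arr 4 (Reg 5) .* Arr 3 (Reg 6 .+ Cst 1 .- Reg 5)) .mod Reg 8))) \<sigma> (3 * d + 2)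
     (\<lambda>\<sigma>'. [fst \<sigma>' 17 = - Cf d M (Suc k)] (mod m) \<and> \<bar>fst \<sigma>' 17\<bar> \<le> W ^ 2 \<and> same {5, 17} {} \<sigma> \<sigma>')"
proof -
  let ?c = "SetR 17 ((Reg 17 .* Reg 5 .+ Arr 4 (Reg 5) .* Arr 3 (Reg 6 .+ Cst 1 .- Reg 5)) .mod Reg 8)"
  define s where "s j = (\<Sum>j'<j. Cf d M j' * (\<Prod>i=Suc j'..<j. int i) * trp d M (Suc k - j'))" for j
  have s_Suc: "s (Suc j) = s j * int j + Cf d M j * trp d M (Suc k - j)" for j
  proof -
    have "(\<Sum>j'<j. Cf d M j' * (\<Prod>i=Suc j'..<Suc j. int i) * trp d M (Suc k - j')) = s j * int j"
      unfolding s_def sum_distrib_right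
      by (rule sum.cong) (auto simp: prod.atLeastLessThan_Suc mult_ac)
    then show ?thesis by (simp add: s_def)
  qed
  have sk: "s (Suc k) = - Cf d M (Suc k)" by (subst Cf.simps) (simp add: s_def)
  define I where "I j \<sigma>' \<longleftrightarrow> [fst \<sigma>' 17 = s j] (mod m) \<and> \<bar>fst \<sigma>' 17\<bar> \<le> W ^ 2" for j and \<sigma>' :: st
  have mm: "0 < m" "m \<le> W ^ 2" "fst \<sigma> 8 = m" using m by (auto simp: modulus_def)
  have kV: "\<bar>int k + 1\<bar> < V" "\<bar>int k + 1\<bar> \<le> V" using k nat_bounds dims by auto
  show ?thesis
  proof (rule ok_mono[OF ok_For[where I = I and L = "int k + 1" and t = 1]])
    fix j \<sigma>' assume j: "j < nat (int k + 1)" "fst \<sigma>' 5 = int j" and I: "I j \<sigma>'"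
      and sm: "same (insert 5 (regs_written ?c)) (arrs_written ?c) \<sigma> \<sigma>'"
    have jk: "j \<le> k" using j by simp
    have st: "fst \<sigma>' 8 = m" "fst \<sigma>' 6 = int k" "snd \<sigma>' = snd \<sigma>"
      using sm mm k by (auto simp: same_def)
    define x y z where "x = fst \<sigma>' 17" "y = snd \<sigma> 4 j" "z = snd \<sigma> 3 (Suc k - j)"
    have ze: "z = trp d M (Suc k - j) mod m" using Tr[of "Suc k - j"] jk k by (auto simp: x_y_z_def)
    have xb: "\<bar>x\<bar> \<le> W ^ 2" using I by (simp add: I_def x_y_z_def)
    have yb: "\<bar>y\<bar> \<le> W ^ 2" using C[OF jk] by (simp add: x_y_z_def)
    have zb: "\<bar>z\<bar> \<le> W ^ 2" unfolding ze using mm by (intro bmod)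
    have jb: "\<bar>int j\<bar> \<le> W ^ 1" using jk k dims by (intro bint) auto
    have b1: "\<bar>x * int j\<bar> \<le> W ^ 4" by (rule bup[OF bmult[OF xb jb HOL.refl]]) simp
    have b2: "\<bar>y * z\<bar> \<le> W ^ 4" by (rule bmult[OF yb zb]) simp
    have bb: "\<bar>x * int j\<bar> \<le> V" "\<bar>y * z\<bar> \<le> V" "\<bar>x * int j + y * z\<bar> \<le> V" "\<bar>(x * int j + y * z) mod m\<bar> \<le> V"
      using bV[OF b1] bV[OF b2] bV[OF badd(1)[OF b1 b2]] bV[OF bmod[OF mm(1,2)]] by simp_all
    have ix: "nat (int k + 1 - int j) = Suc k - j" "\<bar>int k + 1\<bar> \<le> V" "\<bar>int k + 1 - int j\<bar> \<le> V"
       "int k + 1 - int j < int S" "int j < int S" "0 \<le> int k + 1 - int j" "j < S" "int j \<le> int k + 1"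
      using jk k S_ge nat_bounds dims by auto
    have cg: "[(x * int j + y * z) mod m = s (Suc j)] (mod m)"
    proof -
      have "[x * int j + y * z = s j * int j + Cf d M j * trp d M (Suc k - j)] (mod m)"
        using I C[OF jk] by (intro cong_add cong_mult) (auto simp: I_def x_y_z_def(1,2) ze cong_def)
      then show ?thesis unfolding s_Suc by (simp add: cong_def)
    qed
    have Q: "I (Suc j) ((fst \<sigma>')(17 := (x * int j + y * z) mod m), snd \<sigma>)"
      using cg bmod[OF mm(1,2)] by (simp add: I_def)
    show "ok ?c \<sigma>' 1 (I (Suc j))"
      using Q bb ix(2,3) by (simp add: st j(2) ix x_y_z_def[symmetric])
  qed (use m k a0 kV sk mm in \<open>auto simp: I_def s_def same_def nat_add_distrib\<close>)
qed

lemma newton_ok: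
  assumes m: "modulus \<sigma> m"
    and Tr: "\<And>k. 1 \<le> k \<Longrightarrow> k \<le> d \<Longrightarrow> snd \<sigma> 3 k = trp d M k mod m"
  shows "ok newton_prog \<sigma> (20 * (d * d)) (\<lambda>\<sigma>'. (\<forall>k\<le>d. [snd \<sigma>' 4 k = Cf d M k] (mod m) \<and> \<bar>snd \<sigma>' 4 k\<bar> \<le> W ^ 2) \<and>
     snd \<sigma>' 4 d = Cf d M d mod m \<and> same {5, 6, 17} {4} \<sigma> \<sigma>')"
proof -
  let ?i = "For 5 (Reg 6 .+ Cst 1)
       (SetR 17 ((Reg 17 .* Reg 5 .+ Arr 4 (Reg 5) .* Arr 3 (Reg 6 .+ Cst 1 .- Reg 5)) .mod Reg 8))"
  let ?c = "SetR 17 (Cst 0) ;; ?i ;; SetA 4 (Reg 6 .+ Cst 1) ((Cst 0 .- Reg 17) .mod Reg 8)"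
  define I where "I k \<sigma>' \<longleftrightarrow> (\<forall>k'\<le>k. [snd \<sigma>' 4 k' = Cf d M k'] (mod m) \<and> \<bar>snd \<sigma>' 4 k'\<bar> \<le> W ^ 2) \<and>
     (1 \<le> k \<longrightarrow> snd \<sigma>' 4 k = Cf d M k mod m)" for k and \<sigma>' :: st
  let ?s1 = "(fst \<sigma>, (snd \<sigma>)(4 := (snd \<sigma> 4)(0 := 1)))"
  have mm: "0 < m" "m \<le> W ^ 2" using m by (auto simp: modulus_def)
  have m1: "modulus ?s1 m" using m by (simp add: modulus_def regs0_def)
  have 2: "ok (For 6 (Reg 32) ?c) ?s1 (d * (3 * d + 6) + 2)
      (\<lambda>\<sigma>'. I (nat (int d)) \<sigma>' \<and> same (insert 6 (regs_written ?c)) (arrs_written ?c) ?s1 \<sigma>')"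
  proof (rule ok_For[where I = I and L = "int d" and t = "3 * d + 4"])
    show "I 0 ?s1" using W1 by (simp add: I_def Cf.simps)
    show "I k (s(6 := v), a) = I k (s, a)" for k s a v by (simp add: I_def)
    show "\<bar>int d\<bar> < V" using nat_bounds dims by simp
    show "safe \<sigma>' (Reg 32) \<and> eval inp \<sigma>' (Reg 32) = int d"
      if "same (insert 6 (regs_written ?c)) (arrs_written ?c) ?s1 \<sigma>'" for \<sigma>'
      using that m1 by (auto simp: same_def modulus_def regs0_def)
    fix k \<sigma>' assume k: "k < nat (int d)" "fst \<sigma>' 6 = int k" and I: "I k \<sigma>'"
      and sm: "same (insert 6 (regs_written ?c)) (arrs_written ?c) ?s1 \<sigma>'"
    have kd: "k < d" using k by simp
    let ?s2 = "((fst \<sigma>')(17 := 0), snd \<sigma>')"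
    have m': "modulus \<sigma>' m" using modulus_same[OF m1 sm] by simp
    have "ok ?i ?s2 (3 * d + 2) (\<lambda>\<sigma>'. [fst \<sigma>' 17 = - Cf d M (Suc k)] (mod m) \<and> \<bar>fst \<sigma>' 17\<bar> \<le> W ^ 2 \<and> same {5, 17} {} ?s2 \<sigma>')"
    proof (rule newton_inner[OF _ _ kd])
      show "modulus ?s2 m" using m' by (simp add: modulus_def regs0_def)
      show "snd ?s2 3 k = trp d M k mod m" if "1 \<le> k" "k \<le> d" for k
        using Tr that sm by (auto simp: same_def)
    qed (use k I in \<open>auto simp: I_def\<close>)
    then have "ok (?i ;; SetA 4 (Reg 6 .+ Cst 1) ((Cst 0 .- Reg 17) .mod Reg 8)) ?s2 (3 + 3 * d) (I (Suc k))"
    proof (rule ok_seqI)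
      fix \<sigma>3 assume a: "[fst \<sigma>3 17 = - Cf d M (Suc k)] (mod m) \<and> \<bar>fst \<sigma>3 17\<bar> \<le> W ^ 2 \<and> same {5, 17} {} ?s2 \<sigma>3"
      have r3: "fst \<sigma>3 6 = int k" "fst \<sigma>3 8 = m" "snd \<sigma>3 = snd \<sigma>'"
        using a k m' by (auto simp: same_def modulus_def)
      have b17: "\<bar>fst \<sigma>3 17\<bar> \<le> W ^ 2" using a by simp
      have bb: "\<bar>fst \<sigma>3 17\<bar> \<le> V" "\<bar>(- fst \<sigma>3 17) mod m\<bar> \<le> V"
        using bV[OF b17] bV[OF bmod[OF mm]] by simp_all
      have ix: "nat (int k + 1) = Suc k" "\<bar>int k + 1\<bar> \<le> V" "int k + 1 < int S"
        using kd S_ge nat_bounds dims by auto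
      have "[- fst \<sigma>3 17 = - (- Cf d M (Suc k))] (mod m)" using a cong_minus_minus_iff by blast
      then have new: "(- fst \<sigma>3 17) mod m = Cf d M (Suc k) mod m" by (simp add: cong_def)
      have b2: "\<bar>Cf d M (Suc k) mod m\<bar> \<le> W ^ 2" using bmod[OF mm] .
      have "I (Suc k) (fst \<sigma>3, (snd \<sigma>')(4 := (snd \<sigma>' 4)(Suc k := (- fst \<sigma>3 17) mod m)))"
        using I b2 unfolding I_def new by (simp add: le_Suc_eq all_conj_distrib)
      then show "ok (SetA 4 (Reg 6 .+ Cst 1) ((Cst 0 .- Reg 17) .mod Reg 8)) \<sigma>3 1 (I (Suc k))"
        using ix(2) by (simp add: r3 ix bb)
    qed simp
    then show "ok ?c \<sigma>' (3 * d + 4) (I (Suc k))" by simp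
  qed simp_all
  have "ok (For 6 (Reg 32) ?c) ?s1 (20 * (d * d) - 1) (\<lambda>\<sigma>'. (\<forall>k\<le>d. [snd \<sigma>' 4 k = Cf d M k] (mod m) \<and> \<bar>snd \<sigma>' 4 k\<bar> \<le> W ^ 2) \<and>
     snd \<sigma>' 4 d = Cf d M d mod m \<and> same {5, 6, 17} {4} \<sigma> \<sigma>')"
  proof (rule ok_mono[OF 2])
    have e: "d * (3 * d + 6) + 2 = 3 * (d * d) + 6 * d + 2" by (simp add: algebra_simps)
    have dd: "d \<le> d * d" "1 \<le> d * d" using dims by auto
    show "d * (3 * d + 6) + 2 \<le> 20 * (d * d) - 1" unfolding e using dd by linarith
  qed (use dims in \<open>auto simp: I_def same_def\<close>)
  then show ?thesis unfolding newton_prog_def using dims S_ge by simp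
qed

lemma horner_inner:
  assumes m: "modulus \<sigma> m" and x: "\<bar>x\<bar> \<le> W ^ 2" "\<And>\<sigma>'. same {4} {2} \<sigma> \<sigma>' \<Longrightarrow> safe \<sigma>' ex \<and> eval inp \<sigma>' ex = x"
    and y: "\<And>j. j < d \<Longrightarrow> \<bar>y j\<bar> \<le> W ^ 3"
      "\<And>j \<sigma>'. j < d \<Longrightarrow> same {4} {2} \<sigma> \<sigma>' \<Longrightarrow> fst \<sigma>' 4 = int j \<Longrightarrow> safe \<sigma>' ey \<and> eval inp \<sigma>' ey = y j"
    and v: "\<And>j. j < d \<Longrightarrow> \<bar>snd \<sigma> 2 j\<bar> \<le> W ^ 2"
  shows "ok (For 4 (Reg 32) (SetA 2 (Reg 4) ((ex .* Arr 2 (Reg 4) .+ ey) .mod Reg 8))) \<sigma> (3 * d + 2)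
     (\<lambda>\<sigma>'. (\<forall>j<d. snd \<sigma>' 2 j = (x * snd \<sigma> 2 j + y j) mod m) \<and> same {4} {2} \<sigma> \<sigma>')"
proof -
  let ?c = "SetA 2 (Reg 4) ((ex .* Arr 2 (Reg 4) .+ ey) .mod Reg 8)"
  let ?I = "\<lambda>i \<sigma>'. \<forall>j<d. snd \<sigma>' 2 j = (if j < i then (x * snd \<sigma> 2 j + y j) mod m else snd \<sigma> 2 j)"
  have mm: "0 < m" "m \<le> W ^ 2" "fst \<sigma> 8 = m" "fst \<sigma> 32 = int d" using m by (auto simp: modulus_def regs0_def)
  show ?thesis
  proof (rule ok_mono[OF ok_For[where I = ?I and L = "int d" and t = 1]])
    fix i \<sigma>' assume i: "i < nat (int d)" "fst \<sigma>' 4 = int i" and I: "?I i \<sigma>'"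
      and sm: "same (insert 4 (regs_written ?c)) (arrs_written ?c) \<sigma> \<sigma>'"
    have id: "i < d" using i by simp
    have sm': "same {4} {2} \<sigma> \<sigma>'" using sm by simp
    have st: "fst \<sigma>' 8 = m" "snd \<sigma>' 2 i = snd \<sigma> 2 i" using sm' mm I id by (auto simp: same_def)
    have b1: "\<bar>x * snd \<sigma> 2 i\<bar> \<le> W ^ 4" by (rule bmult[OF x(1) v[OF id]]) simp
    have b2: "\<bar>y i\<bar> \<le> W ^ 4" by (rule bup[OF y(1)[OF id]]) simp
    have bb: "\<bar>x * snd \<sigma> 2 i\<bar> \<le> V" "\<bar>x * snd \<sigma> 2 i + y i\<bar> \<le> V" "\<bar>(x * snd \<sigma> 2 i + y i) mod m\<bar> \<le> V"
      using bV[OF b1] bV[OF badd(1)[OF b1 b2]] bV[OF bmod[OF mm(1,2)]] by simp_all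
    have "i < S" using id S_ge dims by simp
    then show "ok ?c \<sigma>' 1 (?I (Suc i))"
      using I by (simp add: st i(2) x(2)[OF sm'] y(2)[OF id sm' i(2)] bb less_Suc_eq)
  qed (use mm nat_bounds dims in \<open>auto simp: same_def\<close>)
qed

lemma horner_ok:
  assumes m: "modulus \<sigma> m"
    and C: "\<forall>k\<le>d. [snd \<sigma> 4 k = Cf d M k] (mod m) \<and> \<bar>snd \<sigma> 4 k\<bar> \<le> W ^ 2" "snd \<sigma> 4 d = Cf d M d mod m"
    and g: "\<And>j. j < d \<Longrightarrow> snd \<sigma> 5 j = g j" "\<And>j. j < d \<Longrightarrow> \<bar>g j\<bar> \<le> W"
  shows "ok horner_prog \<sigma> (40 * (d * d * nz)) (\<lambda>\<sigma>'. (\<forall>j<d. snd \<sigma>' 2 j = (int d * Zf d M g d j) mod m) \<and>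
     snd \<sigma>' 2 d = Cf d M d mod m \<and> same {4, 6, 7, 29} {2, 12} \<sigma> \<sigma>')"
proof -
  let ?N = "negop d M"
  let ?i = "For 4 (Reg 32) (SetA 2 (Reg 4) ((Reg 6 .* Arr 2 (Reg 4) .+ Arr 4 (Reg 6) .* Arr 5 (Reg 4)) .mod Reg 8))"
  let ?c = "mv_prog ;; ?i"
  define I where "I k \<sigma>' \<longleftrightarrow> (\<forall>j<d. [snd \<sigma>' 2 j = Zf d M g k j] (mod m) \<and> \<bar>snd \<sigma>' 2 j\<bar> \<le> W ^ 2)"
    for k and \<sigma>' :: st
  have mm: "0 < m" "m \<le> W ^ 2" using m by (auto simp: modulus_def)
  have 1: "ok (zero_prog 2 (Reg 32)) \<sigma> (3 * d + 2) (\<lambda>\<sigma>''. (\<forall>j<d. snd \<sigma>'' 2 j = 0) \<and> same {29} {2} \<sigma> \<sigma>'')"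
    by (rule zero_ok) (use m S_ge dims in \<open>auto simp: same_def modulus_def regs0_def\<close>)
  have 2: "ok (For 6 (Reg 32) ?c) \<sigma>1 (d * (20 * nz + (3 * d + 2) + 2) + 2)
      (\<lambda>\<sigma>'. I (nat (int d)) \<sigma>' \<and> same (insert 6 (regs_written ?c)) (arrs_written ?c) \<sigma>1 \<sigma>')"
    if s: "\<forall>j<d. snd \<sigma>1 2 j = 0" "same {29} {2} \<sigma> \<sigma>1" for \<sigma>1
  proof (rule ok_For[where I = I and L = "int d" and t = "20 * nz + (3 * d + 2)"])
    have m1: "modulus \<sigma>1 m" using modulus_same[OF m s(2)] by simp
    show "I 0 \<sigma>1" using s W1 by (auto simp: I_def)
    show "I k (s(6 := v), a) = I k (s, a)" for k s a v by (simp add: I_def)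
    show "\<bar>int d\<bar> < V" using nat_bounds dims by simp
    show "safe \<sigma>' (Reg 32) \<and> eval inp \<sigma>' (Reg 32) = int d"
      if "same (insert 6 (regs_written ?c)) (arrs_written ?c) \<sigma>1 \<sigma>'" for \<sigma>'
      using that m1 by (auto simp: same_def modulus_def regs0_def)
    fix k \<sigma>' assume k: "k < nat (int d)" "fst \<sigma>' 6 = int k" and I: "I k \<sigma>'"
      and sm: "same (insert 6 (regs_written ?c)) (arrs_written ?c) \<sigma>1 \<sigma>'"
    have kd: "k < d" using k by simp
    have m': "modulus \<sigma>' m" using modulus_same[OF m1 sm] by simp
    have ar: "snd \<sigma>' 4 = snd \<sigma> 4" "snd \<sigma>' 5 = snd \<sigma> 5" using sm s(2) by (auto simp: same_def)
    have mv: "ok mv_prog \<sigma>' (20 * nz) (\<lambda>\<sigma>''. (\<forall>j<d. snd \<sigma>'' 2 j = ?N (snd \<sigma>' 2) j mod m) \<and>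
       same {7, 29} {2, 12} \<sigma>' \<sigma>'')"
      by (rule mv_ok) (use m' I in \<open>auto simp: modulus_def I_def\<close>)
    show "ok ?c \<sigma>' (20 * nz + (3 * d + 2)) (I (Suc k))"
    proof (rule ok_seqI[OF mv])
      fix \<sigma>2 assume a: "(\<forall>j<d. snd \<sigma>2 2 j = ?N (snd \<sigma>' 2) j mod m) \<and> same {7, 29} {2, 12} \<sigma>' \<sigma>2"
      have m2: "modulus \<sigma>2 m" using modulus_same[OF m', of "{7, 29}" "{2, 12}" \<sigma>2] a by simp
      have vb: "\<bar>snd \<sigma>2 2 j\<bar> \<le> W ^ 2" if "j < d" for j using a that bmod[OF mm] by simp
      have gb: "\<bar>g j\<bar> \<le> W ^ 1" if "j < d" for j using g(2)[OF that] by simp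
      have Cb: "\<bar>snd \<sigma> 4 k\<bar> \<le> W ^ 2" "k \<le> d" using C kd by auto
      have cgb: "\<bar>snd \<sigma> 4 k * g j\<bar> \<le> W ^ 3" if "j < d" for j by (rule bmult[OF Cb(1) gb[OF that]]) simp
      have kb: "\<bar>int k\<bar> \<le> W ^ 2" by (rule bup[OF bint]) (use kd dims in auto)
      have "ok ?i \<sigma>2 (3 * d + 2) (\<lambda>\<sigma>'. (\<forall>j<d. snd \<sigma>' 2 j = (int k * snd \<sigma>2 2 j + snd \<sigma> 4 k * g j) mod m) \<and> same {4} {2} \<sigma>2 \<sigma>')"
      proof (rule horner_inner[OF m2 kb])
        show "safe \<sigma>3 (Reg 6) \<and> eval inp \<sigma>3 (Reg 6) = int k" if "same {4} {2} \<sigma>2 \<sigma>3" for \<sigma>3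
          using that a k by (auto simp: same_def)
        show "safe \<sigma>3 (Arr 4 (Reg 6) .* Arr 5 (Reg 4)) \<and> eval inp \<sigma>3 (Arr 4 (Reg 6) .* Arr 5 (Reg 4)) = snd \<sigma> 4 k * g j"
          if j: "j < d" and s3: "same {4} {2} \<sigma>2 \<sigma>3" "fst \<sigma>3 4 = int j" for j \<sigma>3
        proof -
          have e: "fst \<sigma>3 6 = int k" "snd \<sigma>3 4 = snd \<sigma> 4" "snd \<sigma>3 5 j = g j"
            using s3 a k ar g(1)[OF j] by (auto simp: same_def)
          have "k < S" "j < S" using kd j S_ge dims by auto
          then show ?thesis using bV[OF cgb[OF j]] by (simp add: e s3(2))
        qed
      qed (use vb cgb in auto)
      then show "ok ?i \<sigma>2 (3 * d + 2) (I (Suc k))"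
      proof (rule ok_mono)
        fix \<sigma>3 assume b: "(\<forall>j<d. snd \<sigma>3 2 j = (int k * snd \<sigma>2 2 j + snd \<sigma> 4 k * g j) mod m) \<and> same {4} {2} \<sigma>2 \<sigma>3"
        show "I (Suc k) \<sigma>3" unfolding I_def
        proof (intro allI impI conjI)
          fix j assume j: "j < d"
          have e: "snd \<sigma>3 2 j = (int k * snd \<sigma>2 2 j + snd \<sigma> 4 k * g j) mod m" using b j by blast
          show "\<bar>snd \<sigma>3 2 j\<bar> \<le> W ^ 2" unfolding e using bmod[OF mm] .
          have "[?N (snd \<sigma>' 2) j = ?N (Zf d M g k) j] (mod m)"
            by (rule negop_cong) (use I in \<open>auto simp: I_def\<close>)
          then have "[snd \<sigma>2 2 j = ?N (Zf d M g k) j] (mod m)" using a j by (simp add: cong_def)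
          then have "[int k * snd \<sigma>2 2 j + snd \<sigma> 4 k * g j = int k * ?N (Zf d M g k) j + Cf d M k * g j] (mod m)"
            using C Cb(2) by (intro cong_add cong_mult cong_refl) auto
          then show "[snd \<sigma>3 2 j = Zf d M g (Suc k) j] (mod m)" unfolding e by (simp add: cong_def)
        qed
      qed simp
    qed simp
  qed simp_all
  let ?f = "For 4 (Reg 32) (SetA 2 (Reg 4) ((Reg 32 .* Arr 2 (Reg 4) .+ Cst 0) .mod Reg 8))"
  let ?e = "SetA 2 (Reg 32) (Arr 4 (Reg 32))"
  have 3: "ok (?f ;; ?e) \<sigma>2 (3 * d + 3) (\<lambda>\<sigma>'. (\<forall>j<d. snd \<sigma>' 2 j = (int d * Zf d M g d j) mod m) \<and>
     snd \<sigma>' 2 d = Cf d M d mod m \<and> same {4} {2} \<sigma>2 \<sigma>')"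
    if I: "I d \<sigma>2" and s: "same {6, 7, 29, 4} {2, 12} \<sigma> \<sigma>2" for \<sigma>2
  proof -
    have m2: "modulus \<sigma>2 m" using modulus_same[OF m s] by simp
    have db: "\<bar>int d\<bar> \<le> W ^ 2" by (rule bup[OF bint]) (use dims in auto)
    have "ok ?f \<sigma>2 (3 * d + 2) (\<lambda>\<sigma>'. (\<forall>j<d. snd \<sigma>' 2 j = (int d * snd \<sigma>2 2 j + 0) mod m) \<and> same {4} {2} \<sigma>2 \<sigma>')"
      by (rule horner_inner[OF m2 db]) (use I m2 W1 in \<open>auto simp: I_def same_def modulus_def regs0_def\<close>)
    then show ?thesis
    proof (rule ok_seqI)
      fix \<sigma>3 assume a: "(\<forall>j<d. snd \<sigma>3 2 j = (int d * snd \<sigma>2 2 j + 0) mod m) \<and> same {4} {2} \<sigma>2 \<sigma>3"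
      have r: "fst \<sigma>3 32 = int d" "snd \<sigma>3 4 d = Cf d M d mod m" "d < S"
        using a s m2 C(2) S_ge dims by (auto simp: same_def modulus_def regs0_def)
      have "snd \<sigma>3 2 j = (int d * Zf d M g d j) mod m" if j: "j < d" for j
      proof -
        have "[int d * snd \<sigma>2 2 j = int d * Zf d M g d j] (mod m)"
          using I j by (intro cong_mult cong_refl) (auto simp: I_def)
        then show ?thesis using a j by (simp add: cong_def)
      qed
      then show "ok ?e \<sigma>3 1 (\<lambda>\<sigma>'. (\<forall>j<d. snd \<sigma>' 2 j = (int d * Zf d M g d j) mod m) \<and>
         snd \<sigma>' 2 d = Cf d M d mod m \<and> same {4} {2} \<sigma>2 \<sigma>')"
        using a by (simp add: r) (simp add: same_def)
    qed simp
  qed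
  show ?thesis unfolding horner_prog_def
  proof (rule ok_seqI[OF 1])
    fix \<sigma>1 assume a: "(\<forall>j<d. snd \<sigma>1 2 j = 0) \<and> same {29} {2} \<sigma> \<sigma>1"
    show "ok (For 6 (Reg 32) ?c ;; ?f ;; ?e) \<sigma>1 ((d * (20 * nz + (3 * d + 2) + 2) + 2) + (3 * d + 3))
      (\<lambda>\<sigma>'. (\<forall>j<d. snd \<sigma>' 2 j = (int d * Zf d M g d j) mod m) \<and>
     snd \<sigma>' 2 d = Cf d M d mod m \<and> same {4, 6, 7, 29} {2, 12} \<sigma> \<sigma>')"
    proof (rule ok_seqI[OF 2])
      fix \<sigma>2 assume b: "I (nat (int d)) \<sigma>2 \<and> same (insert 6 (regs_written ?c)) (arrs_written ?c) \<sigma>1 \<sigma>2"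
      have s2: "same {6, 7, 29, 4} {2, 12} \<sigma> \<sigma>2" using a b by (auto simp: same_def)
      show "ok (?f ;; ?e) \<sigma>2 (3 * d + 3) (\<lambda>\<sigma>'. (\<forall>j<d. snd \<sigma>' 2 j = (int d * Zf d M g d j) mod m) \<and>
         snd \<sigma>' 2 d = Cf d M d mod m \<and> same {4, 6, 7, 29} {2, 12} \<sigma> \<sigma>')"
        by (rule ok_mono[OF 3[OF _ s2]]) (use b s2 in \<open>auto simp: same_def\<close>)
    qed (use a in auto)
  next
    have "d * (20 * nz + (3 * d + 2) + 2) = 20 * (d * nz) + 3 * (d * d) + 4 * d" by (simp add: algebra_simps)
    then show "3 * d + 2 + (d * (20 * nz + (3 * d + 2) + 2) + 2 + (3 * d + 3)) \<le> 40 * (d * d * nz)"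
      using dnz by linarith
  qed
qed

lemma solve_ok:
  assumes m: "modulus \<sigma> m" and g: "\<And>j. j < d \<Longrightarrow> snd \<sigma> 5 j = g j" "\<And>j. j < d \<Longrightarrow> \<bar>g j\<bar> \<le> W"
  shows "ok solve_prog \<sigma> (120 * (d * d * nz)) (\<lambda>\<sigma>'. (\<forall>j<d. snd \<sigma>' 2 j = (int d * Zf d M g d j) mod m) \<and>
     snd \<sigma>' 2 d = Cf d M d mod m \<and> same {4, 5, 6, 7, 17, 29} {2, 3, 4, 12} \<sigma> \<sigma>')"
  unfolding solve_prog_def
proof (rule ok_seqI[OF trace_ok[OF m]])
  fix \<sigma>1 assume a: "(\<forall>k. 1 \<le> k \<longrightarrow> k \<le> d \<longrightarrow> snd \<sigma>1 3 k = trp d M k mod m) \<and> same {4, 6, 7, 29} {2, 3, 12} \<sigma> \<sigma>1"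
  have m1: "modulus \<sigma>1 m" using modulus_same[OF m, of "{4, 6, 7, 29}" "{2, 3, 12}" \<sigma>1] a by simp
  show "ok (newton_prog ;; horner_prog) \<sigma>1 (20 * (d * d) + 40 * (d * d * nz)) (\<lambda>\<sigma>'. (\<forall>j<d. snd \<sigma>' 2 j = (int d * Zf d M g d j) mod m) \<and>
     snd \<sigma>' 2 d = Cf d M d mod m \<and> same {4, 5, 6, 7, 17, 29} {2, 3, 4, 12} \<sigma> \<sigma>')"
  proof (rule ok_seqI[OF newton_ok[OF m1]])
    fix \<sigma>2 assume b: "(\<forall>k\<le>d. [snd \<sigma>2 4 k = Cf d M k] (mod m) \<and> \<bar>snd \<sigma>2 4 k\<bar> \<le> W ^ 2) \<and>
       snd \<sigma>2 4 d = Cf d M d mod m \<and> same {5, 6, 17} {4} \<sigma>1 \<sigma>2"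
    have m2: "modulus \<sigma>2 m" using modulus_same[OF m1, of "{5, 6, 17}" "{4}" \<sigma>2] b by simp
    have g2: "snd \<sigma>2 5 j = g j" if "j < d" for j using a b g(1)[OF that] by (simp add: same_def)
    show "ok horner_prog \<sigma>2 (40 * (d * d * nz)) (\<lambda>\<sigma>'. (\<forall>j<d. snd \<sigma>' 2 j = (int d * Zf d M g d j) mod m) \<and>
       snd \<sigma>' 2 d = Cf d M d mod m \<and> same {4, 5, 6, 7, 17, 29} {2, 3, 4, 12} \<sigma> \<sigma>')"
      by (rule ok_mono[OF horner_ok[OF m2 _ _ g2 g(2)]]) (use a b in \<open>auto simp: same_def\<close>)
  qed (use a in auto)
qed (use dnz in simp)

end

section \<open>Programs for the parameters, the moduli and modular inverses\<close>

definition pow_prog :: "nat \<Rightarrow> exp \<Rightarrow> com" where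
  "pow_prog r e = SetR 28 e ;; SetR r (Cst 1) ;;
    While (Reg 28) (SetR r (Cst 2 .* Reg r) ;; SetR 28 (Reg 28 .- Cst 1))"

text \<open>Constants are limited to 64 by \<open>wf_exp\<close>, hence
  \<open>64 * 64 * 64 * 4\<close> for \<open>2 ^ 20\<close>. Register 15 accumulates the sum of
  squares \<open>sg\<close>.\<close>

definition init_prog :: com where
  "init_prog =
    SetR 0 (In (Cst 0)) ;; SetR 32 (In (Cst 1)) ;; SetR 2 (In (Cst 2)) ;; SetR 3 (Reg 32 .+ Cst 8) ;;
    SetR 15 (Cst 1) ;;
    For 4 (Cst 3 .* Reg 2 .+ Reg 32 .+ Reg 0)
      (SetR 15 (Reg 15 .+ In (Cst 7 .+ Reg 4) .* In (Cst 7 .+ Reg 4))) ;;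
    pow_prog 13 (Cst 2 .* In (Cst 6) .- In (Cst 3)) ;;
    pow_prog 16 (In (Cst 4) .- In (Cst 3)) ;;
    SetR 14 (Cst 64 .* Cst 64 .* Cst 64 .* Cst 4 .* Reg 15 .* Reg 15 .* Reg 15 .* Reg 15 .* Reg 13 .* Reg 16) ;;
    SetR 21 (Reg 14 .* Reg 14 .* Reg 14 .* Reg 14) ;;
    SetR 20 (Reg 21 .* Reg 21) ;;
    SetR 30 (Cst 7 .+ Cst 3 .* Reg 2) ;;
    SetR 31 (Reg 30 .+ Reg 32)"

definition rhs_prog :: com where
  "rhs_prog =
    For 4 (Reg 32) (SetA 5 (Reg 4) (In (Reg 30 .+ Reg 4))) ;;
    For 7 (Reg 2) (SetA 5 col_e (Arr 5 col_e .+ Reg 13 .* val_e .* In (Reg 31 .+ row_e)))"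

definition test_prog :: com where
  "test_prog = SetR 12 (Cst 1) ;;
    For 4 (Reg 11) (Cond (Reg 10 .mod Arr 6 (Reg 4)) Skip (SetR 12 (Cst 0)))"

text \<open>
  Raising each prime to the first power that is at least \<open>W\<close> makes \<open>d + 8\<close> moduli of word size suffice.
\<close>

definition power_prog :: com where
  "power_prog = SetR 8 (Reg 10) ;; While (Reg 14 .- Reg 8) (SetR 8 (Reg 8 .* Reg 10))"

definition primes_prog :: com where
  "primes_prog =
    SetR 11 (Cst 0) ;; SetR 10 (Cst 2) ;;
    While (Reg 3 .- Reg 11)
     (test_prog ;;
      Cond (Reg 12)
       (power_prog ;; SetA 6 (Reg 11) (Reg 10) ;; SetA 7 (Reg 11) (Reg 8) ;; SetR 11 (Reg 11 .+ Cst 1))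
       Skip ;;
      SetR 10 (Reg 10 .+ Cst 1))"

text \<open>The extended Euclidean algorithm with the cofactor of register 22 only, reduced modulo
  register 8 so that it keeps word size.\<close>

definition inverse_prog :: com where
  "inverse_prog =
    SetR 23 (Reg 8) ;; SetR 24 (Reg 22) ;; SetR 25 (Cst 0) ;; SetR 26 (Cst 1) ;;
    While (Reg 24)
     (SetR 27 (Reg 23 .div Reg 24) ;;
      SetR 28 (Reg 23 .- Reg 27 .* Reg 24) ;; SetR 23 (Reg 24) ;; SetR 24 (Reg 28) ;;
      SetR 28 ((Reg 25 .- Reg 27 .* Reg 26) .mod Reg 8) ;; SetR 25 (Reg 26) ;; SetR 26 (Reg 28))"

lemma written_progs3 [simp]:
  "regs_written (pow_prog r e) = {r, 28}" "arrs_written (pow_prog r e) = {}"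
  "regs_written rhs_prog = {4, 7}" "arrs_written rhs_prog = {5}"
  "regs_written test_prog = {4, 12}" "arrs_written test_prog = {}"
  "regs_written power_prog = {8}" "arrs_written power_prog = {}"
  "regs_written primes_prog = {4, 8, 10, 11, 12}" "arrs_written primes_prog = {6, 7}"
  "regs_written inverse_prog = {23, 24, 25, 26, 27, 28}" "arrs_written inverse_prog = {}"
  by (auto simp: pow_prog_def rhs_prog_def test_prog_def power_prog_def primes_prog_def inverse_prog_def)

text \<open>The decreasing quantity is a ghost variable: it may merely bound the state, for instance
  by a power of two above a product, without being a function of it.\<close>

lemma (in machine) ok_While_ghost:
  assumes "I k \<sigma>" and safe: "\<And>k \<sigma>'. I k \<sigma>' \<Longrightarrow> safe \<sigma>' e"
    and body: "\<And>k \<sigma>'. I k \<sigma>' \<Longrightarrow> eval inp \<sigma>' e > 0 \<Longrightarrow> \<exists>k'<k. ok c \<sigma>' t (I k')"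
    and t': "k * (t + 1) + 1 \<le> t'"
  shows "ok (While e c) \<sigma> t' (\<lambda>\<sigma>'. (\<exists>k'. I k' \<sigma>') \<and> \<not> eval inp \<sigma>' e > 0)"
proof -
  have "ok (While e c) \<sigma> (k * (t + 1) + 1) (\<lambda>\<sigma>'. (\<exists>k'. I k' \<sigma>') \<and> \<not> eval inp \<sigma>' e > 0)"
    using assms(1)
  proof (induction k arbitrary: \<sigma> rule: less_induct)
    case (less k)
    show ?case
    proof (cases "eval inp \<sigma> e > 0")
      case False
      have "exec (While e c) \<sigma> 1 \<sigma>" by (rule exec.WhileF[OF safe[OF less.prems] False])
      moreover have "1 \<le> k * (t + 1) + 1" by simp
      ultimately show ?thesis unfolding ok_def using less.prems False by blast
    next
      case True
      from body[OF less.prems True] obtain k' \<sigma>' u where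
        1: "k' < k" "exec c \<sigma> u \<sigma>'" "u \<le> t" "I k' \<sigma>'" unfolding ok_def by blast
      from less.IH[OF 1(1,4)] obtain \<sigma>'' v where
        2: "exec (While e c) \<sigma>' v \<sigma>''" "v \<le> k' * (t + 1) + 1" "\<exists>k'. I k' \<sigma>''" "\<not> eval inp \<sigma>'' e > 0"
        unfolding ok_def by blast
      have "Suc (u + v) \<le> Suc k' * (t + 1) + 1" using 1(3) 2(2) by simp
      also have "\<dots> \<le> k * (t + 1) + 1" using 1(1) by (intro add_mono mult_right_mono) auto
      finally show ?thesis unfolding ok_def
        using exec.WhileT[OF safe[OF less.prems] True 1(2) 2(1)] 2(3,4) by blast
    qed
  qed
  then show ?thesis by (rule ok_mono) (use t' in auto)
qed

section \<open>Correctness of the parameters, the moduli and modular inverses\<close>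

context lp
begin

definition "LW = floorlog 2 (nat W)"

lemma W_LW: "W < 2 ^ LW"
proof -
  have "nat W < 2 ^ LW" unfolding LW_def using floorlog_bounds[of "nat W" 2] W1 by simp
  then show ?thesis using W1 by (simp add: nat_less_iff)
qed

lemma LW_ge: "1 \<le> LW" using W_LW W1 by (cases LW) auto

lemma pow_le_LW: "2 ^ e \<le> W \<Longrightarrow> e \<le> LW"
proof -
  assume "2 ^ e \<le> W"
  then have "(2::int) ^ e < 2 ^ LW" using W_LW by linarith
  then show ?thesis by simp
qed

text \<open>Repeated doubling suffices, since \<open>2 ^ nat x \<le> W\<close> bounds the number of
  rounds by the word length. A negative exponent skips the loop and leaves 1, in agreement with
  \<open>nat x\<close>.\<close>

lemma pow_ok:
  assumes e: "safe \<sigma> e" "eval inp \<sigma> e = x" "\<bar>x\<bar> \<le> 3 * W" "2 ^ nat x \<le> W" and r: "r \<noteq> 28"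
  shows "ok (pow_prog r e) \<sigma> (3 * LW + 3) (\<lambda>\<sigma>'. fst \<sigma>' r = 2 ^ nat x \<and> same {r, 28} {} \<sigma> \<sigma>')"
proof -
  let ?I = "\<lambda>k \<sigma>'. k = nat (fst \<sigma>' 28) \<and> fst \<sigma>' r * 2 ^ k = 2 ^ nat x \<and> 1 \<le> fst \<sigma>' r \<and> \<bar>fst \<sigma>' 28\<bar> \<le> 3 * W"
  have V3: "3 * W < V" "2 * W \<le> V"
  proof -
    have "W * 3 < W * W ^ 15"
    proof (rule mult_strict_left_mono)
      have "3 < W ^ 1" using W_ge(4) by simp
      also have "W ^ 1 \<le> W ^ 15" by (rule Wpow_mono) simp
      finally show "3 < W ^ 15" .
    qed (use W1 in simp)
    then show "3 * W < V" by (simp add: V_def power_Suc[symmetric])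
    then show "2 * W \<le> V" using W1 by simp
  qed
  let ?s = "((fst \<sigma>)(28 := x, r := 1), snd \<sigma>)"
  let ?w = "While (Reg 28) (SetR r (Cst 2 .* Reg r) ;; SetR 28 (Reg 28 .- Cst 1))"
  have "ok ?w ?s (3 * LW + 1) (\<lambda>\<sigma>'. (\<exists>k'. ?I k' \<sigma>') \<and> \<not> eval inp \<sigma>' (Reg 28) > 0)"
  proof (rule ok_While_ghost[where I = ?I and k = "nat x" and t = 2])
    show "?I (nat x) ?s" using r e by simp
    show "nat x * (2 + 1) + 1 \<le> 3 * LW + 1" using pow_le_LW[OF e(4)] by simp
    fix k and \<sigma>' :: st assume I: "?I k \<sigma>'" and g: "eval inp \<sigma>' (Reg 28) > 0"
    then have k: "0 < k" "fst \<sigma>' 28 = int k" by auto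
    then obtain k' where k': "k = Suc k'" by (cases k) auto
    have "2 * fst \<sigma>' r * 2 ^ k' = 2 ^ nat x" using I k' by simp
    moreover have "2 * fst \<sigma>' r * 1 \<le> 2 * fst \<sigma>' r * 2 ^ k'" using I by (intro mult_left_mono) auto
    ultimately have b: "2 * fst \<sigma>' r \<le> W" "2 * fst \<sigma>' r * 2 ^ k' = 2 ^ nat x" using e(4) by linarith+
    show "\<exists>k'<k. ok (SetR r (Cst 2 .* Reg r) ;; SetR 28 (Reg 28 .- Cst 1)) \<sigma>' 2 (?I k')"
      using b I k k' r V3 W1 by (intro exI[of _ k']) auto
  qed simp
  then have "ok ?w ?s (3 * LW + 1) (\<lambda>\<sigma>'. fst \<sigma>' r = 2 ^ nat x \<and> same {r, 28} {} ?s \<sigma>')"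
    by (rule ok_mono[OF ok_frame]) (auto simp: same_def)
  then have "ok ?w ?s (3 * LW + 1) (\<lambda>\<sigma>'. fst \<sigma>' r = 2 ^ nat x \<and> same {r, 28} {} \<sigma> \<sigma>')"
    by (rule ok_mono) (auto simp: same_def)
  then show ?thesis unfolding pow_prog_def using e r by simp
qed

definition env :: "st \<Rightarrow> bool" where
  "env \<sigma> \<longleftrightarrow> regs0 \<sigma> \<and> fst \<sigma> 3 = int d + 8 \<and> fst \<sigma> 13 = T \<and> fst \<sigma> 14 = W \<and>
     fst \<sigma> 20 = W ^ 8 \<and> fst \<sigma> 21 = W ^ 4 \<and> fst \<sigma> 30 = 7 + 3 * int nz \<and> fst \<sigma> 31 = 7 + 3 * int nz + int d"

lemma env_same: "env \<sigma> \<Longrightarrow> same R A \<sigma> \<sigma>' \<Longrightarrow> {0, 2, 3, 13, 14, 20, 21, 30, 31, 32} \<inter> R = {} \<Longrightarrow> env \<sigma>'"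
  by (auto simp: env_def regs0_def same_def)

lemma T_le: "T \<le> W" and X_le: "X \<le> W" and TX_le: "2 ^ 20 * (sg ^ 4 * T) \<le> W"
proof -
  have s4: "1 \<le> sg ^ 4" using sg_ge by simp
  have a: "1 \<le> 2 ^ 20 * sg ^ 4" using s4 by simp
  have "1 * T * 1 \<le> (2 ^ 20 * sg ^ 4) * T * X" using a T_ge X_ge by (intro mult_mono) auto
  then show "T \<le> W" by (simp add: W_def)
  have "1 * 1 * X \<le> (2 ^ 20 * sg ^ 4) * T * X" using a T_ge X_ge by (intro mult_mono) auto
  then show "X \<le> W" by (simp add: W_def)
  have "2 ^ 20 * (sg ^ 4 * T) * 1 \<le> 2 ^ 20 * (sg ^ 4 * T) * X" using s4 T_ge X_ge by (intro mult_left_mono) auto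
  then show "2 ^ 20 * (sg ^ 4 * T) \<le> W" by (simp add: W_def mult.assoc)
qed

lemma V_W: "W \<le> V" "W ^ 2 \<le> V" "W ^ 3 \<le> V" "W ^ 4 \<le> V" "W ^ 8 \<le> V" "0 \<le> W" "0 \<le> V"
  using Wpow_mono[of 1 16] Wpow_mono[of 2 16] Wpow_mono[of 3 16] Wpow_mono[of 4 16] Wpow_mono[of 8 16] W1
  by (auto simp: V_def)

lemma init_ok: "ok init_prog (\<lambda>_. 0, \<lambda>_ _. 0) (20 * nz + 10 * LW + 30) (\<lambda>\<sigma>'. env \<sigma>' \<and> snd \<sigma>' = (\<lambda>_ _. 0))"
proof -
  let ?c = "SetR 15 (Reg 15 .+ In (Cst 7 .+ Reg 4) .* In (Cst 7 .+ Reg 4))"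
  let ?s0 = "((\<lambda>_. 0)(0 := int n, 32 := int d, 2 := int nz, 3 := int d + 8, 15 := 1), \<lambda>_ _. 0) :: st"
  let ?N = "3 * nz + d + n"
  let ?p = "\<lambda>k. 1 + (\<Sum>i<k. (read_input inp (7 + i))\<^sup>2)"
  let ?I = "\<lambda>k \<sigma>'. fst \<sigma>' 15 = ?p k"
  have VS: "int n \<le> V" "int d + 8 \<le> V" "int nz \<le> V" "3 * int nz + int d + int n < V" "3 * int nz + int d \<le> V"
     "3 * int nz \<le> V" "7 + 3 * int nz \<le> V" "7 + 3 * int nz + int d \<le> V"
    using nat_bounds dims by auto
  have nN: "nat (3 * int nz + int d + int n) = ?N" by simp
  have pk: "?p k \<le> sg" if "k \<le> ?N" for k
    unfolding sg_def using that by (intro add_mono sum_mono2) auto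
  have 1: "ok (For 4 (Cst 3 .* Reg 2 .+ Reg 32 .+ Reg 0) ?c) ?s0 (15 * nz + 2) (\<lambda>\<sigma>'. fst \<sigma>' 15 = sg \<and> same {4, 15} {} ?s0 \<sigma>')"
  proof (rule ok_mono[OF ok_For[where I = ?I and L = "int ?N" and t = 1]])
    fix k and \<sigma>' :: st assume k: "k < nat (int ?N)" "fst \<sigma>' 4 = int k" and I: "?I k \<sigma>'"
    have kN: "k < ?N" using k by linarith
    have b: "\<bar>read_input inp (7 + k)\<bar> \<le> W" using input_le[OF kN] sgW by linarith
    have b2: "(read_input inp (7 + k))\<^sup>2 \<le> ?p (Suc k)" "0 \<le> (read_input inp (7 + k))\<^sup>2" by (auto simp: sum_nonneg)
    have b3: "?p (Suc k) \<le> W" using pk[of "Suc k"] kN sgW by simp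
    have b4: "0 \<le> ?p k" by (simp add: sum_nonneg)
    have b5: "?p (Suc k) = ?p k + (read_input inp (7 + k))\<^sup>2" by simp
    have i: "nat (7 + int k) = 7 + k" "7 + int k \<le> V" using kN nat_bounds dims by auto
    have c1: "\<bar>read_input inp (7 + k) * read_input inp (7 + k)\<bar> \<le> V" "\<bar>read_input inp (7 + k)\<bar> \<le> V"
      using b b2 b3 V_W unfolding power2_eq_square by linarith+
    have c3: "read_input inp (7 + k) * read_input inp (7 + k) \<le> V" using c1(1) by linarith
    have c2: "\<bar>?p k + read_input inp (7 + k) * read_input inp (7 + k)\<bar> \<le> V"
      using b4 b5 b3 b2 V_W unfolding power2_eq_square by linarith
    show "ok ?c \<sigma>' 1 (?I (Suc k))"
      using c2 by (simp add: I k(2) i c1 c3 power2_eq_square)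
  qed (use VS dims in \<open>auto simp: same_def sg_def nN\<close>)
  have nz2: "\<bar>2 * eR - eE\<bar> \<le> 3 * W" "\<bar>eK - eE\<bar> \<le> 3 * W" using exps by linarith+
  have "3 * W \<le> W * W" using W_ge(4) by (intro mult_right_mono) auto
  then have V3: "3 * W \<le> V" using V_W(2) by (simp add: power2_eq_square)
  have 2: "ok (pow_prog 13 (Cst 2 .* In (Cst 6) .- In (Cst 3))) \<sigma>1 (3 * LW + 3)
     (\<lambda>\<sigma>'. fst \<sigma>' 13 = T \<and> same {13, 28} {} \<sigma>1 \<sigma>')" for \<sigma>1
    unfolding T_def by (rule pow_ok) (use nz2 T_le exps V3 in \<open>auto simp: inp_params T_def\<close>)
  have 3: "ok (pow_prog 16 (In (Cst 4) .- In (Cst 3))) \<sigma>1 (3 * LW + 3)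
     (\<lambda>\<sigma>'. fst \<sigma>' 16 = X \<and> same {16, 28} {} \<sigma>1 \<sigma>')" for \<sigma>1
    unfolding X_def by (rule pow_ok) (use nz2 X_le exps V3 in \<open>auto simp: inp_params X_def\<close>)
  let ?e = "SetR 14 (Cst 64 .* Cst 64 .* Cst 64 .* Cst 4 .* Reg 15 .* Reg 15 .* Reg 15 .* Reg 15 .* Reg 13 .* Reg 16) ;;
    SetR 21 (Reg 14 .* Reg 14 .* Reg 14 .* Reg 14) ;;
    SetR 20 (Reg 21 .* Reg 21) ;;
    SetR 30 (Cst 7 .+ Cst 3 .* Reg 2) ;;
    SetR 31 (Reg 30 .+ Reg 32)"
  have up: "0 \<le> x \<Longrightarrow> x \<le> x * y" if "1 \<le> y" for x y :: int using that mult_left_mono[of 1 y x] by simp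
  \<comment> \<open>Partial products of the expression for register 14. All factors are at least 1,
    so they increase towards \<open>W\<close> and every intermediate value is safe.\<close>
  define c1 c2 c3 c4 c5 where "c1 = 1048576 * sg" "c2 = c1 * sg" "c3 = c2 * sg" "c4 = c3 * sg" "c5 = c4 * T"
  have c6: "c5 * X = W" by (simp add: c1_c2_c3_c4_c5_def W_def power4_eq_xxxx mult_ac)
  have cc: "0 \<le> c1" "c1 \<le> c2" "c2 \<le> c3" "c3 \<le> c4" "c4 \<le> c5" "c5 \<le> W"
  proof -
    show "0 \<le> c1" using sg_ge by (simp add: c1_c2_c3_c4_c5_def)
    then show 2: "c1 \<le> c2" using up[OF sg_ge] by (simp add: c1_c2_c3_c4_c5_def(2))
    then show 3: "c2 \<le> c3" using up[OF sg_ge, of c2] \<open>0 \<le> c1\<close> by (simp add: c1_c2_c3_c4_c5_def(3))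
    then show 4: "c3 \<le> c4" using up[OF sg_ge, of c3] \<open>0 \<le> c1\<close> 2 by (simp add: c1_c2_c3_c4_c5_def(4))
    then show 5: "c4 \<le> c5" using up[OF T_ge, of c4] \<open>0 \<le> c1\<close> 2 3 by (simp add: c1_c2_c3_c4_c5_def(5))
    then show "c5 \<le> W" using up[OF X_ge, of c5] \<open>0 \<le> c1\<close> 2 3 4 unfolding c6 by simp
  qed
  have p8: "W ^ 4 * W ^ 4 = W ^ 8" by (simp flip: power_add)
  have ppow: "W * W = W ^ 2" "W ^ 2 * W = W ^ 3" "W ^ 3 * W = W ^ 4" by (simp_all add: power2_eq_square power3_eq_cube power4_eq_xxxx)
  have 4: "ok ?e \<sigma>2 5 (\<lambda>\<sigma>'. env \<sigma>' \<and> snd \<sigma>' = (\<lambda>_ _. 0))"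
    if s: "regs0 \<sigma>2" "fst \<sigma>2 3 = int d + 8" "fst \<sigma>2 13 = T" "fst \<sigma>2 15 = sg" "fst \<sigma>2 16 = X" "snd \<sigma>2 = (\<lambda>_ _. 0)" for \<sigma>2
  proof -
    have r: "fst \<sigma>2 0 = int n" "fst \<sigma>2 2 = int nz" "fst \<sigma>2 32 = int d" using s by (auto simp: regs0_def)
    have n: "64 \<le> V" "4096 \<le> V" "262144 \<le> V" "1048576 \<le> V" using W_ge(4) V_W by auto
    have ab: "\<bar>c1\<bar> \<le> V" "\<bar>c2\<bar> \<le> V" "\<bar>c3\<bar> \<le> V" "\<bar>c4\<bar> \<le> V" "\<bar>c5\<bar> \<le> V" "\<bar>W\<bar> \<le> V" "\<bar>W ^ 2\<bar> \<le> V" "\<bar>W ^ 3\<bar> \<le> V"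
      "\<bar>W ^ 4\<bar> \<le> V" "\<bar>W ^ 8\<bar> \<le> V"
      using cc V_W W1 by auto
    show ?thesis
      by (simp add: s r n ab c1_c2_c3_c4_c5_def[symmetric] c6 ppow p8 VS V_W env_def regs0_def)
  qed
  have inp': "\<bar>read_input inp 0\<bar> \<le> V" using inp0 VS by simp
  have "ok (For 4 (Cst 3 .* Reg 2 .+ Reg 32 .+ Reg 0) ?c ;; pow_prog 13 (Cst 2 .* In (Cst 6) .- In (Cst 3)) ;;
     pow_prog 16 (In (Cst 4) .- In (Cst 3)) ;; ?e) ?s0 (15 * nz + 2 + (6 * LW + 11)) (\<lambda>\<sigma>'. env \<sigma>' \<and> snd \<sigma>' = (\<lambda>_ _. 0))"
  proof (rule ok_seqI[OF 1])
    fix \<sigma>1 assume a: "fst \<sigma>1 15 = sg \<and> same {4, 15} {} ?s0 \<sigma>1"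
    show "ok (pow_prog 13 (Cst 2 .* In (Cst 6) .- In (Cst 3)) ;;
     pow_prog 16 (In (Cst 4) .- In (Cst 3)) ;; ?e) \<sigma>1 (6 * LW + 11) (\<lambda>\<sigma>'. env \<sigma>' \<and> snd \<sigma>' = (\<lambda>_ _. 0))"
    proof (rule ok_seqI[OF 2])
      fix \<sigma>2 assume b: "fst \<sigma>2 13 = T \<and> same {13, 28} {} \<sigma>1 \<sigma>2"
      show "ok (pow_prog 16 (In (Cst 4) .- In (Cst 3)) ;; ?e) \<sigma>2 (3 * LW + 8) (\<lambda>\<sigma>'. env \<sigma>' \<and> snd \<sigma>' = (\<lambda>_ _. 0))"
      proof (rule ok_seqI[OF 3])
        fix \<sigma>3 assume c: "fst \<sigma>3 16 = X \<and> same {16, 28} {} \<sigma>2 \<sigma>3"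
        have sn: "snd \<sigma>3 = (\<lambda>_ _. 0)" using a b c by (auto simp: same_def fun_eq_iff)
        have rg: "regs0 \<sigma>3" "fst \<sigma>3 3 = int d + 8" "fst \<sigma>3 13 = T" "fst \<sigma>3 15 = sg" "fst \<sigma>3 16 = X"
          using a b c by (auto simp: same_def regs0_def)
        show "ok ?e \<sigma>3 5 (\<lambda>\<sigma>'. env \<sigma>' \<and> snd \<sigma>' = (\<lambda>_ _. 0))"
          by (rule 4) (use sn rg in auto)
      qed simp
    qed simp
  qed simp
  then have f: "ok (For 4 (Cst 3 .* Reg 2 .+ Reg 32 .+ Reg 0) ?c ;; pow_prog 13 (Cst 2 .* In (Cst 6) .- In (Cst 3)) ;;
     pow_prog 16 (In (Cst 4) .- In (Cst 3)) ;; ?e) ?s0 (20 * nz + 10 * LW + 30 - 1 - 1 - 1 - 1 - 1) (\<lambda>\<sigma>'. env \<sigma>' \<and> snd \<sigma>' = (\<lambda>_ _. 0))"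
    by (rule ok_mono) auto
  show ?thesis unfolding init_prog_def
    unfolding ok_Seq_SetR using f inp0 inp_params VS by simp
qed

definition "gv j = bv j + T * (\<Sum>e<nz. if co e = j then va e * cv (ro e) else 0)"

lemma rhs_ok:
  assumes "env \<sigma>"
  shows "\<forall>j<d. \<bar>gv j\<bar> \<le> W"
    "ok rhs_prog \<sigma> (10 * nz) (\<lambda>\<sigma>'. (\<forall>j<d. snd \<sigma>' 5 j = gv j) \<and> same {4, 7} {5} \<sigma> \<sigma>')"
proof -
  define gk where "gk k j = bv j + T * (\<Sum>e<k. if co e = j then va e * cv (ro e) else 0)" for k j
  have r: "fst \<sigma> 32 = int d" "fst \<sigma> 2 = int nz" "fst \<sigma> 30 = 7 + 3 * int nz" "fst \<sigma> 31 = 7 + 3 * int nz + int d" "fst \<sigma> 13 = T"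
    using assms by (auto simp: env_def regs0_def)
  have tb: "\<bar>va e * cv (ro e)\<bar> \<le> sg * sg" if "e < nz" for e
    unfolding abs_mult using va_le[OF that] cv_le[OF ro[OF that]] sg_ge by (intro mult_mono) auto
  \<comment> \<open>Every partial sum has to stay in range, not only the final value.\<close>
  have gb: "\<bar>gk k j\<bar> \<le> W" if "k \<le> nz" "j < d" for k j
  proof -
    have "\<bar>\<Sum>e<k. if co e = j then va e * cv (ro e) else 0\<bar> \<le> (\<Sum>e<k. sg * sg)"
      using that tb sg_ge by (intro order_trans[OF sum_abs] sum_mono) auto
    also have "\<dots> = int k * (sg * sg)" by simp
    also have "\<dots> \<le> sg * (sg * sg)" using that nz_sg sg_ge by (intro mult_right_mono) auto
    finally have s: "\<bar>\<Sum>e<k. if co e = j then va e * cv (ro e) else 0\<bar> \<le> sg * (sg * sg)" .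
    have "\<bar>T * (\<Sum>e<k. if co e = j then va e * cv (ro e) else 0)\<bar> \<le> T * (sg * (sg * sg))"
      unfolding abs_mult using s T_ge by (intro mult_mono) auto
    also have "\<dots> \<le> T * (sg * (sg * (sg * sg)))"
      using T_ge sg_ge by (intro mult_left_mono) (auto simp: mult_le_cancel_left1)
    also have "\<dots> = sg ^ 4 * T" by (simp add: power4_eq_xxxx mult_ac)
    finally have 1: "\<bar>T * (\<Sum>e<k. if co e = j then va e * cv (ro e) else 0)\<bar> \<le> sg ^ 4 * T" .
    have "sg ^ 1 \<le> sg ^ 4" using sg_ge by (intro power_increasing) auto
    moreover have "sg ^ 4 * 1 \<le> sg ^ 4 * T" using sg_ge T_ge by (intro mult_left_mono) auto
    ultimately have "\<bar>bv j\<bar> \<le> sg ^ 4 * T" using bv_le[OF that(2)] by simp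
    then have "\<bar>gk k j\<bar> \<le> 2 * (sg ^ 4 * T)" using 1 unfolding gk_def by linarith
    also have "\<dots> \<le> W" using TX_le \<open>\<bar>bv j\<bar> \<le> sg ^ 4 * T\<close> by simp
    finally show ?thesis .
  qed
  have gkn: "gk nz = gv" by (simp add: gk_def gv_def fun_eq_iff)
  let ?c1 = "SetA 5 (Reg 4) (In (Reg 30 .+ Reg 4))"
  let ?c2 = "SetA 5 col_e (Arr 5 col_e .+ Reg 13 .* val_e .* In (Reg 31 .+ row_e))"
  have 1: "ok (For 4 (Reg 32) ?c1) \<sigma> (3 * d + 2) (\<lambda>\<sigma>'. (\<forall>j<d. snd \<sigma>' 5 j = bv j) \<and> same {4} {5} \<sigma> \<sigma>')"
  proof (rule ok_mono[OF ok_For[where I = "\<lambda>k \<sigma>'. \<forall>j<k. snd \<sigma>' 5 j = bv j" and L = "int d" and t = 1]])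
    fix k \<sigma>' assume k: "k < nat (int d)" "fst \<sigma>' 4 = int k" and I: "\<forall>j<k. snd \<sigma>' 5 j = bv j"
      and sm: "same (insert 4 (regs_written ?c1)) (arrs_written ?c1) \<sigma> \<sigma>'"
    have kd: "k < d" using k by simp
    have i: "nat (7 + 3 * int nz + int k) = 7 + 3 * nz + k" "7 + 3 * int nz + int k \<le> V" "k < S"
      using kd nat_bounds dims S_ge by auto
    have b: "\<bar>bv k\<bar> \<le> V" using bv_le[OF kd] sgW V_W by linarith
    have st: "fst \<sigma>' 30 = 7 + 3 * int nz" using sm r by (simp add: same_def)
    show "ok ?c1 \<sigma>' 1 (\<lambda>\<sigma>'. \<forall>j<Suc k. snd \<sigma>' 5 j = bv j)"
      using I by (simp add: st k(2) i inp_b[OF kd] b less_Suc_eq)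
  qed (use r nat_bounds dims in \<open>auto simp: same_def\<close>)
  have 2: "ok (For 7 (Reg 2) ?c2) \<sigma>1 (3 * nz + 2) (\<lambda>\<sigma>'. (\<forall>j<d. snd \<sigma>' 5 j = gv j) \<and> same {7} {5} \<sigma>1 \<sigma>')"
    if s: "\<forall>j<d. snd \<sigma>1 5 j = bv j" "same {4} {5} \<sigma> \<sigma>1" for \<sigma>1
  proof (rule ok_mono[OF ok_For[where I = "\<lambda>k \<sigma>'. \<forall>j<d. snd \<sigma>' 5 j = gk k j" and L = "int nz" and t = 1]])
    fix k \<sigma>' assume k: "k < nat (int nz)" "fst \<sigma>' 7 = int k" and I: "\<forall>j<d. snd \<sigma>' 5 j = gk k j"
      and sm: "same (insert 7 (regs_written ?c2)) (arrs_written ?c2) \<sigma>1 \<sigma>'"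
    have kn: "k < nz" using k by simp
    note en = entry[OF kn]
    have i: "nat (7 + 3 * int nz + int d + int (ro k)) = 7 + 3 * nz + d + ro k" "7 + 3 * int nz + int d + int (ro k) \<le> V"
      using en(5) nat_bounds dims by auto
    have st: "fst \<sigma>' 31 = 7 + 3 * int nz + int d" "fst \<sigma>' 13 = T" using sm s r by (auto simp: same_def)
    have cb: "\<bar>cv (ro k)\<bar> \<le> W ^ 1" "\<bar>T\<bar> \<le> W ^ 1" "\<bar>va k\<bar> \<le> W ^ 1" using cv_le[OF en(5)] sgW T_le T_ge va_W[OF kn] by auto
    have b1: "\<bar>T * va k\<bar> \<le> W ^ 2" by (rule bmult[OF cb(2,3)]) simp
    have b2: "\<bar>T * va k * cv (ro k)\<bar> \<le> W ^ 3" by (rule bmult[OF b1 cb(1)]) simp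
    have nw: "gk k (co k) + T * va k * cv (ro k) = gk (Suc k) (co k)" by (simp add: gk_def algebra_simps)
    have ot: "gk (Suc k) j = gk k j" if "j \<noteq> co k" for j using that by (simp add: gk_def)
    have bb: "\<bar>T * va k\<bar> \<le> V" "\<bar>T * va k * cv (ro k)\<bar> \<le> V" "\<bar>gk (Suc k) (co k)\<bar> \<le> V" "\<bar>cv (ro k)\<bar> \<le> V"
      using bV[OF b1] bV[OF b2] bV[OF cb(1)] gb[of "Suc k" "co k"] kn en(6) V_W by auto
    show "ok ?c2 \<sigma>' 1 (\<lambda>\<sigma>'. \<forall>j<d. snd \<sigma>' 5 j = gk (Suc k) j)"
      using I by (simp add: en st k(2) i inp_c[OF en(5)] bb nw ot)
  qed (use s r gkn nat_bounds dims in \<open>auto simp: same_def gk_def[of 0]\<close>)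
  show "ok rhs_prog \<sigma> (10 * nz) (\<lambda>\<sigma>'. (\<forall>j<d. snd \<sigma>' 5 j = gv j) \<and> same {4, 7} {5} \<sigma> \<sigma>')"
    unfolding rhs_prog_def
  proof (rule ok_seqI[OF 1])
    fix \<sigma>1 assume a: "(\<forall>j<d. snd \<sigma>1 5 j = bv j) \<and> same {4} {5} \<sigma> \<sigma>1"
    show "ok (For 7 (Reg 2) ?c2) \<sigma>1 (3 * nz + 2) (\<lambda>\<sigma>'. (\<forall>j<d. snd \<sigma>' 5 j = gv j) \<and> same {4, 7} {5} \<sigma> \<sigma>')"
      by (rule ok_mono[OF 2]) (use a in \<open>auto simp: same_def\<close>)
  qed (use dims in simp)
  show "\<forall>j<d. \<bar>gv j\<bar> \<le> W" using gb[of nz] gkn by auto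
qed

text \<open>The invariant keeps two consecutive remainders with their cofactors of \<open>a\<close>.
  The product of the remainders starts below \<open>2 ^ (4 * LW)\<close> and at least halves in each
  round. At the end the smaller one is 0, and since their gcd is 1 the larger one is 1.\<close>

lemma inverse_ok:
  assumes m: "modulus \<sigma> m" and a: "fst \<sigma> 22 = a" "0 \<le> a" "a < m" "coprime a m"
  shows "ok inverse_prog \<sigma> (40 * LW) (\<lambda>\<sigma>'. [fst \<sigma>' 25 * a = 1] (mod m) \<and> \<bar>fst \<sigma>' 25\<bar> \<le> W ^ 2 \<and>
     same {23, 24, 25, 26, 27, 28} {} \<sigma> \<sigma>')"
proof -
  have mm: "0 < m" "m \<le> W ^ 2" "fst \<sigma> 8 = m" using m by (auto simp: modulus_def)
  define I where "I k \<sigma>' \<longleftrightarrow> (let r0 = fst \<sigma>' 23; r1 = fst \<sigma>' 24; u0 = fst \<sigma>' 25; u1 = fst \<sigma>' 26 in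
     0 \<le> r1 \<and> r1 < r0 \<and> r0 \<le> m \<and> r0 * r1 < 2 ^ k \<and> gcd r0 r1 = 1 \<and>
     [u0 * a = r0] (mod m) \<and> [u1 * a = r1] (mod m) \<and> \<bar>u0\<bar> \<le> W ^ 2 \<and> \<bar>u1\<bar> \<le> W ^ 2) \<and> fst \<sigma>' 8 = m"
    for k :: nat and \<sigma>' :: st
  let ?b = "SetR 27 (Reg 23 .div Reg 24) ;;
      SetR 28 (Reg 23 .- Reg 27 .* Reg 24) ;; SetR 23 (Reg 24) ;; SetR 24 (Reg 28) ;;
      SetR 28 ((Reg 25 .- Reg 27 .* Reg 26) .mod Reg 8) ;; SetR 25 (Reg 26) ;; SetR 26 (Reg 28)"
  let ?s = "((fst \<sigma>)(23 := m, 24 := a, 25 := 0, 26 := 1), snd \<sigma>)"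
  have k0: "m * a < 2 ^ (4 * LW)"
  proof -
    have "m * a \<le> W ^ 2 * W ^ 2" using mm a by (intro mult_mono) auto
    also have "\<dots> = W ^ 4" by (simp flip: power_add)
    also have "\<dots> < (2 ^ LW) ^ 4" using W_LW W1 by (intro power_strict_mono) auto
    finally show ?thesis by (simp add: power_mult[symmetric] mult.commute)
  qed
  have "ok (While (Reg 24) ?b) ?s (32 * LW + 1) (\<lambda>\<sigma>'. (\<exists>k'. I k' \<sigma>') \<and> \<not> eval inp \<sigma>' (Reg 24) > 0)"
  proof (rule ok_While_ghost[where k = "4 * LW" and t = 7])
    show "I (4 * LW) ?s"
      using mm a k0 W1 by (auto simp: I_def cong_def coprime_iff_gcd_eq_1 gcd.commute)
    fix k \<sigma>' assume I: "I k \<sigma>'" and g: "eval inp \<sigma>' (Reg 24) > 0"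
    define r0 r1 u0 u1 where "r0 = fst \<sigma>' 23" "r1 = fst \<sigma>' 24" "u0 = fst \<sigma>' 25" "u1 = fst \<sigma>' 26"
    note rd = r0_r1_u0_u1_def
    have J: "0 < r1" "r1 < r0" "r0 \<le> m" "r0 * r1 < 2 ^ k" "gcd r0 r1 = 1" "[u0 * a = r0] (mod m)"
      "[u1 * a = r1] (mod m)" "\<bar>u0\<bar> \<le> W ^ 2" "\<bar>u1\<bar> \<le> W ^ 2" "fst \<sigma>' 8 = m"
      using I g by (auto simp: I_def rd Let_def)
    have "k \<noteq> 0" using J by (metis mult_pos_pos not_less_iff_gr_or_eq order.strict_trans power_0 zless_imp_add1_zle add_0 not_less)
    then obtain k' where k': "k = Suc k'" by (cases k) auto
    define q where "q = r0 div r1"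
    have md: "r0 - q * r1 = r0 mod r1" by (simp add: q_def minus_div_mult_eq_mod)
    have "2 * (r1 * (r0 mod r1)) < r0 * r1" using euclid_halves[of r1 r0] J by simp
    then have pr: "r1 * (r0 mod r1) < 2 ^ k'" using J(4) k' by simp
    have qb: "\<bar>q\<bar> \<le> W ^ 2" using abs_div_le[of r0 r1] J mm by (simp add: q_def)
    have qu: "\<bar>q * u1\<bar> \<le> W ^ 4" by (rule bmult[OF qb J(9)]) simp
    have u04: "\<bar>u0\<bar> \<le> W ^ 4" by (rule bup[OF J(8)]) simp
    have qr: "\<bar>q * r1\<bar> \<le> V" "\<bar>r0 mod r1\<bar> \<le> V"
    proof -
      have r: "0 \<le> r0 mod r1" "r0 mod r1 < r1" using J by auto
      have "q * r1 = r0 - r0 mod r1" using md by simp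
      then show "\<bar>q * r1\<bar> \<le> V" "\<bar>r0 mod r1\<bar> \<le> V" using r J mm V_W by linarith+
    qed
    have bb: "\<bar>q\<bar> \<le> V" "\<bar>q * u1\<bar> \<le> V" "\<bar>u0 - q * u1\<bar> \<le> V" "\<bar>(u0 - q * u1) mod m\<bar> \<le> V"
      using bV[OF qb] bV[OF qu] bV[OF badd(2)[OF u04 qu]] bV[OF bmod[OF mm(1,2)]] by simp_all
    have "[(u0 - q * u1) * a = r0 - q * r1] (mod m)"
      unfolding left_diff_distrib mult.assoc using J by (intro cong_diff cong_mult cong_refl)
    then have cg: "[(u0 - q * u1) mod m * a = r0 mod r1] (mod m)"
      unfolding md by (simp add: cong_def mod_mult_left_eq)
    have gc: "gcd r1 (r0 mod r1) = 1" using J(5) by (simp add: gcd_red_int[symmetric] gcd.commute)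
    have Q: "I k' ((fst \<sigma>')(27 := q, 28 := (u0 - q * u1) mod m, 23 := r1, 24 := r0 mod r1, 25 := u1, 26 := (u0 - q * u1) mod m), snd \<sigma>')"
      using J pr cg gc bmod[OF mm(1,2)] by (simp add: I_def)
    have "ok ?b \<sigma>' 7 (I k')"
      using Q by (simp add: rd[symmetric] q_def[symmetric] md qr bb J(10) I_def)
    then show "\<exists>k'<k. ok ?b \<sigma>' 7 (I k')" using k' by blast
  qed auto
  then have "ok (While (Reg 24) ?b) ?s (32 * LW + 1) (\<lambda>\<sigma>'. [fst \<sigma>' 25 * a = 1] (mod m) \<and> \<bar>fst \<sigma>' 25\<bar> \<le> W ^ 2)"
  proof (rule ok_mono)
    fix \<sigma>' assume "(\<exists>k'. I k' \<sigma>') \<and> \<not> eval inp \<sigma>' (Reg 24) > 0"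
    then obtain k where I: "I k \<sigma>'" and "fst \<sigma>' 24 \<le> 0" by auto
    then have "fst \<sigma>' 24 = 0" by (auto simp: I_def Let_def)
    then show "[fst \<sigma>' 25 * a = 1] (mod m) \<and> \<bar>fst \<sigma>' 25\<bar> \<le> W ^ 2" using I by (auto simp: I_def Let_def)
  qed simp
  from ok_frame[OF this] have f: "32 * LW + 1 \<le> t \<Longrightarrow> ok (While (Reg 24) ?b) ?s t (\<lambda>\<sigma>'. [fst \<sigma>' 25 * a = 1] (mod m) \<and> \<bar>fst \<sigma>' 25\<bar> \<le> W ^ 2 \<and>
     same {23, 24, 25, 26, 27, 28} {} \<sigma> \<sigma>')" for t
    by (rule ok_mono) (auto simp: same_def)
  show ?thesis unfolding inverse_prog_def using LW_ge by (auto simp: mm a(1) intro!: f)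
qed

text \<open>As \<open>D \<le> W ^ d\<close>, already \<open>d + 2\<close> moduli of size at least
  \<open>W\<close> have a product of at least \<open>D * W ^ 2\<close>, which is what the centered
  fractions require.\<close>

definition "K = d + 8"

lemma K_le: "K \<le> 9 * d" "int K + 1 \<le> W" "K < S" "int K + 1 < V"
  using dims nat_bounds S_ge by (auto simp: K_def)

definition prime_power_of :: "nat \<Rightarrow> int \<Rightarrow> bool" where
  "prime_power_of p m \<longleftrightarrow> (\<exists>e. m = int p ^ e) \<and> W \<le> m \<and> m < W * int p"

text \<open>By \<open>plist_many\<close> the candidates up to this bound provide enough primes. The
  factor 4 turns \<open>m < W * p\<close> into \<open>4 * m \<le> W ^ 2\<close> for the
  moduli.\<close>

lemma cand_le: "4 * int (16 * K\<^sup>2 + 2) \<le> W"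
proof -
  have "int K \<le> 9 * int d" using K_le(1) by linarith
  then have "(int K)\<^sup>2 \<le> (9 * int d)\<^sup>2" by (intro power_mono) auto
  also have "\<dots> = 81 * (int d)\<^sup>2" by (simp add: power_mult_distrib)
  also have "(int d)\<^sup>2 \<le> sg\<^sup>2" using nz_sg dims by (intro power_mono) auto
  also have "sg\<^sup>2 \<le> sg ^ 4" using sg_ge by (intro power_increasing) auto
  finally have "(int K)\<^sup>2 \<le> 81 * sg ^ 4" by simp
  moreover have "1 \<le> sg ^ 4" using sg_ge by simp
  ultimately have "4 * (16 * (int K)\<^sup>2 + 2) \<le> 2 ^ 20 * sg ^ 4" by simp
  then show ?thesis using W_ge(1) by simp
qed

lemma test_ok:
  assumes e: "env \<sigma>" and p: "fst \<sigma> 10 = int p" "2 \<le> p" "int p \<le> W" and c: "fst \<sigma> 11 = int (length (plist p))"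
    "length (plist p) \<le> K" and pr: "\<And>l. l < length (plist p) \<Longrightarrow> snd \<sigma> 6 l = int (plist p ! l)"
  shows "ok test_prog \<sigma> (4 * K + 3) (\<lambda>\<sigma>'. fst \<sigma>' 12 = (if prime p then 1 else 0) \<and> same {4, 12} {} \<sigma> \<sigma>')"
proof -
  let ?b = "Cond (Reg 10 .mod Arr 6 (Reg 4)) Skip (SetR 12 (Cst 0))"
  let ?s = "((fst \<sigma>)(12 := 1), snd \<sigma>)"
  let ?I = "\<lambda>k \<sigma>'. fst \<sigma>' 12 = (if \<forall>l<k. \<not> plist p ! l dvd p then 1 else 0 :: int)"
  have "ok (For 4 (Reg 11) ?b) ?s (4 * K + 2) (\<lambda>\<sigma>'. ?I (nat (int (length (plist p)))) \<sigma>' \<and>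
     same (insert 4 (regs_written ?b)) (arrs_written ?b) ?s \<sigma>')"
  proof (rule ok_For[where t = 2])
    fix k \<sigma>' assume k: "k < nat (int (length (plist p)))" "fst \<sigma>' 4 = int k" and I: "?I k \<sigma>'"
      and sm: "same (insert 4 (regs_written ?b)) (arrs_written ?b) ?s \<sigma>'"
    have kl: "k < length (plist p)" "k < S" using k c(2) K_le by auto
    define q where "q = plist p ! k"
    have q: "0 < q" "q < p" using plist_nth[OF kl(1)] by (auto simp: q_def prime_gt_0_nat)
    have st: "fst \<sigma>' 10 = int p" "snd \<sigma>' 6 k = int q" using sm p pr[OF kl(1)] by (auto simp: same_def q_def)
    have md: "int p mod int q = int (p mod q)" by (simp add: zmod_int)
    have "p mod q < q" using q by simp
    then have b: "int (p mod q) \<le> V" using q p V_W by linarith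
    have e: "(\<forall>l<Suc k. \<not> plist p ! l dvd p) \<longleftrightarrow> (\<forall>l<k. \<not> plist p ! l dvd p) \<and> \<not> q dvd p"
      by (auto simp: less_Suc_eq q_def)
    show "ok ?b \<sigma>' 2 (?I (Suc k))"
      using I kl b unfolding e by (simp add: st k(2) md dvd_eq_mod_eq_0)
  qed (use c K_le in \<open>auto simp: same_def\<close>)
  then have "ok (For 4 (Reg 11) ?b) ?s (4 * K + 2) (\<lambda>\<sigma>'. fst \<sigma>' 12 = (if prime p then 1 else 0) \<and> same {4, 12} {} \<sigma> \<sigma>')"
    by (rule ok_mono) (use prime_iff_plist[OF p(2)] in \<open>auto simp: same_def\<close>)
  then show ?thesis unfolding test_prog_def by simp
qed

text \<open>The ghost \<open>k\<close> is a number of doublings that would still reach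
  \<open>W\<close>; multiplication by \<open>p\<close> at least doubles.\<close>

lemma power_ok:
  assumes e: "env \<sigma>" and p: "fst \<sigma> 10 = int p" "2 \<le> p" "int p \<le> W"
  shows "ok power_prog \<sigma> (2 * LW + 2) (\<lambda>\<sigma>'. prime_power_of p (fst \<sigma>' 8) \<and> same {8} {} \<sigma> \<sigma>')"
proof -
  let ?b = "SetR 8 (Reg 8 .* Reg 10)"
  let ?s = "((fst \<sigma>)(8 := int p), snd \<sigma>)"
  let ?I = "\<lambda>k \<sigma>'. (\<exists>e. fst \<sigma>' 8 = int p ^ e) \<and> 1 \<le> fst \<sigma>' 8 \<and> fst \<sigma>' 8 < W * int p \<and> W \<le> fst \<sigma>' 8 * 2 ^ k \<and>
     fst \<sigma>' 10 = int p \<and> fst \<sigma>' 14 = W"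
  have W14: "fst \<sigma> 14 = W" using e by (simp add: env_def)
  have WW: "W * int p \<le> W * W" using p W1 by (intro mult_left_mono) auto
  have WV: "W * W \<le> V" using V_W by (simp add: power2_eq_square)
  have "ok (While (Reg 14 .- Reg 8) ?b) ?s (2 * LW + 1) (\<lambda>\<sigma>'. (\<exists>k. ?I k \<sigma>') \<and> \<not> eval inp \<sigma>' (Reg 14 .- Reg 8) > 0)"
  proof (rule ok_While_ghost[where k = LW and t = 1])
    have "W * 2 \<le> W * int p" using p W1 by (intro mult_left_mono) auto
    moreover have "1 * 2 ^ LW \<le> int p * 2 ^ LW" using p by (intro mult_right_mono) auto
    ultimately have "int p < W * int p" "W \<le> int p * 2 ^ LW" using p W_LW W1 by linarith+
    then show "?I LW ?s" using p(2) by (simp add: W14 p(1)) (rule exI[of _ 1], simp)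
  next
    fix k and \<sigma>' :: st assume I: "?I k \<sigma>'"
    show "safe \<sigma>' (Reg 14 .- Reg 8)" using I WW WV V_W by auto
    assume g: "eval inp \<sigma>' (Reg 14 .- Reg 8) > 0"
    then have mW: "fst \<sigma>' 8 < W" using I by simp
    then have "k \<noteq> 0" using I by (intro notI) simp
    then obtain k' where k': "k = Suc k'" by (cases k) auto
    obtain e where ee: "fst \<sigma>' 8 = int p ^ e" using I by blast
    have "fst \<sigma>' 8 * 2 \<le> fst \<sigma>' 8 * int p" using I p by (intro mult_left_mono) auto
    then have "fst \<sigma>' 8 * 2 * 2 ^ k' \<le> fst \<sigma>' 8 * int p * 2 ^ k'" by (rule mult_right_mono) simp
    moreover have "W \<le> fst \<sigma>' 8 * 2 * 2 ^ k'" using I k' by (simp add: mult.assoc)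
    ultimately have 1: "W \<le> fst \<sigma>' 8 * int p * 2 ^ k'" by linarith
    have 2: "fst \<sigma>' 8 * int p < W * int p" using mW p by (intro mult_strict_right_mono) auto
    have 3: "1 * 1 \<le> fst \<sigma>' 8 * int p" using I p by (intro mult_mono) auto
    have 4: "\<exists>e. fst \<sigma>' 8 * int p = int p ^ e" by (rule exI[of _ "Suc e"]) (simp add: ee mult.commute)
    have "ok ?b \<sigma>' 1 (?I k')"
      using 1 2 3 4 I WW WV by auto
    then show "\<exists>k'<k. ok ?b \<sigma>' 1 (?I k')" using k' by blast
  qed simp
  from ok_frame[OF this] have "ok (While (Reg 14 .- Reg 8) ?b) ?s (2 * LW + 1) (\<lambda>\<sigma>'. prime_power_of p (fst \<sigma>' 8) \<and> same {8} {} \<sigma> \<sigma>')"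
    by (rule ok_mono) (auto simp: prime_power_of_def same_def)
  then show ?thesis unfolding power_prog_def using p by simp
qed

definition moduli :: "(nat \<Rightarrow> int) \<Rightarrow> bool" where
  "moduli ms \<longleftrightarrow> (\<forall>l<K. W \<le> ms l \<and> 4 * ms l \<le> W ^ 2) \<and>
     (\<forall>l<K. \<forall>j<K. l \<noteq> j \<longrightarrow> coprime (ms l) (ms j))"

lemma primes_ok:
  assumes e: "env \<sigma>"
  shows "ok primes_prog \<sigma> (16 * K\<^sup>2 * (4 * K + 2 * LW + 11) + 3) (\<lambda>\<sigma>'. moduli (snd \<sigma>' 7) \<and>
     same {4, 8, 10, 11, 12} {6, 7} \<sigma> \<sigma>')"
proof -
  let ?pp = "power_prog ;; SetA 6 (Reg 11) (Reg 10) ;; SetA 7 (Reg 11) (Reg 8) ;; SetR 11 (Reg 11 .+ Cst 1)"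
  let ?n = "SetR 10 (Reg 10 .+ Cst 1)"
  let ?b = "test_prog ;; Cond (Reg 12) ?pp Skip ;; ?n"
  let ?s = "((fst \<sigma>)(11 := 0, 10 := 2), snd \<sigma>)"
  let ?X = "16 * K\<^sup>2 + 2"
  define J where "J p \<sigma>' \<longleftrightarrow> length (plist p) \<le> K \<and> fst \<sigma>' 11 = int (length (plist p)) \<and>
     (\<forall>l<length (plist p). snd \<sigma>' 6 l = int (plist p ! l) \<and> prime_power_of (plist p ! l) (snd \<sigma>' 7 l))"
    for p and \<sigma>' :: st
  define I where "I k \<sigma>' \<longleftrightarrow> (\<exists>p. 2 \<le> p \<and> p + k = ?X \<and> fst \<sigma>' 10 = int p \<and> J p \<sigma>') \<and> env \<sigma>'" for k and \<sigma>' :: st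
  have 1: "ok (While (Reg 3 .- Reg 11) ?b) ?s (16 * K\<^sup>2 * (4 * K + 2 * LW + 11) + 1)
     (\<lambda>\<sigma>'. (\<exists>k. I k \<sigma>') \<and> \<not> eval inp \<sigma>' (Reg 3 .- Reg 11) > 0)"
  proof (rule ok_While_ghost[where k = "16 * K\<^sup>2" and t = "4 * K + 2 * LW + 10"])
    show "I (16 * K\<^sup>2) ?s" using e by (auto simp: I_def J_def plist_2 env_def regs0_def intro!: exI[of _ 2])
  next
    fix k \<sigma>' assume I: "I k \<sigma>'"
    then obtain p where p: "2 \<le> p" "p + k = ?X" "fst \<sigma>' 10 = int p" "J p \<sigma>'" and e': "env \<sigma>'" by (auto simp: I_def)
    have r3: "fst \<sigma>' 3 = int K" using e' by (simp add: env_def K_def)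
    show "safe \<sigma>' (Reg 3 .- Reg 11)" using p r3 K_le by (auto simp: J_def)
    assume g: "eval inp \<sigma>' (Reg 3 .- Reg 11) > 0"
    define c where "c = length (plist p)"
    have cK: "c < K" using g r3 p by (simp add: J_def c_def)
    \<comment> \<open>With no candidate left, \<open>plist_many\<close> would already have supplied
      \<open>K\<close> primes.\<close>
    have "k \<noteq> 0" using p(2) cK plist_many[of K] by (intro notI) (simp add: c_def)
    then obtain k' where k': "k = Suc k'" by (cases k) auto
    have pX: "p < ?X" using p(2) k' by simp
    define Y where "Y = int ?X"
    have "p + 1 \<le> ?X" using pX by linarith
    then have "int p + 1 \<le> Y" unfolding Y_def by (metis of_nat_1 of_nat_add of_nat_le_iff)
    moreover have "2 \<le> int p" "4 * Y \<le> W" using p(1) cand_le by (simp_all add: Y_def)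
    ultimately have pW: "int p \<le> W" "int p + 1 \<le> W" "4 * int p \<le> W" by linarith+
    have t: "ok test_prog \<sigma>' (4 * K + 3) (\<lambda>\<sigma>''. fst \<sigma>'' 12 = (if prime p then 1 else 0) \<and> same {4, 12} {} \<sigma>' \<sigma>'')"
      by (rule test_ok[OF e' p(3,1) pW(1)]) (use p(4) in \<open>auto simp: J_def\<close>)
    have "ok ?b \<sigma>' (4 * K + 2 * LW + 10) (I k')"
    proof (rule ok_seqI[OF t])
      fix \<sigma>1 assume a: "fst \<sigma>1 12 = (if prime p then 1 else 0) \<and> same {4, 12} {} \<sigma>' \<sigma>1"
      have e1: "env \<sigma>1" using env_same[OF e', of "{4, 12}" "{}"] a by simp
      have r1: "fst \<sigma>1 10 = int p" "fst \<sigma>1 11 = int c" "snd \<sigma>1 = snd \<sigma>'"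
        using a p by (auto simp: same_def J_def c_def)
      have pV: "int p + 1 \<le> V" "int c + 1 \<le> V" "c < S" using pW V_W cK K_le by auto
      show "ok (Cond (Reg 12) ?pp Skip ;; ?n) \<sigma>1 (2 * LW + 7) (I k')"
      proof (cases "prime p")
        case False
        have "I k' ((fst \<sigma>1)(10 := int p + 1), snd \<sigma>1)"
          using e1 p k' False r1 unfolding I_def
          by (auto simp: J_def c_def plist_Suc env_def regs0_def intro!: exI[of _ "Suc p"])
        then show ?thesis using a False pV r1 by simp
      next
        case True
        have pw: "ok power_prog \<sigma>1 (2 * LW + 2) (\<lambda>\<sigma>'. prime_power_of p (fst \<sigma>' 8) \<and> same {8} {} \<sigma>1 \<sigma>')"
          by (rule power_ok[OF e1 r1(1) p(1) pW(1)])
        let ?q = "SetA 6 (Reg 11) (Reg 10) ;; SetA 7 (Reg 11) (Reg 8) ;; SetR 11 (Reg 11 .+ Cst 1)"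
        have "ok (power_prog ;; ?q ;; ?n) \<sigma>1 (6 + 2 * LW) (I k')"
        proof (rule ok_seqI[OF pw])
          fix \<sigma>2 assume b: "prime_power_of p (fst \<sigma>2 8) \<and> same {8} {} \<sigma>1 \<sigma>2"
          have e2: "env \<sigma>2" using env_same[OF e1, of "{8}" "{}"] b by simp
          have r2: "fst \<sigma>2 10 = int p" "fst \<sigma>2 11 = int c" "snd \<sigma>2 = snd \<sigma>'"
            using b r1 by (auto simp: same_def)
          let ?s3 = "((fst \<sigma>2)(11 := int c + 1, 10 := int p + 1), (snd \<sigma>')(6 := (snd \<sigma>' 6)(c := int p), 7 := (snd \<sigma>' 7)(c := fst \<sigma>2 8)))"
          have nth: "plist (Suc p) ! l = (if l < c then plist p ! l else p)" if "l < Suc c" for l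
            using that True by (auto simp: plist_Suc c_def nth_append)
          have len: "length (plist (Suc p)) = Suc c" using True by (simp add: plist_Suc c_def)
          have "J (Suc p) ?s3" unfolding J_def len using nth p(4) b cK by (auto simp: J_def c_def less_Suc_eq)
          then have "I k' ?s3" using e2 p(1,2) k' unfolding I_def
            by (auto simp: env_def regs0_def intro!: exI[of _ "Suc p"])
          then show "ok (?q ;; ?n) \<sigma>2 4 (I k')"
            using pV by (simp add: r2 fun_upd_twist)
        qed simp
        then show ?thesis using a True by simp
      qed
    qed simp
    then show "\<exists>k'<k. ok ?b \<sigma>' (4 * K + 2 * LW + 10) (I k')" using k' by blast
  qed simp
  have "ok (While (Reg 3 .- Reg 11) ?b) ?s (16 * K\<^sup>2 * (4 * K + 2 * LW + 11) + 1)
     (\<lambda>\<sigma>'. moduli (snd \<sigma>' 7) \<and> same {4, 8, 10, 11, 12} {6, 7} \<sigma> \<sigma>')"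
  proof (rule ok_mono[OF ok_frame[OF 1]])
    fix \<sigma>' assume a: "((\<exists>k. I k \<sigma>') \<and> \<not> eval inp \<sigma>' (Reg 3 .- Reg 11) > 0) \<and>
       same (regs_written (While (Reg 3 .- Reg 11) ?b)) (arrs_written (While (Reg 3 .- Reg 11) ?b)) ?s \<sigma>'"
    then obtain k p where p: "2 \<le> p" "p + k = ?X" "J p \<sigma>'" and e': "env \<sigma>'" by (auto simp: I_def)
    have len: "length (plist p) = K" using a e' p by (auto simp: J_def env_def K_def)
    have pp: "prime_power_of (plist p ! l) (snd \<sigma>' 7 l)" "prime (plist p ! l)" "plist p ! l < p" if "l < K" for l
      using p(3) that len plist_nth[of l p] by (auto simp: J_def)
    have "moduli (snd \<sigma>' 7)" unfolding moduli_def
    proof (intro conjI allI impI)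
      fix l assume l: "l < K"
      show "W \<le> snd \<sigma>' 7 l" using pp[OF l] by (simp add: prime_power_of_def)
      have "plist p ! l \<le> ?X" using pp(3)[OF l] p(2) by linarith
      then have "4 * int (plist p ! l) \<le> 4 * int ?X" by (intro mult_left_mono) (simp_all only: of_nat_le_iff)
      then have "4 * int (plist p ! l) \<le> W" using cand_le by (rule order_trans)
      then have "W * (4 * int (plist p ! l)) \<le> W * W" using W1 by (intro mult_left_mono) auto
      then show "4 * snd \<sigma>' 7 l \<le> W ^ 2" using pp(1)[OF l] by (simp add: prime_power_of_def power2_eq_square)
      fix j assume j: "j < K" "l \<noteq> j"
      have "plist p ! l \<noteq> plist p ! j" using plist_distinct[of p] len l j by (simp add: nth_eq_iff_index_eq)
      then have "coprime (plist p ! l) (plist p ! j)" using pp(2)[OF l] pp(2)[OF j(1)] by (simp add: primes_coprime)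
      then have "coprime (int (plist p ! l) ^ e) (int (plist p ! j) ^ f)" for e f by (simp add: coprime_int_iff)
      then show "coprime (snd \<sigma>' 7 l) (snd \<sigma>' 7 j)"
        using pp(1)[OF l] pp(1)[OF j(1)] by (auto simp: prime_power_of_def)
    qed
    then show "moduli (snd \<sigma>' 7) \<and> same {4, 8, 10, 11, 12} {6, 7} \<sigma> \<sigma>'"
      using a by (auto simp: same_def)
  qed simp
  then show ?thesis unfolding primes_prog_def by simp
qed

end

section \<open>Programs for the two passes, the rounding and the output\<close>

definition pass1_prog :: com where
  "pass1_prog = For 9 (Reg 3) (SetR 8 (Arr 7 (Reg 9)) ;; solve_prog ;; SetA 8 (Reg 9) (Arr 2 (Reg 32)))"

text \<open>Tests check positivity, so inequality of two indices is expressed by the square of their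
  difference.\<close>

definition cofactor_prog :: com where
  "cofactor_prog = SetR 22 (Cst 1) ;;
    For 5 (Reg 18) (Cond ((Reg 5 .- Reg 9) .* (Reg 5 .- Reg 9))
      (SetR 22 (Reg 22 .* Arr 7 (Reg 5) .mod Reg 8)) Skip)"

text \<open>The operators \<open>.*\<close>, \<open>.mod\<close> and \<open>.div\<close> have equal
  precedence and associate to the left; the summand is
  \<open>((residue * inverse) mod m * W ^ 8) div m\<close>.\<close>

definition fraction_prog :: com where
  "fraction_prog = SetR 19 (Cst 0) ;;
    For 9 (Reg 18)
     (SetR 8 (Arr 7 (Reg 9)) ;; cofactor_prog ;; inverse_prog ;; SetA 9 (Reg 9) (Reg 25) ;;
      SetR 19 ((Reg 19 .+ Arr 8 (Reg 9) .* Reg 25 .mod Reg 8 .* Reg 20 .div Reg 8) .mod Reg 20)) ;;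
    Cond (Cst 2 .* Reg 19 .- Reg 20) (SetR 19 (Reg 19 .- Reg 20)) Skip"

text \<open>
  The number of moduli has to fit the unknown size of the denominator: with too many of them its
  fraction is too small to be accurate. So moduli are dropped until the fraction reaches \<open>W ^ 4\<close>
  units of \<open>W ^ -8\<close>.
\<close>

definition search_prog :: com where
  "search_prog = SetR 18 (Reg 3 .+ Cst 1) ;; SetR 19 (Cst 0) ;;
    While (Reg 21 .- Reg 19) (SetR 18 (Reg 18 .- Cst 1) ;; fraction_prog)"

text \<open>Storing the residues of all numerators would take \<open>d * K\<close> words. They are
  therefore recomputed for each modulus, and only the accumulated fractions are kept. The first pass
  stores the residues of the denominator, which are \<open>K\<close> words, because the search for
  the number of moduli reads them repeatedly.\<close>

definition pass2_prog :: com where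
  "pass2_prog = zero_prog 10 (Reg 32) ;;
    For 9 (Reg 18)
     (SetR 8 (Arr 7 (Reg 9)) ;; solve_prog ;;
      For 4 (Reg 32) (SetA 10 (Reg 4)
        ((Arr 10 (Reg 4) .+ Arr 2 (Reg 4) .* Arr 9 (Reg 9) .mod Reg 8 .* Reg 20 .div Reg 8) .mod Reg 20)))"

definition quotient_prog :: com where
  "quotient_prog =
    For 4 (Reg 32)
     (SetR 22 (Arr 10 (Reg 4)) ;;
      Cond (Cst 2 .* Reg 22 .- Reg 20) (SetR 22 (Reg 22 .- Reg 20)) Skip ;;
      SetA 11 (Reg 4) (Reg 22 .* Reg 14 .div Reg 19))"

text \<open>All coordinates share the denominator \<open>W\<close>. The output is first assembled in
  array 15, since its first 64 cells are still occupied by registers and temporaries; the other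
  cells are filled here, the first ones in the epilogue.\<close>

definition output_prog :: com where
  "output_prog =
    For 4 (Reg 0) (SetA 12 (Reg 4) (Cst 0 .- Reg 13 .* In (Reg 31 .+ Reg 4) .* Reg 14)) ;;
    For 7 (Reg 2) (SetA 12 row_e (Arr 12 row_e .+ val_e .* Arr 11 col_e)) ;;
    For 4 (Reg 0)
     (SetA 15 (Cst 2 .* Reg 4) (Arr 12 (Reg 4)) ;; SetA 15 (Cst 2 .* Reg 4 .+ Cst 1) (Reg 14)) ;;
    For 4 (Cst 2 .* Reg 0 .- Cst 64) (SetO (Cst 64 .+ Reg 4) (Arr 15 (Cst 64 .+ Reg 4)))"

definition lp_prog :: com where
  "lp_prog = init_prog ;; rhs_prog ;; primes_prog ;; pass1_prog ;; search_prog ;; pass2_prog ;;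
    quotient_prog ;; output_prog"

lemma written_progs4 [simp]:
  "regs_written pass1_prog = {4, 5, 6, 7, 8, 9, 17, 29}" "arrs_written pass1_prog = {2, 3, 4, 8, 12}"
  "regs_written cofactor_prog = {5, 22}" "arrs_written cofactor_prog = {}"
  "regs_written fraction_prog = {5, 8, 9, 19, 22, 23, 24, 25, 26, 27, 28}" "arrs_written fraction_prog = {9}"
  "regs_written search_prog = {5, 8, 9, 18, 19, 22, 23, 24, 25, 26, 27, 28}" "arrs_written search_prog = {9}"
  "regs_written pass2_prog = {4, 5, 6, 7, 8, 9, 17, 29}" "arrs_written pass2_prog = {2, 3, 4, 10, 12}"
  "regs_written quotient_prog = {4, 22}" "arrs_written quotient_prog = {11}"
  by (auto simp: pass1_prog_def cofactor_prog_def fraction_prog_def search_prog_def pass2_prog_def quotient_prog_def)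

lemma wf_lp_prog: "wf_com lp_prog"
  by (simp add: lp_prog_def init_prog_def rhs_prog_def primes_prog_def pass1_prog_def search_prog_def
    pass2_prog_def quotient_prog_def output_prog_def fraction_prog_def cofactor_prog_def inverse_prog_def
    power_prog_def test_prog_def pow_prog_def solve_prog_def trace_prog_def newton_prog_def
    horner_prog_def mv_prog_def zero_prog_def)

section \<open>Correctness of the passes, the search for the number of moduli and the output\<close>

context lp
begin

abbreviation "D \<equiv> Cf d M d"
abbreviation "Z j \<equiv> int d * Zf d M gv d j"
abbreviation "S8 \<equiv> W ^ 8"

lemma modulusI: "env \<sigma> \<Longrightarrow> fst \<sigma> 8 = ms l \<Longrightarrow> moduli ms \<Longrightarrow> l < K \<Longrightarrow> modulus \<sigma> (ms l)"
  using W1 unfolding modulus_def env_def moduli_def by force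

lemma ms_bounds: "moduli ms \<Longrightarrow> l < K \<Longrightarrow> 0 < ms l \<and> 1 < ms l \<and> ms l \<le> W ^ 2 \<and> W \<le> ms l"
  using W1 unfolding moduli_def by force

lemma env_upd: "r \<notin> {0, 2, 3, 13, 14, 20, 21, 30, 31, 32} \<Longrightarrow> env (s(r := v), a) = env (s, b)"
  by (auto simp: env_def regs0_def)

lemma pass1_ok:
  assumes e: "env \<sigma>" and ms: "moduli (snd \<sigma> 7)"
    and g: "\<forall>j<d. snd \<sigma> 5 j = gv j" "\<forall>j<d. \<bar>gv j\<bar> \<le> W"
  shows "ok pass1_prog \<sigma> (K * (120 * (d * d * nz) + 4) + 2) (\<lambda>\<sigma>'. (\<forall>l<K. snd \<sigma>' 8 l = D mod snd \<sigma> 7 l) \<and>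
     same {4, 5, 6, 7, 8, 9, 17, 29} {2, 3, 4, 8, 12} \<sigma> \<sigma>')"
proof -
  let ?c = "SetR 8 (Arr 7 (Reg 9)) ;; solve_prog ;; SetA 8 (Reg 9) (Arr 2 (Reg 32))"
  let ?ms = "snd \<sigma> 7"
  let ?I = "\<lambda>k \<sigma>'. \<forall>l<k. snd \<sigma>' 8 l = D mod ?ms l"
  have r3: "fst \<sigma> 3 = int K" using e by (simp add: env_def K_def)
  show ?thesis unfolding pass1_prog_def
  proof (rule ok_mono[OF ok_For[where I = ?I and L = "int K" and t = "120 * (d * d * nz) + 2"]])
    fix k \<sigma>' assume k: "k < nat (int K)" "fst \<sigma>' 9 = int k" and I: "?I k \<sigma>'"
      and sm: "same (insert 9 (regs_written ?c)) (arrs_written ?c) \<sigma> \<sigma>'"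
    have kK: "k < K" "k < S" using k K_le by auto
    have e': "env \<sigma>'" using env_same[OF e sm] by simp
    have a': "snd \<sigma>' 7 = ?ms" "snd \<sigma>' 5 = snd \<sigma> 5" using sm by (auto simp: same_def)
    let ?s = "((fst \<sigma>')(8 := ?ms k), snd \<sigma>')"
    have m: "modulus ?s (?ms k)"
      by (rule modulusI[OF _ _ ms kK(1)]) (use e' env_upd[of 8 "fst \<sigma>'" _ _ "snd \<sigma>'"] in auto)
    have 1: "ok solve_prog ?s (120 * (d * d * nz)) (\<lambda>\<sigma>'. (\<forall>j<d. snd \<sigma>' 2 j = Z j mod ?ms k) \<and>
       snd \<sigma>' 2 d = D mod ?ms k \<and> same {4, 5, 6, 7, 17, 29} {2, 3, 4, 12} ?s \<sigma>')"
      by (rule solve_ok[OF m]) (use g a' in auto)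
    have "ok (solve_prog ;; SetA 8 (Reg 9) (Arr 2 (Reg 32))) ?s (120 * (d * d * nz) + 1) (?I (Suc k))"
    proof (rule ok_seqI[OF 1])
      fix \<sigma>2 assume a: "(\<forall>j<d. snd \<sigma>2 2 j = Z j mod ?ms k) \<and>
       snd \<sigma>2 2 d = D mod ?ms k \<and> same {4, 5, 6, 7, 17, 29} {2, 3, 4, 12} ?s \<sigma>2"
      have r: "fst \<sigma>2 9 = int k" "fst \<sigma>2 32 = int d" "snd \<sigma>2 8 = snd \<sigma>' 8" "d < S"
        using a k e' S_ge dims by (auto simp: same_def env_def regs0_def)
      show "ok (SetA 8 (Reg 9) (Arr 2 (Reg 32))) \<sigma>2 1 (?I (Suc k))"
        using I a kK by (simp add: r less_Suc_eq)
    qed simp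
    then show "ok ?c \<sigma>' (120 * (d * d * nz) + 2) (?I (Suc k))" using kK by (simp add: k(2) a')
  next
    show "nat (int K) * (120 * (d * d * nz) + 2 + 2) + 2 \<le> K * (120 * (d * d * nz) + 4) + 2"
      by (simp add: algebra_simps)
  qed (use r3 K_le in \<open>auto simp: same_def\<close>)
qed

definition "cofac J ms l = (\<Prod>j\<in>{..<J} - {l}. ms j :: int)"

lemma cofactor_ok:
  assumes e: "env \<sigma>" and ms: "moduli ms" "snd \<sigma> 7 = ms" and J: "J \<le> K" "fst \<sigma> 18 = int J"
    and l: "l < J" "fst \<sigma> 9 = int l" "fst \<sigma> 8 = ms l"
  shows "ok cofactor_prog \<sigma> (4 * K + 3) (\<lambda>\<sigma>'. fst \<sigma>' 22 = cofac J ms l mod ms l \<and> same {5, 22} {} \<sigma> \<sigma>')"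
proof -
  let ?c = "Cond ((Reg 5 .- Reg 9) .* (Reg 5 .- Reg 9)) (SetR 22 (Reg 22 .* Arr 7 (Reg 5) .mod Reg 8)) Skip"
  let ?s = "((fst \<sigma>)(22 := 1), snd \<sigma>)"
  let ?I = "\<lambda>k \<sigma>'. fst \<sigma>' 22 = (\<Prod>j\<in>{..<k} - {l}. ms j) mod ms l"
  have lK: "l < K" using l J by simp
  note mb = ms_bounds[OF ms(1) lK]
  have "ok (For 5 (Reg 18) ?c) ?s (4 * K + 2) (\<lambda>\<sigma>'. ?I (nat (int J)) \<sigma>' \<and>
      same (insert 5 (regs_written ?c)) (arrs_written ?c) ?s \<sigma>')"
  proof (rule ok_For[where t = 2])
    fix k \<sigma>' assume k: "k < nat (int J)" "fst \<sigma>' 5 = int k" and I: "?I k \<sigma>'"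
      and sm: "same (insert 5 (regs_written ?c)) (arrs_written ?c) ?s \<sigma>'"
    have kK: "k < K" "k < S" using k J K_le by auto
    have st: "fst \<sigma>' 9 = int l" "fst \<sigma>' 8 = ms l" "snd \<sigma>' 7 = ms" using sm l ms by (auto simp: same_def)
    define x where "x = fst \<sigma>' 22"
    have xb: "\<bar>x\<bar> \<le> W ^ 2" by (simp only: x_def I) (rule bmod; use mb in simp)
    have kb: "\<bar>ms k\<bar> \<le> W ^ 2" using ms_bounds[OF ms(1) kK(1)] by simp
    have b1: "\<bar>x * ms k\<bar> \<le> W ^ 4" by (rule bmult[OF xb kb]) simp
    have bb: "\<bar>x * ms k\<bar> \<le> V" "\<bar>(x * ms k) mod ms l\<bar> \<le> V"
      using bV[OF b1] bV[OF bmod[of "ms l" 2]] mb by simp_all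
    have dkl: "\<bar>int k - int l\<bar> \<le> W ^ 1" using kK lK K_le by auto
    have db: "\<bar>(int k - int l) * (int k - int l)\<bar> \<le> W ^ 2" by (rule bmult[OF dkl dkl]) simp
    have db': "\<bar>int k - int l\<bar> \<le> V" "\<bar>(int k - int l) * (int k - int l)\<bar> \<le> V" using bV[OF dkl] bV[OF db] by simp_all
    have cs: "0 < (int k - int l) * (int k - int l) \<longleftrightarrow> k \<noteq> l" by (auto simp: zero_less_mult_iff)
    have I': "x = (\<Prod>j\<in>{..<k} - {l}. ms j) mod ms l" using I by (simp add: x_def)
    have p: "{..<Suc k} - {l} = (if k = l then {..<k} - {l} else insert k ({..<k} - {l}))" by auto
    have Q: "(x * ms k) mod ms l = (\<Prod>j\<in>{..<Suc k} - {l}. ms j) mod ms l" if "k \<noteq> l"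
      unfolding p I' using that by (simp add: mod_mult_right_eq mult.commute)
    show "ok ?c \<sigma>' 2 (?I (Suc k))"
    proof (cases "k = l")
      case True
      then have "{..<Suc k} - {l} = {..<k} - {l}" by auto
      then show ?thesis using I' True V_W(7) by (simp add: st k(2) x_def[symmetric])
    next
      case False
      have "\<bar>(\<Prod>j\<in>{..<Suc k} - {l}. ms j) mod ms l\<bar> \<le> V" using bb(2) unfolding Q[OF False] .
      moreover have "(int k - int l) * (int k - int l) \<le> V" using db'(2) by linarith
      ultimately show ?thesis using False kK by (simp add: st k(2) x_def[symmetric] cs db' bb Q[OF False])
    qed
  qed (use J K_le mb in \<open>auto simp: same_def\<close>)
  then have "ok (For 5 (Reg 18) ?c) ?s (4 * K + 2) (\<lambda>\<sigma>'. fst \<sigma>' 22 = cofac J ms l mod ms l \<and> same {5, 22} {} \<sigma> \<sigma>')"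
    by (rule ok_mono) (auto simp: same_def cofac_def)
  then show ?thesis unfolding cofactor_prog_def by simp
qed

lemma cofac_coprime: "moduli ms \<Longrightarrow> J \<le> K \<Longrightarrow> l < J \<Longrightarrow> coprime (cofac J ms l mod ms l) (ms l)"
proof -
  assume a: "moduli ms" "J \<le> K" "l < J"
  have "coprime (cofac J ms l) (ms l)" unfolding cofac_def
    by (rule prod_coprime_left) (use a in \<open>auto simp: moduli_def\<close>)
  then show ?thesis unfolding coprime_iff_gcd_eq_1 by (metis gcd.commute gcd_red_int)
qed

definition "invs J ms w \<longleftrightarrow> (\<forall>l<J. [w l * cofac J ms l = 1] (mod ms l) \<and> \<bar>w l\<bar> \<le> W ^ 2)"
text \<open>The sum of \<open>crt_fraction\<close> with the unit \<open>1 / W ^ 8\<close>.\<close>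

definition "fs J ms w x = (\<Sum>l<J. (x * w l) mod ms l * S8 div ms l)"
definition "ctr x = (if 2 * (x mod S8) - S8 > 0 then x mod S8 - S8 else x mod S8)"

lemma fs_step_bounds:
  assumes "0 < m" "m \<le> W ^ 2" "\<bar>x\<bar> \<le> W ^ 2" "\<bar>w\<bar> \<le> W ^ 2" "\<bar>a\<bar> \<le> W ^ 8"
  shows "\<bar>x * w\<bar> \<le> V" "\<bar>(x * w) mod m\<bar> \<le> V" "\<bar>(x * w) mod m * S8\<bar> \<le> V" "\<bar>(x * w) mod m * S8 div m\<bar> \<le> V"
    "\<bar>a + (x * w) mod m * S8 div m\<bar> \<le> V" "\<bar>(a + (x * w) mod m * S8 div m) mod S8\<bar> \<le> V"
    "\<bar>(a + (x * w) mod m * S8 div m) mod S8\<bar> \<le> W ^ 8"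
proof -
  have S8: "\<bar>S8\<bar> \<le> W ^ 8" "0 < S8" using W1 by auto
  have 1: "\<bar>x * w\<bar> \<le> W ^ 4" by (rule bmult[OF assms(3,4)]) simp
  have 2: "\<bar>(x * w) mod m\<bar> \<le> W ^ 2" by (rule bmod[OF assms(1,2)])
  have 3: "\<bar>(x * w) mod m * S8\<bar> \<le> W ^ 10" by (rule bmult[OF 2 S8(1)]) simp
  have 4: "\<bar>(x * w) mod m * S8 div m\<bar> \<le> W ^ 10" using abs_div_le[of "(x * w) mod m * S8" m] 3 by linarith
  have 5: "\<bar>a\<bar> \<le> W ^ 10" by (rule bup[OF assms(5)]) simp
  show 6: "\<bar>(a + (x * w) mod m * S8 div m) mod S8\<bar> \<le> W ^ 8" by (rule bmod[OF S8(2)]) simp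
  show "\<bar>x * w\<bar> \<le> V" by (rule bV[OF 1]) simp
  show "\<bar>(x * w) mod m\<bar> \<le> V" by (rule bV[OF 2]) simp
  show "\<bar>(x * w) mod m * S8\<bar> \<le> V" by (rule bV[OF 3]) simp
  show "\<bar>(x * w) mod m * S8 div m\<bar> \<le> V" by (rule bV[OF 4]) simp
  show "\<bar>a + (x * w) mod m * S8 div m\<bar> \<le> V" by (rule bV[OF badd(1)[OF 5 4]]) simp
  show "\<bar>(a + (x * w) mod m * S8 div m) mod S8\<bar> \<le> V" by (rule bV[OF 6]) simp
qed

lemma center_bounds:
  shows "\<bar>2 * (x mod S8)\<bar> \<le> V" "\<bar>2 * (x mod S8) - S8\<bar> \<le> V" "\<bar>x mod S8 - S8\<bar> \<le> V" "\<bar>x mod S8\<bar> \<le> V" "\<bar>ctr x\<bar> \<le> W ^ 8"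
proof -
  have S8: "0 < S8" using W1 by auto
  have r: "0 \<le> x mod S8" "x mod S8 < S8" using S8 by auto
  have "W ^ 8 * 2 \<le> W ^ 8 * W ^ 8"
    using W1 Wpow_mono[of 1 8] by (intro mult_left_mono) auto
  then have "2 * S8 \<le> V" by (simp add: V_def flip: power_add)
  moreover define y s where "y = x mod S8" "s = S8"
  ultimately have "0 \<le> y" "y < s" "2 * s \<le> V" using r by auto
  then have "\<bar>2 * y\<bar> \<le> V" "\<bar>2 * y - s\<bar> \<le> V" "\<bar>y - s\<bar> \<le> V" "\<bar>y\<bar> \<le> V" unfolding abs_le_iff by linarith+
  then show "\<bar>2 * (x mod S8)\<bar> \<le> V" "\<bar>2 * (x mod S8) - S8\<bar> \<le> V" "\<bar>x mod S8 - S8\<bar> \<le> V" "\<bar>x mod S8\<bar> \<le> V"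
    unfolding y_s_def .
  show "\<bar>ctr x\<bar> \<le> W ^ 8" using r unfolding ctr_def abs_le_iff by (simp only: split: if_split) linarith
qed

lemma mod_mod_mult: "((x mod m) * w) mod m = (x * w) mod m" for x w m :: int
  by (simp add: mod_mult_left_eq)

lemma fraction_ok:
  assumes e: "env \<sigma>" and ms: "moduli ms" "snd \<sigma> 7 = ms" and J: "J \<le> K" "fst \<sigma> 18 = int J"
    and De: "\<forall>l<K. snd \<sigma> 8 l = D mod ms l"
  shows "ok fraction_prog \<sigma> (K * (4 * K + 40 * LW + 10) + 6) (\<lambda>\<sigma>'. invs J ms (snd \<sigma>' 9) \<and> fst \<sigma>' 19 = ctr (fs J ms (snd \<sigma>' 9) D) \<and>
     same {5, 8, 9, 19, 22, 23, 24, 25, 26, 27, 28} {9} \<sigma> \<sigma>')"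
proof -
  let ?f = "SetR 19 ((Reg 19 .+ Arr 8 (Reg 9) .* Reg 25 .mod Reg 8 .* Reg 20 .div Reg 8) .mod Reg 20)"
  let ?c = "SetR 8 (Arr 7 (Reg 9)) ;; cofactor_prog ;; inverse_prog ;; SetA 9 (Reg 9) (Reg 25) ;; ?f"
  let ?s = "((fst \<sigma>)(19 := 0), snd \<sigma>)"
  define I where "I k \<sigma>' \<longleftrightarrow> (\<forall>l<k. [snd \<sigma>' 9 l * cofac J ms l = 1] (mod ms l) \<and> \<bar>snd \<sigma>' 9 l\<bar> \<le> W ^ 2) \<and>
     fst \<sigma>' 19 = fs k ms (snd \<sigma>' 9) D mod S8" for k and \<sigma>' :: st
  have e0: "env ?s" using e env_upd[of 19 "fst \<sigma>" 0 "snd \<sigma>" "snd \<sigma>"] by simp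
  have 1: "ok (For 9 (Reg 18) ?c) ?s (K * (4 * K + 40 * LW + 10) + 2) (\<lambda>\<sigma>'. I (nat (int J)) \<sigma>' \<and>
      same (insert 9 (regs_written ?c)) (arrs_written ?c) ?s \<sigma>')"
  proof (rule ok_For[where t = "4 * K + 40 * LW + 8"])
    fix k \<sigma>' assume k: "k < nat (int J)" "fst \<sigma>' 9 = int k" and I: "I k \<sigma>'"
      and sm: "same (insert 9 (regs_written ?c)) (arrs_written ?c) ?s \<sigma>'"
    have kK: "k < K" "k < S" "k < J" using k J K_le by auto
    note mb = ms_bounds[OF ms(1) kK(1)]
    have e': "env \<sigma>'" using env_same[OF e0 sm] by simp
    have a': "snd \<sigma>' 7 = ms" "snd \<sigma>' 8 = snd \<sigma> 8" "fst \<sigma>' 18 = int J" using sm ms J by (auto simp: same_def)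
    let ?s1 = "((fst \<sigma>')(8 := ms k), snd \<sigma>')"
    have e1: "env ?s1" using e' env_upd[of 8 "fst \<sigma>'" _ _ "snd \<sigma>'"] by simp
    have c1: "ok cofactor_prog ?s1 (4 * K + 3) (\<lambda>\<sigma>'. fst \<sigma>' 22 = cofac J ms k mod ms k \<and> same {5, 22} {} ?s1 \<sigma>')"
      by (rule cofactor_ok[OF e1 ms(1) _ J(1) _ kK(3)]) (use a' k in auto)
    have "ok (cofactor_prog ;; inverse_prog ;; SetA 9 (Reg 9) (Reg 25) ;; ?f) ?s1 (7 + (4 * K + 40 * LW)) (I (Suc k))"
    proof (rule ok_seqI[OF c1])
      fix \<sigma>2 assume a2: "fst \<sigma>2 22 = cofac J ms k mod ms k \<and> same {5, 22} {} ?s1 \<sigma>2"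
      have e2: "env \<sigma>2" using env_same[OF e1, of "{5, 22}" "{}" \<sigma>2] a2 by simp
      have r2: "fst \<sigma>2 8 = ms k" using a2 by (simp add: same_def)
      have m2: "modulus \<sigma>2 (ms k)" by (rule modulusI[OF e2 r2 ms(1) kK(1)])
      have iv: "ok inverse_prog \<sigma>2 (40 * LW) (\<lambda>\<sigma>'. [fst \<sigma>' 25 * (cofac J ms k mod ms k) = 1] (mod ms k) \<and> \<bar>fst \<sigma>' 25\<bar> \<le> W ^ 2 \<and>
         same {23, 24, 25, 26, 27, 28} {} \<sigma>2 \<sigma>')"
        by (rule inverse_ok[OF m2]) (use a2 mb cofac_coprime[OF ms(1) J(1) kK(3)] in auto)
      show "ok (inverse_prog ;; SetA 9 (Reg 9) (Reg 25) ;; ?f) \<sigma>2 (40 * LW + 2) (I (Suc k))"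
      proof (rule ok_seqI[OF iv])
        fix \<sigma>3 assume a3: "[fst \<sigma>3 25 * (cofac J ms k mod ms k) = 1] (mod ms k) \<and> \<bar>fst \<sigma>3 25\<bar> \<le> W ^ 2 \<and>
           same {23, 24, 25, 26, 27, 28} {} \<sigma>2 \<sigma>3"
        define w where "w = fst \<sigma>3 25"
        have wi: "[w * cofac J ms k = 1] (mod ms k)" using a3 by (simp add: cong_def w_def mod_mult_right_eq)
        have r3: "fst \<sigma>3 9 = int k" "fst \<sigma>3 8 = ms k" "fst \<sigma>3 20 = S8" "fst \<sigma>3 19 = fst \<sigma>' 19" "snd \<sigma>3 = snd \<sigma>'"
          using a3 a2 k e' by (auto simp: same_def env_def)
        have De': "snd \<sigma>' 8 k = D mod ms k" using De kK(1) a'(2) by simp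
        have x2: "\<bar>D mod ms k\<bar> \<le> W ^ 2" using mb by (intro bmod) auto
        have "\<exists>y. fst \<sigma>' 19 = y mod S8" using I unfolding I_def by blast
        then have x8: "\<bar>fst \<sigma>' 19\<bar> \<le> W ^ 8" by (rule bmod_ex) (use W1 in auto)
        have wb: "\<bar>w\<bar> \<le> W ^ 2" using a3 by (simp add: w_def)
        have mb1: "0 < ms k" "ms k \<le> W ^ 2" using mb by auto
        note bb = fs_step_bounds[OF mb1 x2 wb x8]
        have fsk: "fs k ms ((snd \<sigma>' 9)(k := w)) D = fs k ms (snd \<sigma>' 9) D" unfolding fs_def by (rule sum.cong) auto
        have new: "(fst \<sigma>' 19 + ((D mod ms k) * w) mod ms k * S8 div ms k) mod S8 = fs (Suc k) ms ((snd \<sigma>' 9)(k := w)) D mod S8"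
        proof -
          have "fs (Suc k) ms ((snd \<sigma>' 9)(k := w)) D = fs k ms (snd \<sigma>' 9) D + (D * w) mod ms k * S8 div ms k"
            using fsk by (simp add: fs_def)
          then show ?thesis using I unfolding I_def mod_mod_mult by (simp add: mod_add_left_eq)
        qed
        have Q: "I (Suc k) ((fst \<sigma>3)(19 := (fst \<sigma>' 19 + ((D mod ms k) * w) mod ms k * S8 div ms k) mod S8), (snd \<sigma>')(9 := (snd \<sigma>' 9)(k := w)))"
          using I wi wb new unfolding I_def by (simp add: less_Suc_eq)
        show "ok (SetA 9 (Reg 9) (Reg 25) ;; ?f) \<sigma>3 2 (I (Suc k))"
          by (simp add: r3 w_def[symmetric] De' bb kK Q)
      qed simp
    qed simp
    then show "ok ?c \<sigma>' (4 * K + 40 * LW + 8) (I (Suc k))" using kK by (simp add: k(2) a')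
  next
    have "nat (int J) * (4 * K + 40 * LW + 8 + 2) \<le> K * (4 * K + 40 * LW + 10)" using J by (intro mult_mono) auto
    then show "nat (int J) * (4 * K + 40 * LW + 8 + 2) + 2 \<le> K * (4 * K + 40 * LW + 10) + 2" by simp
  qed (use J K_le in \<open>auto simp: same_def I_def fs_def\<close>)
  have "ok (For 9 (Reg 18) ?c ;; Cond (Cst 2 .* Reg 19 .- Reg 20) (SetR 19 (Reg 19 .- Reg 20)) Skip) ?s (K * (4 * K + 40 * LW + 10) + 4)
    (\<lambda>\<sigma>'. invs J ms (snd \<sigma>' 9) \<and> fst \<sigma>' 19 = ctr (fs J ms (snd \<sigma>' 9) D) \<and>
     same {5, 8, 9, 19, 22, 23, 24, 25, 26, 27, 28} {9} \<sigma> \<sigma>')"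
  proof (rule ok_seqI[OF 1])
    fix \<sigma>2 assume a: "I (nat (int J)) \<sigma>2 \<and> same (insert 9 (regs_written ?c)) (arrs_written ?c) ?s \<sigma>2"
    have r: "fst \<sigma>2 20 = S8" "fst \<sigma>2 19 = fs J ms (snd \<sigma>2 9) D mod S8" "invs J ms (snd \<sigma>2 9)"
      using a e by (auto simp: same_def env_def I_def invs_def)
    have sm: "same {5, 8, 9, 19, 22, 23, 24, 25, 26, 27, 28} {9} \<sigma> \<sigma>2"
      using a by (auto simp: same_def)
    have sm': "same {5, 8, 9, 19, 22, 23, 24, 25, 26, 27, 28} {9} \<sigma> ((fst \<sigma>2)(19 := v), snd \<sigma>2)" for v
      using sm by (auto simp: same_def)
    show "ok (Cond (Cst 2 .* Reg 19 .- Reg 20) (SetR 19 (Reg 19 .- Reg 20)) Skip) \<sigma>2 2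
       (\<lambda>\<sigma>'. invs J ms (snd \<sigma>' 9) \<and> fst \<sigma>' 19 = ctr (fs J ms (snd \<sigma>' 9) D) \<and>
     same {5, 8, 9, 19, 22, 23, 24, 25, 26, 27, 28} {9} \<sigma> \<sigma>')"
      using center_bounds[of "fs J ms (snd \<sigma>2 9) D"] r(3) sm sm' by (simp add: r(1,2) ctr_def)
  qed simp
  then have "ok (For 9 (Reg 18) ?c ;; Cond (Cst 2 .* Reg 19 .- Reg 20) (SetR 19 (Reg 19 .- Reg 20)) Skip) ?s (5 + K * (4 * K + 40 * LW + 10))
    (\<lambda>\<sigma>'. invs J ms (snd \<sigma>' 9) \<and> fst \<sigma>' 19 = ctr (fs J ms (snd \<sigma>' 9) D) \<and>
     same {5, 8, 9, 19, 22, 23, 24, 25, 26, 27, 28} {9} \<sigma> \<sigma>')"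
    by (rule ok_mono) auto
  then show ?thesis unfolding fraction_prog_def by simp
qed

definition "Np J ms = (\<Prod>l<J. ms l :: int)"

lemma Np_pos: "moduli ms \<Longrightarrow> J \<le> K \<Longrightarrow> 0 < Np J ms"
  unfolding Np_def by (rule prod_pos) (use ms_bounds in auto)

text \<open>The fraction is at most a quarter in absolute value and the rounding error
  \<open>J\<close> is below \<open>S8 / 4\<close>, so the approximation is below
  \<open>S8 / 2\<close> in absolute value and its centered residue determines it.\<close>

lemma ctr_fraction:
  assumes ms: "moduli ms" and J: "J \<le> K" and w: "invs J ms w" and x: "4 * \<bar>x\<bar> \<le> Np J ms"
  shows "real_of_int S8 * real_of_int x / real_of_int (Np J ms) - real J \<le> real_of_int (ctr (fs J ms w x))"
    "real_of_int (ctr (fs J ms w x)) \<le> real_of_int S8 * real_of_int x / real_of_int (Np J ms)"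
proof -
  have S8: "0 < S8" using W1 by simp
  obtain a where a: "[fs J ms w x = a] (mod S8)"
    "real_of_int S8 * real_of_int x / real_of_int (Np J ms) - real J \<le> real_of_int a"
    "real_of_int a \<le> real_of_int S8 * real_of_int x / real_of_int (Np J ms)"
  proof (rule crt_fraction[of J ms w S8 x])
    show "0 < ms l" if "l < J" for l using ms_bounds[OF ms] that J by simp
    show "coprime (ms l) (ms j)" if "l < J" "j < J" "l \<noteq> j" for l j using ms that J by (simp add: moduli_def)
    show "[w l * (\<Prod>j\<in>{..<J} - {l}. ms j) = 1] (mod ms l)" if "l < J" for l
      using w that by (simp add: invs_def cofac_def)
  qed (use S8 that in \<open>auto simp: fs_def Np_def\<close>)
  let ?q = "real_of_int x / real_of_int (Np J ms)"
  have N: "0 < real_of_int (Np J ms)" using Np_pos[OF ms J] by simp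
  have "4 * \<bar>real_of_int x\<bar> \<le> real_of_int (Np J ms)" using x by linarith
  then have "\<bar>?q\<bar> \<le> 1 / 4" using N by (simp add: abs_divide field_simps)
  then have "\<bar>real_of_int S8 * ?q\<bar> \<le> real_of_int S8 * (1 / 4)"
    unfolding abs_mult using S8 by (intro mult_mono) auto
  moreover have "real J < real_of_int S8 / 4"
  proof -
    have "int J + 1 \<le> W" using J K_le by simp
    moreover have "W * 4 \<le> W * W ^ 7"
      using W_ge(4) Wpow_mono[of 1 7] W1 by (intro mult_left_mono) auto
    ultimately have "4 * int J < S8" using W1 by (simp add: power_Suc[symmetric])
    then have "real_of_int (4 * int J) < real_of_int S8" by (rule of_int_less_iff[THEN iffD2])
    then show ?thesis by simp
  qed
  ultimately have "\<bar>real_of_int a\<bar> < real_of_int S8 / 2" using a(2,3) by (simp only: times_divide_eq_right)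
  then have "real_of_int (2 * \<bar>a\<bar>) < real_of_int S8" by simp
  then have "2 * \<bar>a\<bar> < S8" by (rule of_int_less_iff[THEN iffD1])
  from centered_mod[OF a(1) this] have "ctr (fs J ms w x) = a" by (simp add: ctr_def)
  then show "real_of_int S8 * real_of_int x / real_of_int (Np J ms) - real J \<le> real_of_int (ctr (fs J ms w x))"
    "real_of_int (ctr (fs J ms w x)) \<le> real_of_int S8 * real_of_int x / real_of_int (Np J ms)"
    using a by simp_all
qed

text \<open>The lower bound \<open>W ^ 4\<close> limits the relative error of the denominator; the
  bound on the product keeps denominator and numerators below a quarter of it, so that centered
  residues are unambiguous.\<close>

definition "found ms \<sigma>' \<longleftrightarrow> (\<exists>J\<le>K. 1 \<le> J \<and> fst \<sigma>' 18 = int J \<and> invs J ms (snd \<sigma>' 9) \<and>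
    fst \<sigma>' 19 = ctr (fs J ms (snd \<sigma>' 9) D) \<and> W ^ 4 \<le> fst \<sigma>' 19 \<and> D * W ^ 2 \<le> Np J ms)"

text \<open>Dropping a modulus is harmless: a fraction below \<open>W ^ 4\<close> units implies
  \<open>W ^ 4 * D \<le> 2 * Np k ms\<close>, and as the dropped modulus is at most
  \<open>W ^ 2 / 4\<close>, the remaining product is still at least \<open>D * W ^ 2\<close>. The
  empty product violates this inequality, so the search succeeds before the moduli run out.\<close>

lemma search_ok:
  assumes e: "env \<sigma>" and ms: "moduli ms" "snd \<sigma> 7 = ms" and De: "\<forall>l<K. snd \<sigma> 8 l = D mod ms l"
    and D: "0 < D" "D \<le> W ^ d"
  shows "ok search_prog \<sigma> (K * (K * (4 * K + 40 * LW + 10) + 8) + 3) (\<lambda>\<sigma>'. found ms \<sigma>' \<and>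
     same {5, 8, 9, 18, 19, 22, 23, 24, 25, 26, 27, 28} {9} \<sigma> \<sigma>')"
proof -
  let ?s = "((fst \<sigma>)(18 := int K + 1, 19 := 0), snd \<sigma>)"
  let ?b = "SetR 18 (Reg 18 .- Cst 1) ;; fraction_prog"
  define I where "I k \<sigma>' \<longleftrightarrow> (found ms \<sigma>' \<or> fst \<sigma>' 19 < W ^ 4 \<and> fst \<sigma>' 18 = int k + 1 \<and> D * W ^ 2 \<le> Np k ms \<and> k \<le> K) \<and>
     env \<sigma>' \<and> snd \<sigma>' 7 = ms \<and> snd \<sigma>' 8 = snd \<sigma> 8 \<and> \<bar>fst \<sigma>' 19\<bar> \<le> W ^ 8" for k and \<sigma>' :: st
  have 1: "ok (While (Reg 21 .- Reg 19) ?b) ?s (K * (K * (4 * K + 40 * LW + 10) + 8) + 1)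
     (\<lambda>\<sigma>'. (\<exists>k. I k \<sigma>') \<and> \<not> eval inp \<sigma>' (Reg 21 .- Reg 19) > 0)"
  proof (rule ok_While_ghost[where k = K and t = "K * (4 * K + 40 * LW + 10) + 7"])
    have "D * W ^ 2 \<le> W ^ d * W ^ 2" using D W1 by (intro mult_right_mono) auto
    also have "\<dots> = W ^ (d + 2)" by (simp only: power_add)
    also have "\<dots> \<le> W ^ K" by (rule Wpow_mono) (simp add: K_def)
    also have "\<dots> = (\<Prod>l<K. W)" by simp
    also have "\<dots> \<le> Np K ms" unfolding Np_def by (rule prod_mono) (use ms_bounds[OF ms(1)] W1 in auto)
    finally show "I K ?s" unfolding I_def using e ms(2) W1
      by (simp add: env_def regs0_def)
  next
    fix k \<sigma>' assume I: "I k \<sigma>'"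
    have r: "fst \<sigma>' 21 = W ^ 4" "\<bar>fst \<sigma>' 19\<bar> \<le> W ^ 8" "env \<sigma>'" using I by (auto simp: I_def env_def)
    have b48: "\<bar>W ^ 4\<bar> \<le> W ^ 8" using Wpow_mono[of 4 8] W1 by simp
    show "safe \<sigma>' (Reg 21 .- Reg 19)" using bV[OF badd(2)[OF b48 r(2)]] by (simp add: r)
    assume g: "eval inp \<sigma>' (Reg 21 .- Reg 19) > 0"
    then have lt: "fst \<sigma>' 19 < W ^ 4" by (simp add: r)
    then have nf: "\<not> found ms \<sigma>'" by (auto simp: found_def)
    then have k: "fst \<sigma>' 18 = int k + 1" "D * W ^ 2 \<le> Np k ms" "k \<le> K" using I by (auto simp: I_def)
    have "k \<noteq> 0"
    proof
      assume "k = 0"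
      then have "D * W ^ 2 \<le> 1" using k by (simp add: Np_def)
      moreover have "1 * W ^ 2 \<le> D * W ^ 2" using D by (intro mult_right_mono) auto
      moreover have "2 \<le> W ^ 2" using Wpow_mono[of 1 2] W1 by simp
      ultimately show False by linarith
    qed
    then obtain k' where k': "k = Suc k'" by (cases k) auto
    let ?s1 = "((fst \<sigma>')(18 := int k), snd \<sigma>')"
    have e1: "env ?s1" using r(3) env_upd[of 18 "fst \<sigma>'" _ _ "snd \<sigma>'"] by simp
    have "ok fraction_prog ?s1 (K * (4 * K + 40 * LW + 10) + 6) (\<lambda>\<sigma>'. invs k ms (snd \<sigma>' 9) \<and> fst \<sigma>' 19 = ctr (fs k ms (snd \<sigma>' 9) D) \<and>
     same {5, 8, 9, 19, 22, 23, 24, 25, 26, 27, 28} {9} ?s1 \<sigma>')"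
      by (rule fraction_ok[OF e1 ms(1) _ k(3)]) (use I De in \<open>auto simp: I_def\<close>)
    then have "ok fraction_prog ?s1 (6 + K * (4 * K + 40 * LW + 10)) (I k')"
    proof (rule ok_mono)
      fix \<sigma>2 assume a: "invs k ms (snd \<sigma>2 9) \<and> fst \<sigma>2 19 = ctr (fs k ms (snd \<sigma>2 9) D) \<and>
        same {5, 8, 9, 19, 22, 23, 24, 25, 26, 27, 28} {9} ?s1 \<sigma>2"
      have e2: "env \<sigma>2" using env_same[OF e1, of "{5, 8, 9, 19, 22, 23, 24, 25, 26, 27, 28}" "{9}" \<sigma>2] a by simp
      have r2: "fst \<sigma>2 18 = int k" "snd \<sigma>2 7 = ms" "snd \<sigma>2 8 = snd \<sigma> 8" using a I by (auto simp: same_def I_def)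
      have b2: "\<bar>fst \<sigma>2 19\<bar> \<le> W ^ 8" using a center_bounds by simp
      have alt: "found ms \<sigma>2 \<or> fst \<sigma>2 19 < W ^ 4 \<and> fst \<sigma>2 18 = int k' + 1 \<and> D * W ^ 2 \<le> Np k' ms \<and> k' \<le> K"
      proof (cases "fst \<sigma>2 19 < W ^ 4")
        case False
        then have "found ms \<sigma>2" unfolding found_def using a r2 k k' by (intro exI[of _ k]) auto
        then show ?thesis ..
      next
        case True
        have W2: "4 \<le> W ^ 2" using power_mono[of 2 W 2] W1 by simp
        have "D * 4 \<le> D * W ^ 2" using W2 D(1) by (intro mult_left_mono) auto
        then have x: "4 * \<bar>D\<bar> \<le> Np k ms" using k(2) D(1) by linarith
        have N: "0 < Np k ms" "0 < Np k' ms" using Np_pos[OF ms(1)] k k' by auto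
        have "real_of_int S8 * real_of_int D / real_of_int (Np k ms) - real k \<le> real_of_int (fst \<sigma>2 19)"
          using ctr_fraction(1)[OF ms(1) k(3) _ x] a by simp
        moreover have "real_of_int (fst \<sigma>2 19) \<le> real_of_int (W ^ 4)" using True by (simp only: of_int_le_iff)
        moreover have "real k \<le> real_of_int (W ^ 4)"
        proof -
          have "int k \<le> W ^ 1" using k K_le by simp
          also have "\<dots> \<le> W ^ 4" by (rule Wpow_mono) simp
          finally have "real_of_int (int k) \<le> real_of_int (W ^ 4)" by (simp only: of_int_le_iff)
          then show ?thesis by simp
        qed
        ultimately have "real_of_int S8 * real_of_int D / real_of_int (Np k ms) \<le> 2 * real_of_int (W ^ 4)" by linarith
        then have "real_of_int S8 * real_of_int D \<le> 2 * real_of_int (W ^ 4) * real_of_int (Np k ms)"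
          using N by (simp add: pos_divide_le_eq)
        then have "real_of_int (S8 * D) \<le> real_of_int (2 * W ^ 4 * Np k ms)" by simp
        then have "S8 * D \<le> 2 * W ^ 4 * Np k ms" by (rule of_int_le_iff[THEN iffD1])
        also have "S8 = W ^ 4 * W ^ 4" by (simp flip: power_add)
        finally have "W ^ 4 * (W ^ 4 * D) \<le> W ^ 4 * (2 * Np k ms)" by (simp only: mult_ac)
        then have "W ^ 4 * D \<le> 2 * Np k ms" by (rule mult_left_le_imp_le) (use W1 in simp)
        also have "Np k ms = Np k' ms * ms k'" using k' by (simp add: Np_def)
        finally have "W ^ 4 * D \<le> 2 * (Np k' ms * ms k')" .
        moreover have "2 * (Np k' ms * ms k') \<le> Np k' ms * W ^ 2"
        proof -
          have "4 * ms k' \<le> W ^ 2" "0 < ms k'" using ms(1) ms_bounds[OF ms(1), of k'] k k' by (auto simp: moduli_def)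
          then have "2 * ms k' \<le> W ^ 2" by linarith
          then have "Np k' ms * (2 * ms k') \<le> Np k' ms * W ^ 2" using N by (intro mult_left_mono) auto
          then show ?thesis by (simp add: mult_ac)
        qed
        ultimately have "W ^ 4 * D \<le> Np k' ms * W ^ 2" by linarith
        then have "W ^ 2 * (D * W ^ 2) \<le> W ^ 2 * Np k' ms" by (simp add: mult_ac power4_eq_xxxx power2_eq_square)
        then have "D * W ^ 2 \<le> Np k' ms" by (rule mult_left_le_imp_le) (use W1 in simp)
        then show ?thesis using True r2 k k' by simp
      qed
      then show "I k' \<sigma>2" unfolding I_def using e2 r2 b2 by blast
    qed simp
    then have "ok ?b \<sigma>' (K * (4 * K + 40 * LW + 10) + 7) (I k')" using k(1,3) K_le by simp
    then show "\<exists>k'<k. ok ?b \<sigma>' (K * (4 * K + 40 * LW + 10) + 7) (I k')" using k' by blast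
  qed simp
  have "ok (While (Reg 21 .- Reg 19) ?b) ?s (K * (K * (4 * K + 40 * LW + 10) + 8) + 1)
     (\<lambda>\<sigma>'. found ms \<sigma>' \<and> same {5, 8, 9, 18, 19, 22, 23, 24, 25, 26, 27, 28} {9} \<sigma> \<sigma>')"
  proof (rule ok_mono[OF ok_frame[OF 1]])
    fix \<sigma>' assume a: "((\<exists>k. I k \<sigma>') \<and> \<not> eval inp \<sigma>' (Reg 21 .- Reg 19) > 0) \<and>
       same (regs_written (While (Reg 21 .- Reg 19) ?b)) (arrs_written (While (Reg 21 .- Reg 19) ?b)) ?s \<sigma>'"
    then have "found ms \<sigma>'" by (auto simp: I_def env_def)
    then show "found ms \<sigma>' \<and> same {5, 8, 9, 18, 19, 22, 23, 24, 25, 26, 27, 28} {9} \<sigma> \<sigma>'"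
      using a by (auto simp: same_def)
  qed simp
  then have f: "t \<ge> K * (K * (4 * K + 40 * LW + 10) + 8) + 1 \<Longrightarrow> ok (While (Reg 21 .- Reg 19) ?b) ?s t
     (\<lambda>\<sigma>'. found ms \<sigma>' \<and> same {5, 8, 9, 18, 19, 22, 23, 24, 25, 26, 27, 28} {9} \<sigma> \<sigma>')" for t
    by (rule ok_mono)
  have r3: "fst \<sigma> 3 = int K" using e by (simp add: env_def K_def)
  show ?thesis unfolding search_prog_def using K_le by (auto simp: r3 intro!: f)
qed

lemma pass2_inner:
  assumes e: "env \<sigma>" and m: "fst \<sigma> 8 = m" "0 < m" "m \<le> W ^ 2" and l: "fst \<sigma> 9 = int l" "l < S"
    and w: "snd \<sigma> 9 l = w" "\<bar>w\<bar> \<le> W ^ 2"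
    and v: "\<forall>j<d. snd \<sigma> 2 j = z j mod m" and a: "\<forall>j<d. snd \<sigma> 10 j = f j mod S8"
  shows "ok (For 4 (Reg 32) (SetA 10 (Reg 4)
        ((Arr 10 (Reg 4) .+ Arr 2 (Reg 4) .* Arr 9 (Reg 9) .mod Reg 8 .* Reg 20 .div Reg 8) .mod Reg 20))) \<sigma> (3 * d + 2)
    (\<lambda>\<sigma>'. (\<forall>j<d. snd \<sigma>' 10 j = (f j + (z j * w) mod m * S8 div m) mod S8) \<and> same {4} {10} \<sigma> \<sigma>')"
proof -
  let ?c = "SetA 10 (Reg 4)
        ((Arr 10 (Reg 4) .+ Arr 2 (Reg 4) .* Arr 9 (Reg 9) .mod Reg 8 .* Reg 20 .div Reg 8) .mod Reg 20)"
  let ?I = "\<lambda>k \<sigma>'. \<forall>j<d. snd \<sigma>' 10 j = (if j < k then (f j + (z j * w) mod m * S8 div m) mod S8 else f j mod S8)"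
  have r: "fst \<sigma> 32 = int d" "fst \<sigma> 20 = S8" using e by (auto simp: env_def regs0_def)
  have S8: "0 < S8" using W1 by simp
  show ?thesis
  proof (rule ok_mono[OF ok_For[where I = ?I and L = "int d" and t = 1]])
    fix i \<sigma>' assume i: "i < nat (int d)" "fst \<sigma>' 4 = int i" and I: "?I i \<sigma>'"
      and sm: "same (insert 4 (regs_written ?c)) (arrs_written ?c) \<sigma> \<sigma>'"
    have id: "i < d" "i < S" using i S_ge dims by auto
    have st: "fst \<sigma>' 8 = m" "fst \<sigma>' 9 = int l" "fst \<sigma>' 20 = S8" "snd \<sigma>' 9 l = w" "snd \<sigma>' 2 i = z i mod m"
      using sm m l w v id r by (auto simp: same_def)
    have ai: "snd \<sigma>' 10 i = f i mod S8" using I id by simp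
    have b1: "\<bar>z i mod m\<bar> \<le> W ^ 2" by (rule bmod[OF m(2,3)])
    have b2: "\<bar>f i mod S8\<bar> \<le> W ^ 8" by (rule bmod[OF S8]) simp
    note bb = fs_step_bounds[OF m(2,3) b1 w(2) b2, unfolded mod_mod_mult]
    have bz: "\<bar>z i mod m * w\<bar> \<le> V" by (rule fs_step_bounds(1)[OF m(2,3) b1 w(2) b2])
    have new: "(f i mod S8 + (z i * w) mod m * S8 div m) mod S8 = (f i + (z i * w) mod m * S8 div m) mod S8"
      by (rule mod_add_left_eq)
    have nb: "\<bar>(f i + (z i * w) mod m * S8 div m) mod S8\<bar> \<le> V" using bb(6) unfolding new .
    show "ok ?c \<sigma>' 1 (?I (Suc i))"
      by (simp add: st i(2) id l ai mod_mod_mult bb bz new nb) (use I in \<open>auto simp: less_Suc_eq\<close>)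
  qed (use r a nat_bounds dims in \<open>auto simp: same_def\<close>)
qed

lemma pass2_ok:
  assumes e: "env \<sigma>" and ms: "moduli ms" "snd \<sigma> 7 = ms" and J: "J \<le> K" "fst \<sigma> 18 = int J" and w: "invs J ms (snd \<sigma> 9)"
    and g: "\<forall>j<d. snd \<sigma> 5 j = gv j" "\<forall>j<d. \<bar>gv j\<bar> \<le> W"
  shows "ok pass2_prog \<sigma> (K * (120 * (d * d * nz) + 3 * d + 5) + 3 * d + 4) (\<lambda>\<sigma>'. (\<forall>j<d. snd \<sigma>' 10 j = fs J ms (snd \<sigma> 9) (Z j) mod S8) \<and>
     same {4, 5, 6, 7, 8, 9, 17, 29} {2, 3, 4, 10, 12} \<sigma> \<sigma>')"
proof -
  let ?i = "For 4 (Reg 32) (SetA 10 (Reg 4)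
        ((Arr 10 (Reg 4) .+ Arr 2 (Reg 4) .* Arr 9 (Reg 9) .mod Reg 8 .* Reg 20 .div Reg 8) .mod Reg 20))"
  let ?c = "SetR 8 (Arr 7 (Reg 9)) ;; solve_prog ;; ?i"
  let ?w = "snd \<sigma> 9"
  define I where "I k \<sigma>' \<longleftrightarrow> (\<forall>j<d. snd \<sigma>' 10 j = fs k ms ?w (Z j) mod S8)" for k and \<sigma>' :: st
  have 0: "ok (zero_prog 10 (Reg 32)) \<sigma> (3 * d + 2) (\<lambda>\<sigma>''. (\<forall>j<d. snd \<sigma>'' 10 j = 0) \<and> same {29} {10} \<sigma> \<sigma>'')"
    by (rule zero_ok) (use e S_ge dims in \<open>auto simp: same_def env_def regs0_def\<close>)
  have 1: "ok (For 9 (Reg 18) ?c) \<sigma>1 (K * (120 * (d * d * nz) + 3 * d + 5) + 2) (\<lambda>\<sigma>'. I (nat (int J)) \<sigma>' \<and>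
      same (insert 9 (regs_written ?c)) (arrs_written ?c) \<sigma>1 \<sigma>')"
    if z: "\<forall>j<d. snd \<sigma>1 10 j = 0" and s1: "same {29} {10} \<sigma> \<sigma>1" for \<sigma>1
  proof (rule ok_For[where t = "120 * (d * d * nz) + (3 * d + 3)"])
    have e1: "env \<sigma>1" using env_same[OF e s1] by simp
    fix k \<sigma>' assume k: "k < nat (int J)" "fst \<sigma>' 9 = int k" and I: "I k \<sigma>'"
      and sm: "same (insert 9 (regs_written ?c)) (arrs_written ?c) \<sigma>1 \<sigma>'"
    have kK: "k < K" "k < S" "k < J" using k J K_le by auto
    note mb = ms_bounds[OF ms(1) kK(1)]
    have e': "env \<sigma>'" using env_same[OF e1 sm] by simp
    have a': "snd \<sigma>' 7 = ms" "snd \<sigma>' 5 = snd \<sigma> 5" "snd \<sigma>' 9 = ?w" using sm s1 ms by (auto simp: same_def)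
    let ?s = "((fst \<sigma>')(8 := ms k), snd \<sigma>')"
    have es: "env ?s" using e' env_upd[of 8 "fst \<sigma>'" _ _ "snd \<sigma>'"] by simp
    have m: "modulus ?s (ms k)" by (rule modulusI[OF es _ ms(1) kK(1)]) simp
    have 1: "ok solve_prog ?s (120 * (d * d * nz)) (\<lambda>\<sigma>'. (\<forall>j<d. snd \<sigma>' 2 j = Z j mod ms k) \<and>
       snd \<sigma>' 2 d = D mod ms k \<and> same {4, 5, 6, 7, 17, 29} {2, 3, 4, 12} ?s \<sigma>')"
      by (rule solve_ok[OF m]) (use g a' in auto)
    have "ok (solve_prog ;; ?i) ?s (120 * (d * d * nz) + (3 * d + 2)) (I (Suc k))"
    proof (rule ok_seqI[OF 1])
      fix \<sigma>2 assume a: "(\<forall>j<d. snd \<sigma>2 2 j = Z j mod ms k) \<and>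
       snd \<sigma>2 2 d = D mod ms k \<and> same {4, 5, 6, 7, 17, 29} {2, 3, 4, 12} ?s \<sigma>2"
      have e2: "env \<sigma>2" using env_same[OF es, of "{4, 5, 6, 7, 17, 29}" "{2, 3, 4, 12}" \<sigma>2] a by simp
      have r: "fst \<sigma>2 9 = int k" "fst \<sigma>2 8 = ms k" "snd \<sigma>2 9 = ?w" "snd \<sigma>2 10 = snd \<sigma>' 10"
        using a k a' by (auto simp: same_def)
      have "ok ?i \<sigma>2 (3 * d + 2) (\<lambda>\<sigma>'. (\<forall>j<d. snd \<sigma>' 10 j = (fs k ms ?w (Z j) + (Z j * ?w k) mod ms k * S8 div ms k) mod S8) \<and> same {4} {10} \<sigma>2 \<sigma>')"
        by (rule pass2_inner[OF e2 r(2) _ _ r(1) kK(2)]) (use mb w kK a I r in \<open>auto simp: invs_def I_def\<close>)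
      then show "ok ?i \<sigma>2 (3 * d + 2) (I (Suc k))" by (rule ok_mono) (auto simp: I_def fs_def)
    qed simp
    then have f: "t \<ge> 120 * (d * d * nz) + (3 * d + 2) \<Longrightarrow> ok (solve_prog ;; ?i) ?s t (I (Suc k))" for t
      by (rule ok_mono)
    show "ok ?c \<sigma>' (120 * (d * d * nz) + (3 * d + 3)) (I (Suc k))"
      using kK by (simp add: k(2) a' f)
  next
    have "nat (int J) * (120 * (d * d * nz) + (3 * d + 3) + 2) \<le> K * (120 * (d * d * nz) + 3 * d + 5)"
      using J by (intro mult_mono) auto
    then show "nat (int J) * (120 * (d * d * nz) + (3 * d + 3) + 2) + 2 \<le> K * (120 * (d * d * nz) + 3 * d + 5) + 2" by simp
  qed (use J K_le s1 z in \<open>auto simp: same_def I_def fs_def\<close>)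
  show ?thesis unfolding pass2_prog_def
  proof (rule ok_seqI[OF 0])
    fix \<sigma>1 assume a: "(\<forall>j<d. snd \<sigma>1 10 j = 0) \<and> same {29} {10} \<sigma> \<sigma>1"
    show "ok (For 9 (Reg 18) ?c) \<sigma>1 (K * (120 * (d * d * nz) + 3 * d + 5) + 2) (\<lambda>\<sigma>'. (\<forall>j<d. snd \<sigma>' 10 j = fs J ms ?w (Z j) mod S8) \<and>
     same {4, 5, 6, 7, 8, 9, 17, 29} {2, 3, 4, 10, 12} \<sigma> \<sigma>')"
      by (rule ok_mono[OF 1]) (use a in \<open>auto simp: same_def I_def\<close>)
  qed simp
qed

lemma quotient_ok:
  assumes e: "env \<sigma>" and a: "\<forall>j<d. snd \<sigma> 10 j = f j mod S8" and D: "fst \<sigma> 19 = q"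
  shows "ok quotient_prog \<sigma> (10 * d + 2) (\<lambda>\<sigma>'. (\<forall>j<d. snd \<sigma>' 11 j = ctr (f j) * W div q) \<and> same {4, 22} {11} \<sigma> \<sigma>')"
proof -
  let ?c = "SetR 22 (Arr 10 (Reg 4)) ;;
      Cond (Cst 2 .* Reg 22 .- Reg 20) (SetR 22 (Reg 22 .- Reg 20)) Skip ;;
      SetA 11 (Reg 4) (Reg 22 .* Reg 14 .div Reg 19)"
  let ?I = "\<lambda>k \<sigma>'. \<forall>j<k. snd \<sigma>' 11 j = ctr (f j) * W div q"
  have r: "fst \<sigma> 32 = int d" "fst \<sigma> 20 = S8" "fst \<sigma> 14 = W" using e by (auto simp: env_def regs0_def)
  show ?thesis unfolding quotient_prog_def
  proof (rule ok_mono[OF ok_For[where I = ?I and L = "int d" and t = 4]])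
    fix i \<sigma>' assume i: "i < nat (int d)" "fst \<sigma>' 4 = int i" and I: "?I i \<sigma>'"
      and sm: "same (insert 4 (regs_written ?c)) (arrs_written ?c) \<sigma> \<sigma>'"
    have id: "i < d" "i < S" using i S_ge dims by auto
    have st: "fst \<sigma>' 14 = W" "fst \<sigma>' 19 = q" "fst \<sigma>' 20 = S8" "snd \<sigma>' 10 i = f i mod S8"
      using sm D a id r by (auto simp: same_def)
    have W: "\<bar>W\<bar> \<le> W ^ 1" using W1 by simp
    have b1: "\<bar>ctr (f i) * W\<bar> \<le> W ^ 9" by (rule bmult[OF center_bounds(5) W]) simp
    have b2: "\<bar>ctr (f i) * W div q\<bar> \<le> W ^ 9" using abs_div_le[of "ctr (f i) * W" q] b1 by linarith
    have bb: "\<bar>ctr (f i) * W\<bar> \<le> V" "\<bar>ctr (f i) * W div q\<bar> \<le> V" using bV[OF b1] bV[OF b2] by simp_all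
    show "ok ?c \<sigma>' 4 (?I (Suc i))"
    proof (cases "2 * (f i mod S8) - S8 > 0")
      case True
      then have c: "f i mod S8 - S8 = ctr (f i)" by (simp add: ctr_def)
      have cb: "2 * (f i mod S8) - S8 \<le> V" "\<bar>ctr (f i)\<bar> \<le> V"
        using center_bounds(2)[of "f i"] bV[OF center_bounds(5)[of "f i"]] by linarith+
      show ?thesis using True
        by (simp add: st i(2) id center_bounds c cb bb del: diff_gt_0_iff_gt) (use I in \<open>auto simp: less_Suc_eq\<close>)
    next
      case False
      then have c: "f i mod S8 = ctr (f i)" by (simp add: ctr_def)
      have cb: "\<bar>2 * ctr (f i)\<bar> \<le> V" "\<bar>2 * ctr (f i) - S8\<bar> \<le> V" "\<not> 2 * ctr (f i) - S8 > 0"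
        using center_bounds[of "f i"] False unfolding c by simp_all
      show ?thesis using cb(3)
        by (simp add: st i(2) id c cb bb del: diff_gt_0_iff_gt) (use I in \<open>auto simp: less_Suc_eq\<close>)
    qed
  qed (use r nat_bounds dims in \<open>auto simp: same_def\<close>)
qed

text \<open>\<open>W\<close> times coordinate \<open>i\<close> of \<open>A y - T c\<close> for
  \<open>y = yh / W\<close>.\<close>

definition "xh yh i = (\<Sum>e<nz. if ro e = i then va e * yh (co e) else 0) - T * cv i * W"

lemma output_ok:
  assumes e: "env \<sigma>" and y: "\<forall>j<d. snd \<sigma> 11 j = yh j" "\<forall>j<d. \<bar>yh j\<bar> \<le> W ^ 9"
  shows "ok output_prog \<sigma> (30 * nz) (\<lambda>\<sigma>'. \<forall>i<n. \<forall>k. (k = 2 * i \<or> k = 2 * i + 1) \<longrightarrow>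
     (if k < 64 then snd \<sigma>' 15 k else snd \<sigma>' 0 k) = (if k = 2 * i then xh yh i else W))"
proof -
  have r: "fst \<sigma> 32 = int d" "fst \<sigma> 0 = int n" "fst \<sigma> 2 = int nz" "fst \<sigma> 13 = T" "fst \<sigma> 14 = W" "fst \<sigma> 31 = 7 + 3 * int nz + int d"
    using e by (auto simp: env_def regs0_def)
  let ?c1 = "SetA 12 (Reg 4) (Cst 0 .- Reg 13 .* In (Reg 31 .+ Reg 4) .* Reg 14)"
  let ?c2 = "SetA 12 row_e (Arr 12 row_e .+ val_e .* Arr 11 col_e)"
  let ?c3 = "SetA 15 (Cst 2 .* Reg 4) (Arr 12 (Reg 4)) ;; SetA 15 (Cst 2 .* Reg 4 .+ Cst 1) (Reg 14)"
  let ?c4 = "SetO (Cst 64 .+ Reg 4) (Arr 15 (Cst 64 .+ Reg 4))"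
  define xk where "xk k i = (\<Sum>e<k. if ro e = i then va e * yh (co e) else 0) - T * cv i * W" for k i
  have xkn: "xk nz = xh yh" by (simp add: xk_def xh_def fun_eq_iff)
  have tb: "\<bar>T * cv i\<bar> \<le> W ^ 2" "\<bar>T * cv i * W\<bar> \<le> W ^ 3" if "i < n" for i
  proof -
    have a: "\<bar>T\<bar> \<le> W ^ 1" "\<bar>cv i\<bar> \<le> W ^ 1" "\<bar>W\<bar> \<le> W ^ 1" using T_le T_ge cv_le[OF that] sgW W1 by auto
    show b: "\<bar>T * cv i\<bar> \<le> W ^ 2" by (rule bmult[OF a(1,2)]) simp
    show "\<bar>T * cv i * W\<bar> \<le> W ^ 3" by (rule bmult[OF b a(3)]) simp
  qed
  have yb: "\<bar>va e * yh (co e)\<bar> \<le> W ^ 10" if "e < nz" for e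
    by (rule bmult[OF va_W[OF that]]) (use y co[OF that] in auto)
  have xb: "\<bar>xk k i\<bar> \<le> W ^ 12" if "k \<le> nz" "i < n" for k i
  proof -
    have "\<bar>\<Sum>e<k. if ro e = i then va e * yh (co e) else 0\<bar> \<le> (\<Sum>e<k. W ^ 10)"
      using that yb W1 by (intro order_trans[OF sum_abs] sum_mono) auto
    also have "\<dots> = int k * W ^ 10" by simp
    also have "\<dots> \<le> W * W ^ 10" using that nat_bounds W1 by (intro mult_right_mono) auto
    finally have 1: "\<bar>\<Sum>e<k. if ro e = i then va e * yh (co e) else 0\<bar> \<le> W ^ 11" by (simp add: power_Suc[symmetric])
    have 2: "\<bar>T * cv i * W\<bar> \<le> W ^ 11" by (rule bup[OF tb(2)[OF that(2)]]) simp
    show ?thesis unfolding xk_def using badd(2)[OF 1 2] by simp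
  qed
  have 1: "ok (For 4 (Reg 0) ?c1) \<sigma> (3 * n + 2) (\<lambda>\<sigma>'. (\<forall>i<n. snd \<sigma>' 12 i = xk 0 i) \<and> same {4} {12} \<sigma> \<sigma>')"
  proof (rule ok_mono[OF ok_For[where I = "\<lambda>k \<sigma>'. \<forall>i<k. snd \<sigma>' 12 i = xk 0 i" and L = "int n" and t = 1]])
    fix k \<sigma>' assume k: "k < nat (int n)" "fst \<sigma>' 4 = int k" and I: "\<forall>i<k. snd \<sigma>' 12 i = xk 0 i"
      and sm: "same (insert 4 (regs_written ?c1)) (arrs_written ?c1) \<sigma> \<sigma>'"
    have kn: "k < n" using k by simp
    have i: "nat (7 + 3 * int nz + int d + int k) = 7 + 3 * nz + d + k" "7 + 3 * int nz + int d + int k \<le> V" "k < S"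
      using kn nat_bounds dims S_ge by auto
    have b: "\<bar>cv k\<bar> \<le> V" using cv_le[OF kn] sgW V_W by linarith
    have bb: "\<bar>T * cv k\<bar> \<le> V" "\<bar>T * cv k * W\<bar> \<le> V" using bV[OF tb(1)[OF kn]] bV[OF tb(2)[OF kn]] by simp_all
    have st: "fst \<sigma>' 31 = 7 + 3 * int nz + int d" "fst \<sigma>' 13 = T" "fst \<sigma>' 14 = W" using sm r by (auto simp: same_def)
    show "ok ?c1 \<sigma>' 1 (\<lambda>\<sigma>'. \<forall>i<Suc k. snd \<sigma>' 12 i = xk 0 i)"
      by (simp add: st k(2) i inp_c[OF kn] b bb) (use I in \<open>auto simp: less_Suc_eq xk_def\<close>)
  qed (use r nat_bounds dims in \<open>auto simp: same_def\<close>)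
  have 2: "ok (For 7 (Reg 2) ?c2) \<sigma>1 (3 * nz + 2) (\<lambda>\<sigma>'. (\<forall>i<n. snd \<sigma>' 12 i = xh yh i) \<and> same {7} {12} \<sigma>1 \<sigma>')"
    if s: "\<forall>i<n. snd \<sigma>1 12 i = xk 0 i" "same {4} {12} \<sigma> \<sigma>1" for \<sigma>1
  proof (rule ok_mono[OF ok_For[where I = "\<lambda>k \<sigma>'. \<forall>i<n. snd \<sigma>' 12 i = xk k i" and L = "int nz" and t = 1]])
    fix k \<sigma>' assume k: "k < nat (int nz)" "fst \<sigma>' 7 = int k" and I: "\<forall>i<n. snd \<sigma>' 12 i = xk k i"
      and sm: "same (insert 7 (regs_written ?c2)) (arrs_written ?c2) \<sigma>1 \<sigma>'"
    have kn: "k < nz" using k by simp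
    note en = entry[OF kn]
    have st: "snd \<sigma>' 11 (co k) = yh (co k)" "snd \<sigma>' 12 (ro k) = xk k (ro k)" using sm s y en I by (auto simp: same_def)
    have nw: "xk k (ro k) + va k * yh (co k) = xk (Suc k) (ro k)" by (simp add: xk_def algebra_simps)
    have ot: "xk (Suc k) i = xk k i" if "i \<noteq> ro k" for i using that by (simp add: xk_def)
    have bb: "\<bar>va k * yh (co k)\<bar> \<le> V" "\<bar>xk (Suc k) (ro k)\<bar> \<le> V"
      using bV[OF yb[OF kn]] bV[OF xb[of "Suc k" "ro k"]] kn en(5) by auto
    show "ok ?c2 \<sigma>' 1 (\<lambda>\<sigma>'. \<forall>i<n. snd \<sigma>' 12 i = xk (Suc k) i)"
      by (simp add: en st k(2) bb nw) (use I ot in auto)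
  qed (use s r xkn nat_bounds dims in \<open>auto simp: same_def\<close>)
  have 3: "ok (For 4 (Reg 0) ?c3) \<sigma>2 (4 * n + 2) (\<lambda>\<sigma>'. (\<forall>i<n. snd \<sigma>' 15 (2 * i) = xh yh i \<and> snd \<sigma>' 15 (2 * i + 1) = W) \<and> same {4} {15} \<sigma>2 \<sigma>')"
    if s: "\<forall>i<n. snd \<sigma>2 12 i = xh yh i" "same {4, 7} {12} \<sigma> \<sigma>2" for \<sigma>2
  proof (rule ok_mono[OF ok_For[where I = "\<lambda>k \<sigma>'. \<forall>i<k. snd \<sigma>' 15 (2 * i) = xh yh i \<and> snd \<sigma>' 15 (2 * i + 1) = W" and L = "int n" and t = 2]])
    fix k \<sigma>' assume k: "k < nat (int n)" "fst \<sigma>' 4 = int k" and I: "\<forall>i<k. snd \<sigma>' 15 (2 * i) = xh yh i \<and> snd \<sigma>' 15 (2 * i + 1) = W"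
      and sm: "same (insert 4 (regs_written ?c3)) (arrs_written ?c3) \<sigma>2 \<sigma>'"
    have kn: "k < n" using k by simp
    have i: "nat (2 * int k) = 2 * k" "nat (2 * int k + 1) = 2 * k + 1" "2 * int k \<le> V" "2 * int k + 1 \<le> V"
      "2 * int k < int S" "2 * int k + 1 < int S" "k < S"
      using kn nat_bounds dims S_ge by auto
    have st: "snd \<sigma>' 12 k = xh yh k" "fst \<sigma>' 14 = W" using sm s r kn by (auto simp: same_def)
    show "ok ?c3 \<sigma>' 2 (\<lambda>\<sigma>'. \<forall>i<Suc k. snd \<sigma>' 15 (2 * i) = xh yh i \<and> snd \<sigma>' 15 (2 * i + 1) = W)"
      by (simp add: st k(2) i) (use I in \<open>auto simp: less_Suc_eq\<close>)
  qed (use s r nat_bounds dims in \<open>auto simp: same_def\<close>)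
  have 4: "ok (For 4 (Cst 2 .* Reg 0 .- Cst 64) ?c4) \<sigma>3 (6 * n + 2) (\<lambda>\<sigma>'. \<forall>i<n. \<forall>k. (k = 2 * i \<or> k = 2 * i + 1) \<longrightarrow>
     (if k < 64 then snd \<sigma>' 15 k else snd \<sigma>' 0 k) = (if k = 2 * i then xh yh i else W))"
    if s: "\<forall>i<n. snd \<sigma>3 15 (2 * i) = xh yh i \<and> snd \<sigma>3 15 (2 * i + 1) = W" "same {4, 7} {12, 15} \<sigma> \<sigma>3" for \<sigma>3
  proof (rule ok_mono[OF ok_For[where I = "\<lambda>k \<sigma>'. \<forall>i<k. snd \<sigma>' 0 (64 + i) = snd \<sigma>3 15 (64 + i)" and L = "2 * int n - 64" and t = 1]])
    fix k \<sigma>' assume k: "k < nat (2 * int n - 64)" "fst \<sigma>' 4 = int k" and I: "\<forall>i<k. snd \<sigma>' 0 (64 + i) = snd \<sigma>3 15 (64 + i)"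
      and sm: "same (insert 4 (regs_written ?c4)) (arrs_written ?c4) \<sigma>3 \<sigma>'"
    have kn: "64 + int k < 2 * int n" using k by linarith
    have i: "nat (64 + int k) = 64 + k" "64 + int k \<le> V" "64 + int k < int S" "64 + int k < int base"
      using kn nat_bounds dims S_ge by (auto simp: base_def)
    have st: "snd \<sigma>' 15 = snd \<sigma>3 15" using sm by (auto simp: same_def)
    show "ok ?c4 \<sigma>' 1 (\<lambda>\<sigma>'. \<forall>i<Suc k. snd \<sigma>' 0 (64 + i) = snd \<sigma>3 15 (64 + i))"
      by (simp add: st k(2) i) (use I in \<open>auto simp: less_Suc_eq\<close>)
  next
    fix \<sigma>' assume a: "(\<forall>i<nat (2 * int n - 64). snd \<sigma>' 0 (64 + i) = snd \<sigma>3 15 (64 + i)) \<and>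
      same (insert 4 (regs_written ?c4)) (arrs_written ?c4) \<sigma>3 \<sigma>'"
    show "\<forall>i<n. \<forall>k. (k = 2 * i \<or> k = 2 * i + 1) \<longrightarrow>
     (if k < 64 then snd \<sigma>' 15 k else snd \<sigma>' 0 k) = (if k = 2 * i then xh yh i else W)"
    proof (intro allI impI)
      fix i k assume ik: "i < n" "k = 2 * i \<or> k = 2 * i + 1"
      have "(if k < 64 then snd \<sigma>' 15 k else snd \<sigma>' 0 k) = snd \<sigma>3 15 k"
      proof (cases "k < 64")
        case True
        then show ?thesis using a by (auto simp: same_def)
      next
        case False
        then have "k - 64 < nat (2 * int n - 64)" "64 + (k - 64) = k" using ik by auto
        then show ?thesis using a False by metis
      qed
      then show "(if k < 64 then snd \<sigma>' 15 k else snd \<sigma>' 0 k) = (if k = 2 * i then xh yh i else W)"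
        using s(1) ik by auto
    qed
  qed (use s r nat_bounds dims in \<open>auto simp: same_def\<close>)
  show ?thesis unfolding output_prog_def
  proof (rule ok_seqI[OF 1])
    fix \<sigma>1 assume a1: "(\<forall>i<n. snd \<sigma>1 12 i = xk 0 i) \<and> same {4} {12} \<sigma> \<sigma>1"
    show "ok (For 7 (Reg 2) ?c2 ;; For 4 (Reg 0) ?c3 ;; For 4 (Cst 2 .* Reg 0 .- Cst 64) ?c4) \<sigma>1 ((3 * nz + 2) + ((4 * n + 2) + (6 * n + 2)))
     (\<lambda>\<sigma>'. \<forall>i<n. \<forall>k. (k = 2 * i \<or> k = 2 * i + 1) \<longrightarrow>
     (if k < 64 then snd \<sigma>' 15 k else snd \<sigma>' 0 k) = (if k = 2 * i then xh yh i else W))"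
    proof (rule ok_seqI[OF 2])
      fix \<sigma>2 assume a2: "(\<forall>i<n. snd \<sigma>2 12 i = xh yh i) \<and> same {7} {12} \<sigma>1 \<sigma>2"
      have s2: "same {4, 7} {12} \<sigma> \<sigma>2" using a1 a2 by (auto simp: same_def)
      show "ok (For 4 (Reg 0) ?c3 ;; For 4 (Cst 2 .* Reg 0 .- Cst 64) ?c4) \<sigma>2 ((4 * n + 2) + (6 * n + 2))
     (\<lambda>\<sigma>'. \<forall>i<n. \<forall>k. (k = 2 * i \<or> k = 2 * i + 1) \<longrightarrow>
     (if k < 64 then snd \<sigma>' 15 k else snd \<sigma>' 0 k) = (if k = 2 * i then xh yh i else W))"
      proof (rule ok_seqI[OF 3[OF _ s2]])
        fix \<sigma>3 assume a3: "(\<forall>i<n. snd \<sigma>3 15 (2 * i) = xh yh i \<and> snd \<sigma>3 15 (2 * i + 1) = W) \<and> same {4} {15} \<sigma>2 \<sigma>3"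
        show "ok (For 4 (Cst 2 .* Reg 0 .- Cst 64) ?c4) \<sigma>3 (6 * n + 2)
     (\<lambda>\<sigma>'. \<forall>i<n. \<forall>k. (k = 2 * i \<or> k = 2 * i + 1) \<longrightarrow>
     (if k < 64 then snd \<sigma>' 15 k else snd \<sigma>' 0 k) = (if k = 2 * i then xh yh i else W))"
          by (rule 4) (use a3 s2 in \<open>auto simp: same_def\<close>)
      qed (use a2 in auto)
    qed (use a1 in auto)
  qed (use dims dnz in linarith)
qed

end

section \<open>Running time and accuracy of the whole program\<close>

context lp
begin

text \<open>The leading terms are the \<open>2 * K\<close> runs of \<open>solve_prog\<close>, each
  of order \<open>d * d * nz\<close>. The terms from primes and cofactors are of order
  \<open>d * d * d\<close> and \<open>d * d * LW\<close>, which \<open>1 \<le> nz\<close> and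
  \<open>1 \<le> LW\<close> absorb.\<close>

lemma total_time:
  "(20 * nz + 10 * LW + 30) + ((10 * nz) + ((16 * K\<^sup>2 * (4 * K + 2 * LW + 11) + 3) +
    ((K * (120 * (d * d * nz) + 4) + 2) + ((K * (K * (4 * K + 40 * LW + 10) + 8) + 3) +
    ((K * (120 * (d * d * nz) + 3 * d + 5) + 3 * d + 4) + ((10 * d + 2) + 30 * nz))))))
    \<le> 80000 * (d * d * d * nz * LW)"
proof -
  define P where "P = d * d * d * nz * LW"
  have up: "x \<le> x * y" if "1 \<le> y" for x y :: nat using that by simp
  have d1: "1 \<le> d" and z1: "1 \<le> nz" and L1: "1 \<le> LW" using dims dnz LW_ge by auto
  have a: "d * d * d * nz \<le> P" unfolding P_def by (rule up[OF L1])
  have b: "d * d * d \<le> d * d * d * nz" "d * d \<le> d * d * d" "d \<le> d * d" using up[OF z1] up[OF d1] by auto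
  have c: "d * d * d * LW \<le> P"
    unfolding P_def using z1 by (intro mult_right_mono up) auto
  have e: "d * d * LW \<le> d * d * d * LW" "d * LW \<le> d * d * LW" "LW \<le> d * LW"
    using up[OF d1] d1 by (auto intro!: mult_right_mono)
  have f: "nz \<le> d * nz" "d * nz \<le> d * d * nz" "d * d * nz \<le> d * d * d * nz"
    using up[OF d1] d1 by (auto intro!: mult_right_mono)
  have m: "1 \<le> P" "d \<le> P" "d * d \<le> P" "d * d * d \<le> P" "nz \<le> P" "LW \<le> P" "d * LW \<le> P" "d * d * LW \<le> P"
    using a b c e f d1 by linarith+
  have K9: "K \<le> 9 * d" by (rule K_le)
  have "16 * K\<^sup>2 * (4 * K + 2 * LW + 11) \<le> 16 * (9 * d)\<^sup>2 * (4 * (9 * d) + 2 * LW + 11)"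
    using K9 by (intro mult_mono power_mono add_mono) auto
  also have "\<dots> = 46656 * (d * d * d) + 2592 * (d * d * LW) + 14256 * (d * d)"
    by (simp add: power2_eq_square algebra_simps)
  finally have 1: "16 * K\<^sup>2 * (4 * K + 2 * LW + 11) \<le> 63504 * P" using m by linarith
  have "K * (120 * (d * d * nz) + 4) \<le> 9 * d * (120 * (d * d * nz) + 4)" using K9 by (intro mult_mono) auto
  also have "\<dots> = 1080 * (d * d * d * nz) + 36 * d" by (simp add: algebra_simps)
  finally have 2: "K * (120 * (d * d * nz) + 4) \<le> 1116 * P" using m a by linarith
  have "K * (K * (4 * K + 40 * LW + 10) + 8) \<le> 9 * d * (9 * d * (4 * (9 * d) + 40 * LW + 10) + 8)"
    using K9 by (intro mult_mono add_mono) auto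
  also have "\<dots> = 2916 * (d * d * d) + 3240 * (d * d * LW) + 810 * (d * d) + 72 * d" by (simp add: algebra_simps)
  finally have 3: "K * (K * (4 * K + 40 * LW + 10) + 8) \<le> 7038 * P" using m by linarith
  have "K * (120 * (d * d * nz) + 3 * d + 5) \<le> 9 * d * (120 * (d * d * nz) + 3 * d + 5)" using K9 by (intro mult_mono) auto
  also have "\<dots> = 1080 * (d * d * d * nz) + 27 * (d * d) + 45 * d" by (simp add: algebra_simps)
  finally have 4: "K * (120 * (d * d * nz) + 3 * d + 5) \<le> 1152 * P" using m a by linarith
  show ?thesis unfolding P_def[symmetric] using 1 2 3 4 m by linarith
qed

lemma lp_ok:
  assumes D: "0 < D" "D \<le> W ^ d"
    and y: "\<And>j. j < d \<Longrightarrow> real_of_int (Z j) = real_of_int D * y j" "\<And>j. j < d \<Longrightarrow> 1 + \<bar>y j\<bar> \<le> real_of_int W"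
  shows "ok lp_prog (\<lambda>_. 0, \<lambda>_ _. 0) (80000 * (d * d * d * nz * LW)) (\<lambda>\<sigma>'. \<exists>yh.
     (\<forall>j<d. \<bar>real_of_int (yh j) / real_of_int W - y j\<bar> \<le> 2 / real_of_int W) \<and>
     (\<forall>i<n. \<forall>k. (k = 2 * i \<or> k = 2 * i + 1) \<longrightarrow>
       (if k < 64 then snd \<sigma>' 15 k else snd \<sigma>' 0 k) = (if k = 2 * i then xh yh i else W)))"
    (is "ok _ _ _ ?Q")
proof -
  have Wr: "0 < real_of_int W" using W1 by simp
  \<comment> \<open>One \<open>1 / W\<close> is the error of the quotient of the two fractions, the
    other comes from rounding it down to a multiple of \<open>1 / W\<close>.\<close>
  have acc: "\<bar>real_of_int (ctr (fs J ms w (Z j)) * W div q) / real_of_int W - y j\<bar> \<le> 2 / real_of_int W"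
    if ms: "moduli ms" and J: "J \<le> K" and w: "invs J ms w" and q: "q = ctr (fs J ms w D)" "W ^ 4 \<le> q"
      and N: "D * W ^ 2 \<le> Np J ms" and j: "j < d" for J ms w q j
  proof -
    let ?s = "real_of_int S8 / real_of_int (Np J ms)"
    have W4: "4 \<le> W ^ 2" using power_mono[of 2 W 2] W1 by simp
    have "D * 4 \<le> D * W ^ 2" using W4 D(1) by (intro mult_left_mono) auto
    then have xD: "4 * \<bar>D\<bar> \<le> Np J ms" using N D(1) by linarith
    \<comment> \<open>\<open>Z j\<close> is \<open>D * y j\<close>, at most \<open>D * W\<close> in
      absolute value, and \<open>4 * W \<le> W * W\<close>.\<close>
    have xZ: "4 * \<bar>Z j\<bar> \<le> Np J ms"
    proof -
      have "real_of_int (4 * \<bar>Z j\<bar>) = 4 * \<bar>real_of_int (Z j)\<bar>" by (simp only: of_int_mult of_int_abs of_int_numeral)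
      also have "\<dots> = 4 * (real_of_int D * \<bar>y j\<bar>)" unfolding y(1)[OF j] using D(1) by (simp add: abs_mult)
      also have "\<dots> \<le> 4 * (real_of_int D * real_of_int W)" using y(2)[OF j] D(1) by (intro mult_left_mono) auto
      also have "\<dots> = real_of_int (D * (4 * W))" by simp
      also have "\<dots> \<le> real_of_int (D * (W * W))"
        using D(1) W_ge(4) by (intro of_int_le_iff[THEN iffD2] mult_left_mono mult_right_mono) auto
      also have "\<dots> \<le> real_of_int (Np J ms)"
        using N by (intro of_int_le_iff[THEN iffD2]) (simp add: power2_eq_square)
      finally show ?thesis by (rule of_int_le_iff[THEN iffD1])
    qed
    note cD = ctr_fraction[OF ms J w xD] and cZ = ctr_fraction[OF ms J w xZ]
    have q4: "(real_of_int W) ^ 4 \<le> real_of_int q"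
    proof -
      have "real_of_int (W ^ 4) \<le> real_of_int q" using q(2) by (rule of_int_le_iff[THEN iffD2])
      then show ?thesis by simp
    qed
    let ?a = "ctr (fs J ms w (Z j))"
    have "\<bar>real_of_int ?a / real_of_int q - y j\<bar> \<le> 1 / real_of_int W"
    proof (rule fraction_quotient[where s = ?s and D = "real_of_int D" and J = "real J"])
      show "?s * (real_of_int D * y j) - real J \<le> real_of_int ?a" "real_of_int ?a \<le> ?s * (real_of_int D * y j)"
        using cZ unfolding y(1)[OF j, symmetric] by simp_all
      show "?s * real_of_int D - real J \<le> real_of_int q" "real_of_int q \<le> ?s * real_of_int D"
        using cD unfolding q(1) by simp_all
      have "int J \<le> W" using J K_le by simp
      then have "real_of_int (int J) \<le> real_of_int W" by (rule of_int_le_iff[THEN iffD2])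
      then show "real J \<le> real_of_int W" by simp
    qed (use q4 y(2)[OF j] in auto)
    moreover have "\<bar>real_of_int (?a * W div q) / real_of_int W - real_of_int ?a / real_of_int q\<bar> \<le> 1 / real_of_int W"
    proof -
      let ?x = "real_of_int (?a * W) / real_of_int q"
      have "\<lfloor>?x\<rfloor> = ?a * W div q" by (rule floor_divide_of_int_eq)
      then have "real_of_int (?a * W div q) = real_of_int \<lfloor>?x\<rfloor>" by simp
      then have "\<bar>real_of_int (?a * W div q) - ?x\<bar> \<le> 1" by linarith
      then have "\<bar>(real_of_int (?a * W div q) - ?x) / real_of_int W\<bar> \<le> 1 / real_of_int W"
        unfolding abs_divide using Wr by (intro frac_le) auto
      moreover have "?x / real_of_int W = real_of_int ?a / real_of_int q" using Wr by simp
      ultimately show ?thesis by (simp add: diff_divide_distrib)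
    qed
    ultimately show ?thesis by linarith
  qed
  have "ok lp_prog (\<lambda>_. 0, \<lambda>_ _. 0) ((20 * nz + 10 * LW + 30) + ((10 * nz) + ((16 * K\<^sup>2 * (4 * K + 2 * LW + 11) + 3) +
    ((K * (120 * (d * d * nz) + 4) + 2) + ((K * (K * (4 * K + 40 * LW + 10) + 8) + 3) +
    ((K * (120 * (d * d * nz) + 3 * d + 5) + 3 * d + 4) + ((10 * d + 2) + 30 * nz))))))) ?Q"
    unfolding lp_prog_def
  proof (rule ok_seqI[OF init_ok _ order_refl], elim conjE)
    fix \<sigma>1 :: st assume e1: "env \<sigma>1"
    note g = rhs_ok(1)[OF e1]
    show "ok (rhs_prog ;; primes_prog ;; pass1_prog ;; search_prog ;; pass2_prog ;; quotient_prog ;; output_prog) \<sigma>1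
      ((10 * nz) + ((16 * K\<^sup>2 * (4 * K + 2 * LW + 11) + 3) +
    ((K * (120 * (d * d * nz) + 4) + 2) + ((K * (K * (4 * K + 40 * LW + 10) + 8) + 3) +
    ((K * (120 * (d * d * nz) + 3 * d + 5) + 3 * d + 4) + ((10 * d + 2) + 30 * nz)))))) ?Q"
    proof (rule ok_seqI[OF rhs_ok(2)[OF e1] _ order_refl], elim conjE)
      fix \<sigma>2 :: st assume g2: "\<forall>j<d. snd \<sigma>2 5 j = gv j" and s2: "same {4, 7} {5} \<sigma>1 \<sigma>2"
      have e2: "env \<sigma>2" using env_same[OF e1 s2] by simp
      show "ok (primes_prog ;; pass1_prog ;; search_prog ;; pass2_prog ;; quotient_prog ;; output_prog) \<sigma>2
       ((16 * K\<^sup>2 * (4 * K + 2 * LW + 11) + 3) +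
    ((K * (120 * (d * d * nz) + 4) + 2) + ((K * (K * (4 * K + 40 * LW + 10) + 8) + 3) +
    ((K * (120 * (d * d * nz) + 3 * d + 5) + 3 * d + 4) + ((10 * d + 2) + 30 * nz))))) ?Q"
      proof (rule ok_seqI[OF primes_ok[OF e2] _ order_refl], elim conjE)
        fix \<sigma>3 :: st assume ms: "moduli (snd \<sigma>3 7)" and s3: "same {4, 8, 10, 11, 12} {6, 7} \<sigma>2 \<sigma>3"
        have e3: "env \<sigma>3" using env_same[OF e2 s3] by simp
        have g3: "\<forall>j<d. snd \<sigma>3 5 j = gv j" using g2 s3 by (simp add: same_def)
        show "ok (pass1_prog ;; search_prog ;; pass2_prog ;; quotient_prog ;; output_prog) \<sigma>3
    ((K * (120 * (d * d * nz) + 4) + 2) + ((K * (K * (4 * K + 40 * LW + 10) + 8) + 3) +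
    ((K * (120 * (d * d * nz) + 3 * d + 5) + 3 * d + 4) + ((10 * d + 2) + 30 * nz)))) ?Q"
        proof (rule ok_seqI[OF pass1_ok[OF e3 ms g3 g] _ order_refl], elim conjE)
          fix \<sigma>4 :: st assume De: "\<forall>l<K. snd \<sigma>4 8 l = D mod snd \<sigma>3 7 l"
            and s4: "same {4, 5, 6, 7, 8, 9, 17, 29} {2, 3, 4, 8, 12} \<sigma>3 \<sigma>4"
          have e4: "env \<sigma>4" using env_same[OF e3 s4] by simp
          have a4: "\<forall>j<d. snd \<sigma>4 5 j = gv j" "snd \<sigma>4 7 = snd \<sigma>3 7" using g3 s4 by (simp_all add: same_def)
          show "ok (search_prog ;; pass2_prog ;; quotient_prog ;; output_prog) \<sigma>4
    ((K * (K * (4 * K + 40 * LW + 10) + 8) + 3) +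
    ((K * (120 * (d * d * nz) + 3 * d + 5) + 3 * d + 4) + ((10 * d + 2) + 30 * nz))) ?Q"
          proof (rule ok_seqI[OF search_ok[OF e4 ms a4(2) De D] _ order_refl], elim conjE)
            fix \<sigma>5 :: st assume fo: "found (snd \<sigma>3 7) \<sigma>5"
              and s5: "same {5, 8, 9, 18, 19, 22, 23, 24, 25, 26, 27, 28} {9} \<sigma>4 \<sigma>5"
            have e5: "env \<sigma>5" using env_same[OF e4 s5] by simp
            have a5: "\<forall>j<d. snd \<sigma>5 5 j = gv j" "snd \<sigma>5 7 = snd \<sigma>3 7" using a4 s5 by (simp_all add: same_def)
            obtain J where J: "J \<le> K" "fst \<sigma>5 18 = int J" and w: "invs J (snd \<sigma>3 7) (snd \<sigma>5 9)"
              and q: "fst \<sigma>5 19 = ctr (fs J (snd \<sigma>3 7) (snd \<sigma>5 9) D)" "W ^ 4 \<le> fst \<sigma>5 19" "D * W ^ 2 \<le> Np J (snd \<sigma>3 7)"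
              using fo unfolding found_def by blast
            show "ok (pass2_prog ;; quotient_prog ;; output_prog) \<sigma>5
    ((K * (120 * (d * d * nz) + 3 * d + 5) + 3 * d + 4) + ((10 * d + 2) + 30 * nz)) ?Q"
            proof (rule ok_seqI[OF pass2_ok[OF e5 ms a5(2) J w a5(1) g] _ order_refl], elim conjE)
              fix \<sigma>6 :: st assume f6: "\<forall>j<d. snd \<sigma>6 10 j = fs J (snd \<sigma>3 7) (snd \<sigma>5 9) (Z j) mod S8"
                and s6: "same {4, 5, 6, 7, 8, 9, 17, 29} {2, 3, 4, 10, 12} \<sigma>5 \<sigma>6"
              have e6: "env \<sigma>6" using env_same[OF e5 s6] by simp
              have q6: "fst \<sigma>6 19 = fst \<sigma>5 19" using s6 by (simp add: same_def)
              define yh where "yh j = ctr (fs J (snd \<sigma>3 7) (snd \<sigma>5 9) (Z j)) * W div fst \<sigma>5 19" for j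
              have yb: "\<forall>j<d. \<bar>yh j\<bar> \<le> W ^ 9"
              proof (intro allI impI)
                fix j
                have Wb: "\<bar>W\<bar> \<le> W ^ 1" using W1 by simp
                have "\<bar>ctr (fs J (snd \<sigma>3 7) (snd \<sigma>5 9) (Z j)) * W\<bar> \<le> W ^ 9" by (rule bmult[OF center_bounds(5) Wb]) simp
                then show "\<bar>yh j\<bar> \<le> W ^ 9" unfolding yh_def by (rule order_trans[OF abs_div_le])
              qed
              have ya: "\<forall>j<d. \<bar>real_of_int (yh j) / real_of_int W - y j\<bar> \<le> 2 / real_of_int W"
                using acc[OF ms J(1) w q] by (simp add: yh_def)
              show "ok (quotient_prog ;; output_prog) \<sigma>6 ((10 * d + 2) + 30 * nz) ?Q"
              proof (rule ok_seqI[OF quotient_ok[OF e6 f6 q6] _ order_refl], elim conjE)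
                fix \<sigma>7 :: st assume y7: "\<forall>j<d. snd \<sigma>7 11 j = ctr (fs J (snd \<sigma>3 7) (snd \<sigma>5 9) (Z j)) * W div fst \<sigma>5 19"
                  and s7: "same {4, 22} {11} \<sigma>6 \<sigma>7"
                have e7: "env \<sigma>7" using env_same[OF e6 s7] by simp
                have y7': "\<forall>j<d. snd \<sigma>7 11 j = yh j" using y7 by (simp add: yh_def)
                show "ok output_prog \<sigma>7 (30 * nz) ?Q"
                  by (rule ok_mono[OF output_ok[OF e7 y7' yb] order_refl]) (use ya in blast)
              qed
            qed
          qed
        qed
      qed
    qed
  qed
  then show ?thesis by (rule ok_mono) (use total_time in auto)
qed

end

section \<open>The linear program in coordinates\<close>

lemma ip_Cauchy_Schwarz: "(ip n x y)\<^sup>2 \<le> ip n x x * ip n y y"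
proof (cases "ip n y y = 0")
  case True
  then have "\<forall>i<n. y i = 0" using ip_zero by blast
  then have "ip n x y = 0" by (simp add: ip_def)
  then show ?thesis using True by simp
next
  case False
  then have p: "0 < ip n y y" using ip_nonneg[of n y] by linarith
  define s where "s = - (ip n x y / ip n y y)"
  have "0 \<le> ip n (\<lambda>i. x i + s * y i) (\<lambda>i. x i + s * y i)" by (rule ip_nonneg)
  also have "\<dots> = ip n x x + 2 * s * ip n x y + s\<^sup>2 * ip n y y"
    by (simp add: ip_add ip_add2 ip_scale ip_scale2 ip_sym[of n y x] power2_eq_square algebra_simps)
  also have "\<dots> = ip n x x - (ip n x y)\<^sup>2 / ip n y y"
    using p by (simp add: s_def power2_eq_square field_simps)
  finally show ?thesis using p by (simp add: field_simps)
qed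

lemma ip_le_sqrt: "ip n x x \<le> a \<Longrightarrow> ip n y y \<le> b \<Longrightarrow> \<bar>ip n x y\<bar> \<le> sqrt (a * b)"
proof -
  assume a: "ip n x x \<le> a" "ip n y y \<le> b"
  have "(ip n x y)\<^sup>2 \<le> a * b"
    using ip_Cauchy_Schwarz[of n x y] mult_mono[OF a] ip_nonneg[of n x] ip_nonneg[of n y] a by linarith
  then show ?thesis by (simp add: real_le_rsqrt)
qed

definition av :: "nat \<Rightarrow> (nat \<Rightarrow> nat \<Rightarrow> real) \<Rightarrow> (nat \<Rightarrow> real) \<Rightarrow> nat \<Rightarrow> real" where
  "av d a x i = (\<Sum>j<d. a i j * x j)"
definition atv :: "nat \<Rightarrow> (nat \<Rightarrow> nat \<Rightarrow> real) \<Rightarrow> (nat \<Rightarrow> real) \<Rightarrow> nat \<Rightarrow> real" where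
  "atv n a z j = (\<Sum>i<n. a i j * z i)"
definition gram :: "nat \<Rightarrow> (nat \<Rightarrow> nat \<Rightarrow> real) \<Rightarrow> nat \<Rightarrow> nat \<Rightarrow> real" where
  "gram n a j k = (\<Sum>i<n. a i j * a i k)"
definition frob :: "nat \<Rightarrow> nat \<Rightarrow> (nat \<Rightarrow> nat \<Rightarrow> real) \<Rightarrow> real" where
  "frob n d a = (\<Sum>i<n. \<Sum>j<d. (a i j)\<^sup>2)"

lemma atv_av: "atv n a (av d a x) j = mvr d (gram n a) x j"
  unfolding atv_def av_def mvr_def gram_def sum_distrib_left sum_distrib_right mult.assoc
  by (rule sum.swap)

lemma av_adjoint: "ip n (av d a x) z = ip d x (atv n a z)"
proof -
  have "ip n (av d a x) z = (\<Sum>i<n. \<Sum>j<d. x j * (a i j * z i))"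
    by (simp add: ip_def av_def sum_distrib_right sum_distrib_left mult_ac)
  also have "\<dots> = ip d x (atv n a z)"
    unfolding ip_def atv_def sum_distrib_left by (rule sum.swap)
  finally show ?thesis .
qed

lemma av_norm: "ip n (av d a x) (av d a x) \<le> frob n d a * ip d x x"
proof -
  have "ip n (av d a x) (av d a x) = (\<Sum>i<n. (ip d (a i) x)\<^sup>2)"
    by (simp add: ip_def av_def power2_eq_square)
  also have "\<dots> \<le> (\<Sum>i<n. ip d (a i) (a i) * ip d x x)" by (rule sum_mono) (rule ip_Cauchy_Schwarz)
  also have "\<dots> = frob n d a * ip d x x"
    by (simp add: frob_def ip_def sum_distrib_right power2_eq_square)
  finally show ?thesis .
qed

lemma atv_norm: "ip d (atv n a z) (atv n a z) \<le> frob n d a * ip n z z"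
proof -
  have "ip d (atv n a z) (atv n a z) = (\<Sum>j<d. (ip n (\<lambda>i. a i j) z)\<^sup>2)"
    by (simp add: ip_def atv_def power2_eq_square)
  also have "\<dots> \<le> (\<Sum>j<d. ip n (\<lambda>i. a i j) (\<lambda>i. a i j) * ip n z z)" by (rule sum_mono) (rule ip_Cauchy_Schwarz)
  also have "\<dots> = frob n d a * ip n z z"
    unfolding frob_def ip_def sum_distrib_right[symmetric] power2_eq_square by (subst sum.swap) simp
  finally show ?thesis .
qed

lemma atv_diff: "atv n a (\<lambda>i. x i - y i) j = atv n a x j - atv n a y j"
  by (simp add: atv_def right_diff_distrib sum_subtractf)
lemma atv_add: "atv n a (\<lambda>i. x i + s * y i) j = atv n a x j + s * atv n a y j"
  by (simp add: atv_def distrib_left sum.distrib sum_distrib_left mult_ac)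
lemma av_diff: "av d a (\<lambda>j. x j - y j) i = av d a x i - av d a y i"
  by (simp add: av_def right_diff_distrib sum_subtractf)
lemma atv_cong: "(\<And>i. i < n \<Longrightarrow> x i = y i) \<Longrightarrow> atv n a x j = atv n a y j" by (simp add: atv_def)

text \<open>
  The vector \<open>x = A y - t c\<close> satisfies the equality constraints but need not be nonnegative, and
  \<open>-c\<close> is, up to the range of \<open>A\<close>, parallel to \<open>x\<close>; so the objective gap is a quadratic in \<open>x\<close>.
\<close>

lemma objective_gap:
  assumes x: "\<And>i. i < n \<Longrightarrow> x i = av d a y i - t * c i"
    and eq: "\<And>j. j < d \<Longrightarrow> atv n a x j = atv n a x' j"
  shows "t * (ip n c x - ip n c x') \<le> ip n x' x' / 4"
proof -
  let ?h = "\<lambda>i. x i - x' i"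
  have "ip n (av d a y) ?h = 0"
    unfolding av_adjoint using eq by (simp add: ip_def atv_diff)
  moreover have "t * ip n c ?h = ip n (\<lambda>i. t * c i) ?h" by (simp add: ip_scale)
  moreover have "ip n (\<lambda>i. t * c i) ?h = ip n (\<lambda>i. av d a y i - x i) ?h"
    by (rule ip_cong) (use x in auto)
  ultimately have 1: "t * ip n c ?h = - ip n x ?h" by (simp add: ip_diff)
  have e: "ip n z ?h = ip n z x - ip n z x'" for z by (simp add: ip_def right_diff_distrib sum_subtractf)
  have "0 \<le> ip n (\<lambda>i. x i + (- 1 / 2) * x' i) (\<lambda>i. x i + (- 1 / 2) * x' i)" by (rule ip_nonneg)
  also have "\<dots> = ip n x x - ip n x x' + ip n x' x' / 4"
    unfolding ip_add ip_add2 ip_scale ip_scale2 using ip_sym[of n x' x] by simp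
  finally show ?thesis using 1 unfolding e by (simp add: algebra_simps)
qed

definition feas :: "nat \<Rightarrow> nat \<Rightarrow> (nat \<Rightarrow> nat \<Rightarrow> real) \<Rightarrow> (nat \<Rightarrow> real) \<Rightarrow> (nat \<Rightarrow> real) set" where
  "feas n d a b = {x. (\<forall>j<d. atv n a x j = b j) \<and> (\<forall>i<n. 0 \<le> x i)}"

text \<open>Attainment is what makes the \<open>LEAST\<close> in \<open>lp_min\<close> denote the
  minimum; the bound \<open>B\<close> will come from the outer radius.\<close>

lemma feas_min:
  assumes ne: "x0 \<in> feas n d a b" and bd: "\<And>x. x \<in> feas n d a b \<Longrightarrow> ip n x x \<le> B"
  shows "\<exists>x\<in>feas n d a b. \<forall>y\<in>feas n d a b. ip n c x \<le> ip n c y"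
proof (rule coord_attains_min[where d = n and B = "sqrt B"])
  show "feas n d a b \<noteq> {}" using ne by blast
  fix x i assume "x \<in> feas n d a b" "i < n"
  then have "(x i)\<^sup>2 \<le> ip n x x"
    unfolding ip_def power2_eq_square by (intro member_le_sum) auto
  then have "(x i)\<^sup>2 \<le> B" using bd[OF \<open>x \<in> feas n d a b\<close>] by linarith
  then show "\<bar>x i\<bar> \<le> sqrt B" by (simp add: real_le_rsqrt)
next
  fix X :: "nat \<Rightarrow> nat \<Rightarrow> real" and l assume X: "\<And>k. X k \<in> feas n d a b" and l: "\<And>i. i < n \<Longrightarrow> (\<lambda>k. X k i) \<longlonglongrightarrow> l i"
  have "atv n a l j = b j" if "j < d" for j
  proof -
    have "(\<lambda>k. atv n a (X k) j) \<longlonglongrightarrow> atv n a l j"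
      unfolding atv_def using l by (auto intro!: tendsto_sum tendsto_mult)
    moreover have "atv n a (X k) j = b j" for k using X that by (simp add: feas_def)
    ultimately show ?thesis by (simp add: LIMSEQ_const_iff)
  qed
  moreover have "0 \<le> l i" if "i < n" for i
    using LIMSEQ_le_const[OF l[OF that], of 0] X that by (auto simp: feas_def)
  ultimately show "l \<in> feas n d a b" by (simp add: feas_def)
next
  fix X :: "nat \<Rightarrow> nat \<Rightarrow> real" and l assume l: "\<And>i. i < n \<Longrightarrow> (\<lambda>k. X k i) \<longlonglongrightarrow> l i"
  then show "(\<lambda>k. ip n c (X k)) \<longlonglongrightarrow> ip n c l"
    unfolding ip_def by (auto intro!: tendsto_sum tendsto_mult)
qed

text \<open>A nonnegative kernel vector is a recession direction of the feasible set, and this set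
  is bounded.\<close>

lemma no_nonneg_kernel:
  assumes x: "x \<in> feas n d a b" and bd: "\<And>x. x \<in> feas n d a b \<Longrightarrow> ip n x x \<le> B"
    and h: "\<And>j. j < d \<Longrightarrow> atv n a h j = 0" "\<And>i. i < n \<Longrightarrow> 0 \<le> h i" "i < n"
  shows "h i = 0"
proof (rule ccontr)
  assume "h i \<noteq> 0"
  then have hi: "0 < h i" using h(2,3) by force
  \<comment> \<open>Chosen so that coordinate \<open>i\<close> of the shifted point is at least
    \<open>\<bar>B\<bar> + 1\<close>, whose square exceeds \<open>B\<close>.\<close>
  define s where "s = (\<bar>B\<bar> + 1) / h i"
  have s: "0 < s" using hi by (simp add: s_def)
  let ?y = "\<lambda>i. x i + s * h i"
  have "?y \<in> feas n d a b" using x h s by (auto simp: feas_def atv_add)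
  then have "ip n ?y ?y \<le> B" by (rule bd)
  moreover have "(?y i)\<^sup>2 \<le> ip n ?y ?y"
    unfolding ip_def power2_eq_square using h(3) by (intro member_le_sum) auto
  moreover have "\<bar>B\<bar> + 1 \<le> ?y i" using x h(3) hi by (simp add: feas_def s_def)
  then have "(\<bar>B\<bar> + 1)\<^sup>2 \<le> (?y i)\<^sup>2" by (intro power_mono) auto
  moreover have "B < (\<bar>B\<bar> + 1)\<^sup>2"
  proof -
    have "\<bar>B\<bar> + 1 \<le> (\<bar>B\<bar> + 1)\<^sup>2" by (rule self_le_power) auto
    then show ?thesis by linarith
  qed
  ultimately show False by linarith
qed

text \<open>\<open>A (sol g)\<close> is the solution of \<open>A^T x = g\<close> in the range of
  \<open>A\<close>. Its squared norm equals \<open>ip d (sol g) g\<close>, so one factor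
  \<open>\<kappa>\<close> suffices where the squared norm of \<open>sol g\<close> costs two.\<close>

lemma (in eigenbasis) sol_gram:
  assumes G: "\<And>i j. i < d \<Longrightarrow> j < d \<Longrightarrow> real_of_int (M i j) = gram n a i j"
    and lam: "\<And>k. k < d \<Longrightarrow> lam k \<ge> 1 / \<kappa>" "0 < \<kappa>"
  shows "\<And>j. j < d \<Longrightarrow> atv n a (av d a (sol g)) j = real_of_int (g j)"
    "ip n (av d a (sol g)) (av d a (sol g)) \<le> \<kappa> * ip d (\<lambda>j. real_of_int (g j)) (\<lambda>j. real_of_int (g j))"
proof -
  let ?g = "\<lambda>j. real_of_int (g j)"
  show 1: "atv n a (av d a (sol g)) j = ?g j" if "j < d" for j
  proof -
    have "mvr d (gram n a) (sol g) j = mvr d Mr (sol g) j"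
      unfolding mvr_def by (rule sum.cong) (use G that in auto)
    then show ?thesis using sol_correct[OF that] by (simp add: atv_av)
  qed
  have "ip n (av d a (sol g)) (av d a (sol g)) = ip d (sol g) ?g"
    unfolding av_adjoint by (rule ip_cong) (use 1 in auto)
  also have "\<dots> = ip d ?g (sol g)" by (rule ip_sym)
  also have "\<dots> = ip d ?g (\<lambda>j. \<Sum>k<d. ip d (sol g) (u k) * u k j)"
    by (rule ip_cong) (use expand in auto)
  also have "\<dots> = ip d (\<lambda>j. \<Sum>k<d. ip d (sol g) (u k) * u k j) ?g" by (rule ip_sym)
  also have "\<dots> = (\<Sum>k<d. ip d (sol g) (u k) * ip d (u k) ?g)" by (simp add: ip_sum ip_scale)
  also have "\<dots> = (\<Sum>k<d. (ip d ?g (u k))\<^sup>2 / lam k)"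
    by (rule sum.cong) (auto simp: ip_sol ip_sym[of d "u _"] power2_eq_square)
  also have "\<dots> \<le> (\<Sum>k<d. \<kappa> * (ip d ?g (u k))\<^sup>2)"
  proof (rule sum_mono)
    fix k assume "k \<in> {..<d}"
    then have k: "k < d" by simp
    have "1 / lam k \<le> \<kappa>" using lam(1)[OF k] lam(2) pos[OF k] by (simp add: field_simps)
    then have "1 / lam k * (ip d ?g (u k))\<^sup>2 \<le> \<kappa> * (ip d ?g (u k))\<^sup>2" by (rule mult_right_mono) simp
    then show "(ip d ?g (u k))\<^sup>2 / lam k \<le> \<kappa> * (ip d ?g (u k))\<^sup>2" by simp
  qed
  also have "\<dots> = \<kappa> * ip d ?g ?g" by (simp add: parseval sum_distrib_left)
  finally show "ip n (av d a (sol g)) (av d a (sol g)) \<le> \<kappa> * ip d ?g ?g" .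
qed

section \<open>Matrices and vectors\<close>

abbreviation (input) "Af A \<equiv> \<lambda>i j. real_of_int (A $$ (i, j))"

lemma scalar_prod_ip: "v \<in> carrier_vec n \<Longrightarrow> w \<in> carrier_vec n \<Longrightarrow> v \<bullet> w = ip n (($) v) (($) w)"
  by (simp add: scalar_prod_def ip_def atLeast0LessThan)

lemma mult_transpose_vec:
  assumes "A \<in> carrier_mat n d" "x \<in> carrier_vec n"
  shows "(real_mat A)\<^sup>T *\<^sub>v x = vec d (atv n (Af A) (($) x))"
  using assms by (intro eq_vecI) (auto simp: real_mat_def scalar_prod_def atv_def atLeast0LessThan intro!: sum.cong)

lemma mult_vec:
  assumes "A \<in> carrier_mat n d" "x \<in> carrier_vec d"
  shows "real_mat A *\<^sub>v x = vec n (av d (Af A) (($) x))"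
  using assms by (intro eq_vecI) (auto simp: real_mat_def scalar_prod_def av_def atLeast0LessThan intro!: sum.cong)

lemma lp_feasible_feas:
  assumes A: "A \<in> carrier_mat n d" and b: "b \<in> carrier_vec d" and x: "x \<in> carrier_vec n"
  shows "x \<in> lp_feasible (real_mat A) (real_vec b) \<longleftrightarrow> ($) x \<in> feas n d (Af A) (\<lambda>j. real_of_int (b $ j))"
proof -
  have "(real_mat A)\<^sup>T *\<^sub>v x = real_vec b \<longleftrightarrow> (\<forall>j<d. atv n (Af A) (($) x) j = real_of_int (b $ j))"
    unfolding mult_transpose_vec[OF A x] using b by (auto simp: real_vec_def vec_eq_iff)
  then show ?thesis using A x by (auto simp: lp_feasible_def feas_def real_mat_def)
qed

lemma feas_cong: "(\<And>i. i < n \<Longrightarrow> x i = y i) \<Longrightarrow> x \<in> feas n d a b \<longleftrightarrow> y \<in> feas n d a b"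
  using atv_cong[of n x y a] by (auto simp: feas_def)

lemma outer_radius_feas:
  assumes A: "A \<in> carrier_mat n d" and b: "b \<in> carrier_vec d" and R: "has_outer_radius (real_mat A) (real_vec b) R"
    and x: "x \<in> feas n d (Af A) (\<lambda>j. real_of_int (b $ j))"
  shows "sqrt (ip n x x) \<le> R"
proof -
  have c: "vec n x \<in> carrier_vec n" by simp
  have "($) (vec n x) \<in> feas n d (Af A) (\<lambda>j. real_of_int (b $ j))"
    using x feas_cong[of n x "($) (vec n x)"] by simp
  then have "l2_norm (vec n x) \<le> R"
    using R lp_feasible_feas[OF A b c] by (simp add: has_outer_radius_def)
  moreover have "ip n (($) (vec n x)) (($) (vec n x)) = ip n x x" by (rule ip_cong) auto
  ultimately show ?thesis by (simp add: l2_norm_def scalar_prod_ip[OF c c])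
qed

lemma lp_min_attained:
  assumes A: "A \<in> carrier_mat n d" and b: "b \<in> carrier_vec d" and c: "c \<in> carrier_vec n"
    and R: "has_outer_radius (real_mat A) (real_vec b) R" "0 \<le> R"
    and x0: "x0 \<in> feas n d (Af A) (\<lambda>j. real_of_int (b $ j))"
  obtains x where "x \<in> feas n d (Af A) (\<lambda>j. real_of_int (b $ j))"
    "lp_min (real_mat A) (real_vec b) (real_vec c) = ip n (\<lambda>i. real_of_int (c $ i)) x"
proof -
  let ?F = "feas n d (Af A) (\<lambda>j. real_of_int (b $ j))"
  let ?c = "\<lambda>i. real_of_int (c $ i)"
  have bd: "ip n x x \<le> R\<^sup>2" if "x \<in> ?F" for x
    using outer_radius_feas[OF A b R(1) that] R(2) by (simp add: sqrt_le_D)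
  obtain x where x: "x \<in> ?F" "\<forall>y\<in>?F. ip n ?c x \<le> ip n ?c y" using feas_min[OF x0 bd] by blast
  have cx: "real_vec c \<bullet> v = ip n ?c (($) v)" if "v \<in> carrier_vec n" for v
  proof -
    have "real_vec c \<bullet> v = ip n (($) (real_vec c)) (($) v)"
      using that c by (intro scalar_prod_ip) (auto simp: real_vec_def)
    also have "\<dots> = ip n ?c (($) v)" by (rule ip_cong) (use c in \<open>auto simp: real_vec_def\<close>)
    finally show ?thesis .
  qed
  have "lp_min (real_mat A) (real_vec b) (real_vec c) = ip n ?c x"
    unfolding lp_min_def
  proof (rule Least_equality)
    have v: "vec n x \<in> carrier_vec n" by simp
    have "($) (vec n x) \<in> ?F" using x(1) feas_cong[of n x "($) (vec n x)"] by simp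
    then have "vec n x \<in> lp_feasible (real_mat A) (real_vec b)" using lp_feasible_feas[OF A b v] by simp
    moreover have "real_vec c \<bullet> vec n x = ip n ?c x" unfolding cx[OF v] by (rule ip_cong) auto
    ultimately show "ip n ?c x \<in> (\<bullet>) (real_vec c) ` lp_feasible (real_mat A) (real_vec b)" by force
  next
    fix z assume "z \<in> (\<bullet>) (real_vec c) ` lp_feasible (real_mat A) (real_vec b)"
    then obtain v where v: "v \<in> lp_feasible (real_mat A) (real_vec b)" "z = real_vec c \<bullet> v" by auto
    then have vc: "v \<in> carrier_vec n" using A by (simp add: lp_feasible_def real_mat_def)
    then have "($) v \<in> ?F" using v lp_feasible_feas[OF A b vc] by simp
    then show "ip n ?c x \<le> z" using x(2) v(2) cx[OF vc] by simp
  qed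
  then show ?thesis using that x(1) by blast
qed

text \<open>\<open>rank\<close> is the size of a maximal independent subset of the set of columns.
  Repeated columns collapse in this set, so for them the contradiction comes from counting instead
  of a linear dependence.\<close>

lemma full_rank_kernel:
  assumes A: "A \<in> carrier_mat n d" and rk: "full_column_rank (real_mat A)"
    and v: "\<And>i. i < n \<Longrightarrow> av d (Af A) v i = 0" and j: "j < d"
  shows "v j = 0"
proof (rule ccontr)
  assume nz: "v j \<noteq> 0"
  let ?A = "real_mat A" and ?v = "vec d v"
  interpret vec_space "TYPE(real)" n .
  have Ac: "?A \<in> carrier_mat n d" using A by (simp add: real_mat_def)
  have r: "rank ?A = d" using rk Ac by (simp add: full_column_rank_def)
  have vc: "?v \<in> carrier_vec d" by simp
  have v0: "?v \<noteq> 0\<^sub>v d" using nz j by (auto simp: vec_eq_iff)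
  have "av d (Af A) (($) ?v) i = 0" if "i < n" for i
    using v[OF that] by (simp add: av_def)
  then have Av: "?A *\<^sub>v ?v = 0\<^sub>v n" unfolding mult_vec[OF A vc] by (auto simp: vec_eq_iff)
  show False
  proof (cases "distinct (cols ?A)")
    case True
    then have "lin_indpt (set (cols ?A))" using full_rank_lin_indpt[OF Ac r] by simp
    then show False using lin_depI[OF Ac vc v0 Av True] by blast
  next
    case False
    obtain S where S: "maximal S (\<lambda>T. T \<subseteq> set (cols ?A) \<and> lin_indpt T)"
      using maximal_exists[of "(\<lambda>T. T \<subseteq> set (cols ?A) \<and> lin_indpt T)" "card (set (cols ?A))" "{}"]
      by (meson List.finite_set card_mono empty_iff empty_subsetI finite_lin_indpt2 rev_finite_subset)
    then have "card S \<le> card (set (cols ?A))" by (simp add: card_mono maximal_def)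
    moreover have "card (set (cols ?A)) < length (cols ?A)"
      using False card_distinct card_length le_neq_implies_less by blast
    ultimately show False using rank_card_indpt[OF Ac S] r Ac by simp
  qed
qed

lemma gram_matrix_mult:
  assumes A: "A \<in> carrier_mat n d" and v: "v \<in> carrier_vec d"
  shows "((real_mat A)\<^sup>T * real_mat A) *\<^sub>v v = vec d (mvr d (gram n (Af A)) (($) v))"
proof -
  have Ac: "real_mat A \<in> carrier_mat n d" using A by (simp add: real_mat_def)
  have "((real_mat A)\<^sup>T * real_mat A) *\<^sub>v v = (real_mat A)\<^sup>T *\<^sub>v (real_mat A *\<^sub>v v)"
    by (rule assoc_mult_mat_vec[OF _ Ac v]) (use Ac in simp)
  also have "\<dots> = vec d (atv n (Af A) (($) (vec n (av d (Af A) (($) v)))))"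
    unfolding mult_vec[OF A v] by (rule mult_transpose_vec[OF A]) simp
  also have "\<dots> = vec d (mvr d (gram n (Af A)) (($) v))"
    by (rule eq_vecI) (auto simp: atv_av[symmetric] atv_def)
  finally show ?thesis .
qed

text \<open>For a symmetric positive definite matrix the singular values are the eigenvalues: in the
  eigenbasis its square has the eigenvalues \<open>(lam k)\<^sup>2\<close>, and the condition
  \<open>0 \<le> s\<close> selects the root.\<close>

lemma singular_values_gram:
  assumes A: "A \<in> carrier_mat n d" and e: "eigenbasis d M u lam"
    and G: "\<And>i j. i < d \<Longrightarrow> j < d \<Longrightarrow> real_of_int (M i j) = gram n (Af A) i j"
  shows "singular_values ((real_mat A)\<^sup>T * real_mat A) = lam ` {..<d}"
proof -
  interpret eigenbasis d M u lam by (rule e)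
  let ?M = "(real_mat A)\<^sup>T * real_mat A"
  let ?G = "gram n (Af A)"
  have Ac: "real_mat A \<in> carrier_mat n d" using A by (simp add: real_mat_def)
  have Mc: "?M \<in> carrier_mat d d" using Ac by simp
  have sy: "?M\<^sup>T = ?M" using Ac by (simp add: transpose_mult[of _ d n])
  have gM: "mvr d ?G x i = mvr d Mr x i" if "i < d" for x i
    unfolding mvr_def by (rule sum.cong) (use G that in auto)
  have MM: "(?M\<^sup>T * ?M) *\<^sub>v v = vec d (\<lambda>i. \<Sum>k<d. (lam k)\<^sup>2 * ip d (($) v) (u k) * u k i)" if v: "v \<in> carrier_vec d" for v
  proof -
    have "(?M\<^sup>T * ?M) *\<^sub>v v = ?M *\<^sub>v (?M *\<^sub>v v)" unfolding sy by (rule assoc_mult_mat_vec[OF Mc Mc v])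
    also have "\<dots> = vec d (mvr d ?G (($) (vec d (mvr d ?G (($) v)))))"
      unfolding gram_matrix_mult[OF A v] by (rule gram_matrix_mult[OF A]) simp
    also have "\<dots> = vec d (\<lambda>i. \<Sum>k<d. (lam k)\<^sup>2 * ip d (($) v) (u k) * u k i)"
    proof (rule eq_vecI)
      fix i assume "i < dim_vec (vec d (\<lambda>i. \<Sum>k<d. (lam k)\<^sup>2 * ip d (($) v) (u k) * u k i))"
      then have i: "i < d" by simp
      have 1: "mvr d Mr (($) v) i = (\<Sum>k<d. (lam k * ip d (($) v) (u k)) * u k i)" if "i < d" for i
        by (rule mvr_expand) (use that expand in auto)
      have "mvr d Mr (($) (vec d (mvr d ?G (($) v)))) i = (\<Sum>k<d. lam k * (lam k * ip d (($) v) (u k)) * u k i)"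
        by (rule mvr_expand) (use i 1 gM in auto)
      then show "vec d (mvr d ?G (($) (vec d (mvr d ?G (($) v))))) $ i =
        vec d (\<lambda>i. \<Sum>k<d. (lam k)\<^sup>2 * ip d (($) v) (u k) * u k i) $ i"
        using i gM by (simp add: power2_eq_square mult.assoc)
    qed simp
    finally show ?thesis .
  qed
  show ?thesis
  proof (intro equalityI subsetI)
    fix s assume "s \<in> singular_values ?M"
    then have s: "0 \<le> s" and "eigenvalue (?M\<^sup>T * ?M) (s\<^sup>2)" unfolding singular_values_def by blast+
    then obtain v where "eigenvector (?M\<^sup>T * ?M) v (s\<^sup>2)" unfolding eigenvalue_def by blast
    moreover have dr: "dim_row (?M\<^sup>T * ?M) = d" using Ac by simp
    ultimately have v: "v \<in> carrier_vec d" "v \<noteq> 0\<^sub>v d" "(?M\<^sup>T * ?M) *\<^sub>v v = s\<^sup>2 \<cdot>\<^sub>v v"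
      unfolding eigenvector_def dr by blast+
    have "\<exists>k<d. ip d (($) v) (u k) \<noteq> 0"
    proof (rule ccontr)
      assume "\<not> ?thesis"
      then have "v $ i = 0" if "i < d" for i using expand[OF that, of "($) v"] by simp
      then show False using v(1,2) by (auto simp: vec_eq_iff)
    qed
    then obtain k where k: "k < d" "ip d (($) v) (u k) \<noteq> 0" by blast
    have "s\<^sup>2 * ip d (($) v) (u k) = ip d (\<lambda>i. s\<^sup>2 * v $ i) (u k)" by (simp add: ip_scale)
    also have "\<dots> = ip d (\<lambda>i. \<Sum>l<d. ((lam l)\<^sup>2 * ip d (($) v) (u l)) * u l i) (u k)"
    proof (rule ip_cong)
      fix i assume i: "i < d"
      have "(s\<^sup>2 \<cdot>\<^sub>v v) $ i = vec d (\<lambda>i. \<Sum>k<d. (lam k)\<^sup>2 * ip d (($) v) (u k) * u k i) $ i"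
        unfolding v(3)[symmetric] MM[OF v(1)] ..
      then show "s\<^sup>2 * v $ i = (\<Sum>l<d. ((lam l)\<^sup>2 * ip d (($) v) (u l)) * u l i)" using i v(1) by simp
    qed simp
    also have "\<dots> = (\<Sum>l<d. ((lam l)\<^sup>2 * ip d (($) v) (u l)) * ip d (u l) (u k))" by (simp add: ip_sum ip_scale)
    also have "\<dots> = (\<Sum>l<d. if l = k then (lam l)\<^sup>2 * ip d (($) v) (u l) else 0)"
      by (rule sum.cong) (use on k in \<open>auto simp: orthonormal_def\<close>)
    also have "\<dots> = (lam k)\<^sup>2 * ip d (($) v) (u k)" using k by simp
    finally have "s\<^sup>2 = (lam k)\<^sup>2" using k by simp
    then have "s = lam k" using s pos[OF k(1)] by (simp add: power2_eq_iff)
    then show "s \<in> lam ` {..<d}" using k by auto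
  next
    fix s assume "s \<in> lam ` {..<d}"
    then obtain k where k: "k < d" "s = lam k" by auto
    let ?v = "vec d (u k)"
    have vc: "?v \<in> carrier_vec d" by simp
    have uk: "ip d (($) ?v) (u l) = (if l = k then 1 else 0)" if "l < d" for l
    proof -
      have "ip d (($) ?v) (u l) = ip d (u k) (u l)" by (rule ip_cong) auto
      then show ?thesis using on k that by (auto simp: orthonormal_def)
    qed
    have "(?M\<^sup>T * ?M) *\<^sub>v ?v = s\<^sup>2 \<cdot>\<^sub>v ?v"
    proof (rule eq_vecI)
      fix i assume "i < dim_vec (s\<^sup>2 \<cdot>\<^sub>v ?v)"
      then have i: "i < d" by simp
      have "(\<Sum>l<d. (lam l)\<^sup>2 * ip d (($) ?v) (u l) * u l i) = (\<Sum>l<d. if l = k then (lam l)\<^sup>2 * u l i else 0)"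
        by (rule sum.cong) (auto simp: uk)
      then show "((?M\<^sup>T * ?M) *\<^sub>v ?v) $ i = (s\<^sup>2 \<cdot>\<^sub>v ?v) $ i" unfolding MM[OF vc] using i k by simp
    qed (use MM[OF vc] in simp)
    moreover have "?v \<noteq> 0\<^sub>v d"
    proof
      assume "?v = 0\<^sub>v d"
      then have "ip d (($) ?v) (u k) = 0" by (simp add: ip_def)
      then show False using uk[OF k(1)] by simp
    qed
    ultimately show "s \<in> singular_values ?M"
      using k pos[OF k(1)] Mc unfolding singular_values_def eigenvalue_def eigenvector_def
      by (auto intro!: exI[of _ ?v])
  qed
qed

section \<open>Lists of triples and rounded exponents\<close>

lemma read_input_append:
  "k < length xs \<Longrightarrow> read_input (xs @ ys) k = read_input xs k"
  "read_input (xs @ ys) (length xs + k) = read_input ys k"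
  by (simp_all add: read_input_def nth_append)

lemma concat_triples:
  "length (concat (map (\<lambda>p. [f p, g p, h p]) xs)) = 3 * length xs"
  "e < length xs \<Longrightarrow> concat (map (\<lambda>p. [f p, g p, h p]) xs) ! (3 * e) = f (xs ! e)"
  "e < length xs \<Longrightarrow> concat (map (\<lambda>p. [f p, g p, h p]) xs) ! (3 * e + 1) = g (xs ! e)"
  "e < length xs \<Longrightarrow> concat (map (\<lambda>p. [f p, g p, h p]) xs) ! (3 * e + 2) = h (xs ! e)"
proof -
  show "length (concat (map (\<lambda>p. [f p, g p, h p]) xs)) = 3 * length xs" by (induction xs) auto
  have "e < length xs \<Longrightarrow> concat (map (\<lambda>p. [f p, g p, h p]) xs) ! (3 * e) = f (xs ! e) \<and>
    concat (map (\<lambda>p. [f p, g p, h p]) xs) ! (3 * e + 1) = g (xs ! e) \<and>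
    concat (map (\<lambda>p. [f p, g p, h p]) xs) ! (3 * e + 2) = h (xs ! e)"
  proof (induction xs arbitrary: e)
    case (Cons x xs)
    show ?case
    proof (cases e)
      case (Suc e')
      have "3 * e = Suc (Suc (Suc (3 * e')))" using Suc by simp
      then show ?thesis using Cons Suc by simp
    qed simp
  qed simp
  then show "e < length xs \<Longrightarrow> concat (map (\<lambda>p. [f p, g p, h p]) xs) ! (3 * e) = f (xs ! e)"
    "e < length xs \<Longrightarrow> concat (map (\<lambda>p. [f p, g p, h p]) xs) ! (3 * e + 1) = g (xs ! e)"
    "e < length xs \<Longrightarrow> concat (map (\<lambda>p. [f p, g p, h p]) xs) ! (3 * e + 2) = h (xs ! e)"
    by blast+
qed

lemma sum_split: "(\<Sum>i<m + k. f i) = (\<Sum>i<m. f i) + (\<Sum>i<k. f (m + i))" for f :: "nat \<Rightarrow> 'a::comm_monoid_add"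
  by (induction k) (auto simp: add.assoc)

lemma sum_triples: "(\<Sum>i<3 * m. f i) = (\<Sum>e<m. f (3 * e) + f (3 * e + 1) + f (3 * e + 2))"
  for f :: "nat \<Rightarrow> 'a::comm_monoid_add"
proof (induction m)
  case (Suc m)
  have e: "3 * Suc m = Suc (Suc (Suc (3 * m)))" by simp
  show ?case unfolding e using Suc by (simp add: add.assoc)
qed simp

lemma le_pow_nat:
  assumes "0 < q" "log 2 q \<le> real_of_int z"
  shows "q \<le> 2 ^ nat z"
proof -
  have "q = 2 powr (log 2 q)" using assms by simp
  also have "\<dots> \<le> 2 powr real (nat z)" using assms(2) by (intro powr_mono) auto
  finally show ?thesis by (simp add: powr_realpow)
qed

text \<open>\<open>nat\<close> truncates negative exponents, where the power is 1 however small
  \<open>q\<close> is; hence the maximum. \<open>m\<close> counts the bits lost by rounding.\<close>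

lemma pow_nat_le:
  assumes "0 < q" "real_of_int z \<le> log 2 q + real m"
  shows "2 ^ nat z \<le> max 1 (2 ^ m * q)"
proof (cases "0 \<le> z")
  case True
  have "2 ^ nat z = 2 powr real_of_int z" using True by (simp add: powr_realpow[symmetric])
  also have "\<dots> \<le> 2 powr (real m + log 2 q)" using assms(2) by (intro powr_mono) auto
  also have "\<dots> = 2 ^ m * q" unfolding powr_add using assms(1) by (simp add: powr_realpow)
  finally show ?thesis by simp
qed simp

section \<open>What condition number, inner radius and outer radius imply\<close>

locale lp_problem =
  fixes n d :: nat and A :: "int mat" and b c :: "int vec" and U \<epsilon> \<kappa> r R :: real
  assumes dim: "1 \<le> d" "d \<le> n"
    and A: "A \<in> carrier_mat n d" and b: "b \<in> carrier_vec d" and c: "c \<in> carrier_vec n"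
    and rank: "full_column_rank (real_mat A)"
    and AU: "\<And>i j. i < n \<Longrightarrow> j < d \<Longrightarrow> \<bar>real_of_int (A $$ (i, j))\<bar> \<le> U"
    and bU: "\<And>j. j < d \<Longrightarrow> \<bar>real_of_int (b $ j)\<bar> \<le> U"
    and cU: "\<And>i. i < n \<Longrightarrow> \<bar>real_of_int (c $ i)\<bar> \<le> U"
    and eps: "0 < \<epsilon>" "\<epsilon> < 1"
    and cond: "condition_number ((real_mat A)\<^sup>T * real_mat A) \<le> \<kappa>"
    and r: "0 < r" and inner: "has_inner_radius (real_mat A) (real_vec b) r"
    and outer: "has_outer_radius (real_mat A) (real_vec b) R"
begin

abbreviation "ar \<equiv> \<lambda>i j. real_of_int (A $$ (i, j))"
abbreviation "br \<equiv> \<lambda>j. real_of_int (b $ j)"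
abbreviation "cr \<equiv> \<lambda>i. real_of_int (c $ i)"
definition "G j k = (\<Sum>i<n. A $$ (i, j) * A $$ (i, k))"

lemma G_gram: "real_of_int (G j k) = gram n ar j k" by (simp add: G_def gram_def)

lemma int_sq_ge: "z \<noteq> 0 \<Longrightarrow> 1 \<le> (real_of_int z)\<^sup>2"
proof -
  assume "z \<noteq> 0"
  then have "1 \<le> z\<^sup>2" using zero_less_power2[of z] by linarith
  then have "real_of_int 1 \<le> real_of_int (z\<^sup>2)" by linarith
  then show ?thesis by simp
qed

text \<open>Full rank excludes zero columns, and a nonzero integer has a square of at least
  1.\<close>

lemma G_diag: "j < d \<Longrightarrow> 1 \<le> real_of_int (G j j)"
proof -
  assume j: "j < d"
  have "\<exists>i<n. A $$ (i, j) \<noteq> 0"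
  proof (rule ccontr)
    assume "\<not> ?thesis"
    then have "av d ar (\<lambda>k. if k = j then 1 else 0) i = 0" if "i < n" for i
      using that j by (simp add: av_def if_distrib cong: if_cong)
    from full_rank_kernel[OF A rank this j] show False by simp
  qed
  then obtain i where i: "i < n" "A $$ (i, j) \<noteq> 0" by blast
  have "(ar i j)\<^sup>2 \<le> (\<Sum>i<n. (ar i j)\<^sup>2)" using i by (intro member_le_sum) auto
  then show ?thesis using int_sq_ge[OF i(2)] by (simp add: G_def power2_eq_square)
qed

text \<open>A condition number fixes no scale, but integrality does: by \<open>G_diag\<close> the
  trace is at least \<open>d\<close>, so the largest eigenvalue is at least 1 and the smallest at
  least \<open>1 / \<kappa>\<close>.\<close>

lemma spectrum:
  obtains u lam where "eigenbasis d G u lam" "\<And>k. k < d \<Longrightarrow> 1 / \<kappa> \<le> lam k" "1 \<le> \<kappa>"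
proof -
  let ?Gr = "\<lambda>i j. real_of_int (G i j)"
  obtain u lam where on: "orthonormal d d u"
    and ev: "\<And>k i. k < d \<Longrightarrow> i < d \<Longrightarrow> mvr d ?Gr (u k) i = lam k * u k i"
    by (rule spectral[of d ?Gr]) (auto simp: G_def mult.commute)
  have pos: "0 < lam k" if k: "k < d" for k
  proof -
    have u1: "ip d (u k) (u k) = 1" using on k by (simp add: orthonormal_def)
    have "lam k = ip d (u k) (\<lambda>i. lam k * u k i)" by (simp add: ip_scale2 u1)
    also have "\<dots> = ip d (u k) (atv n ar (av d ar (u k)))"
      by (rule ip_cong) (use ev[OF k] in \<open>auto simp: atv_av G_gram\<close>)
    also have "\<dots> = ip n (av d ar (u k)) (av d ar (u k))" by (rule av_adjoint[symmetric])
    finally have l: "lam k = ip n (av d ar (u k)) (av d ar (u k))" .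
    have "lam k \<noteq> 0"
    proof
      assume "lam k = 0"
      then have "av d ar (u k) i = 0" if "i < n" for i using l ip_zero[OF _ that] by simp
      then have "u k j = 0" if "j < d" for j using full_rank_kernel[OF A rank _ that] by simp
      then show False using u1 by (simp add: ip_def)
    qed
    then show ?thesis using l ip_nonneg[of n "av d ar (u k)"] by linarith
  qed
  have e: "eigenbasis d G u lam" by standard (use on ev pos in auto)
  define L where "L = lam ` {..<d}"
  have L: "finite L" "L \<noteq> {}" using dim by (auto simp: L_def lessThan_empty_iff)
  have sv: "singular_values ((real_mat A)\<^sup>T * real_mat A) = L"
    unfolding L_def by (rule singular_values_gram[OF A e]) (rule G_gram)
  have "Min L \<in> L" using L by (rule Min_in)
  then have mn: "0 < Min L" using pos by (auto simp: L_def)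
  have "real d = (\<Sum>i<d. 1)" by simp
  also have "\<dots> \<le> (\<Sum>i<d. real_of_int (G i i))" by (rule sum_mono) (use G_diag in auto)
  also have "\<dots> = (\<Sum>k<d. lam k)" using eigenbasis.sum_lam[OF e] by simp
  also have "\<dots> \<le> (\<Sum>k<d. Max L)" by (rule sum_mono) (use L in \<open>auto simp: L_def\<close>)
  finally have mx: "1 \<le> Max L" using dim by simp
  have cd: "Max L / Min L \<le> \<kappa>" using cond by (simp add: condition_number_def sv)
  have "0 < Max L / Min L" using mx mn by simp
  then have k0: "0 < \<kappa>" using cd by linarith
  have "Max L \<le> \<kappa> * Min L" using cd mn by (simp add: field_simps)
  then have m: "1 / \<kappa> \<le> Min L" using mx k0 by (simp add: field_simps)
  have lk: "1 / \<kappa> \<le> lam k" if "k < d" for k using m Min_le[of L "lam k"] L that by (force simp: L_def)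
  have "Min L \<le> Max L" using L by simp
  then have "1 \<le> Max L / Min L" using mn by simp
  then have "1 \<le> \<kappa>" using cd by linarith
  then show ?thesis using that e lk by blast
qed

lemma kappa_ge: "1 \<le> \<kappa>" by (rule spectrum)

lemma interior:
  obtains x where "x \<in> feas n d ar br" "\<And>i. i < n \<Longrightarrow> r \<le> x i"
proof -
  have dr: "dim_row (real_mat A) = n" using A by (simp add: real_mat_def)
  obtain x where x: "x \<in> carrier_vec n" "(real_mat A)\<^sup>T *\<^sub>v x = real_vec b" "\<forall>i<n. r \<le> x $ i"
    using inner unfolding has_inner_radius_def dr by blast
  have "x \<in> lp_feasible (real_mat A) (real_vec b)"
    unfolding lp_feasible_def dr using x r by force
  then have "($) x \<in> feas n d ar br" using lp_feasible_feas[OF A b x(1)] by simp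
  then show ?thesis using that x(3) by blast
qed

lemma r_le_R: "r \<le> R"
proof -
  obtain x where x: "x \<in> feas n d ar br" "\<And>i. i < n \<Longrightarrow> r \<le> x i" by (rule interior) blast
  have n: "0 < n" using dim by simp
  have "r\<^sup>2 \<le> (x 0)\<^sup>2" using x(2)[OF n] r by (intro power_mono) auto
  also have "\<dots> \<le> ip n x x" unfolding ip_def power2_eq_square using n by (intro member_le_sum) auto
  finally have "r \<le> sqrt (ip n x x)" by (rule real_le_rsqrt)
  then show ?thesis using outer_radius_feas[OF A b outer x(1)] by linarith
qed

lemma R_pos: "0 < R" using r r_le_R by linarith

lemma feas_norm: "x \<in> feas n d ar br \<Longrightarrow> ip n x x \<le> R\<^sup>2"
  using outer_radius_feas[OF A b outer] by (rule sqrt_le_D)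

text \<open>The variable of a zero row could be increased without limit.\<close>

lemma nonzero_row: "i < n \<Longrightarrow> \<exists>j<d. A $$ (i, j) \<noteq> 0"
proof (rule ccontr)
  assume i: "i < n" and z: "\<not> (\<exists>j<d. A $$ (i, j) \<noteq> 0)"
  obtain x where x: "x \<in> feas n d ar br" "\<And>i. i < n \<Longrightarrow> r \<le> x i" by (rule interior) blast
  let ?h = "\<lambda>k. if k = i then 1 else 0 :: real"
  have k: "atv n ar ?h j = 0" if "j < d" for j
    using that z i by (simp add: atv_def if_distrib cong: if_cong)
  have "0 \<le> ?h k" for k by simp
  from no_nonneg_kernel[OF x(1) feas_norm k this i] show False by simp
qed

text \<open>The solution \<open>x0\<close> in the range of \<open>A\<close> has squared norm at most
  \<open>\<kappa> * ip d br br\<close>. If all its coordinates were below \<open>r\<close> in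
  absolute value, subtracting it from an interior point would give a positive kernel vector.\<close>

lemma inner_radius_le: "r\<^sup>2 \<le> \<kappa> * ip d br br"
proof -
  obtain u lam where e: "eigenbasis d G u lam" and lam: "\<And>k. k < d \<Longrightarrow> 1 / \<kappa> \<le> lam k" "1 \<le> \<kappa>" by (rule spectrum) blast
  interpret eigenbasis d G u lam by (rule e)
  have k0: "0 < \<kappa>" using lam(2) by linarith
  define x0 where "x0 = av d ar (sol (($) b))"
  have x0: "atv n ar x0 j = br j" if "j < d" for j
    unfolding x0_def by (rule sol_gram(1)[OF G_gram lam(1) k0 that])
  have x0n: "ip n x0 x0 \<le> \<kappa> * ip d br br"
    unfolding x0_def by (rule sol_gram(2)[OF G_gram lam(1) k0])
  obtain x where x: "x \<in> feas n d ar br" "\<And>i. i < n \<Longrightarrow> r \<le> x i" by (rule interior) blast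
  have "\<exists>i<n. r \<le> \<bar>x0 i\<bar>"
  proof (rule ccontr)
    assume "\<not> ?thesis"
    then have lt: "\<bar>x0 i\<bar> < r" if "i < n" for i using that by force
    have pos: "0 < x i - x0 i" if "i < n" for i using lt[OF that] x(2)[OF that] by linarith
    have "atv n ar (\<lambda>i. x i - x0 i) j = 0" if "j < d" for j
      using x(1) x0[OF that] that by (simp add: atv_diff feas_def)
    moreover have "0 < n" using dim by simp
    ultimately have "x 0 - x0 0 = 0"
      using no_nonneg_kernel[OF x(1) feas_norm, of "\<lambda>i. x i - x0 i" 0] pos by (meson less_imp_le)
    then show False using pos[OF \<open>0 < n\<close>] by simp
  qed
  then obtain i where i: "i < n" "r \<le> \<bar>x0 i\<bar>" by blast
  have "r\<^sup>2 \<le> \<bar>x0 i\<bar>\<^sup>2" using i(2) r by (intro power_mono) auto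
  also have "\<dots> = (x0 i)\<^sup>2" by simp
  also have "\<dots> \<le> ip n x0 x0" unfolding ip_def power2_eq_square using i by (intro member_le_sum) auto
  finally show ?thesis using x0n by linarith
qed

text \<open>A positive inner radius forces \<open>b\<close> to be nonzero, by the preceding
  inequality; its entries are integers.\<close>

lemma b_norm: "1 \<le> ip d br br" and U_ge: "1 \<le> U"
proof -
  have "0 < \<kappa> * ip d br br" using inner_radius_le r by (meson less_le_trans zero_less_power)
  then have "ip d br br \<noteq> 0" by auto
  then have "\<exists>j<d. b $ j \<noteq> 0" by (auto simp: ip_def intro!: sum.neutral)
  then obtain j where j: "j < d" "b $ j \<noteq> 0" by blast
  have "(br j)\<^sup>2 \<le> ip d br br" unfolding ip_def power2_eq_square using j by (intro member_le_sum) auto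
  then show "1 \<le> ip d br br" using int_sq_ge[OF j(2)] by linarith
  have "1 \<le> \<bar>b $ j\<bar>" using j(2) by linarith
  then have "1 \<le> \<bar>br j\<bar>" by linarith
  then show "1 \<le> U" using bU[OF j(1)] by linarith
qed

text \<open>Together with \<open>b_norm\<close> this bounds \<open>R\<close> from below, so that a
  negative exponent of \<open>R\<close> also has word size.\<close>

lemma b_norm_le: "ip d br br \<le> frob n d ar * R\<^sup>2"
proof -
  obtain x where x: "x \<in> feas n d ar br" by (rule interior)
  have "ip d br br = ip d (atv n ar x) (atv n ar x)" by (rule ip_cong) (use x in \<open>auto simp: feas_def\<close>)
  also have "\<dots> \<le> frob n d ar * ip n x x" by (rule atv_norm)
  also have "\<dots> \<le> frob n d ar * R\<^sup>2"
    by (rule mult_left_mono[OF feas_norm[OF x]]) (simp add: frob_def sum_nonneg)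
  finally show ?thesis .
qed

section \<open>The sparse input\<close>

definition "es = filter (\<lambda>(i, j). A $$ (i, j) \<noteq> 0) (List.product [0..<n] [0..<d])"
definition "ro e = fst (es ! e)"
definition "co e = snd (es ! e)"
definition "va e = A $$ (es ! e)"

lemma es: "set es = {(i, j). i < n \<and> j < d \<and> A $$ (i, j) \<noteq> 0}" "distinct es" "length es = nnz A"
proof -
  show s: "set es = {(i, j). i < n \<and> j < d \<and> A $$ (i, j) \<noteq> 0}" by (auto simp: es_def)
  show di: "distinct es" by (simp add: es_def distinct_product)
  show "length es = nnz A" using distinct_card[OF di] A by (simp add: nnz_def s)
qed

lemma es_nth: "e < nnz A \<Longrightarrow> ro e < n" "e < nnz A \<Longrightarrow> co e < d" "e < nnz A \<Longrightarrow> va e \<noteq> 0"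
  "va e = A $$ (ro e, co e)"
  using nth_mem[of e es] by (auto simp: es ro_def co_def va_def)

text \<open>Turns a sum over the entry list into one over all positions, where zero entries
  contribute nothing; the sparse formulas that follow are instances.\<close>

lemma sum_entries:
  fixes f :: "nat \<Rightarrow> nat \<Rightarrow> 'b::comm_monoid_add"
  assumes z: "\<And>i j. i < n \<Longrightarrow> j < d \<Longrightarrow> A $$ (i, j) = 0 \<Longrightarrow> f i j = 0"
  shows "(\<Sum>e<nnz A. f (ro e) (co e)) = (\<Sum>i<n. \<Sum>j<d. f i j)"
proof -
  have "(\<Sum>e<nnz A. f (ro e) (co e)) = (\<Sum>p\<in>set es. f (fst p) (snd p))"
    unfolding ro_def co_def by (rule sum.reindex_bij_betw[OF bij_betw_nth]) (use es in auto)
  also have "\<dots> = (\<Sum>p\<in>{..<n} \<times> {..<d}. f (fst p) (snd p))"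
    by (rule sum.mono_neutral_left) (use z in \<open>auto simp: es\<close>)
  finally show ?thesis by (simp add: sum.cartesian_product case_prod_unfold)
qed

lemma gram_sparse: "j < d \<Longrightarrow> k < d \<Longrightarrow> sparse_gram (nnz A) ro co va j k = G j k"
proof -
  assume jk: "j < d" "k < d"
  have 1: "(\<Sum>e'<nnz A. if ro e' = i \<and> co e' = k then va e' else 0) = A $$ (i, k)" if "i < n" for i
  proof -
    have "(\<Sum>e'<nnz A. if ro e' = i \<and> co e' = k then A $$ (ro e', co e') else 0) =
      (\<Sum>i'<n. \<Sum>j'<d. if i' = i \<and> j' = k then A $$ (i', j') else 0)" by (rule sum_entries) auto
    also have "\<dots> = (\<Sum>i'<n. if i' = i then \<Sum>j'<d. if j' = k then A $$ (i', j') else 0 else 0)"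
      by (rule sum.cong) (auto intro: sum.neutral)
    also have "\<dots> = A $$ (i, k)" using that jk by simp
    finally show ?thesis unfolding es_nth(4) .
  qed
  have "sparse_gram (nnz A) ro co va j k = (\<Sum>e<nnz A. if co e = j then A $$ (ro e, co e) * A $$ (ro e, k) else 0)"
    unfolding sparse_gram_def by (rule sum.cong) (use 1 es_nth in auto)
  also have "\<dots> = (\<Sum>i<n. \<Sum>j'<d. if j' = j then A $$ (i, j') * A $$ (i, k) else 0)"
    by (rule sum_entries) auto
  also have "\<dots> = G j k" using jk by (simp add: G_def)
  finally show ?thesis .
qed

lemma col_sparse: "j < d \<Longrightarrow> (\<Sum>e<nnz A. if co e = j then va e * f (ro e) else 0) = (\<Sum>i<n. A $$ (i, j) * f i)"
proof -
  assume j: "j < d"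
  have "(\<Sum>e<nnz A. if co e = j then A $$ (ro e, co e) * f (ro e) else 0) =
    (\<Sum>i<n. \<Sum>j'<d. if j' = j then A $$ (i, j') * f i else 0)" by (rule sum_entries) auto
  then show ?thesis unfolding es_nth(4) using j by simp
qed

lemma row_sparse: "i < n \<Longrightarrow> (\<Sum>e<nnz A. if ro e = i then va e * f (co e) else 0) = (\<Sum>j<d. A $$ (i, j) * f j)"
proof -
  assume i: "i < n"
  have "(\<Sum>e<nnz A. if ro e = i then A $$ (ro e, co e) * f (co e) else 0) =
    (\<Sum>i'<n. \<Sum>j<d. if i' = i then A $$ (i', j) * f j else 0)" by (rule sum_entries) auto
  also have "\<dots> = (\<Sum>i'<n. if i' = i then \<Sum>j<d. A $$ (i', j) * f j else 0)" by (rule sum.cong) auto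
  finally show ?thesis unfolding es_nth(4) using i by simp
qed

definition "eE = \<lfloor>log 2 \<epsilon>\<rfloor>"
definition "eK = \<lceil>log 2 \<kappa>\<rceil>"
definition "eR = \<lceil>log 2 R\<rceil>"
definition "hdr = [int n, int d, int (nnz A), eE, eK, \<lfloor>log 2 r\<rfloor>, eR]"
definition "inp = lp_input A b c \<epsilon> \<kappa> r R"

lemma inp_eq: "inp = hdr @ sparse_entries A @ list_of_vec b @ list_of_vec c"
  using A by (simp add: inp_def lp_input_def hdr_def eE_def eK_def eR_def)

lemma entries_eq: "sparse_entries A = concat (map (\<lambda>p. [int (fst p), int (snd p), A $$ p]) es)"
  using A by (simp add: sparse_entries_def es_def case_prod_unfold)

lemma entries_length: "length (sparse_entries A) = 3 * nnz A"
  by (simp only: entries_eq concat_triples es)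

lemma read_header: "read_input inp 0 = int n" "read_input inp 1 = int d" "read_input inp 2 = int (nnz A)"
  "read_input inp 3 = eE" "read_input inp 4 = eK" "read_input inp 6 = eR"
  by (simp_all add: inp_eq hdr_def read_input_def)

lemma length_hdr: "length hdr = 7" by (simp add: hdr_def)

lemma read_body: "read_input inp (7 + k) = read_input (sparse_entries A @ list_of_vec b @ list_of_vec c) k"
  using length_hdr read_input_append(2)[of hdr "sparse_entries A @ list_of_vec b @ list_of_vec c" k]
  by (simp add: inp_eq)

lemma read_entry:
  assumes e: "e < nnz A"
  shows "read_input inp (7 + 3 * e) = int (ro e)" "read_input inp (7 + (3 * e + 1)) = int (co e)"
    "read_input inp (7 + (3 * e + 2)) = va e"
proof -
  have e': "e < length es" using e es by simp
  have *: "k < 3 * nnz A \<Longrightarrow> read_input inp (7 + k) = sparse_entries A ! k" for k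
    unfolding read_body by (subst read_input_append) (auto simp: entries_length read_input_def)
  show "read_input inp (7 + 3 * e) = int (ro e)"
    using *[of "3 * e"] concat_triples(2)[OF e'] e by (simp add: entries_eq ro_def)
  show "read_input inp (7 + (3 * e + 1)) = int (co e)"
    using *[of "3 * e + 1"] concat_triples(3)[OF e'] e by (simp add: entries_eq co_def)
  show "read_input inp (7 + (3 * e + 2)) = va e"
    using *[of "3 * e + 2"] concat_triples(4)[OF e'] e by (simp add: entries_eq va_def)
qed

lemma read_b: "j < d \<Longrightarrow> read_input inp (7 + (3 * nnz A + j)) = b $ j"
  unfolding read_body using read_input_append(2)[of "sparse_entries A" "list_of_vec b @ list_of_vec c" j] b
  by (simp add: entries_length read_input_def nth_append list_of_vec_index)

lemma read_c: "i < n \<Longrightarrow> read_input inp (7 + (3 * nnz A + d + i)) = c $ i"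
  unfolding read_body
  using read_input_append(2)[of "sparse_entries A" "list_of_vec b @ list_of_vec c" "d + i"]
    read_input_append(2)[of "list_of_vec b" "list_of_vec c" i] b c
  by (simp add: entries_length read_input_def list_of_vec_index add.assoc)

text \<open>One sweep over the input computes this number. It dominates the squared norms of
  \<open>A\<close>, \<open>b\<close> and \<open>c\<close>, and, the listed entries being nonzero
  integers, also \<open>nnz A\<close> and thereby \<open>n\<close> and \<open>d\<close>.\<close>

definition "sg = 1 + (\<Sum>i<3 * nnz A + d + n. (read_input inp (7 + i))\<^sup>2)"

lemma sg_eq: "sg = 1 + (\<Sum>e<nnz A. (int (ro e))\<^sup>2 + (int (co e))\<^sup>2 + (va e)\<^sup>2) + (\<Sum>j<d. (b $ j)\<^sup>2) + (\<Sum>i<n. (c $ i)\<^sup>2)"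
  unfolding sg_def sum_split sum_triples using read_entry read_b read_c by simp

lemma frob_eq: "frob n d ar = (\<Sum>e<nnz A. (real_of_int (va e))\<^sup>2)"
  unfolding frob_def es_nth(4) by (rule sum_entries[symmetric]) simp

lemma sg_ge: "1 + frob n d ar + ip d br br + ip n cr cr \<le> real_of_int sg"
proof -
  have "frob n d ar \<le> (\<Sum>e<nnz A. (real (ro e))\<^sup>2 + (real (co e))\<^sup>2 + (real_of_int (va e))\<^sup>2)"
    unfolding frob_eq by (rule sum_mono) simp
  then show ?thesis by (simp add: sg_eq ip_def power2_eq_square)
qed

lemma nnz_le_frob: "real (nnz A) \<le> frob n d ar"
proof -
  have "(\<Sum>e<nnz A. 1) \<le> (\<Sum>e<nnz A. (real_of_int (va e))\<^sup>2)"
    by (rule sum_mono) (use es_nth(3) int_sq_ge in auto)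
  then show ?thesis by (simp add: frob_eq)
qed

lemma n_le_nnz: "n \<le> nnz A"
proof -
  have "{..<n} \<subseteq> fst ` set es" using nonzero_row by (force simp: es)
  then have "card {..<n} \<le> card (fst ` set es)" by (rule card_mono[rotated]) simp
  also have "\<dots> \<le> length es" using card_image_le[of "set es" fst] card_length[of es] by (meson List.finite_set le_trans)
  finally show ?thesis using es by simp
qed

lemma nnz_le: "nnz A \<le> n * d"
proof -
  have "length es \<le> length (List.product [0..<n] [0..<d])" unfolding es_def by (rule length_filter_le)
  then show ?thesis using es by simp
qed

text \<open>There are \<open>3 * nnz A + d + n \<le> 5 * n\<^sup>2\<close> squares, each at most
  \<open>n\<^sup>2 * U\<^sup>2\<close>, since indices are bounded by \<open>n\<close> and values by
  \<open>U\<close>.\<close>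

lemma sg_le: "real_of_int sg \<le> 6 * real n ^ 4 * U\<^sup>2"
proof -
  let ?N = "(real n)\<^sup>2 * U\<^sup>2"
  have n: "1 \<le> real n" using dim by simp
  have n2: "1 \<le> (real n)\<^sup>2" using n by (rule one_le_power)
  have U2: "1 \<le> U\<^sup>2" using U_ge by (rule one_le_power)
  have nN: "(real n)\<^sup>2 \<le> ?N" using mult_left_mono[OF U2, of "(real n)\<^sup>2"] by simp
  have UN: "U\<^sup>2 \<le> ?N" using mult_right_mono[OF n2, of "U\<^sup>2"] by simp
  have sqU: "x\<^sup>2 \<le> ?N" if "\<bar>x\<bar> \<le> U" for x :: real
  proof -
    have "\<bar>x\<bar>\<^sup>2 \<le> U\<^sup>2" using that by (intro power_mono) auto
    then show ?thesis using UN by simp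
  qed
  have sqn: "(real k)\<^sup>2 \<le> ?N" if "k \<le> n" for k
  proof -
    have "(real k)\<^sup>2 \<le> (real n)\<^sup>2" using that by (intro power_mono) auto
    then show ?thesis using nN by linarith
  qed
  have 1: "(real (ro e))\<^sup>2 + (real (co e))\<^sup>2 + (real_of_int (va e))\<^sup>2 \<le> 3 * ?N" if e: "e < nnz A" for e
  proof -
    have "ro e \<le> n" "co e \<le> n" using es_nth(1,2)[OF e] dim by auto
    moreover have "\<bar>real_of_int (va e)\<bar> \<le> U" unfolding es_nth(4) using es_nth(1,2)[OF e] by (rule AU)
    ultimately show ?thesis using sqn sqU by (smt (verit))
  qed
  have s1: "(\<Sum>e<nnz A. (real (ro e))\<^sup>2 + (real (co e))\<^sup>2 + (real_of_int (va e))\<^sup>2) \<le> (\<Sum>e<nnz A. 3 * ?N)"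
    by (rule sum_mono) (use 1 in auto)
  have s2: "(\<Sum>j<d. (br j)\<^sup>2) \<le> (\<Sum>j<d. ?N)" by (rule sum_mono) (use sqU bU in auto)
  have s3: "(\<Sum>i<n. (cr i)\<^sup>2) \<le> (\<Sum>i<n. ?N)" by (rule sum_mono) (use sqU cU in auto)
  have "real_of_int sg = 1 + (\<Sum>e<nnz A. (real (ro e))\<^sup>2 + (real (co e))\<^sup>2 + (real_of_int (va e))\<^sup>2) + (\<Sum>j<d. (br j)\<^sup>2) + (\<Sum>i<n. (cr i)\<^sup>2)"
    by (simp add: sg_eq)
  also have "\<dots> \<le> 1 + real (nnz A) * (3 * ?N) + real d * ?N + real n * ?N" using s1 s2 s3 by simp
  also have "\<dots> = 1 + (3 * real (nnz A) + real d + real n) * ?N" by (simp add: algebra_simps)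
  also have "\<dots> \<le> 1 + (5 * (real n)\<^sup>2) * ?N"
  proof -
    have "nnz A \<le> n * n" using nnz_le dim by (meson le_trans mult_le_mono2)
    then have "real (nnz A) \<le> real n * real n" by (metis of_nat_le_iff of_nat_mult)
    moreover have "real d \<le> real n" using dim by simp
    moreover have "real n \<le> real n * real n" using n by simp
    ultimately have "3 * real (nnz A) + real d + real n \<le> 5 * (real n)\<^sup>2" unfolding power2_eq_square by linarith
    then have "(3 * real (nnz A) + real d + real n) * ?N \<le> (5 * (real n)\<^sup>2) * ?N" by (rule mult_right_mono) simp
    then show ?thesis by simp
  qed
  also have "\<dots> \<le> 6 * ((real n)\<^sup>2 * ?N)"
  proof -
    have "1 \<le> ?N" using UN U2 by linarith
    then have "1 * 1 \<le> (real n)\<^sup>2 * ?N" using n2 by (intro mult_mono) auto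
    moreover have "5 * (real n)\<^sup>2 * ?N = 5 * ((real n)\<^sup>2 * ?N)" by (simp only: mult.assoc)
    ultimately show ?thesis by linarith
  qed
  also have "\<dots> = 6 * real n ^ 4 * U\<^sup>2" by (simp add: power2_eq_square power4_eq_xxxx)
  finally show ?thesis .
qed

section \<open>Parameters of the algorithm\<close>

definition "T = (2::int) ^ nat (2 * eR - eE)"
definition "X = (2::int) ^ nat (eK - eE)"
definition "W = 2 ^ 20 * sg ^ 4 * T * X"

abbreviation "sgr \<equiv> real_of_int sg"
abbreviation "Tr \<equiv> real_of_int T"
abbreviation "Xr \<equiv> real_of_int X"
abbreviation "Wr \<equiv> real_of_int W"

lemma sg_bounds: "frob n d ar \<le> sgr" "ip d br br \<le> sgr" "ip n cr cr \<le> sgr" "1 \<le> sgr"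
  "real (nnz A) \<le> sgr" "real n \<le> sgr" "real d \<le> sgr"
proof -
  have f: "0 \<le> frob n d ar" by (simp add: frob_def sum_nonneg)
  show 1: "frob n d ar \<le> sgr" "ip d br br \<le> sgr" "ip n cr cr \<le> sgr" "1 \<le> sgr"
    using sg_ge f ip_nonneg[of d br] ip_nonneg[of n cr] by linarith+
  show z: "real (nnz A) \<le> sgr" using nnz_le_frob 1(1) by linarith
  have "real n \<le> real (nnz A)" "real d \<le> real n" using n_le_nnz dim by simp_all
  then show "real n \<le> sgr" "real d \<le> sgr" using z by linarith+
qed

lemma exponents: "log 2 R \<le> real_of_int eR" "real_of_int eR \<le> log 2 R + 1"
  "real_of_int eE \<le> log 2 \<epsilon>" "log 2 \<epsilon> \<le> real_of_int eE + 1"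
  "log 2 \<kappa> \<le> real_of_int eK" "real_of_int eK \<le> log 2 \<kappa> + 1"
  unfolding eR_def eE_def eK_def by linarith+

text \<open>Rounding loses up to two bits for \<open>log 2 R\<close>, which is doubled, and one for
  \<open>log 2 \<epsilon>\<close>: together the factor \<open>2 ^ 3\<close>.\<close>

lemma T_bounds: "R\<^sup>2 / \<epsilon> \<le> Tr" "Tr \<le> max 1 (2 ^ 3 * (R\<^sup>2 / \<epsilon>))" "1 \<le> Tr"
proof -
  have p: "0 < R\<^sup>2 / \<epsilon>" using R_pos eps by simp
  have l: "log 2 (R\<^sup>2 / \<epsilon>) = 2 * log 2 R - log 2 \<epsilon>" using R_pos eps by (simp add: log_divide log_nat_power)
  have e: "Tr = 2 ^ nat (2 * eR - eE)" by (simp add: T_def)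
  show "R\<^sup>2 / \<epsilon> \<le> Tr" unfolding e by (rule le_pow_nat[OF p]) (use exponents l in simp)
  show "Tr \<le> max 1 (2 ^ 3 * (R\<^sup>2 / \<epsilon>))" unfolding e by (rule pow_nat_le[OF p]) (use exponents l in simp)
  show "1 \<le> Tr" unfolding e by simp
qed

lemma X_bounds: "\<kappa> / \<epsilon> \<le> Xr" "Xr \<le> max 1 (2 ^ 2 * (\<kappa> / \<epsilon>))" "1 \<le> Xr"
proof -
  have p: "0 < \<kappa> / \<epsilon>" using kappa_ge eps by simp
  have l: "log 2 (\<kappa> / \<epsilon>) = log 2 \<kappa> - log 2 \<epsilon>" using kappa_ge eps by (simp add: log_divide)
  have e: "Xr = 2 ^ nat (eK - eE)" by (simp add: X_def)
  show "\<kappa> / \<epsilon> \<le> Xr" unfolding e by (rule le_pow_nat[OF p]) (use exponents l in simp)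
  show "Xr \<le> max 1 (2 ^ 2 * (\<kappa> / \<epsilon>))" unfolding e by (rule pow_nat_le[OF p]) (use exponents l in simp)
  show "1 \<le> Xr" unfolding e by simp
qed

lemma X_ge: "1 / \<epsilon> \<le> Xr" "\<kappa> \<le> Xr"
proof -
  have "1 / \<epsilon> \<le> \<kappa> / \<epsilon>" using kappa_ge eps by (simp add: divide_right_mono)
  then show "1 / \<epsilon> \<le> Xr" using X_bounds by linarith
  have "\<kappa> * \<epsilon> \<le> \<kappa> * 1" using kappa_ge eps by (intro mult_left_mono) auto
  then have "\<kappa> \<le> \<kappa> / \<epsilon>" using eps by (simp add: field_simps)
  then show "\<kappa> \<le> Xr" using X_bounds by linarith
qed

lemma Wr_eq: "Wr = 2 ^ 20 * sgr ^ 4 * Tr * Xr" by (simp add: W_def)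

text \<open>Every lower bound required of \<open>W\<close> splits into three factors, one below each
  of \<open>sg ^ 4\<close>, \<open>T\<close> and \<open>X\<close>.\<close>

lemma W_prod: "0 \<le> s \<Longrightarrow> 0 \<le> t \<Longrightarrow> 0 \<le> x \<Longrightarrow> s \<le> sgr ^ 4 \<Longrightarrow> t \<le> Tr \<Longrightarrow> x \<le> Xr \<Longrightarrow> 2 ^ 20 * (s * t * x) \<le> Wr"
  unfolding Wr_eq mult.assoc using T_bounds(3) X_bounds(3)
  by (intro mult_left_mono mult_mono) auto

lemma sg_pow: "sgr \<le> sgr ^ 4" "1 \<le> sgr ^ 4" "sgr\<^sup>2 \<le> sgr ^ 4"
  using sg_bounds(4) self_le_power[of sgr 4] one_le_power[of sgr 4] power_increasing[of 2 4 sgr] by auto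

lemma W_ge: "1048576 * sgr \<le> Wr" "1048576 * Tr \<le> Wr" "1048576 * Xr \<le> Wr" "1048576 * (sgr * Tr * \<kappa>) \<le> Wr"
  "1048576 * sgr\<^sup>2 \<le> Wr" "1048576 * (sgr\<^sup>2 / \<epsilon>) \<le> Wr"
proof -
  note b = sg_bounds(4) T_bounds(3) X_bounds(3) sg_pow X_ge kappa_ge
  show "1048576 * sgr \<le> Wr" using W_prod[of sgr 1 1] b by simp
  show "1048576 * Tr \<le> Wr" using W_prod[of 1 Tr 1] b by simp
  show "1048576 * Xr \<le> Wr" using W_prod[of 1 1 Xr] b by simp
  show "1048576 * (sgr * Tr * \<kappa>) \<le> Wr" using W_prod[of sgr Tr \<kappa>] b by simp
  show "1048576 * sgr\<^sup>2 \<le> Wr" using W_prod[of "sgr\<^sup>2" 1 1] b by simp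
  show "1048576 * (sgr\<^sup>2 / \<epsilon>) \<le> Wr" using W_prod[of "sgr\<^sup>2" 1 "1 / \<epsilon>"] b eps by simp
qed

lemma W_pos: "1 \<le> Wr" "1 \<le> W"
proof -
  show "1 \<le> Wr" using W_ge(1) sg_bounds(4) by linarith
  then show "1 \<le> W" by linarith
qed

lemma log2_le: "0 < x \<Longrightarrow> log 2 x \<le> 2 * x" for x :: real
proof -
  assume x: "0 < x"
  have l: "1 / 2 \<le> ln (2::real)" using ln_le_minus_one[of "1 / 2 :: real"] by (simp add: ln_div)
  have "log 2 x = ln x / ln 2" by (simp add: log_def)
  also have "\<dots> \<le> x / ln 2" using ln_bound[OF x] by (intro divide_right_mono) auto
  also have "\<dots> \<le> x / (1 / 2)" using l x by (intro divide_left_mono) auto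
  finally show ?thesis by simp
qed

text \<open>The program handles the exponents as words too. The delicate case is a very small
  \<open>R\<close>, where \<open>b_norm\<close> and \<open>b_norm_le\<close> give
  \<open>1 / R \<le> sg\<close>.\<close>

lemma exponents_le: "\<bar>eE\<bar> \<le> W" "\<bar>eK\<bar> \<le> W" "\<bar>eR\<bar> \<le> W"
proof -
  have "log 2 \<epsilon> \<le> 0" using eps by simp
  moreover have "- log 2 \<epsilon> = log 2 (1 / \<epsilon>)" using eps by (simp add: log_divide)
  moreover have "log 2 (1 / \<epsilon>) \<le> 2 * (1 / \<epsilon>)" using eps by (intro log2_le) simp
  ultimately have "\<bar>real_of_int eE\<bar> \<le> Wr"
    using exponents(3,4) X_ge(1) W_ge(3) X_bounds(3) by linarith
  then show "\<bar>eE\<bar> \<le> W" by linarith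
  have "0 \<le> log 2 \<kappa>" using kappa_ge by simp
  then have "\<bar>real_of_int eK\<bar> \<le> Wr"
    using exponents(5,6) log2_le[of \<kappa>] kappa_ge X_ge(2) W_ge(3) X_bounds(3) by linarith
  then show "\<bar>eK\<bar> \<le> W" by linarith
  have "R \<le> 1 + R\<^sup>2"
  proof (cases "R \<le> 1")
    case False
    then have "R \<le> R\<^sup>2" by (intro self_le_power) auto
    then show ?thesis by simp
  qed (simp add: add_increasing2)
  moreover have "R\<^sup>2 * \<epsilon> \<le> R\<^sup>2 * 1" using eps by (intro mult_left_mono) auto
  then have "R\<^sup>2 \<le> R\<^sup>2 / \<epsilon>" using eps by (simp add: field_simps)
  ultimately have up: "real_of_int eR \<le> Wr"
    using exponents(2) log2_le[OF R_pos] T_bounds(1,3) W_ge(2) by linarith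
  have "1 \<le> frob n d ar * R\<^sup>2" using b_norm b_norm_le by linarith
  also have "\<dots> \<le> sgr\<^sup>2 * R\<^sup>2"
  proof (rule mult_right_mono)
    have "sgr \<le> sgr\<^sup>2" using sg_bounds(4) by (intro self_le_power) auto
    then show "frob n d ar \<le> sgr\<^sup>2" using sg_bounds(1) by linarith
  qed simp
  finally have sR: "1\<^sup>2 \<le> (sgr * R)\<^sup>2" by (simp add: power_mult_distrib)
  have "0 \<le> sgr * R" using sg_bounds(4) R_pos by simp
  with sR have "1 \<le> sgr * R" by (rule power2_le_imp_le)
  then have "1 / R \<le> sgr" using R_pos by (simp add: field_simps)
  moreover have "- log 2 R = log 2 (1 / R)" using R_pos by (simp add: log_divide)
  moreover have "log 2 (1 / R) \<le> 2 * (1 / R)" using R_pos by (intro log2_le) simp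
  ultimately have "- real_of_int eR \<le> Wr"
    using exponents(1) W_ge(1) sg_bounds(4) by linarith
  then show "\<bar>eR\<bar> \<le> W" using up by linarith
qed

lemma lp_inst: "lp inp (W ^ 16) (2 * n + 80) n d (nnz A) ro co va (($) b) (($) c) eE eK eR sg T X W"
proof unfold_locales
  show "64 \<le> 2 * n + 80" by simp
  have "real n \<le> sgr" "1 \<le> sgr" by (rule sg_bounds)+
  then have "real_of_int (int (2 * n + 80) + int n + 100) \<le> Wr" using W_ge(1) by simp
  then have "int (2 * n + 80) + int n + 100 \<le> W" by linarith
  also have "W \<le> W ^ 16" using W_pos by (intro self_le_power) auto
  finally show "int (2 * n + 80) + int n + 100 \<le> W ^ 16" .
  show "1 \<le> d" "d \<le> n" by (rule dim)+
  show "n \<le> nnz A" by (rule n_le_nnz)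
  show "read_input inp 0 = int n" "read_input inp 1 = int d" "read_input inp 2 = int (nnz A)"
    "read_input inp 3 = eE" "read_input inp 4 = eK" "read_input inp 6 = eR" by (rule read_header)+
  show "int (nnz A) \<le> sg" using sg_bounds(5) by linarith
  show "\<bar>eE\<bar> \<le> W" "\<bar>eK\<bar> \<le> W" "\<bar>eR\<bar> \<le> W" by (rule exponents_le)+
  fix e assume e: "e < nnz A"
  have e8: "8 + 3 * e = 7 + (3 * e + 1)" "9 + 3 * e = 7 + (3 * e + 2)" by simp_all
  show "read_input inp (7 + 3 * e) = int (ro e)" by (rule read_entry[OF e])
  show "read_input inp (8 + 3 * e) = int (co e)" unfolding e8 by (rule read_entry[OF e])
  show "read_input inp (9 + 3 * e) = va e" unfolding e8 by (rule read_entry[OF e])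
  show "ro e < n" "co e < d" using es_nth(1,2)[OF e] by blast+
next
  fix j assume "j < d"
  then show "read_input inp (7 + 3 * nnz A + j) = b $ j" unfolding add.assoc by (rule read_b)
next
  fix i assume "i < n"
  from read_c[OF this] show "read_input inp (7 + 3 * nnz A + d + i) = c $ i" unfolding add.assoc .
qed (simp_all add: sg_def T_def X_def W_def)

section \<open>Word length\<close>

definition "Q = real n * \<kappa> * U * R / (\<epsilon> * r)"
abbreviation "L \<equiv> log_factor n \<kappa> U R \<epsilon> r"

lemma ge1_mult: "1 \<le> x \<Longrightarrow> 1 \<le> y \<Longrightarrow> x \<le> x * y \<and> y \<le> x * y \<and> 1 \<le> x * y" for x y :: real
  using mult_mono[of 1 x 1 y] mult_left_mono[of 1 y x] mult_right_mono[of 1 x y] by auto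

lemma Q_ge: "real n \<le> Q" "\<kappa> \<le> Q" "U \<le> Q" "R / r \<le> Q" "1 / \<epsilon> \<le> Q" "real n * \<kappa> * U \<le> Q" "1 \<le> Q"
proof -
  have n: "1 \<le> real n" using dim by simp
  have R: "1 \<le> R / r" using r r_le_R by simp
  have e: "1 \<le> 1 / \<epsilon>" using eps by simp
  note 1 = ge1_mult[OF R e]
  note 2 = ge1_mult[OF n kappa_ge]
  note 3 = ge1_mult[OF conjunct2[OF conjunct2[OF 2]] U_ge]
  note 4 = ge1_mult[OF conjunct2[OF conjunct2[OF 3]] conjunct2[OF conjunct2[OF 1]]]
  have "Q = real n * \<kappa> * U * ((R / r) * (1 / \<epsilon>))" by (simp add: Q_def)
  then show "real n \<le> Q" "\<kappa> \<le> Q" "U \<le> Q" "R / r \<le> Q" "1 / \<epsilon> \<le> Q" "real n * \<kappa> * U \<le> Q" "1 \<le> Q"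
    using 1 2 3 4 by linarith+
qed

text \<open>\<open>Q\<close> bounds \<open>R / r\<close>, and multiplying by
  \<open>r \<le> n * \<kappa> * U\<close> recovers \<open>R\<close>.\<close>

lemma R_le: "R \<le> Q\<^sup>2"
proof -
  have n: "1 \<le> real n" using dim by simp
  have "r\<^sup>2 \<le> \<kappa> * ip d br br" by (rule inner_radius_le)
  also have "ip d br br \<le> (\<Sum>j<d. U\<^sup>2)"
    unfolding ip_def power2_eq_square[symmetric]
    by (rule sum_mono) (use bU U_ge in \<open>auto simp: abs_le_square_iff[symmetric]\<close>)
  also have "(\<Sum>j<d. U\<^sup>2) \<le> real n * U\<^sup>2" using dim by (simp add: mult_right_mono)
  also have "\<kappa> * (real n * U\<^sup>2) \<le> \<kappa>\<^sup>2 * ((real n)\<^sup>2 * U\<^sup>2)"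
  proof (intro mult_mono)
    show "\<kappa> \<le> \<kappa>\<^sup>2" using kappa_ge by (intro self_le_power) auto
    show "real n \<le> (real n)\<^sup>2" using n by (intro self_le_power) auto
  qed auto
  finally have r2: "r\<^sup>2 \<le> (real n * \<kappa> * U)\<^sup>2" using kappa_ge by (simp add: power_mult_distrib mult_ac)
  have "0 \<le> real n * \<kappa> * U" using kappa_ge U_ge by simp
  with r2 have "r \<le> real n * \<kappa> * U" by (rule power2_le_imp_le)
  then have "r \<le> Q" using Q_ge by linarith
  then have "R / r * r \<le> Q * Q" using Q_ge r by (intro mult_mono) auto
  then show ?thesis using r by (simp add: power2_eq_square)
qed

text \<open>\<open>sg\<close> is of order \<open>Q ^ 6\<close> and enters to the fourth power,
  \<open>T\<close> contributes \<open>Q ^ 5\<close> and \<open>X\<close> contributes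
  \<open>Q ^ 2\<close>, in all exponent 31; the constants \<open>1296 * 8 * 4\<close> are below
  \<open>2 ^ 16\<close>.\<close>

lemma W_le: "Wr \<le> 2 ^ 36 * Q ^ 31"
proof -
  have q: "1 \<le> Q" by (rule Q_ge)
  have s: "sgr \<le> 6 * Q ^ 6"
  proof -
    have "sgr \<le> 6 * (real n ^ 4 * U\<^sup>2)" using sg_le by simp
    also have "\<dots> \<le> 6 * (Q ^ 4 * Q\<^sup>2)" using Q_ge U_ge by (intro mult_left_mono mult_mono power_mono) auto
    finally show ?thesis by (simp add: power_add[symmetric])
  qed
  have s4: "sgr ^ 4 \<le> 1296 * Q ^ 24"
  proof -
    have "sgr ^ 4 \<le> (6 * Q ^ 6) ^ 4" using s sg_bounds(4) by (intro power_mono) auto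
    then show ?thesis by (simp add: power_mult_distrib power_mult[symmetric])
  qed
  have t: "Tr \<le> 8 * Q ^ 5"
  proof -
    have "R\<^sup>2 * (1 / \<epsilon>) \<le> (Q\<^sup>2)\<^sup>2 * Q" using R_le R_pos Q_ge eps by (intro mult_mono power_mono) auto
    then have "R\<^sup>2 / \<epsilon> \<le> Q ^ 5" by (simp add: power_mult[symmetric] power_Suc2[symmetric] del: power_Suc)
    moreover have "1 \<le> Q ^ 5" using q by (rule one_le_power)
    ultimately show ?thesis using T_bounds(2) by simp
  qed
  have x: "Xr \<le> 4 * Q ^ 2"
  proof -
    have "\<kappa> * (1 / \<epsilon>) \<le> Q * Q" using Q_ge eps by (intro mult_mono) auto
    then have "\<kappa> / \<epsilon> \<le> Q ^ 2" by (simp add: power2_eq_square)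
    moreover have "1 \<le> Q ^ 2" using q by (rule one_le_power)
    ultimately show ?thesis using X_bounds(2) by simp
  qed
  have "Wr \<le> 2 ^ 20 * (1296 * Q ^ 24) * (8 * Q ^ 5) * (4 * Q ^ 2)"
    unfolding Wr_eq using s4 t x T_bounds(3) X_bounds(3) sg_pow q
    by (intro mult_mono mult_left_mono mult_nonneg_nonneg) auto
  also have "\<dots> = 2 ^ 20 * 41472 * Q ^ 31"
  proof -
    have "Q ^ 24 * Q ^ 5 * Q ^ 2 = Q ^ 31" by (simp add: power_add[symmetric])
    then show ?thesis by (simp add: mult_ac)
  qed
  also have "\<dots> \<le> 2 ^ 36 * Q ^ 31" using q by (intro mult_right_mono) simp_all
  finally show ?thesis .
qed

lemma L_ge: "1 \<le> L" "log 2 Q \<le> L" by (simp_all add: log_factor_def Q_def)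

lemma log_W: "log 2 Wr \<le> 67 * L"
proof -
  have q: "1 \<le> Q" by (rule Q_ge)
  have "log 2 Wr \<le> log 2 (2 ^ 36 * Q ^ 31)" using W_le W_pos q by (subst log_le_cancel_iff) auto
  also have "\<dots> = 36 + 31 * log 2 Q" using q log_pow_cancel[of "2::real" 36] by (simp add: log_mult log_nat_power)
  finally show ?thesis using L_ge by linarith
qed

lemma floorlog_le: "1 \<le> z \<Longrightarrow> real (floorlog 2 (nat z)) \<le> log 2 (real_of_int z) + 1"
proof -
  assume z: "1 \<le> z"
  have "0 \<le> log 2 (real (nat z))" using z by simp
  then have "real (nat \<lfloor>log 2 (real (nat z))\<rfloor>) \<le> log 2 (real (nat z))" by linarith
  then show ?thesis using z by (simp add: floorlog_def)
qed

lemma floorlog_W: "real (floorlog 2 (nat W)) \<le> 68 * L"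
  using floorlog_le[OF W_pos(2)] log_W L_ge by linarith

text \<open>From \<open>18 \<le> 2 ^ 5\<close> and \<open>log_W\<close> the size is at most
  \<open>5 + 16 * 67 * L + 2\<close>, where 2 accounts for the sign and for
  \<open>floorlog\<close>.\<close>

lemma bit_size_V: "real (bit_size (18 * W ^ 16)) \<le> 1079 * L"
proof -
  have p: "1 \<le> W ^ 16" using W_pos by (intro one_le_power) auto
  then have "real (floorlog 2 (nat (18 * W ^ 16))) \<le> log 2 (real_of_int (18 * W ^ 16)) + 1"
    by (intro floorlog_le) linarith
  also have "log 2 (real_of_int (18 * W ^ 16)) \<le> log 2 (2 ^ 5 * Wr ^ 16)"
    using W_pos by (subst log_le_cancel_iff) auto
  also have "\<dots> = 5 + 16 * log 2 Wr" using W_pos log_pow_cancel[of "2::real" 5] by (simp add: log_mult log_nat_power)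
  finally show ?thesis using p log_W L_ge unfolding bit_size_def by simp
qed

section \<open>Correctness and complexity\<close>

lemma sparse_eigenbasis: "eigenbasis d G u lam \<Longrightarrow> eigenbasis d (sparse_gram (nnz A) ro co va) u lam"
proof -
  assume "eigenbasis d G u lam"
  then interpret E: eigenbasis d G u lam .
  show ?thesis
  proof
    fix k i assume "k < d" "i < d"
    have "mvr d (\<lambda>i j. real_of_int (sparse_gram (nnz A) ro co va i j)) (u k) i = mvr d E.Mr (u k) i"
      unfolding mvr_def by (rule sum.cong) (use gram_sparse \<open>i < d\<close> in auto)
    then show "mvr d (\<lambda>i j. real_of_int (sparse_gram (nnz A) ro co va i j)) (u k) i = lam k * u k i"
      using E.ev[OF \<open>k < d\<close> \<open>i < d\<close>] by simp
  qed (use E.on E.pos in auto)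
qed

lemma trace_gram: "(\<Sum>j<d. gram n ar j j) = frob n d ar"
  unfolding gram_def frob_def power2_eq_square by (rule sum.swap)

lemma rhs_norm:
  assumes g: "\<And>j. j < d \<Longrightarrow> g j = br j + Tr * atv n ar cr j"
  shows "ip d g g \<le> (2 * (Tr * sgr))\<^sup>2"
proof -
  have "ip d g g = (\<Sum>j<d. (br j + Tr * atv n ar cr j)\<^sup>2)"
    unfolding ip_def power2_eq_square by (rule sum.cong) (use g in auto)
  also have "\<dots> \<le> (\<Sum>j<d. 2 * (br j * br j) + 2 * Tr\<^sup>2 * (atv n ar cr j * atv n ar cr j))"
  proof (rule sum_mono)
    fix j
    have "0 \<le> (br j - Tr * atv n ar cr j)\<^sup>2" by simp
    then show "(br j + Tr * atv n ar cr j)\<^sup>2 \<le> 2 * (br j * br j) + 2 * Tr\<^sup>2 * (atv n ar cr j * atv n ar cr j)"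
      by (simp add: power2_eq_square algebra_simps)
  qed
  also have "\<dots> = 2 * ip d br br + 2 * Tr\<^sup>2 * ip d (atv n ar cr) (atv n ar cr)"
    by (simp add: sum.distrib sum_distrib_left ip_def)
  also have "\<dots> \<le> 2 * (Tr\<^sup>2 * sgr\<^sup>2) + 2 * (Tr\<^sup>2 * sgr\<^sup>2)"
  proof -
    have "1 \<le> Tr\<^sup>2" using T_bounds(3) by (rule one_le_power)
    moreover have "sgr \<le> sgr\<^sup>2" using sg_bounds(4) by (intro self_le_power) auto
    ultimately have "1 * sgr \<le> Tr\<^sup>2 * sgr\<^sup>2" using sg_bounds(4) by (intro mult_mono) auto
    moreover have "ip d (atv n ar cr) (atv n ar cr) \<le> sgr\<^sup>2"
    proof -
      have "ip d (atv n ar cr) (atv n ar cr) \<le> frob n d ar * ip n cr cr" by (rule atv_norm)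
      also have "\<dots> \<le> sgr * sgr" using sg_bounds ip_nonneg[of n cr] by (intro mult_mono) auto
      finally show ?thesis by (simp add: power2_eq_square)
    qed
    then have "Tr\<^sup>2 * ip d (atv n ar cr) (atv n ar cr) \<le> Tr\<^sup>2 * sgr\<^sup>2" by (rule mult_left_mono) simp
    ultimately show ?thesis using sg_bounds(2) by linarith
  qed
  finally show ?thesis by (simp add: power_mult_distrib)
qed

text \<open>An error of \<open>2 / W\<close> per coordinate has norm at most
  \<open>sqrt sg * 2 / W\<close>, and \<open>A\<close>, its transpose and the product with
  \<open>c\<close> multiply by at most \<open>sqrt sg\<close> each. Both quantities are thus at most
  \<open>\<eta>\<close>, and \<open>W\<close> dominates
  \<open>sg\<^sup>2 / \<epsilon>\<close>.\<close>

lemma rounding_error: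
  assumes dl: "\<And>j. j < d \<Longrightarrow> \<bar>dl j\<bar> \<le> 2 / Wr"
  shows "\<bar>ip n cr (av d ar dl)\<bar> \<le> \<epsilon> / 2"
    "sqrt (ip d (atv n ar (av d ar dl)) (atv n ar (av d ar dl))) \<le> \<epsilon> / 2"
proof -
  define \<eta> where "\<eta> = 2 * sgr\<^sup>2 / Wr"
  have W0: "0 < Wr" using W_pos by linarith
  have \<eta>0: "0 \<le> \<eta>" using W0 by (simp add: \<eta>_def)
  have \<eta>: "\<eta> \<le> \<epsilon> / 2"
  proof -
    have "4 * (sgr\<^sup>2 / \<epsilon>) \<le> 1048576 * (sgr\<^sup>2 / \<epsilon>)" using eps by (intro mult_right_mono) auto
    then have "4 * (sgr\<^sup>2 / \<epsilon>) \<le> Wr" using W_ge(6) by linarith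
    then show ?thesis using W0 eps by (simp add: \<eta>_def field_simps)
  qed
  have s2: "sgr \<le> sgr\<^sup>2" using sg_bounds(4) by (intro self_le_power) auto
  have f0: "0 \<le> frob n d ar" by (simp add: frob_def sum_nonneg)
  have "ip d dl dl = (\<Sum>j<d. \<bar>dl j\<bar>\<^sup>2)" by (simp add: ip_def power2_eq_square)
  also have "\<dots> \<le> (\<Sum>j<d. (2 / Wr)\<^sup>2)" by (intro sum_mono power_mono dl) auto
  also have "\<dots> \<le> sgr * (2 / Wr)\<^sup>2" using sg_bounds(7) by (simp add: mult_right_mono)
  finally have d1: "ip d dl dl \<le> sgr * (2 / Wr)\<^sup>2" .
  have "ip n (av d ar dl) (av d ar dl) \<le> frob n d ar * ip d dl dl" by (rule av_norm)
  also have "\<dots> \<le> sgr * (sgr * (2 / Wr)\<^sup>2)"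
    using d1 sg_bounds ip_nonneg[of d dl] by (intro mult_mono) auto
  finally have d2: "ip n (av d ar dl) (av d ar dl) \<le> sgr * (sgr * (2 / Wr)\<^sup>2)" .
  have e2: "\<eta>\<^sup>2 = sgr\<^sup>2 * (sgr * (sgr * (2 / Wr)\<^sup>2))" by (simp add: \<eta>_def power2_eq_square)
  have p: "0 \<le> sgr * (sgr * (2 / Wr)\<^sup>2)" using sg_bounds(4) by simp
  have "ip n cr cr \<le> sgr\<^sup>2" using s2 sg_bounds(3) by linarith
  from ip_le_sqrt[OF this d2] have "\<bar>ip n cr (av d ar dl)\<bar> \<le> \<eta>"
    unfolding e2[symmetric] using \<eta>0 by simp
  then show "\<bar>ip n cr (av d ar dl)\<bar> \<le> \<epsilon> / 2" using \<eta> by linarith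
  have "ip d (atv n ar (av d ar dl)) (atv n ar (av d ar dl)) \<le> frob n d ar * ip n (av d ar dl) (av d ar dl)"
    by (rule atv_norm)
  also have "\<dots> \<le> frob n d ar * (sgr * (sgr * (2 / Wr)\<^sup>2))" by (rule mult_left_mono[OF d2 f0])
  also have "\<dots> \<le> \<eta>\<^sup>2" unfolding e2 using s2 sg_bounds(1) by (intro mult_right_mono[OF _ p]) linarith
  finally have "sqrt (ip d (atv n ar (av d ar dl)) (atv n ar (av d ar dl))) \<le> sqrt (\<eta>\<^sup>2)"
    by (rule real_sqrt_le_mono)
  then show "sqrt (ip d (atv n ar (av d ar dl)) (atv n ar (av d ar dl))) \<le> \<epsilon> / 2"
    using \<eta> \<eta>0 by simp
qed

text \<open>The accuracy is split: \<open>\<epsilon> / 4\<close> for the exact point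
  \<open>xs\<close> of the regularized problem, \<open>\<epsilon> / 2\<close> for rounding.\<close>

lemma approximate_solution:
  assumes y: "\<And>j. j < d \<Longrightarrow> atv n ar (av d ar y) j = br j + Tr * atv n ar cr j"
    and yh: "\<And>j. j < d \<Longrightarrow> \<bar>yh j - y j\<bar> \<le> 2 / Wr"
  defines "x \<equiv> vec n (\<lambda>i. av d ar yh i - Tr * cr i)"
  shows "real_vec c \<bullet> x \<le> lp_min (real_mat A) (real_vec b) (real_vec c) + \<epsilon>"
    "l2_norm ((real_mat A)\<^sup>T *\<^sub>v x - real_vec b) \<le> \<epsilon>"
proof -
  define dl where "dl j = yh j - y j" for j
  define xs where "xs i = av d ar y i - Tr * cr i" for i
  note err = rounding_error[of dl, OF yh[folded dl_def]]
  have xc: "x \<in> carrier_vec n" by (simp add: x_def)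
  have xi: "x $ i = xs i + 1 * av d ar dl i" if "i < n" for i
    using that by (simp add: x_def xs_def dl_def[abs_def] av_diff)
  have cv: "real_vec c \<in> carrier_vec n" using c by (simp add: real_vec_def)
  have "real_vec c \<bullet> x = ip n (($) (real_vec c)) (($) x)" by (rule scalar_prod_ip[OF cv xc])
  also have "\<dots> = ip n cr (\<lambda>i. xs i + 1 * av d ar dl i)"
    by (rule ip_cong) (use c xi in \<open>auto simp: real_vec_def\<close>)
  also have "\<dots> = ip n cr xs + ip n cr (av d ar dl)" by (simp add: ip_add2)
  finally have obj: "real_vec c \<bullet> x = ip n cr xs + ip n cr (av d ar dl)" .
  have axs: "atv n ar xs j = br j" if "j < d" for j
    using y[OF that] atv_add[of n ar "av d ar y" "- Tr" cr j] by (simp add: xs_def[abs_def])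
  obtain x0 where x0: "x0 \<in> feas n d ar br" by (rule interior)
  obtain z where z: "z \<in> feas n d ar br"
    "lp_min (real_mat A) (real_vec b) (real_vec c) = ip n cr z"
    using lp_min_attained[OF A b c outer less_imp_le[OF R_pos] x0] by blast
  have "Tr * (ip n cr xs - ip n cr z) \<le> ip n z z / 4"
    by (rule objective_gap[of n xs d ar y]) (use axs z(1) in \<open>auto simp: xs_def feas_def\<close>)
  then have gap: "Tr * (ip n cr xs - ip n cr z) \<le> R\<^sup>2 / 4" using feas_norm[OF z(1)] by linarith
  have "ip n cr xs - ip n cr z \<le> \<epsilon> / 4"
  proof (rule ccontr)
    assume "\<not> ?thesis"
    then have lt: "\<epsilon> / 4 < ip n cr xs - ip n cr z" by simp
    have "R\<^sup>2 / 4 = R\<^sup>2 / \<epsilon> * (\<epsilon> / 4)" using eps by simp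
    also have "\<dots> \<le> Tr * (\<epsilon> / 4)" using T_bounds(1) eps by (intro mult_right_mono) auto
    also have "\<dots> < Tr * (ip n cr xs - ip n cr z)" using lt T_bounds(3) by (intro mult_strict_left_mono) linarith+
    finally show False using gap by simp
  qed
  then show "real_vec c \<bullet> x \<le> lp_min (real_mat A) (real_vec b) (real_vec c) + \<epsilon>"
    using obj z(2) err(1) eps by linarith
  define w where "w = atv n ar (av d ar dl)"
  have "atv n ar (($) x) j = br j + w j" if "j < d" for j
  proof -
    have "atv n ar (($) x) j = atv n ar (\<lambda>i. xs i + 1 * av d ar dl i) j" by (rule atv_cong) (rule xi)
    then show ?thesis unfolding atv_add axs[OF that] by (simp add: w_def)
  qed
  then have "(real_mat A)\<^sup>T *\<^sub>v x - real_vec b = vec d w"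
    unfolding mult_transpose_vec[OF A xc] using b by (intro eq_vecI) (auto simp: real_vec_def)
  moreover have "vec d w \<bullet> vec d w = ip d w w"
    by (subst scalar_prod_ip[of _ d]) (auto intro: ip_cong)
  ultimately show "l2_norm ((real_mat A)\<^sup>T *\<^sub>v x - real_vec b) \<le> \<epsilon>"
    using err(2) eps by (simp add: l2_norm_def w_def)
qed

text \<open>\<open>5440000 = 80000 * 68\<close> combines the while steps with the word length in
  terms of \<open>L\<close>. Of the three logarithms one counts loop rounds and two come from
  schoolbook multiplication. In the space bound, \<open>64 + 2 * n + 16 * (2 * n + 80)\<close> cells
  are at most \<open>1400 * n\<close>.\<close>

lemma solves:
  defines "P \<equiv> compile lp_prog"
  shows "halts P inp"
    and "\<exists>x \<in> carrier_vec n. outputs_vec P inp x \<and>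
      real_vec c \<bullet> x \<le> lp_min (real_mat A) (real_vec b) (real_vec c) + \<epsilon> \<and>
      l2_norm ((real_mat A)\<^sup>T *\<^sub>v x - real_vec b) \<le> \<epsilon>"
    and "real (bit_time P inp) \<le> (5440000 * real (length P) + 140) * (11 * 1079\<^sup>2) *
      (real d ^ 3 * real (nnz A) * L ^ 3)"
    and "real (bit_space P inp) \<le> 1400 * 1079 * (real n * L)"
proof -
  interpret I: lp inp "W ^ 16" "2 * n + 80" n d "nnz A" ro co va "($) b" "($) c" eE eK eR sg T X W
    by (rule lp_inst)
  obtain u lam where e: "eigenbasis d G u lam" and lam: "\<And>k. k < d \<Longrightarrow> 1 / \<kappa> \<le> lam k" "1 \<le> \<kappa>"
    by (rule spectrum) blast
  interpret E: eigenbasis d I.M u lam by (rule sparse_eigenbasis[OF e])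
  have k0: "0 < \<kappa>" using lam(2) by linarith
  have Mg: "real_of_int (I.M i j) = gram n ar i j" if "i < d" "j < d" for i j
    using gram_sparse[OF that] G_gram by simp
  have gv: "real_of_int (I.gv j) = br j + Tr * atv n ar cr j" if "j < d" for j
    unfolding I.gv_def col_sparse[OF that, of "($) c"] by (simp add: atv_def)
  define y where "y = E.sol I.gv"
  have ay: "atv n ar (av d ar y) j = br j + Tr * atv n ar cr j" if "j < d" for j
    unfolding y_def using E.sol_gram(1)[OF Mg lam(1) k0 that, of I.gv] gv[OF that] by simp
  have Dp: "0 < I.D" by (rule E.Cf_pos)
  have "(\<Sum>i<d. real_of_int (I.M i i)) \<le> sgr" using trace_gram Mg sg_bounds(1) by simp
  from E.Cf_le[OF this] have "real_of_int I.D \<le> (real d * sgr) ^ d" .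
  also have "\<dots> \<le> Wr ^ d"
  proof (rule power_mono)
    have "real d * sgr \<le> sgr * sgr" using sg_bounds by (intro mult_right_mono) auto
    then show "real d * sgr \<le> Wr" using W_ge(5) zero_le_power2[of sgr] unfolding power2_eq_square by linarith
  qed (use sg_bounds in simp)
  finally have DW: "I.D \<le> W ^ d" by (metis of_int_le_iff of_int_power)
  \<comment> \<open>Solving the system costs the factor \<open>\<kappa>\<close>, and the right-hand
    side has norm at most \<open>2 * T * sg\<close>; \<open>W\<close> contains this product.\<close>
  have yW: "1 + \<bar>y j\<bar> \<le> Wr" if j: "j < d" for j
  proof -
    have "(y j)\<^sup>2 \<le> ip d y y" unfolding ip_def power2_eq_square using j by (intro member_le_sum) auto
    also have "\<dots> \<le> \<kappa>\<^sup>2 * ip d (\<lambda>j. real_of_int (I.gv j)) (\<lambda>j. real_of_int (I.gv j))"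
      unfolding y_def by (rule E.sol_norm[OF lam(1) k0])
    also have "\<dots> \<le> \<kappa>\<^sup>2 * (2 * (Tr * sgr))\<^sup>2" by (rule mult_left_mono[OF rhs_norm]) (use gv in auto)
    finally have "\<bar>y j\<bar>\<^sup>2 \<le> (2 * (sgr * Tr * \<kappa>))\<^sup>2" by (simp add: power_mult_distrib mult_ac)
    moreover have p: "1 \<le> sgr * Tr * \<kappa>" using ge1_mult sg_bounds(4) T_bounds(3) lam(2) by blast
    then have "0 \<le> 2 * (sgr * Tr * \<kappa>)" by linarith
    ultimately have "\<bar>y j\<bar> \<le> 2 * (sgr * Tr * \<kappa>)" by (rule power2_le_imp_le)
    then show ?thesis using p W_ge(4) by linarith
  qed
  have "I.ok lp_prog (\<lambda>_. 0, \<lambda>_ _. 0) (80000 * (d * d * d * nnz A * I.LW)) (\<lambda>\<sigma>'. \<exists>yh.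
     (\<forall>j<d. \<bar>real_of_int (yh j) / Wr - y j\<bar> \<le> 2 / Wr) \<and>
     (\<forall>i<n. \<forall>k. (k = 2 * i \<or> k = 2 * i + 1) \<longrightarrow>
       (if k < 64 then snd \<sigma>' 15 k else snd \<sigma>' 0 k) = (if k = 2 * i then I.xh yh i else W)))"
  proof (rule I.lp_ok[OF Dp DW])
    fix j assume j: "j < d"
    then have "0 < d" by simp
    from E.Zf_sol[OF this j] show "real_of_int (I.Z j) = real_of_int I.D * y j" unfolding y_def .
    show "1 + \<bar>y j\<bar> \<le> Wr" by (rule yW[OF j])
  qed
  then obtain \<sigma>' t yh where ex: "I.exec lp_prog (\<lambda>_. 0, \<lambda>_ _. 0) t \<sigma>'"
    and t: "t \<le> 80000 * (d * d * d * nnz A * I.LW)"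
    and yh: "\<forall>j<d. \<bar>real_of_int (yh j) / Wr - y j\<bar> \<le> 2 / Wr"
    and out: "\<forall>i<n. \<forall>k. (k = 2 * i \<or> k = 2 * i + 1) \<longrightarrow>
       (if k < 64 then snd \<sigma>' 15 k else snd \<sigma>' 0 k) = (if k = 2 * i then I.xh yh i else W)"
    unfolding I.ok_def by blast
  note cc = I.compile_correct[OF ex wf_lp_prog, folded P_def]
  show "halts P inp" by (rule cc(1))
  have fm: "final_memory P inp k = (if k = 2 * i then I.xh yh i else W)"
    if i: "i < n" and k: "k = 2 * i \<or> k = 2 * i + 1" for i k
  proof -
    have "final_memory P inp k = (if k < 64 then snd \<sigma>' 15 k else snd \<sigma>' 0 k)"
      using cc(2)[of k] cc(3)[of k] i k by auto
    then show ?thesis using out i k by metis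
  qed
  define yr where "yr j = real_of_int (yh j) / Wr" for j
  define x where "x = vec n (\<lambda>i. av d ar yr i - Tr * cr i)"
  have W0: "0 < Wr" "0 < W" using W_pos by linarith+
  have "outputs_vec P inp x"
    unfolding outputs_vec_def
  proof (intro allI impI conjI)
    fix i assume "i < dim_vec x"
    then have i: "i < n" by (simp add: x_def)
    have f: "final_memory P inp (2 * i) = I.xh yh i" "final_memory P inp (2 * i + 1) = W"
      using fm[OF i, of "2 * i"] fm[OF i, of "2 * i + 1"] by simp_all
    show "0 < final_memory P inp (2 * i + 1)" unfolding f by (rule W0)
    have "real_of_int (I.xh yh i) = (\<Sum>j<d. ar i j * real_of_int (yh j)) - Tr * cr i * Wr"
      unfolding I.xh_def row_sparse[OF i, of yh] by simp
    moreover have "av d ar yr i = (\<Sum>j<d. ar i j * real_of_int (yh j)) / Wr"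
      by (simp add: av_def yr_def sum_divide_distrib)
    ultimately have "x $ i = real_of_int (I.xh yh i) / Wr"
      using i W0 by (simp add: x_def field_simps)
    then show "x $ i = real_of_int (final_memory P inp (2 * i)) / real_of_int (final_memory P inp (2 * i + 1))"
      unfolding f .
  qed
  moreover have "real_vec c \<bullet> x \<le> lp_min (real_mat A) (real_vec b) (real_vec c) + \<epsilon>"
    "l2_norm ((real_mat A)\<^sup>T *\<^sub>v x - real_vec b) \<le> \<epsilon>"
    unfolding x_def by (rule approximate_solution[OF ay]; use yh in \<open>simp add: yr_def\<close>)+
  moreover have "x \<in> carrier_vec n" by (simp add: x_def)
  ultimately show "\<exists>x \<in> carrier_vec n. outputs_vec P inp x \<and>
      real_vec c \<bullet> x \<le> lp_min (real_mat A) (real_vec b) (real_vec c) + \<epsilon> \<and>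
      l2_norm ((real_mat A)\<^sup>T *\<^sub>v x - real_vec b) \<le> \<epsilon>" by blast
  have L1: "1 \<le> L" by (rule L_ge)
  have be: "real I.\<beta> \<le> 1079 * L" unfolding I.\<beta>_def I.V'_def by (rule bit_size_V)
  have b1: "1 \<le> I.\<beta>" by (simp add: I.\<beta>_def bit_size_def)
  define N where "N = real d ^ 3 * real (nnz A)"
  have "1 \<le> real d" "1 \<le> real (nnz A)" using dim n_le_nnz by simp_all
  then have N1: "1 \<le> N" unfolding N_def using ge1_mult one_le_power by blast
  have cm: "real I.cmax \<le> 11 * 1079\<^sup>2 * L ^ 2"
  proof -
    have "I.cmax \<le> 11 * (I.\<beta> * I.\<beta>)" unfolding I.cmax_def using b1 by simp
    then have "real I.cmax \<le> 11 * (real I.\<beta>)\<^sup>2" by (simp add: power2_eq_square flip: of_nat_mult)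
    also have "(real I.\<beta>)\<^sup>2 \<le> (1079 * L)\<^sup>2" by (rule power_mono[OF be]) simp
    finally show ?thesis by (simp add: power_mult_distrib)
  qed
  have tl: "real (t * length P + 140) \<le> (5440000 * real (length P) + 140) * (N * L)"
  proof -
    have "real t \<le> real (80000 * (d * d * d * nnz A * I.LW))" using t by (simp only: of_nat_le_iff)
    also have "\<dots> = 80000 * (N * real I.LW)" by (simp add: N_def power3_eq_cube)
    also have "\<dots> \<le> 80000 * (N * (68 * L))"
      unfolding I.LW_def using N1 floorlog_W by (intro mult_left_mono) auto
    finally have "real t \<le> 5440000 * (N * L)" by simp
    then have "real t * real (length P) \<le> 5440000 * (N * L) * real (length P)" by (rule mult_right_mono) simp
    moreover have "1 \<le> N * L" using ge1_mult[OF N1 L1] by blast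
    ultimately show ?thesis by (simp add: algebra_simps)
  qed
  have "real (bit_time P inp) \<le> real ((t * length P + 140) * I.cmax)" using cc(4) by (simp only: of_nat_le_iff)
  also have "\<dots> = real (t * length P + 140) * real I.cmax" by (rule of_nat_mult)
  also have "\<dots> \<le> (5440000 * real (length P) + 140) * (N * L) * (11 * 1079\<^sup>2 * L ^ 2)"
    by (rule mult_mono[OF tl cm]) (use N1 L1 in auto)
  also have "\<dots> = (5440000 * real (length P) + 140) * (11 * 1079\<^sup>2) * (N * L ^ 3)"
    by (simp add: power2_eq_square power3_eq_cube mult_ac)
  finally show "real (bit_time P inp) \<le> (5440000 * real (length P) + 140) * (11 * 1079\<^sup>2) *
      (real d ^ 3 * real (nnz A) * L ^ 3)" unfolding N_def .
  have "I.mtop \<le> 1400 * n" unfolding I.mtop_def I.base_def using dim by simp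
  then have "real I.mtop \<le> 1400 * real n" by linarith
  then have "real I.mtop * real I.\<beta> \<le> 1400 * real n * (1079 * L)" using be by (intro mult_mono) auto
  moreover have "real (bit_space P inp) \<le> real (I.mtop * I.\<beta>)" using cc(5) by (simp only: of_nat_le_iff)
  ultimately show "real (bit_space P inp) \<le> 1400 * 1079 * (real n * L)" by simp
qed

end

theorem theorem6p3:
  shows "\<exists>(P :: program) (C :: real) (k :: nat).
    \<forall>(n :: nat) (d :: nat) (A :: int mat) (b :: int vec) (c :: int vec)
      (U :: real) (\<epsilon> :: real) (\<kappa> :: real) (r :: real) (R :: real).
      1 \<le> d \<and> d \<le> n \<and>
      A \<in> carrier_mat n d \<and> b \<in> carrier_vec d \<and> c \<in> carrier_vec n \<and>
      full_column_rank (real_mat A) \<and>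
      (\<forall>i<n. \<forall>j<d. real_of_int (A $$ (i, j)) \<in> {-U..U}) \<and>
      (\<forall>j<d. real_of_int (b $ j) \<in> {-U..U}) \<and>
      (\<forall>i<n. real_of_int (c $ i) \<in> {-U..U}) \<and>
      0 < \<epsilon> \<and> \<epsilon> < 1 \<and>
      condition_number ((real_mat A)\<^sup>T * real_mat A) \<le> \<kappa> \<and>
      0 < r \<and> has_inner_radius (real_mat A) (real_vec b) r \<and>
      has_outer_radius (real_mat A) (real_vec b) R
      \<longrightarrow>
      halts P (lp_input A b c \<epsilon> \<kappa> r R) \<and>
      (\<exists>x \<in> carrier_vec n.
         outputs_vec P (lp_input A b c \<epsilon> \<kappa> r R) x \<and>
         real_vec c \<bullet> x \<le> lp_min (real_mat A) (real_vec b) (real_vec c) + \<epsilon> \<and>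
         l2_norm ((real_mat A)\<^sup>T *\<^sub>v x - real_vec b) \<le> \<epsilon>) \<and>
      real (bit_time P (lp_input A b c \<epsilon> \<kappa> r R))
        \<le> C * (real d ^ 3 * real (nnz A) * sqrt (real n) * log_factor n \<kappa> U R \<epsilon> r ^ k) \<and>
      real (bit_space P (lp_input A b c \<epsilon> \<kappa> r R))
        \<le> C * (real n * log_factor n \<kappa> U R \<epsilon> r)"
proof -
  let ?P = "compile lp_prog"
  define C1 C2 :: real where "C1 = (5440000 * real (length ?P) + 140) * (11 * 1079\<^sup>2)" and "C2 = 1400 * 1079"
  have C: "0 \<le> C1" "0 \<le> C2" by (simp_all add: C1_def C2_def)
  show ?thesis
  proof (rule exI[of _ ?P], rule exI[of _ "C1 + C2"], rule exI[of _ 3], intro allI impI)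
    fix n d :: nat and A :: "int mat" and b c :: "int vec" and U \<epsilon> \<kappa> r R :: real
    let ?L = "log_factor n \<kappa> U R \<epsilon> r" and ?inp = "lp_input A b c \<epsilon> \<kappa> r R"
    assume H: "1 \<le> d \<and> d \<le> n \<and>
      A \<in> carrier_mat n d \<and> b \<in> carrier_vec d \<and> c \<in> carrier_vec n \<and>
      full_column_rank (real_mat A) \<and>
      (\<forall>i<n. \<forall>j<d. real_of_int (A $$ (i, j)) \<in> {-U..U}) \<and>
      (\<forall>j<d. real_of_int (b $ j) \<in> {-U..U}) \<and>
      (\<forall>i<n. real_of_int (c $ i) \<in> {-U..U}) \<and>
      0 < \<epsilon> \<and> \<epsilon> < 1 \<and>
      condition_number ((real_mat A)\<^sup>T * real_mat A) \<le> \<kappa> \<and>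
      0 < r \<and> has_inner_radius (real_mat A) (real_vec b) r \<and>
      has_outer_radius (real_mat A) (real_vec b) R"
    interpret lp_problem n d A b c U \<epsilon> \<kappa> r R
      by standard (use H in \<open>simp_all add: abs_le_iff\<close>, force+)
    have L: "1 \<le> ?L" by (rule L_ge)
    have n: "1 \<le> real n" using dim by simp
    let ?N = "real d ^ 3 * real (nnz A) * ?L ^ 3"
    \<comment> \<open>\<open>sqrt (real n)\<close> is at least 1, so the bound of
      \<open>solves\<close> passes to the stated form.\<close>
    have "?N * 1 \<le> ?N * sqrt (real n)" using n L by (intro mult_left_mono) auto
    moreover have "?N * sqrt (real n) = real d ^ 3 * real (nnz A) * sqrt (real n) * ?L ^ 3" by (simp add: mult_ac)
    moreover have "0 \<le> ?N" using L by simp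
    ultimately have N: "C1 * ?N \<le> (C1 + C2) * (real d ^ 3 * real (nnz A) * sqrt (real n) * ?L ^ 3)"
      using C by (intro mult_mono[of C1 "C1 + C2"]) linarith+
    have S: "C2 * (real n * ?L) \<le> (C1 + C2) * (real n * ?L)" using C L by (intro mult_right_mono) auto
    note s = solves[unfolded inp_def, folded C1_def C2_def]
    show "halts ?P ?inp \<and>
      (\<exists>x \<in> carrier_vec n. outputs_vec ?P ?inp x \<and>
         real_vec c \<bullet> x \<le> lp_min (real_mat A) (real_vec b) (real_vec c) + \<epsilon> \<and>
         l2_norm ((real_mat A)\<^sup>T *\<^sub>v x - real_vec b) \<le> \<epsilon>) \<and>
      real (bit_time ?P ?inp) \<le> (C1 + C2) * (real d ^ 3 * real (nnz A) * sqrt (real n) * ?L ^ 3) \<and>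
      real (bit_space ?P ?inp) \<le> (C1 + C2) * (real n * ?L)"
      by (intro conjI s(1) s(2) order_trans[OF s(3) N] order_trans[OF s(4) S])
  qed
qed

end
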